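(* Let $\Delta$ be the distribution of $2$-planes in $\mathbb R^4$ spanned pointwise by \[ X_1=\partial_{x_1}+2x_2\,\partial_{x_3}+x_3^2\,\partial_{x_4},\qquad X_2=\partial_{x_2}-2x_1\,\partial_{x_3}, \] and let $g$ be any smooth metric on $\Delta$. Then in the sub-Riemannian manifold $(\mathbb R^4,\Delta,g)$ every length-minimizing curve is smooth; in particular, no horizontal curve with a corner is length minimizing.
   Context: A smooth metric $g$ on $\Delta$ is a smoothly varying positive definite quadratic form $g(x;\cdot)$ on $\Delta(x)$. An absolutely continuous curve $\gamma$ is $\Delta$-horizontal if $\dot\gamma=h_1X_1(\gamma)+h_2X_2(\gamma)$ a.e. with $h_1,h_2$ bounded measurable; its length is $\int\sqrt{g(\gamma;\dot\gamma)}\,dt$, the distance $d(x,y)$ is the infimum of lengths of horizontal curves joining $x$ to $y$, and a curve is length minimizing if its length equals the distance between its endpoints. A horizontal curve has a corner at $\gamma(t)$ ($t$ interior) if the one-sided derivatives at $t$ exist and are linearly independent.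
   Formalization: Smoothness is stated for length-minimizing curves parametrized with constant speed, since a non-smooth reparametrization of a minimizer is still length minimizing; the statement on corners covers every parametrization. *)

theory Defs
  imports "HOL-Analysis.Analysis"
begin

definition X1 :: "real^4 \<Rightarrow> real^4" where
  "X1 x = vector [1, 0, 2 * x$2, (x$3)^2]"

definition X2 :: "real^4 \<Rightarrow> real^4" where
  "X2 x = vector [0, 1, - 2 * x$1, 0]"

definition smooth_R4 :: "(real^4 \<Rightarrow> real) \<Rightarrow> bool" where
  "smooth_R4 f \<longleftrightarrow>
     (\<exists>D :: 4 list \<Rightarrow> real^4 \<Rightarrow> real.
        D [] = f \<and>
        (\<forall>is x i. ((\<lambda>s. D is (x + s *\<^sub>R axis i 1)) has_real_derivative D (i # is) x) (at 0)) \<and>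
        (\<forall>is. continuous_on UNIV (D is)))"

text \<open>C-infinity curves on a set S of reals (one-sided derivatives at the
  endpoints of a closed interval): D k is the k-th derivative.\<close>

definition smooth_curve_on :: "real set \<Rightarrow> (real \<Rightarrow> real^4) \<Rightarrow> bool" where
  "smooth_curve_on S \<gamma> \<longleftrightarrow>
     (\<exists>D :: nat \<Rightarrow> real \<Rightarrow> real^4.
        (\<forall>t\<in>S. D 0 t = \<gamma> t) \<and>
        (\<forall>k. \<forall>t\<in>S. (D k has_vector_derivative D (Suc k) t) (at t within S)))"

text \<open>A smooth metric on Delta: g x is a quadratic form on Delta(x) whose
  matrix in the (pointwise linearly independent) frame X1, X2 has smooth
  entries a, b, c and is positive definite. Values of g x v for v not in
  Delta(x) are irrelevant.\<close>

definition smooth_metric_on_Delta :: "(real^4 \<Rightarrow> real^4 \<Rightarrow> real) \<Rightarrow> bool" where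
  "smooth_metric_on_Delta g \<longleftrightarrow>
     (\<exists>a b c. smooth_R4 a \<and> smooth_R4 b \<and> smooth_R4 c \<and>
        (\<forall>x. a x > 0 \<and> a x * c x - (b x)^2 > 0) \<and>
        (\<forall>x h1 h2. g x (h1 *\<^sub>R X1 x + h2 *\<^sub>R X2 x) =
            a x * h1^2 + 2 * b x * h1 * h2 + c x * h2^2))"

definition absolutely_continuous_on :: "real \<Rightarrow> real \<Rightarrow> (real \<Rightarrow> real^4) \<Rightarrow> bool" where
  "absolutely_continuous_on a b f \<longleftrightarrow>
     (\<forall>\<epsilon>>0. \<exists>\<delta>>0. \<forall>n (u::nat \<Rightarrow> real) v.
        (\<forall>i<n. a \<le> u i \<and> u i \<le> v i \<and> v i \<le> b) \<and>
        (\<forall>i<n. \<forall>j<n. i \<noteq> j \<longrightarrow> v i \<le> u j \<or> v j \<le> u i) \<and>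
        (\<Sum>i<n. v i - u i) < \<delta>
        \<longrightarrow> (\<Sum>i<n. norm (f (v i) - f (u i))) < \<epsilon>)"

definition horizontal :: "real \<Rightarrow> real \<Rightarrow> (real \<Rightarrow> real^4) \<Rightarrow> bool" where
  "horizontal a b \<gamma> \<longleftrightarrow>
     a \<le> b \<and> absolutely_continuous_on a b \<gamma> \<and>
     (\<exists>h1 h2 :: real \<Rightarrow> real.
        h1 \<in> borel_measurable lborel \<and> h2 \<in> borel_measurable lborel \<and>
        (\<exists>M. \<forall>t\<in>{a..b}. \<bar>h1 t\<bar> \<le> M \<and> \<bar>h2 t\<bar> \<le> M) \<and>
        (AE t in lborel. t \<in> {a..b} \<longrightarrow>
           (\<gamma> has_vector_derivative (h1 t *\<^sub>R X1 (\<gamma> t) + h2 t *\<^sub>R X2 (\<gamma> t))) (at t)))"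

definition sr_length :: "(real^4 \<Rightarrow> real^4 \<Rightarrow> real) \<Rightarrow> real \<Rightarrow> real \<Rightarrow> (real \<Rightarrow> real^4) \<Rightarrow> real" where
  "sr_length g a b \<gamma> = integral {a..b} (\<lambda>t. sqrt (g (\<gamma> t) (vector_derivative \<gamma> (at t))))"

definition sr_dist :: "(real^4 \<Rightarrow> real^4 \<Rightarrow> real) \<Rightarrow> real^4 \<Rightarrow> real^4 \<Rightarrow> real" where
  "sr_dist g x y = Inf {sr_length g a b \<gamma> | a b \<gamma>. horizontal a b \<gamma> \<and> \<gamma> a = x \<and> \<gamma> b = y}"

definition length_minimizing :: "(real^4 \<Rightarrow> real^4 \<Rightarrow> real) \<Rightarrow> real \<Rightarrow> real \<Rightarrow> (real \<Rightarrow> real^4) \<Rightarrow> bool" where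
  "length_minimizing g a b \<gamma> \<longleftrightarrow>
     horizontal a b \<gamma> \<and> sr_length g a b \<gamma> = sr_dist g (\<gamma> a) (\<gamma> b)"

definition constant_speed :: "(real^4 \<Rightarrow> real^4 \<Rightarrow> real) \<Rightarrow> real \<Rightarrow> real \<Rightarrow> (real \<Rightarrow> real^4) \<Rightarrow> bool" where
  "constant_speed g a b \<gamma> \<longleftrightarrow>
     (\<exists>c. AE t in lborel. t \<in> {a..b} \<longrightarrow> g (\<gamma> t) (vector_derivative \<gamma> (at t)) = c)"

definition has_corner_at :: "(real \<Rightarrow> real^4) \<Rightarrow> real \<Rightarrow> bool" where
  "has_corner_at \<gamma> t \<longleftrightarrow>
     (\<exists>v w. (\<gamma> has_vector_derivative v) (at_left t) \<and>
            (\<gamma> has_vector_derivative w) (at_right t) \<and>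
            (\<forall>\<alpha> \<beta>. \<alpha> *\<^sub>R v + \<beta> *\<^sub>R w = 0 \<longrightarrow> \<alpha> = 0 \<and> \<beta> = 0))"

end

theory Submission
  imports Defs
begin

text \<open>A horizontal curve x is described by its controls u1, u2. A minimizer of constant speed also minimizes
  the energy, and an open mapping argument for finite families of variations of the controls yields a multiplier
  (l0, p). If l0 is nonzero, the controls are smooth functions of x and p, and bootstrapping makes x smooth. If
  l0 = 0, then p4 is a nonzero constant and p3 = p4 x1 x3, whence u1 (3 x3 + 2 x1 x2) = 2 x1^2 u2 and x3 x1^3
  is a constant k. For nonzero k this equation is a smooth direction field along x. For k = 0 either x1 = 0 and x
  is a straight line, or x3 = 0, x4 is constant and the projection of x to the plane moves on lines through the
  origin; minimizers being injective, x is then a segment or a corner made of two rays.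

  Such a corner is not minimizing. A shortcut at scale e saves length of order e; the dilations of weights
  (1,1,2,5) preserve the distribution, so a suitable shortcut keeps x3 and changes x4 by a multiple of e^5, and
  a loop based at a point of a ray with nonzero x1 undoes this change at cost o(e).

  For a minimizer of arbitrary speed, the reparametrization by arc length is a minimizer of unit speed, hence
  smooth, so both one-sided derivatives at a point are multiples of the same vector. That reparametrization is
  controlled almost everywhere because the arc length has a negligible set of critical values.\<close>

section \<open>Bounded measurable functions and their primitives\<close>

text \<open>Smoothness depends on the parametrization and is therefore claimed at constant speed; a
  corner is a geometric feature and is excluded at any speed. Energy replaces length because its
  derivative in the controls is linear in them with a positive definite matrix, which can be
  inverted when l0 is nonzero. The system is triangular: x1 and x2 integrate the controls, x3 uses
  x1 and x2, and x4 uses x3. Trajectories, their variations and the costates are thus all iterated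
  integrals. The weights come from the same structure: x3 has weight 1 + 1, and x4 has weight 2 * 2
  + 1 = 5. Near the corner a loop of size e moves x4 only by order e^5, so a repair made there would
  cost as much as the shortcut saves. Away from x1 = 0 a double loop with sides \<delta> and D moves
  x4 by about 8 x1^2 \<delta>^2 D, which is cubic, so an error of order e^5 is repaired at cost of
  order e^(3/2). The two rays of a corner are independent, so one of them leaves x1 = 0.\<close>

definition ae :: "real \<Rightarrow> real \<Rightarrow> (real \<Rightarrow> bool) \<Rightarrow> bool" where
  "ae a b P \<longleftrightarrow> negligible {t\<in>{a..b}. \<not> P t}"

definition bm :: "real \<Rightarrow> real \<Rightarrow> (real \<Rightarrow> real) \<Rightarrow> bool" where
  "bm a b f \<longleftrightarrow> f \<in> borel_measurable (lebesgue_on {a..b}) \<and> (\<exists>M. \<forall>t\<in>{a..b}. \<bar>f t\<bar> \<le> M)"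

definition lipr :: "real \<Rightarrow> real \<Rightarrow> (real \<Rightarrow> real) \<Rightarrow> bool" where
  "lipr a b F \<longleftrightarrow> (\<exists>M. \<forall>s\<in>{a..b}. \<forall>t\<in>{a..b}. \<bar>F s - F t\<bar> \<le> M * \<bar>s - t\<bar>)"

text \<open>Bounded controls make the coordinates of a horizontal curve Lipschitz. Pairs of a
  Lipschitz function and a bounded almost everywhere derivative are stable under sums, products and
  smooth composition, and the derivative fixes the function up to a constant.\<close>

definition prim :: "real \<Rightarrow> real \<Rightarrow> (real \<Rightarrow> real) \<Rightarrow> (real \<Rightarrow> real) \<Rightarrow> bool" where
  "prim a b F f \<longleftrightarrow> bm a b f \<and> lipr a b F \<and> ae a b (\<lambda>t. (F has_real_derivative f t) (at t))"

lemma ae_mono: "ae a b P \<Longrightarrow> (\<And>t. t \<in> {a..b} \<Longrightarrow> P t \<Longrightarrow> Q t) \<Longrightarrow> ae a b Q"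
  unfolding ae_def by (rule negligible_subset) auto

lemma ae_all: "(\<And>t. t \<in> {a..b} \<Longrightarrow> P t) \<Longrightarrow> ae a b P"
  unfolding ae_def by (rule negligible_subset[of "{}"]) auto

lemma ae_conj: assumes "ae a b P" "ae a b Q" shows "ae a b (\<lambda>t. P t \<and> Q t)"
  using negligible_Un[OF assms[unfolded ae_def]] unfolding ae_def
  by (rule negligible_subset) auto

lemma ae_mono2: "ae a b P \<Longrightarrow> ae a b Q \<Longrightarrow> (\<And>t. t \<in> {a..b} \<Longrightarrow> P t \<Longrightarrow> Q t \<Longrightarrow> R t) \<Longrightarrow> ae a b R"
  using ae_conj ae_mono by (metis (no_types, lifting))

lemma ae_mono3: "ae a b P \<Longrightarrow> ae a b Q \<Longrightarrow> ae a b R \<Longrightarrow>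
   (\<And>t. t \<in> {a..b} \<Longrightarrow> P t \<Longrightarrow> Q t \<Longrightarrow> R t \<Longrightarrow> S t) \<Longrightarrow> ae a b S"
  using ae_mono2[OF ae_conj[of a b P Q], of R S] by blast

lemma ae_subset: "ae a b P \<Longrightarrow> a \<le> c \<Longrightarrow> d \<le> b \<Longrightarrow> ae c d P"
  unfolding ae_def by (rule negligible_subset) auto

lemma ae_interior: "ae a b (\<lambda>t. a < t \<and> t < b)"
  unfolding ae_def by (rule negligible_subset[of "{a,b}"]) (auto simp: not_less)

lemma ae_finite: "finite S \<Longrightarrow> ae a b (\<lambda>t. t \<notin> S)"
  unfolding ae_def by (rule negligible_subset[of S]) (auto intro: negligible_finite)

text \<open>An almost everywhere statement only asks that the exceptional set be covered by a null
  set, so passing from Borel to Lebesgue measure changes nothing.\<close>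

lemma AE_lborel_iff_ae: "(AE t in lborel. t \<in> {a..b} \<longrightarrow> P t) \<longleftrightarrow> ae a b P"
proof -
  have eq: "{t \<in> space lebesgue. \<not> (t \<in> {a..b} \<longrightarrow> P t)} = {t\<in>{a..b}. \<not> P t}" by auto
  have "(AE t in lborel. t \<in> {a..b} \<longrightarrow> P t) \<longleftrightarrow> (AE t in lebesgue. t \<in> {a..b} \<longrightarrow> P t)"
    by (rule AE_completion_iff[symmetric])
  also have "\<dots> \<longleftrightarrow> (\<exists>N. negligible N \<and> {t\<in>{a..b}. \<not> P t} \<subseteq> N)"
    unfolding eventually_ae_filter eq by (simp add: Bex_def negligible_iff_null_sets)
  also have "\<dots> \<longleftrightarrow> ae a b P" unfolding ae_def using negligible_subset by blast
  finally show ?thesis .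
qed

lemma bm_cont: assumes "continuous_on {a..b} f" shows "bm a b f"
proof -
  have "bounded (f ` {a..b})" using assms compact_continuous_image compact_imp_bounded by blast
  then have "\<exists>M. \<forall>t\<in>{a..b}. \<bar>f t\<bar> \<le> M" unfolding bounded_iff by auto
  with assms show ?thesis unfolding bm_def by (auto intro: continuous_imp_measurable_on_sets_lebesgue)
qed

lemma bm_const [simp]: "bm a b (\<lambda>t. c)"
  unfolding bm_def by auto

lemma bm_add: assumes "bm a b f" "bm a b g" shows "bm a b (\<lambda>t. f t + g t)"
proof -
  from assms obtain M N where "\<forall>t\<in>{a..b}. \<bar>f t\<bar> \<le> M" "\<forall>t\<in>{a..b}. \<bar>g t\<bar> \<le> N" unfolding bm_def by auto
  then have "\<forall>t\<in>{a..b}. \<bar>f t + g t\<bar> \<le> M + N" by (fastforce intro: order_trans[OF abs_triangle_ineq] add_mono)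
  then show ?thesis using assms unfolding bm_def by auto
qed

lemma bm_mult: assumes "bm a b f" "bm a b g" shows "bm a b (\<lambda>t. f t * g t)"
proof -
  from assms obtain M N where "\<forall>t\<in>{a..b}. \<bar>f t\<bar> \<le> M" "\<forall>t\<in>{a..b}. \<bar>g t\<bar> \<le> N" unfolding bm_def by auto
  then have "\<forall>t\<in>{a..b}. \<bar>f t * g t\<bar> \<le> M * N" by (auto simp: abs_mult intro!: mult_mono)
  then show ?thesis using assms unfolding bm_def by auto
qed

lemma bm_cmult: "bm a b f \<Longrightarrow> bm a b (\<lambda>t. c * f t)" using bm_mult[OF bm_const] .

lemma bm_minus: "bm a b f \<Longrightarrow> bm a b (\<lambda>t. - f t)" using bm_cmult[of a b f "-1"] by simp

lemma bm_diff: "bm a b f \<Longrightarrow> bm a b g \<Longrightarrow> bm a b (\<lambda>t. f t - g t)"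
  using bm_add[OF _ bm_minus, of a b f g] by simp

lemma bm_power: "bm a b f \<Longrightarrow> bm a b (\<lambda>t. f t ^ n)"
  by (induction n) (auto intro: bm_mult)

lemma bm_sum: "(\<And>i. i \<in> S \<Longrightarrow> bm a b (f i)) \<Longrightarrow> bm a b (\<lambda>t. \<Sum>i\<in>S. f i t)"
  by (induction S rule: infinite_finite_induct) (auto intro: bm_add)

lemmas bm_intros = bm_const bm_add bm_mult bm_minus bm_diff bm_power bm_sum

lemma bm_subset: assumes "bm a b f" "a \<le> c" "d \<le> b" shows "bm c d f"
proof -
  have "{c..d} \<subseteq> {a..b}" using assms by auto
  then show ?thesis using assms(1) unfolding bm_def by (blast intro: measurable_restrict_mono)
qed

lemma bm_cong: assumes "bm a b f" "\<And>t. t \<in> {a..b} \<Longrightarrow> g t = f t" shows "bm a b g"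
proof -
  have "g \<in> borel_measurable (lebesgue_on {a..b}) \<longleftrightarrow> f \<in> borel_measurable (lebesgue_on {a..b})"
    by (rule measurable_cong) (use assms in auto)
  then show ?thesis using assms unfolding bm_def by auto
qed

lemma bm_integrable: assumes "bm a b f" shows "f integrable_on {a..b}"
proof -
  obtain M where "\<forall>t\<in>{a..b}. \<bar>f t\<bar> \<le> M" using assms unfolding bm_def by auto
  then show ?thesis using assms unfolding bm_def
    by (auto intro: measurable_bounded_by_integrable_imp_integrable_real[where g="\<lambda>_. M"])
qed

lemma bm_integrable_sub: "bm a b f \<Longrightarrow> a \<le> c \<Longrightarrow> d \<le> b \<Longrightarrow> f integrable_on {c..d}"
  using bm_subset bm_integrable by blast

lemma bm_join: assumes "bm a b f" "bm b c f" "a \<le> b" "b \<le> c" shows "bm a c f"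
proof -
  from assms obtain M N where "\<forall>t\<in>{a..b}. \<bar>f t\<bar> \<le> M" "\<forall>t\<in>{b..c}. \<bar>f t\<bar> \<le> N" unfolding bm_def by auto
  then have B: "\<forall>t\<in>{a..c}. \<bar>f t\<bar> \<le> max M N" by (auto simp: le_max_iff_disj)
  \<comment> \<open>Integrability glues along adjacent intervals; measurability is then read off
    from it.\<close>
  have "f integrable_on {a..c}" using assms by (metis bm_integrable Henstock_Kurzweil_Integration.integrable_combine)
  then have "f \<in> borel_measurable (lebesgue_on {a..c})" using integrable_imp_measurable by blast
  then show ?thesis using B unfolding bm_def by auto
qed

lemma bm_bounded: assumes "bm a b f" obtains M where "M > 0" "\<And>t. t \<in> {a..b} \<Longrightarrow> \<bar>f t\<bar> \<le> M"
proof -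
  obtain M where M: "\<forall>t\<in>{a..b}. \<bar>f t\<bar> \<le> M" using assms unfolding bm_def by auto
  have "\<bar>f t\<bar> \<le> \<bar>M\<bar> + 1" if "t \<in> {a..b}" for t using bspec[OF M that] by linarith
  then show ?thesis using that[of "\<bar>M\<bar> + 1"] by auto
qed

lemma bm_ae_cong: assumes "bm a b f" "ae a b (\<lambda>t. g t = f t)" "\<And>t. t \<in> {a..b} \<Longrightarrow> \<bar>g t\<bar> \<le> M"
  shows "bm a b g"
proof -
  have "g integrable_on {a..b}"
    by (rule integrable_spike[OF bm_integrable[OF assms(1)] assms(2)[unfolded ae_def]]) auto
  then show ?thesis unfolding bm_def using integrable_imp_measurable assms(3) by blast
qed

lemma ae_integral_cong: "ae a b (\<lambda>t. g t = f t) \<Longrightarrow> integral {a..b} g = integral {a..b} f"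
  unfolding ae_def by (rule integral_spike) auto

section \<open>Absolute continuity and the fundamental theorem of calculus\<close>

definition acr :: "real \<Rightarrow> real \<Rightarrow> (real \<Rightarrow> real) \<Rightarrow> bool" where
  "acr a b f \<longleftrightarrow> (\<forall>\<epsilon>>0. \<exists>\<delta>>0. \<forall>n (u::nat \<Rightarrow> real) v.
        (\<forall>i<n. a \<le> u i \<and> u i \<le> v i \<and> v i \<le> b) \<and>
        (\<forall>i<n. \<forall>j<n. i \<noteq> j \<longrightarrow> v i \<le> u j \<or> v j \<le> u i) \<and>
        (\<Sum>i<n. v i - u i) < \<delta> \<longrightarrow> (\<Sum>i<n. \<bar>f (v i) - f (u i)\<bar>) < \<epsilon>)"

lemma lipr_acr: assumes "lipr a b F" shows "acr a b F"
proof -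
  obtain M0 where M0: "\<forall>s\<in>{a..b}. \<forall>t\<in>{a..b}. \<bar>F s - F t\<bar> \<le> M0 * \<bar>s - t\<bar>" using assms unfolding lipr_def by auto
  define M where "M = \<bar>M0\<bar> + 1"
  have Mp: "M > 0" unfolding M_def by simp
  have M: "\<bar>F s - F t\<bar> \<le> M * \<bar>s - t\<bar>" if "s \<in> {a..b}" "t \<in> {a..b}" for s t
    using M0 that mult_right_mono[of M0 M "\<bar>s - t\<bar>"] unfolding M_def by fastforce
  show ?thesis unfolding acr_def
  proof (intro allI impI)
    fix e :: real assume e: "e > 0"
    show "\<exists>\<delta>>0. \<forall>n (u::nat \<Rightarrow> real) v.
        (\<forall>i<n. a \<le> u i \<and> u i \<le> v i \<and> v i \<le> b) \<and>
        (\<forall>i<n. \<forall>j<n. i \<noteq> j \<longrightarrow> v i \<le> u j \<or> v j \<le> u i) \<and>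
        (\<Sum>i<n. v i - u i) < \<delta> \<longrightarrow> (\<Sum>i<n. \<bar>F (v i) - F (u i)\<bar>) < e"
    proof (intro exI[of _ "e/M"] conjI allI impI)
      show "0 < e/M" using e Mp by simp
      fix n and u v :: "nat \<Rightarrow> real"
      assume *: "(\<forall>i<n. a \<le> u i \<and> u i \<le> v i \<and> v i \<le> b) \<and> (\<forall>i<n. \<forall>j<n. i \<noteq> j \<longrightarrow> v i \<le> u j \<or> v j \<le> u i) \<and>
         (\<Sum>i<n. v i - u i) < e/M"
      have "(\<Sum>i<n. \<bar>F (v i) - F (u i)\<bar>) \<le> (\<Sum>i<n. M * (v i - u i))"
      proof (rule sum_mono)
        fix i assume "i \<in> {..<n}"
        then have "a \<le> u i" "u i \<le> v i" "v i \<le> b" using * by auto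
        then show "\<bar>F (v i) - F (u i)\<bar> \<le> M * (v i - u i)" using M[of "v i" "u i"] by auto
      qed
      also have "\<dots> = M * (\<Sum>i<n. v i - u i)" by (simp add: sum_distrib_left)
      also have "\<dots> < e" using * Mp by (simp add: field_simps)
      finally show "(\<Sum>i<n. \<bar>F (v i) - F (u i)\<bar>) < e" .
    qed
  qed
qed

text \<open>Absolute continuity is stated for intervals numbered by naturals, whereas a tagged
  division supplies intervals indexed by its own elements; this is the reindexing.\<close>

lemma acr_set_bound:
  assumes ac: "\<forall>n (u::nat \<Rightarrow> real) v.
        (\<forall>i<n. a \<le> u i \<and> u i \<le> v i \<and> v i \<le> b) \<and>
        (\<forall>i<n. \<forall>j<n. i \<noteq> j \<longrightarrow> v i \<le> u j \<or> v j \<le> u i) \<and>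
        (\<Sum>i<n. v i - u i) < d \<longrightarrow> (\<Sum>i<n. \<bar>F (v i) - F (u i)\<bar>) < e"
    and S: "finite S" "\<And>s. s \<in> S \<Longrightarrow> a \<le> u s \<and> u s \<le> v s \<and> v s \<le> b"
      "\<And>s t. s \<in> S \<Longrightarrow> t \<in> S \<Longrightarrow> s \<noteq> t \<Longrightarrow> v s \<le> u t \<or> v t \<le> (u s::real)"
      "(\<Sum>s\<in>S. v s - u s) < d"
  shows "(\<Sum>s\<in>S. \<bar>F (v s) - F (u s)\<bar>) < e"
proof -
  obtain h where h: "bij_betw h {..<card S} S"
    using ex_bij_betw_nat_finite[OF S(1)] unfolding atLeast0LessThan by blast
  have hS: "h i \<in> S" if "i < card S" for i using h that by (auto simp: bij_betw_def)
  have hi: "h i \<noteq> h j" if "i < card S" "j < card S" "i \<noteq> j" for i j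
    using h that by (auto simp: bij_betw_def inj_on_def)
  have "(\<Sum>i<card S. \<bar>F (v (h i)) - F (u (h i))\<bar>) < e"
  proof (rule ac[rule_format, of "card S" "u \<circ> h" "v \<circ> h", unfolded comp_def], intro conjI allI impI)
    show "(\<Sum>i<card S. v (h i) - u (h i)) < d"
      using S(4) sum.reindex_bij_betw[OF h, of "\<lambda>s. v s - u s"] by simp
  qed (use S(2)[OF hS] S(3)[OF hS hS hi] in auto)
  then show ?thesis using sum.reindex_bij_betw[OF h, of "\<lambda>s. \<bar>F (v s) - F (u s)\<bar>"] by simp
qed

text \<open>A gauge argument. At a point of differentiability the gauge makes the increment of
  \<open>F\<close> agree with \<open>f\<close> times the length up to \<open>e\<close> times the
  length. At a point of the null set \<open>N\<close> it confines the interval to an open set of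
  small measure, where absolute continuity makes the increments small in total.\<close>

lemma acr_FTC:
  assumes ab: "a \<le> b" and ac: "acr a b F" and der: "ae a b (\<lambda>t. (F has_real_derivative f t) (at t))"
  shows "(f has_integral F b - F a) {a..b}"
proof -
  define N where "N = {t\<in>{a..b}. \<not> (F has_real_derivative f t) (at t)}"
  have N: "negligible N" using der unfolding ae_def N_def .
  \<comment> \<open>Setting the integrand to zero on \<open>N\<close> leaves only increments of
    \<open>F\<close> to estimate at bad tags.\<close>
  define g where "g t = (if t \<in> N then 0 else f t)" for t
  have "(g has_integral F b - F a) {a..b}"
    unfolding has_integral_real
  proof (intro allI impI)
    fix e0 :: real assume e0: "e0 > 0"
    \<comment> \<open>The added 1 keeps the quotient meaningful when \<open>a = b\<close>.\<close>
    define e where "e = e0 / (2 * (b - a + 1))"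
    have e: "e > 0" "e * (b - a) < e0/2"
    proof -
      show "e > 0" unfolding e_def using e0 ab by simp
      have "e * (b - a) < e * (b - a + 1)" using \<open>e > 0\<close> by (simp add: algebra_simps)
      also have "\<dots> = e0/2" unfolding e_def using ab by (simp add: field_simps)
      finally show "e * (b - a) < e0/2" .
    qed
    have e02: "e0/2 > 0" using e0 by simp
    obtain d where d: "d > 0" and dac: "\<forall>n (u::nat \<Rightarrow> real) v.
        (\<forall>i<n. a \<le> u i \<and> u i \<le> v i \<and> v i \<le> b) \<and>
        (\<forall>i<n. \<forall>j<n. i \<noteq> j \<longrightarrow> v i \<le> u j \<or> v j \<le> u i) \<and>
        (\<Sum>i<n. v i - u i) < d \<longrightarrow> (\<Sum>i<n. \<bar>F (v i) - F (u i)\<bar>) < e0/2"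
      using ac[unfolded acr_def, THEN spec, THEN mp, OF e02] by blast
    obtain U where U: "open U" "N \<subseteq> U" "U \<in> lmeasurable" "measure lebesgue U < d"
    proof -
      obtain U where U: "open U" "N \<subseteq> U" "U - N \<in> lmeasurable" "emeasure lebesgue (U - N) < ennreal d"
        using sets_lebesgue_outer_open[OF negligible_imp_sets[OF N] d] by blast
      have m: "U \<in> lmeasurable"
        using fmeasurable.Un[OF U(3) negligible_imp_measurable[OF N]] U(2) by (simp add: Un_absorb2)
      have "measure lebesgue (U - N) < d" using U(3,4) d
        by (metis emeasure_eq_measure2 ennreal_less_iff measure_nonneg)
      then have "measure lebesgue U < d"
        using N m by (simp add: measure_Diff_null_set negligible_iff_null_sets fmeasurableD)
      then show thesis using that U m by blast
    qed
    \<comment> \<open>The radius of the gauge: inside \<open>U\<close> at points of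
      \<open>N\<close>, and within the linear approximation elsewhere.\<close>
    have "\<exists>r>0. (x \<in> N \<longrightarrow> ball x r \<subseteq> U) \<and>
        (x \<in> {a..b} - N \<longrightarrow> (\<forall>y. \<bar>y - x\<bar> < r \<longrightarrow> \<bar>F y - F x - (y - x) * f x\<bar> \<le> e * \<bar>y - x\<bar>))" for x
    proof (cases "x \<in> N")
      case True
      then show ?thesis using U(1,2) open_contains_ball by blast
    next
      case False
      show ?thesis
      proof (cases "x \<in> {a..b}")
        case True
        then have "(F has_real_derivative f x) (at x)" using False unfolding N_def by auto
        then have "\<exists>r>0. \<forall>y. norm (y - x) < r \<longrightarrow> norm (F y - F x - f x * (y - x)) \<le> e * norm (y - x)"
          unfolding has_field_derivative_def has_derivative_at_alt using e(1) by auto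
        then show ?thesis using False by (auto simp: mult.commute)
      qed (use False in \<open>auto intro: exI[of _ 1]\<close>)
    qed
    then obtain r where r: "\<And>x. r x > 0" "\<And>x. x \<in> N \<Longrightarrow> ball x (r x) \<subseteq> U"
      "\<And>x y. x \<in> {a..b} - N \<Longrightarrow> \<bar>y - x\<bar> < r x \<Longrightarrow> \<bar>F y - F x - (y - x) * f x\<bar> \<le> e * \<bar>y - x\<bar>"
      by metis
    show "\<exists>\<gamma>. gauge \<gamma> \<and> (\<forall>p. p tagged_division_of {a..b} \<and> \<gamma> fine p \<longrightarrow>
        norm (sum (\<lambda>(x,k). measure lborel k *\<^sub>R g x) p - (F b - F a)) < e0)"
    proof (intro exI[of _ "\<lambda>x. ball x (r x)"] conjI allI impI)
      show "gauge (\<lambda>x. ball x (r x))" using r(1) gauge_ball_dependent by blast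
      fix p assume p: "p tagged_division_of {a..b} \<and> (\<lambda>x. ball x (r x)) fine p"
      then have pt: "p tagged_division_of cbox a b" and fine: "\<And>x K. (x,K) \<in> p \<Longrightarrow> K \<subseteq> ball x (r x)"
        by (auto simp: fine_def)
      have fin: "finite p" using pt by auto
      have K: "K = {Inf K..Sup K}" "Inf K \<le> x" "x \<le> Sup K" "a \<le> Inf K" "Sup K \<le> b" if xKp: "(x,K) \<in> p" for x K
      proof -
        obtain u v where uv: "K = cbox u v" "x \<in> K" "K \<subseteq> cbox a b" using tagged_division_ofD(2,3,4)[OF pt xKp] by blast
        then have "u \<le> v" "Inf K = u" "Sup K = v" by auto
        then show "K = {Inf K..Sup K}" "Inf K \<le> x" "x \<le> Sup K" "a \<le> Inf K" "Sup K \<le> b" using uv by auto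
      qed
      define h where "h = (\<lambda>(x::real,K). measure lborel K *\<^sub>R g x - (F (Sup K) - F (Inf K)))"
      define p1 where "p1 = {q\<in>p. fst q \<notin> N}"
      \<comment> \<open>Degenerate intervals contribute nothing at bad tags and are dropped, so that
        non-overlapping intervals are ordered and have nonempty interiors.\<close>
      define p2 where "p2 = {q\<in>p. fst q \<in> N \<and> Inf (snd q) < Sup (snd q)}"
      have "F b - F a = (\<Sum>(x,K)\<in>p. F (Sup K) - F (Inf K))"
        using additive_tagged_division_1[OF ab pt[unfolded box_real], of F] by simp
      then have "sum (\<lambda>(x,k). measure lborel k *\<^sub>R g x) p - (F b - F a) = sum h p"
        unfolding h_def by (simp add: sum_subtractf split_def)
      also have "sum h p = sum h (p1 \<union> p2)"
      proof (rule sum.mono_neutral_right[OF fin])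
        show "p1 \<union> p2 \<subseteq> p" unfolding p1_def p2_def by auto
        show "\<forall>i\<in>p - (p1 \<union> p2). h i = 0"
        proof (rule ballI)
          fix q' assume q': "q' \<in> p - (p1 \<union> p2)"
          obtain x K where xK: "q' = (x,K)" by force
          have q: "(x,K) \<in> p" using q' xK by auto
          have "\<not> Inf K < Sup K" "x \<in> N" using q' unfolding xK p1_def p2_def by auto
          then have "Inf K = Sup K" "g x = 0" using K(2,3)[OF q] by (auto simp: g_def)
          then show "h q' = 0" unfolding xK h_def using K(1)[OF q] by (simp add: content_real_if)
        qed
      qed
      also have "\<dots> = sum h p1 + sum h p2"
        by (rule sum.union_disjoint) (use fin in \<open>auto simp: p1_def p2_def\<close>)
      finally have eq: "sum (\<lambda>(x,k). measure lborel k *\<^sub>R g x) p - (F b - F a) = sum h p1 + sum h p2" .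
      have "\<bar>sum h p1\<bar> \<le> (\<Sum>q\<in>p1. e * (Sup (snd q) - Inf (snd q)))"
      proof (rule order_trans[OF sum_abs sum_mono])
        fix q assume q: "q \<in> p1"
        obtain x K where xk: "q = (x,K)" by force
        with q have xK: "(x,K) \<in> p" "x \<notin> N" unfolding p1_def by auto
        note k = K[OF xK(1)]
        have xab: "x \<in> {a..b} - N" using k xK by auto
        have "Inf K \<in> K" "Sup K \<in> K" using k by (metis atLeastAtMost_iff order.trans order_refl)+
        then have "\<bar>Inf K - x\<bar> < r x" "\<bar>Sup K - x\<bar> < r x" 
          using subsetD[OF fine[OF xK(1)], of "Inf K"] subsetD[OF fine[OF xK(1)], of "Sup K"] by (auto simp: dist_real_def)
        then have "\<bar>F (Inf K) - F x - (Inf K - x) * f x\<bar> \<le> e * (x - Inf K)"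
          "\<bar>F (Sup K) - F x - (Sup K - x) * f x\<bar> \<le> e * (Sup K - x)"
          using r(3)[OF xab, of "Inf K"] r(3)[OF xab, of "Sup K"] k by auto
        moreover have cK: "measure lborel K = Sup K - Inf K" using k by (metis content_real order.trans)
        moreover have "h q = (F (Inf K) - F x - (Inf K - x) * f x) - (F (Sup K) - F x - (Sup K - x) * f x)"
          unfolding xk h_def g_def prod.case cK using xK(2) by (simp add: algebra_simps)
        moreover have "e * (Sup K - Inf K) = e * (Sup K - x) + e * (x - Inf K)" by (simp add: algebra_simps)
        ultimately show "\<bar>h q\<bar> \<le> e * (Sup (snd q) - Inf (snd q))"
          unfolding xk snd_conv by linarith
      qed
      also have "\<dots> \<le> (\<Sum>q\<in>p. e * (Sup (snd q) - Inf (snd q)))"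
      proof (rule sum_mono2[OF fin])
        fix q assume "q \<in> p - p1"
        then have "(fst q, snd q) \<in> p" by auto
        then have "Inf (snd q) \<le> Sup (snd q)" using K(2,3) by (meson order.trans)
        then show "0 \<le> e * (Sup (snd q) - Inf (snd q))" using e(1) by simp
      qed (auto simp: p1_def)
      also have "\<dots> = e * (b - a)"
        using additive_tagged_division_1[OF ab pt[unfolded box_real], of "\<lambda>x. x"]
        by (simp add: sum_distrib_left[symmetric] split_def)
      finally have 1: "\<bar>sum h p1\<bar> < e0/2" using e(2) by linarith
      have disj: "Sup (snd q) \<le> Inf (snd q') \<or> Sup (snd q') \<le> Inf (snd q)"
        if q: "q \<in> p2" "q' \<in> p2" "q \<noteq> q'" for q q'
      proof (rule ccontr)
        assume n: "\<not> ?thesis"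
        obtain x K x' K' where xk: "q = (x,K)" "q' = (x',K')" by force
        have "(x,K) \<in> p" "(x',K') \<in> p" "(x,K) \<noteq> (x',K')" using q xk unfolding p2_def by auto
        then have i: "interior K \<inter> interior K' = {}" using pt tagged_division_ofD(5) by blast
        have "K = {Inf K..Sup K}" "K' = {Inf K'..Sup K'}" using K(1)[OF \<open>(x,K) \<in> p\<close>] K(1)[OF \<open>(x',K') \<in> p\<close>] by auto
        then have "{Inf K<..<Sup K} \<inter> {Inf K'<..<Sup K'} = {}"
          using i by (metis interior_atLeastAtMost_real)
        moreover have "Inf K < Sup K" "Inf K' < Sup K'" using q unfolding p2_def xk by auto
        moreover have "Inf K' < Sup K" "Inf K < Sup K'" using n unfolding xk by auto
        ultimately have "max (Inf K) (Inf K') < min (Sup K) (Sup K')" by auto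
        then obtain z where "max (Inf K) (Inf K') < z" "z < min (Sup K) (Sup K')" using dense by blast
        then have "z \<in> {Inf K<..<Sup K} \<inter> {Inf K'<..<Sup K'}" by auto
        then show False using \<open>{Inf K<..<Sup K} \<inter> {Inf K'<..<Sup K'} = {}\<close> by auto
      qed
      have fin2: "finite p2" using fin unfolding p2_def by auto
      \<comment> \<open>The open interiors are disjoint subsets of \<open>U\<close>, so their total
        length is at most the measure of \<open>U\<close>, which is below \<open>d\<close>.\<close>
      define J where "J q = {Inf (snd q)<..<Sup (snd q)}" for q :: "real \<times> real set"
      have J0: "J q \<in> lmeasurable \<and> measure lebesgue (J q) = Sup (snd q) - Inf (snd q)" if "q \<in> p2" for q
        using that unfolding J_def p2_def by (auto simp: measure_completion)
      have mU: "measure lebesgue (\<Union>(J ` p2)) = (\<Sum>q\<in>p2. measure lebesgue (J q))"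
      proof (rule measure_negligible_finite_Union_image[OF fin2])
        have "J q \<inter> J q' = {}" if "q \<in> p2" "q' \<in> p2" "q \<noteq> q'" for q q'
          using disj[OF that] unfolding J_def by force
        then show "pairwise (\<lambda>x y. negligible (J x \<inter> J y)) p2" by (simp add: pairwise_def)
      qed (use J0 in auto)
      have sub: "\<Union>(J ` p2) \<subseteq> U"
      proof clarify
        fix x x' K assume q: "(x', K) \<in> p2" and x: "x \<in> J (x',K)"
        have q': "(x',K) \<in> p" "x' \<in> N" using q unfolding p2_def by auto
        have "x \<in> K" using x K(1)[OF q'(1)] unfolding J_def by (metis atLeastAtMost_iff greaterThanLessThan_iff less_imp_le snd_conv)
        then show "x \<in> U" using fine[OF q'(1)] r(2)[OF q'(2)] by auto
      qed
      have "(\<Sum>q\<in>p2. Sup (snd q) - Inf (snd q)) = (\<Sum>q\<in>p2. measure lebesgue (J q))"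
        by (rule sum.cong) (use J0 in auto)
      also have "\<dots> \<le> measure lebesgue U"
        unfolding mU[symmetric] by (rule measure_mono_fmeasurable[OF sub _ U(3)])
          (use J0 fin2 in \<open>auto intro!: sets.finite_UN fmeasurableD\<close>)
      finally have lt: "(\<Sum>q\<in>p2. Sup (snd q) - Inf (snd q)) < d" using U(4) by linarith
      have "(\<Sum>q\<in>p2. \<bar>F (Sup (snd q)) - F (Inf (snd q))\<bar>) < e0/2"
      proof (rule acr_set_bound[OF dac fin2 _ disj lt])
        fix q assume q: "q \<in> p2"
        have qp: "(fst q, snd q) \<in> p" using q unfolding p2_def by simp
        have "Inf (snd q) < Sup (snd q)" using q unfolding p2_def by blast
        then show "a \<le> Inf (snd q) \<and> Inf (snd q) \<le> Sup (snd q) \<and> Sup (snd q) \<le> b"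
          using K(4)[OF qp] K(5)[OF qp] by simp
      qed
      moreover have "\<bar>sum h p2\<bar> \<le> (\<Sum>q\<in>p2. \<bar>F (Sup (snd q)) - F (Inf (snd q))\<bar>)"
        by (rule order_trans[OF sum_abs sum_mono]) (auto simp: h_def p2_def g_def split_def)
      ultimately have "\<bar>sum h p2\<bar> < e0/2" by linarith
      then show "norm (sum (\<lambda>(x,k). measure lborel k *\<^sub>R g x) p - (F b - F a)) < e0" unfolding eq using 1 by simp
    qed
  qed
  then show ?thesis
    by (rule has_integral_spike[OF N, rotated]) (auto simp: g_def)
qed

section \<open>Differentiation of indefinite integrals almost everywhere\<close>

lemma bm_right_derivative:
  fixes f :: "real \<Rightarrow> real"
  assumes "\<And>c d. f integrable_on {c..d}"
  obtains N where "negligible N"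
    "\<And>x e. x \<notin> N \<Longrightarrow> 0 < e \<Longrightarrow> \<exists>d>0. \<forall>h. 0 < h \<and> h < d \<longrightarrow> \<bar>integral {x..x + h} f - h * f x\<bar> \<le> e * h"
proof -
  obtain N where N: "negligible N" "\<And>x e. x \<notin> N \<Longrightarrow> 0 < e \<Longrightarrow>
     \<exists>d>0. \<forall>h. 0 < h \<and> h < d \<longrightarrow> norm(integral (cbox x (x + h *\<^sub>R One)) f /\<^sub>R h ^ DIM(real) - f x) < e"
    using integrable_ccontinuous_explicit[of f] assms by (metis box_real(2))
  show ?thesis
  proof (rule that[OF N(1)])
    fix x e :: real assume "x \<notin> N" "0 < e"
    then obtain d where d: "d > 0" "\<And>h. 0 < h \<Longrightarrow> h < d \<Longrightarrow> \<bar>integral {x..x + h} f / h - f x\<bar> < e"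
      using N(2)[of x e] by (auto simp: field_simps)
    show "\<exists>d>0. \<forall>h. 0 < h \<and> h < d \<longrightarrow> \<bar>integral {x..x + h} f - h * f x\<bar> \<le> e * h"
    proof (intro exI[of _ d] conjI allI impI d(1))
      fix h assume h: "0 < h \<and> h < d"
      have "\<bar>integral {x..x + h} f - h * f x\<bar> = h * \<bar>integral {x..x + h} f / h - f x\<bar>"
        using h by (simp add: abs_mult[symmetric, of h] abs_if field_simps)
      also have "\<dots> \<le> h * e" using d(2)[of h] h by (intro mult_left_mono) auto
      finally show "\<bar>integral {x..x + h} f - h * f x\<bar> \<le> e * h" by (simp add: mult.commute)
    qed
  qed
qed

lemma bm_integral_lip:
  assumes f: "bm a b f" shows "lipr a b (\<lambda>t. integral {a..t} f)"
proof -
  obtain M where M: "M > 0" "\<And>t. t \<in> {a..b} \<Longrightarrow> \<bar>f t\<bar> \<le> M" using bm_bounded[OF f] by blast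
  have le: "\<bar>integral {a..t} f - integral {a..s} f\<bar> \<le> M * (t - s)" if "a \<le> s" "s \<le> t" "t \<le> b" for s t
  proof -
    have "integral {a..s} f + integral {s..t} f = integral {a..t} f"
      by (rule Henstock_Kurzweil_Integration.integral_combine) (use that bm_integrable_sub[OF f] in auto)
    moreover have "norm (integral {s..t} f) \<le> integral {s..t} (\<lambda>_. M)"
      by (rule integral_norm_bound_integral) (use that M bm_integrable_sub[OF f] in auto)
    then have "\<bar>integral {s..t} f\<bar> \<le> M * (t - s)" using that by (simp add: mult.commute)
    ultimately show ?thesis by auto
  qed
  show ?thesis unfolding lipr_def
  proof (intro exI[of _ M] ballI)
    fix s t assume st: "s \<in> {a..b}" "t \<in> {a..b}"
    show "\<bar>integral {a..s} f - integral {a..t} f\<bar> \<le> M * \<bar>s - t\<bar>"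
      using le[of s t] le[of t s] st by (cases "s \<le> t") auto
  qed
qed

text \<open>Differentiation over the boxes \<open>{x..x + h}\<close> sees only the right side of a
  point. The left side comes from the same result for the reflected function, whose exceptional set
  is reflected back.\<close>

lemma bm_integral_deriv:
  assumes f: "bm a b f" shows "ae a b (\<lambda>t. ((\<lambda>t. integral {a..t} f) has_real_derivative f t) (at t))"
proof -
  define F where "F t = integral {a..t} f" for t
  \<comment> \<open>Extension by zero makes the function integrable on every interval, including
    those that leave \<open>{a..b}\<close>.\<close>
  define g where "g t = (if t \<in> {a..b} then f t else 0)" for t
  have gi: "g integrable_on {c..d}" for c d
  proof -
    have "g integrable_on UNIV" unfolding g_def integrable_restrict_UNIV by (rule bm_integrable[OF f])
    then show ?thesis using integrable_on_subinterval[of g UNIV c d] by simp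
  qed
  have gi': "(\<lambda>t. g (-t)) integrable_on {c..d}" for c d
    using Henstock_Kurzweil_Integration.integrable_reflect_real[where f=g and a="-d" and b="-c"] gi by simp
  obtain N where N: "negligible N"
    "\<And>x e. x \<notin> N \<Longrightarrow> 0 < e \<Longrightarrow> \<exists>d>0. \<forall>h. 0 < h \<and> h < d \<longrightarrow> \<bar>integral {x..x + h} g - h * g x\<bar> \<le> e * h"
    using bm_right_derivative[OF gi] by blast
  obtain N' where N': "negligible N'"
    "\<And>x e. x \<notin> N' \<Longrightarrow> 0 < e \<Longrightarrow>
      \<exists>d>0. \<forall>h. 0 < h \<and> h < d \<longrightarrow> \<bar>integral {x..x + h} (\<lambda>t. g (-t)) - h * g (-x)\<bar> \<le> e * h"
    using bm_right_derivative[OF gi'] by blast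
  have neg: "negligible (N \<union> uminus ` N')"
    using N(1) N'(1) negligible_differentiable_image_negligible[of N' uminus] by (auto intro!: derivative_intros simp: differentiable_on_minus)
  have FG: "integral {s..t} g = F t - F s" if "a \<le> s" "s \<le> t" "t \<le> b" for s t
  proof -
    have "integral {a..s} f + integral {s..t} f = integral {a..t} f"
      by (rule Henstock_Kurzweil_Integration.integral_combine) (use that bm_integrable_sub[OF f] in auto)
    moreover have "integral {s..t} g = integral {s..t} f"
      by (rule integral_cong) (use that in \<open>auto simp: g_def\<close>)
    ultimately show ?thesis unfolding F_def by simp
  qed
  have der: "(F has_real_derivative f x) (at x)" if x: "a < x" "x < b" "x \<notin> N \<union> uminus ` N'" for x
    unfolding has_field_derivative_def has_derivative_at_alt
  proof (intro conjI allI impI)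
    show "bounded_linear ((*) (f x))" by (simp add: bounded_linear_mult_right)
    fix e :: real assume e: "0 < e"
    have x': "x \<notin> N" "-x \<notin> N'" using x(3) by (auto simp: image_iff)
    obtain d1 where d1: "d1 > 0" "\<And>h. 0 < h \<Longrightarrow> h < d1 \<Longrightarrow> \<bar>integral {x..x + h} g - h * g x\<bar> \<le> e * h"
      using N(2)[OF x'(1) e] by blast
    obtain d2 where d2: "d2 > 0" "\<And>h. 0 < h \<Longrightarrow> h < d2 \<Longrightarrow> \<bar>integral {-x..-x + h} (\<lambda>t. g (-t)) - h * g x\<bar> \<le> e * h"
      using N'(2)[OF x'(2) e] by auto
    define d where "d = min (min d1 d2) (min (x - a) (b - x))"
    show "\<exists>d>0. \<forall>y. norm (y - x) < d \<longrightarrow> norm (F y - F x - f x * (y - x)) \<le> e * norm (y - x)"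
    proof (intro exI[of _ d] conjI allI impI)
      show "0 < d" unfolding d_def using d1 d2 x by auto
      fix y assume y: "norm (y - x) < d"
      have gx: "g x = f x" using x by (auto simp: g_def)
      consider "y = x" | "y > x" | "y < x" by linarith
      then show "norm (F y - F x - f x * (y - x)) \<le> e * norm (y - x)"
      proof cases
        case 2
        then have "\<bar>integral {x..x + (y-x)} g - (y-x) * g x\<bar> \<le> e * (y-x)" using y unfolding d_def by (intro d1(2)) auto
        moreover have "integral {x..y} g = F y - F x" using 2 y x unfolding d_def by (intro FG) auto
        ultimately show ?thesis using 2 gx by (simp add: mult.commute)
      next
        case 3
        then have "\<bar>integral {-x..-x + (x-y)} (\<lambda>t. g (-t)) - (x-y) * g x\<bar> \<le> e * (x-y)" using y unfolding d_def by (intro d2(2)) auto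
        moreover have "integral {-x..-x + (x-y)} (\<lambda>t. g (-t)) = integral {y..x} g"
          using Henstock_Kurzweil_Integration.integral_reflect_real[where f=g and a=y and b=x] by simp
        moreover have "integral {y..x} g = F x - F y" using 3 y x unfolding d_def by (intro FG) auto
        ultimately show ?thesis using 3 gx by (simp add: algebra_simps abs_le_iff)
      qed simp
    qed
  qed
  have "ae a b (\<lambda>t. t \<notin> N \<union> uminus ` N')" unfolding ae_def by (rule negligible_subset[OF neg]) auto
  then show ?thesis using ae_interior[of a b] by (rule ae_mono2) (use der in \<open>auto simp: F_def[abs_def]\<close>)
qed

section \<open>Calculus of Lipschitz primitives\<close>

lemma primI_integral:
  assumes f: "bm a b f" and F: "\<And>t. t \<in> {a..b} \<Longrightarrow> F t = C + integral {a..t} f"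
  shows "prim a b F f"
  unfolding prim_def
proof (intro conjI f)
  show "lipr a b F" using bm_integral_lip[OF f] F unfolding lipr_def by auto
  show "ae a b (\<lambda>t. (F has_real_derivative f t) (at t))"
    using bm_integral_deriv[OF f] ae_interior
  proof (rule ae_mono2)
    fix t assume *: "t \<in> {a..b}" "((\<lambda>t. integral {a..t} f) has_real_derivative f t) (at t)" "a < t \<and> t < b"
    have "((\<lambda>t. C + integral {a..t} f) has_real_derivative f t) (at t)"
      using DERIV_add[OF DERIV_const[of C] *(2)] by simp
    then show "(F has_real_derivative f t) (at t)"
      by (rule has_field_derivative_transform_within_open[of _ _ _ "{a<..<b}"]) (use * F in auto)
  qed
qed

lemma prim_bm: "prim a b F f \<Longrightarrow> bm a b f" unfolding prim_def by simp

lemma lipr_subset: assumes "lipr a b F" "a \<le> c" "d \<le> b" shows "lipr c d F"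
proof -
  obtain M where "\<forall>s\<in>{a..b}. \<forall>t\<in>{a..b}. \<bar>F s - F t\<bar> \<le> M * \<bar>s - t\<bar>" using assms(1) unfolding lipr_def by auto
  then have "\<forall>s\<in>{c..d}. \<forall>t\<in>{c..d}. \<bar>F s - F t\<bar> \<le> M * \<bar>s - t\<bar>" using assms(2,3) by auto
  then show ?thesis unfolding lipr_def by blast
qed

lemma prim_has_integral:
  assumes "prim a b F f" "a \<le> s" "s \<le> t" "t \<le> b" shows "(f has_integral F t - F s) {s..t}"
proof (rule acr_FTC[OF assms(3)])
  show "acr s t F" using assms unfolding prim_def by (auto intro: lipr_acr lipr_subset)
  show "ae s t (\<lambda>t. (F has_real_derivative f t) (at t))" using assms unfolding prim_def by (auto intro: ae_subset)
qed

lemma prim_integral: "prim a b F f \<Longrightarrow> a \<le> s \<Longrightarrow> s \<le> t \<Longrightarrow> t \<le> b \<Longrightarrow> F t - F s = integral {s..t} f"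
  using prim_has_integral by (metis integral_unique)

lemma prim_cont: assumes "prim a b F f" shows "continuous_on {a..b} F"
proof -
  obtain M where M: "\<forall>s\<in>{a..b}. \<forall>t\<in>{a..b}. \<bar>F s - F t\<bar> \<le> M * \<bar>s - t\<bar>" using assms unfolding prim_def lipr_def by auto
  have "(\<bar>M\<bar>)-lipschitz_on {a..b} F"
  proof (rule lipschitz_onI)
    fix s t assume "s \<in> {a..b}" "t \<in> {a..b}"
    then have "\<bar>F s - F t\<bar> \<le> M * \<bar>s - t\<bar>" using M by auto
    also have "\<dots> \<le> \<bar>M\<bar> * \<bar>s - t\<bar>" by (intro mult_right_mono) auto
    finally show "dist (F s) (F t) \<le> \<bar>M\<bar> * dist s t" by (simp add: dist_real_def)
  qed simp
  then show ?thesis by (rule lipschitz_on_continuous_on)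
qed

lemma prim_lip: assumes "prim a b F f" shows "\<exists>M. M > 0 \<and> (\<forall>t\<in>{a..b}. \<bar>F t\<bar> \<le> M) \<and> (\<forall>s\<in>{a..b}. \<forall>t\<in>{a..b}. \<bar>F s - F t\<bar> \<le> M * \<bar>s - t\<bar>)"
proof -
  obtain M where M: "\<forall>s\<in>{a..b}. \<forall>t\<in>{a..b}. \<bar>F s - F t\<bar> \<le> M * \<bar>s - t\<bar>" using assms unfolding prim_def lipr_def by auto
  obtain B where B: "B > 0" "\<And>t. t \<in> {a..b} \<Longrightarrow> \<bar>F t\<bar> \<le> B" using bm_bounded[OF bm_cont[OF prim_cont[OF assms]]] by blast
  show ?thesis
  proof (intro exI[of _ "max M B"] conjI ballI)
    fix s t assume "s \<in> {a..b}" "t \<in> {a..b}"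
    then have "\<bar>F s - F t\<bar> \<le> M * \<bar>s - t\<bar>" using M by auto
    also have "\<dots> \<le> max M B * \<bar>s - t\<bar>" by (intro mult_right_mono) auto
    finally show "\<bar>F s - F t\<bar> \<le> max M B * \<bar>s - t\<bar>" .
  qed (use B in \<open>auto simp: le_max_iff_disj less_max_iff_disj\<close>)
qed

lemma prim_const: "prim a b (\<lambda>t. c) (\<lambda>t. 0)"
  unfolding prim_def lipr_def by (auto intro!: ae_all derivative_eq_intros exI[of _ 0])

lemma prim_add: assumes "prim a b F f" "prim a b G g" shows "prim a b (\<lambda>t. F t + G t) (\<lambda>t. f t + g t)"
  unfolding prim_def
proof (intro conjI)
  show "bm a b (\<lambda>t. f t + g t)" using assms by (auto intro: bm_add prim_bm)
  obtain M N where "\<forall>s\<in>{a..b}. \<forall>t\<in>{a..b}. \<bar>F s - F t\<bar> \<le> M * \<bar>s - t\<bar>" "\<forall>s\<in>{a..b}. \<forall>t\<in>{a..b}. \<bar>G s - G t\<bar> \<le> N * \<bar>s - t\<bar>"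
    using assms unfolding prim_def lipr_def by auto
  then have "\<forall>s\<in>{a..b}. \<forall>t\<in>{a..b}. \<bar>F s + G s - (F t + G t)\<bar> \<le> (M + N) * \<bar>s - t\<bar>"
    by (fastforce simp: algebra_simps)
  then show "lipr a b (\<lambda>t. F t + G t)" unfolding lipr_def by blast
  show "ae a b (\<lambda>t. ((\<lambda>t. F t + G t) has_real_derivative f t + g t) (at t))"
    by (rule ae_mono2[of a b "\<lambda>t. (F has_real_derivative f t) (at t)" "\<lambda>t. (G has_real_derivative g t) (at t)"])
      (use assms in \<open>auto simp: prim_def intro: DERIV_add\<close>)
qed

lemma prim_mult: assumes "prim a b F f" "prim a b G g" shows "prim a b (\<lambda>t. F t * G t) (\<lambda>t. f t * G t + F t * g t)"
  unfolding prim_def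
proof (intro conjI)
  show "bm a b (\<lambda>t. f t * G t + F t * g t)" 
    by (intro bm_add bm_mult prim_bm[OF assms(1)] prim_bm[OF assms(2)] bm_cont prim_cont[OF assms(1)] prim_cont[OF assms(2)])
  obtain M where M: "M > 0" "\<forall>t\<in>{a..b}. \<bar>F t\<bar> \<le> M" "\<forall>s\<in>{a..b}. \<forall>t\<in>{a..b}. \<bar>F s - F t\<bar> \<le> M * \<bar>s - t\<bar>"
    using prim_lip[OF assms(1)] by blast
  obtain N where N: "N > 0" "\<forall>t\<in>{a..b}. \<bar>G t\<bar> \<le> N" "\<forall>s\<in>{a..b}. \<forall>t\<in>{a..b}. \<bar>G s - G t\<bar> \<le> N * \<bar>s - t\<bar>"
    using prim_lip[OF assms(2)] by blast
  have "\<forall>s\<in>{a..b}. \<forall>t\<in>{a..b}. \<bar>F s * G s - F t * G t\<bar> \<le> (2 * M * N) * \<bar>s - t\<bar>"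
  proof (intro ballI)
    fix s t assume st: "s \<in> {a..b}" "t \<in> {a..b}"
    have "\<bar>F s * G s - F t * G t\<bar> = \<bar>(F s - F t) * G s + F t * (G s - G t)\<bar>" by (simp add: algebra_simps)
    also have "\<dots> \<le> \<bar>F s - F t\<bar> * \<bar>G s\<bar> + \<bar>F t\<bar> * \<bar>G s - G t\<bar>" by (metis abs_mult abs_triangle_ineq)
    also have "\<dots> \<le> (M * \<bar>s - t\<bar>) * N + M * (N * \<bar>s - t\<bar>)"
      using M N st by (intro add_mono mult_mono) auto
    finally show "\<bar>F s * G s - F t * G t\<bar> \<le> (2 * M * N) * \<bar>s - t\<bar>" by (simp add: algebra_simps)
  qed
  then show "lipr a b (\<lambda>t. F t * G t)" unfolding lipr_def by blast
  show "ae a b (\<lambda>t. ((\<lambda>t. F t * G t) has_real_derivative f t * G t + F t * g t) (at t))"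
    by (rule ae_mono2[of a b "\<lambda>t. (F has_real_derivative f t) (at t)" "\<lambda>t. (G has_real_derivative g t) (at t)"])
      (use assms in \<open>auto simp: prim_def intro!: derivative_eq_intros\<close>)
qed

lemma prim_cong:
  assumes "prim a b F f" "\<And>t. t \<in> {a..b} \<Longrightarrow> G t = F t" "bm a b g" "ae a b (\<lambda>t. g t = f t)" shows "prim a b G g"
  unfolding prim_def
proof (intro conjI assms(3))
  show "lipr a b G" using assms(1,2) unfolding prim_def lipr_def by auto
  have 1: "ae a b (\<lambda>t. (F has_real_derivative f t) (at t))" using assms(1) unfolding prim_def by simp
  show "ae a b (\<lambda>t. (G has_real_derivative g t) (at t))"
    using 1 assms(4) ae_interior
  proof (rule ae_mono3)
    fix t assume *: "t \<in> {a..b}" "(F has_real_derivative f t) (at t)" "g t = f t" "a < t \<and> t < b"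
    have "(G has_real_derivative f t) (at t)"
      by (rule has_field_derivative_transform_within_open[OF *(2), of "{a<..<b}"]) (use * assms(2) in auto)
    then show "(G has_real_derivative g t) (at t)" using *(3) by simp
  qed
qed

lemma prim_cong': "prim a b F f \<Longrightarrow> (\<And>t. t \<in> {a..b} \<Longrightarrow> G t = F t) \<Longrightarrow> (\<And>t. t \<in> {a..b} \<Longrightarrow> g t = f t) \<Longrightarrow> prim a b G g"
  by (rule prim_cong) (auto intro: bm_cong prim_bm ae_all)

lemma prim_unique: assumes "prim a b F f" "prim a b F g" shows "ae a b (\<lambda>t. f t = g t)"
  by (rule ae_mono2[of a b "\<lambda>t. (F has_real_derivative f t) (at t)" "\<lambda>t. (F has_real_derivative g t) (at t)"])
    (use assms in \<open>auto simp: prim_def intro: DERIV_unique\<close>)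

lemma prim_cmult: assumes "prim a b F f" shows "prim a b (\<lambda>t. c * F t) (\<lambda>t. c * f t)"
  using prim_mult[OF prim_const[of a b c] assms] by simp

lemma prim_minus: assumes "prim a b F f" shows "prim a b (\<lambda>t. - F t) (\<lambda>t. - f t)"
  using prim_cmult[OF assms, of "-1"] by simp

lemma prim_diff: assumes "prim a b F f" "prim a b G g" shows "prim a b (\<lambda>t. F t - G t) (\<lambda>t. f t - g t)"
  using prim_add[OF assms(1) prim_minus[OF assms(2)]] by simp

lemma prim_subset: assumes "prim a b F f" "a \<le> c" "d \<le> b" shows "prim c d F f"
  using assms bm_subset ae_subset lipr_subset unfolding prim_def by blast

text \<open>The form in which conserved quantities are detected: the derivative is computed as an
  identity that holds almost everywhere.\<close>

lemma prim_zero_const: assumes "prim a b F f" "ae a b (\<lambda>t. f t = 0)" "t \<in> {a..b}" shows "F t = F a"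
proof -
  have "integral {a..t} f = integral {a..t} (\<lambda>_. 0)"
    by (rule ae_integral_cong, rule ae_subset[OF assms(2)]) (use assms in auto)
  then show ?thesis using prim_integral[OF assms(1), of a t] assms(3) by auto
qed

lemma bm_abs: assumes "bm a b f" shows "bm a b (\<lambda>t. \<bar>f t\<bar>)"
  using assms unfolding bm_def by auto

lemma prim_mono:
  assumes "prim a b F f" "ae a b (\<lambda>t. 0 \<le> f t)" "a \<le> s" "s \<le> t" "t \<le> b" shows "F s \<le> F t"
proof -
  \<comment> \<open>The sign is known only almost everywhere; the absolute value is nonnegative
    everywhere and has the same integral.\<close>
  have "integral {s..t} f = integral {s..t} (\<lambda>t. \<bar>f t\<bar>)"
    by (rule ae_integral_cong, rule ae_mono, rule ae_subset[OF assms(2)]) (use assms in auto)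
  also have "\<dots> \<ge> 0" by (rule integral_nonneg, rule bm_integrable_sub[OF bm_abs[OF prim_bm[OF assms(1)]]]) (use assms in auto)
  finally show ?thesis using prim_integral[OF assms(1), of s t] assms by auto
qed

lemma prim_recip:
  assumes F: "prim a b F f" and nz: "\<And>t. t \<in> {a..b} \<Longrightarrow> F t \<noteq> 0"
  shows "prim a b (\<lambda>t. 1 / F t) (\<lambda>t. - f t / (F t)\<^sup>2)"
proof -
  have ci: "continuous_on {a..b} (\<lambda>t. 1 / F t)" using nz prim_cont[OF F] by (auto intro!: continuous_intros)
  obtain M where M: "M > 0" "\<forall>s\<in>{a..b}. \<forall>t\<in>{a..b}. \<bar>F s - F t\<bar> \<le> M * \<bar>s - t\<bar>"
    using prim_lip[OF F] by blast
  obtain N where N: "N > 0" "\<And>t. t\<in>{a..b} \<Longrightarrow> \<bar>1 / F t\<bar> \<le> N"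
    using bm_bounded[OF bm_cont[OF ci]] by blast
  have "\<forall>s\<in>{a..b}. \<forall>t\<in>{a..b}. \<bar>1 / F s - 1 / F t\<bar> \<le> (M * N * N) * \<bar>s - t\<bar>"
  proof (intro ballI)
    fix s t assume st: "s \<in> {a..b}" "t \<in> {a..b}"
    have "1 / F s - 1 / F t = (F t - F s) * (1 / F s) * (1 / F t)" using nz st by (simp add: field_simps)
    then have "\<bar>1 / F s - 1 / F t\<bar> = \<bar>F s - F t\<bar> * \<bar>1 / F s\<bar> * \<bar>1 / F t\<bar>" by (simp add: abs_mult abs_minus_commute)
    also have "\<dots> \<le> (M * \<bar>s - t\<bar>) * N * N" using M N st by (intro mult_mono) auto
    finally show "\<bar>1 / F s - 1 / F t\<bar> \<le> (M * N * N) * \<bar>s - t\<bar>" by (simp add: algebra_simps)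
  qed
  then have l: "lipr a b (\<lambda>t. 1 / F t)" unfolding lipr_def by blast
  have "bm a b (\<lambda>t. - (f t * ((1 / F t) * (1 / F t))))" by (intro bm_intros bm_cont[OF ci] prim_bm[OF F])
  then have m: "bm a b (\<lambda>t. - f t / (F t)\<^sup>2)" by (rule bm_cong) (simp add: power2_eq_square)
  have d: "ae a b (\<lambda>t. (F has_real_derivative f t) (at t))" using F unfolding prim_def by simp
  have "ae a b (\<lambda>t. ((\<lambda>t. 1 / F t) has_real_derivative - f t / (F t)\<^sup>2) (at t))"
  proof (rule ae_mono[OF d])
    fix t assume "t \<in> {a..b}" "(F has_real_derivative f t) (at t)"
    then show "((\<lambda>t. 1 / F t) has_real_derivative - f t / (F t)\<^sup>2) (at t)"
      using nz[of t] by (auto intro!: derivative_eq_intros simp: power2_eq_square)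
  qed
  then show ?thesis unfolding prim_def using l m by blast
qed

text \<open>The indefinite integral is monotone with equal end values, hence constant; its almost
  everywhere derivative is both \<open>f\<close> and 0.\<close>

lemma integral_nonneg_ae_0:
  assumes f: "bm a b f" and nn: "\<And>t. t \<in> {a..b} \<Longrightarrow> 0 \<le> f t" and 0: "integral {a..b} f = 0"
  shows "ae a b (\<lambda>t. f t = 0)"
proof -
  define H where "H t = integral {a..t} f" for t
  have p: "prim a b H f" by (rule primI_integral[OF f, of _ 0]) (auto simp: H_def)
  have "H t = 0" if t: "t \<in> {a..b}" for t
  proof -
    have "H a \<le> H t" "H t \<le> H b" using prim_mono[OF p ae_all[OF nn]] t by auto
    then show ?thesis using 0 unfolding H_def by auto
  qed
  then have "prim a b (\<lambda>t. 0) f" using prim_cong'[OF p, of "\<lambda>t. 0"] by auto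
  then show ?thesis using prim_unique prim_const by blast
qed

lemma prim_shift: assumes "prim a b F f" shows "prim (a + c) (b + c) (\<lambda>t. F (t - c)) (\<lambda>t. f (t - c))"
proof -
  have i: "((\<lambda>t. f (t - c)) has_integral F (t - c) - F a) {a + c..t}" if t: "t \<in> {a+c..b+c}" for t
  proof -
    have "(f has_integral F (t - c) - F a) (cbox a (t - c))" using prim_has_integral[OF assms, of a "t - c"] t by auto
    from has_integral_affinity[OF this, of 1 "-c"] show ?thesis
      by (simp add: add.commute image_add_atLeastAtMost')
  qed
  obtain M where M: "\<And>t. t \<in> {a..b} \<Longrightarrow> \<bar>f t\<bar> \<le> M" using bm_bounded[OF prim_bm[OF assms]] by blast
  have "bm (a+c) (b+c) (\<lambda>t. f (t - c))"
  proof (cases "a \<le> b")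
    case True
    then have "(\<lambda>t. f (t - c)) \<in> borel_measurable (lebesgue_on {a+c..b+c})"
      using i[of "b+c"] by (intro integrable_imp_measurable) (auto simp: integrable_on_def)
    then show ?thesis unfolding bm_def using M by (auto intro!: exI[of _ M])
  qed (auto intro: bm_cont)
  then show ?thesis by (rule primI_integral[where C="F a"]) (use integral_unique[OF i] in \<open>auto\<close>)
qed

lemma prim_join:
  assumes p: "prim a b F f" "prim b c F f" and ab: "a \<le> b" "b \<le> c" shows "prim a c F f"
proof (rule primI_integral[where C="F a"])
  show bm: "bm a c f" using assms by (auto intro: bm_join prim_bm)
  fix t assume t: "t \<in> {a..c}"
  show "F t = F a + integral {a..t} f"
  proof (cases "t \<le> b")
    case True
    then show ?thesis using prim_integral[OF p(1), of a t] t by auto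
  next
    case False
    have "integral {a..b} f + integral {b..t} f = integral {a..t} f"
      by (rule Henstock_Kurzweil_Integration.integral_combine) (use False t ab bm_integrable_sub[OF bm] in auto)
    then show ?thesis using prim_integral[OF p(1), of a b] prim_integral[OF p(2), of b t] t False ab by auto
  qed
qed

section \<open>Horizontal curves in terms of their controls\<close>

lemma vector4_nth: "(vector [w,x,y,z] :: real^4) $ 1 = w" "(vector [w,x,y,z] :: real^4) $ 2 = x"
  "(vector [w,x,y,z] :: real^4) $ 3 = y" "(vector [w,x,y,z] :: real^4) $ 4 = z"
  by (simp_all add: vector_def)

lemma frame_nth: "(h1 *\<^sub>R X1 x + h2 *\<^sub>R X2 x) $ 1 = h1" "(h1 *\<^sub>R X1 x + h2 *\<^sub>R X2 x) $ 2 = h2"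
  "(h1 *\<^sub>R X1 x + h2 *\<^sub>R X2 x) $ 3 = 2 * x$2 * h1 - 2 * x$1 * h2"
  "(h1 *\<^sub>R X1 x + h2 *\<^sub>R X2 x) $ 4 = (x$3)\<^sup>2 * h1"
  by (simp_all add: X1_def X2_def vector4_nth)

lemma vec4_eq_iff: "x = y \<longleftrightarrow> x$1 = y$1 \<and> x$2 = y$2 \<and> x$3 = y$3 \<and> x$4 = (y::real^4)$4"
  by (simp add: vec_eq_iff forall_4)

lemma has_vector_derivative_iff_nth:
  "(\<gamma> has_vector_derivative v) (at t within S) \<longleftrightarrow>
    (\<forall>i. ((\<lambda>t. \<gamma> t $ i) has_real_derivative (v::real^4) $ i) (at t within S))"
proof -
  have "(\<gamma> has_vector_derivative v) (at t within S) \<longleftrightarrow>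
    (\<forall>e\<in>Basis. ((\<lambda>t. \<gamma> t \<bullet> e) has_derivative (\<lambda>h. (h *\<^sub>R v) \<bullet> e)) (at t within S))"
    unfolding has_vector_derivative_def by (rule has_derivative_componentwise_within)
  also have "\<dots> \<longleftrightarrow> (\<forall>i. ((\<lambda>t. \<gamma> t $ i) has_real_derivative v $ i) (at t within S))"
    by (auto simp: Basis_vec_def inner_axis has_field_derivative_def mult_commute_abs)
  finally show ?thesis .
qed

text \<open>The control system written out in coordinates, with the controls as explicit data.
  Controls are Lebesgue measurable here and matter only up to null sets.\<close>

definition ctl :: "real \<Rightarrow> real \<Rightarrow> (real \<Rightarrow> real) \<Rightarrow> (real \<Rightarrow> real) \<Rightarrow> (real \<Rightarrow> real^4) \<Rightarrow> bool" where
  "ctl a b u1 u2 x \<longleftrightarrow> a \<le> b \<and> prim a b (\<lambda>t. x t $ 1) u1 \<and> prim a b (\<lambda>t. x t $ 2) u2 \<and>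
     prim a b (\<lambda>t. x t $ 3) (\<lambda>t. 2 * x t $ 2 * u1 t - 2 * x t $ 1 * u2 t) \<and>
     prim a b (\<lambda>t. x t $ 4) (\<lambda>t. (x t $ 3)\<^sup>2 * u1 t)"

lemma ctlD: assumes "ctl a b u1 u2 x"
  shows "a \<le> b" "prim a b (\<lambda>t. x t $ 1) u1" "prim a b (\<lambda>t. x t $ 2) u2"
     "prim a b (\<lambda>t. x t $ 3) (\<lambda>t. 2 * x t $ 2 * u1 t - 2 * x t $ 1 * u2 t)"
     "prim a b (\<lambda>t. x t $ 4) (\<lambda>t. (x t $ 3)\<^sup>2 * u1 t)" "bm a b u1" "bm a b u2"
  using assms prim_bm unfolding ctl_def by blast+

lemma ctl_cont_nth: assumes "ctl a b u1 u2 x" shows "continuous_on {a..b} (\<lambda>t. x t $ i)"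
  using exhaust_4[of i] ctlD(2-5)[OF assms, THEN prim_cont] by auto

lemma ctl_cont: assumes "ctl a b u1 u2 x" shows "continuous_on {a..b} x"
  using continuous_on_vec_lambda[of "{a..b}" "\<lambda>i t. x t $ i"] ctl_cont_nth[OF assms] by simp

lemma ctl_deriv: assumes "ctl a b u1 u2 x"
  shows "ae a b (\<lambda>t. (x has_vector_derivative (u1 t *\<^sub>R X1 (x t) + u2 t *\<^sub>R X2 (x t))) (at t))"
proof -
  let ?P = "\<lambda>i v t. ((\<lambda>t. x t $ i) has_real_derivative v t) (at t)"
  have "ae a b (?P 1 u1)" "ae a b (?P 2 u2)" "ae a b (?P 3 (\<lambda>t. 2 * x t $ 2 * u1 t - 2 * x t $ 1 * u2 t))"
    "ae a b (?P 4 (\<lambda>t. (x t $ 3)\<^sup>2 * u1 t))" using ctlD(2-5)[OF assms] unfolding prim_def by simp_all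
  then have "ae a b (\<lambda>t. (?P 1 u1 t \<and> ?P 2 u2 t) \<and> (?P 3 (\<lambda>t. 2 * x t $ 2 * u1 t - 2 * x t $ 1 * u2 t) t \<and>
     ?P 4 (\<lambda>t. (x t $ 3)\<^sup>2 * u1 t) t))" by (intro ae_conj)
  then show ?thesis
    unfolding has_vector_derivative_iff_nth forall_4 frame_nth by (rule ae_mono) simp
qed

text \<open>\<open>horizontal\<close> asks for Borel controls while \<open>bm\<close> is Lebesgue
  measurability. Changing a function on a null set may destroy its bound, so the Borel version is
  truncated at the old bound.\<close>

lemma bm_borel_version:
  assumes "bm a b f"
  obtains h M where "h \<in> borel_measurable lborel" "\<And>t. \<bar>h t\<bar> \<le> M" "ae a b (\<lambda>t. h t = f t)"
proof -
  obtain M where M: "M > 0" "\<And>t. t \<in> {a..b} \<Longrightarrow> \<bar>f t\<bar> \<le> M" using bm_bounded[OF assms] by blast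
  have "(\<lambda>t. if t \<in> {a..b} then f t else 0) \<in> borel_measurable lebesgue"
    using assms unfolding bm_def by (subst borel_measurable_if) auto
  then obtain h0 where h0: "h0 \<in> borel_measurable lborel" "AE t in lborel. (if t \<in> {a..b} then f t else 0) = h0 t"
    using completion_ex_borel_measurable_real by blast
  have ae: "ae a b (\<lambda>t. f t = h0 t)" using h0(2) by (intro AE_lborel_iff_ae[THEN iffD1]) (auto elim: AE_mp)
  show ?thesis
  proof (rule that[of "\<lambda>t. max (-M) (min M (h0 t))" M])
    show "(\<lambda>t. max (-M) (min M (h0 t))) \<in> borel_measurable lborel" using h0(1) by measurable
    show "\<bar>max (-M) (min M (h0 t))\<bar> \<le> M" for t using M(1) by auto
    show "ae a b (\<lambda>t. max (-M) (min M (h0 t)) = f t)"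
      by (rule ae_mono[OF ae]) (use M(2) in \<open>fastforce simp: abs_le_iff\<close>)
  qed
qed

text \<open>Absolute continuity of each coordinate turns the almost everywhere velocity into an
  integral formula, from which the Lipschitz property follows because the controls are
  bounded.\<close>

lemma horizontal_imp_ctl:
  assumes h: "horizontal a b \<gamma>" obtains u1 u2 where "ctl a b u1 u2 \<gamma>"
proof -
  obtain h1 h2 M where ab: "a \<le> b" and ac: "absolutely_continuous_on a b \<gamma>"
    and hm: "h1 \<in> borel_measurable lborel" "h2 \<in> borel_measurable lborel"
    and hb: "\<forall>t\<in>{a..b}. \<bar>h1 t\<bar> \<le> M \<and> \<bar>h2 t\<bar> \<le> M"
    and ae0: "AE t in lborel. t \<in> {a..b} \<longrightarrow> (\<gamma> has_vector_derivative (h1 t *\<^sub>R X1 (\<gamma> t) + h2 t *\<^sub>R X2 (\<gamma> t))) (at t)"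
    using h unfolding horizontal_def by blast
  have ae: "ae a b (\<lambda>t. (\<gamma> has_vector_derivative (h1 t *\<^sub>R X1 (\<gamma> t) + h2 t *\<^sub>R X2 (\<gamma> t))) (at t))"
    using ae0 AE_lborel_iff_ae by blast
  have bm: "bm a b h1" "bm a b h2"
    using hb measurable_restrict_space1[OF measurable_completion[OF hm(1)]]
      measurable_restrict_space1[OF measurable_completion[OF hm(2)]] unfolding bm_def by auto
  have acr: "acr a t (\<lambda>t. \<gamma> t $ i)" if "t \<le> b" for t i
    unfolding acr_def
  proof (intro allI impI)
    fix e :: real assume "e > 0"
    then obtain d where d: "d > 0" "\<And>n (u::nat \<Rightarrow> real) v.
        (\<forall>i<n. a \<le> u i \<and> u i \<le> v i \<and> v i \<le> b) \<Longrightarrow>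
        (\<forall>i<n. \<forall>j<n. i \<noteq> j \<longrightarrow> v i \<le> u j \<or> v j \<le> u i) \<Longrightarrow>
        (\<Sum>i<n. v i - u i) < d \<Longrightarrow> (\<Sum>i<n. norm (\<gamma> (v i) - \<gamma> (u i))) < e"
      using ac[unfolded absolutely_continuous_on_def, THEN spec, THEN mp, of e] by blast
    show "\<exists>\<delta>>0. \<forall>n (u::nat \<Rightarrow> real) v.
        (\<forall>i<n. a \<le> u i \<and> u i \<le> v i \<and> v i \<le> t) \<and>
        (\<forall>i<n. \<forall>j<n. i \<noteq> j \<longrightarrow> v i \<le> u j \<or> v j \<le> u i) \<and>
        (\<Sum>i<n. v i - u i) < \<delta> \<longrightarrow> (\<Sum>j<n. \<bar>\<gamma> (v j) $ i - \<gamma> (u j) $ i\<bar>) < e"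
    proof (intro exI[of _ d] conjI allI impI d(1), elim conjE)
      fix n and u v :: "nat \<Rightarrow> real"
      assume *: "\<forall>i<n. a \<le> u i \<and> u i \<le> v i \<and> v i \<le> t" "\<forall>i<n. \<forall>j<n. i \<noteq> j \<longrightarrow> v i \<le> u j \<or> v j \<le> u i"
        "(\<Sum>i<n. v i - u i) < d"
      have "(\<Sum>j<n. \<bar>\<gamma> (v j) $ i - \<gamma> (u j) $ i\<bar>) \<le> (\<Sum>j<n. norm (\<gamma> (v j) - \<gamma> (u j)))"
        by (rule sum_mono) (metis component_le_norm_cart vector_minus_component)
      also have "\<dots> < e" using * \<open>t \<le> b\<close> by (intro d(2)) fastforce+
      finally show "(\<Sum>j<n. \<bar>\<gamma> (v j) $ i - \<gamma> (u j) $ i\<bar>) < e" .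
    qed
  qed
  have FTC: "\<gamma> t $ i = \<gamma> a $ i + integral {a..t} (\<lambda>t. (h1 t *\<^sub>R X1 (\<gamma> t) + h2 t *\<^sub>R X2 (\<gamma> t)) $ i)"
    if t: "t \<in> {a..b}" for t i
  proof -
    have "((\<lambda>t. (h1 t *\<^sub>R X1 (\<gamma> t) + h2 t *\<^sub>R X2 (\<gamma> t)) $ i) has_integral \<gamma> t $ i - \<gamma> a $ i) {a..t}"
    proof (rule acr_FTC[of a t "\<lambda>t. \<gamma> t $ i"])
      show "ae a t (\<lambda>t. ((\<lambda>t. \<gamma> t $ i) has_real_derivative (h1 t *\<^sub>R X1 (\<gamma> t) + h2 t *\<^sub>R X2 (\<gamma> t)) $ i) (at t))"
        by (rule ae_mono[OF ae_subset[OF ae]]) (use t in \<open>auto simp: has_vector_derivative_iff_nth simp del: vector_add_component\<close>)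
    qed (use t acr in auto)
    then show ?thesis by (simp add: integral_unique)
  qed
  note F = FTC[of _ 1, unfolded frame_nth] FTC[of _ 2, unfolded frame_nth] FTC[of _ 3, unfolded frame_nth] FTC[of _ 4, unfolded frame_nth]
  have p1: "prim a b (\<lambda>t. \<gamma> t $ 1) h1" by (rule primI_integral[OF bm(1) F(1)])
  have p2: "prim a b (\<lambda>t. \<gamma> t $ 2) h2" by (rule primI_integral[OF bm(2) F(2)])
  have p3: "prim a b (\<lambda>t. \<gamma> t $ 3) (\<lambda>t. 2 * \<gamma> t $ 2 * h1 t - 2 * \<gamma> t $ 1 * h2 t)"
    by (rule primI_integral[OF _ F(3)]) (intro bm_intros bm bm_cont prim_cont[OF p1] prim_cont[OF p2])
  have p4: "prim a b (\<lambda>t. \<gamma> t $ 4) (\<lambda>t. (\<gamma> t $ 3)\<^sup>2 * h1 t)"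
    by (rule primI_integral[OF _ F(4)]) (intro bm_intros bm bm_cont prim_cont[OF p3])
  show ?thesis using that ab p1 p2 p3 p4 unfolding ctl_def by blast
qed

text \<open>Makes the competitors constructed from controls admissible in the infimum that defines
  \<open>sr_dist\<close>.\<close>

lemma ctl_imp_horizontal:
  assumes c: "ctl a b u1 u2 x" shows "horizontal a b x"
proof -
  have lip: "\<exists>M>0. \<forall>s\<in>{a..b}. \<forall>t\<in>{a..b}. \<bar>x s $ i - x t $ i\<bar> \<le> M * \<bar>s - t\<bar>" for i
    using exhaust_4[of i] prim_lip[OF ctlD(2)[OF c]] prim_lip[OF ctlD(3)[OF c]] prim_lip[OF ctlD(4)[OF c]] prim_lip[OF ctlD(5)[OF c]]
    by (elim disjE) blast+
  then obtain M where M: "\<And>i. M i > 0" "\<And>i s t. s \<in> {a..b} \<Longrightarrow> t \<in> {a..b} \<Longrightarrow> \<bar>x s $ i - x t $ i\<bar> \<le> M i * \<bar>s - t\<bar>"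
    by metis
  define L where "L = (\<Sum>i\<in>UNIV. M i)"
  have L0: "L > 0" unfolding L_def by (rule sum_pos) (use M in auto)
  have L: "norm (x s - x t) \<le> L * \<bar>s - t\<bar>" if "s \<in> {a..b}" "t \<in> {a..b}" for s t
  proof -
    have "norm (x s - x t) \<le> (\<Sum>i\<in>UNIV. \<bar>(x s - x t) $ i\<bar>)" by (rule norm_le_l1_cart)
    also have "\<dots> \<le> (\<Sum>i\<in>UNIV. M i * \<bar>s - t\<bar>)" by (rule sum_mono) (use M(2) that in simp)
    finally show ?thesis by (simp add: L_def sum_distrib_right)
  qed
  have ac: "absolutely_continuous_on a b x"
    unfolding absolutely_continuous_on_def
  proof (intro allI impI)
    fix e :: real assume e: "e > 0"
    show "\<exists>\<delta>>0. \<forall>n (u::nat \<Rightarrow> real) v.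
        (\<forall>i<n. a \<le> u i \<and> u i \<le> v i \<and> v i \<le> b) \<and>
        (\<forall>i<n. \<forall>j<n. i \<noteq> j \<longrightarrow> v i \<le> u j \<or> v j \<le> u i) \<and>
        (\<Sum>i<n. v i - u i) < \<delta> \<longrightarrow> (\<Sum>i<n. norm (x (v i) - x (u i))) < e"
    proof (intro exI[of _ "e/L"] conjI allI impI, goal_cases)
      case 1 then show ?case using e L0 by simp
    next
      case (2 n u v)
      have "(\<Sum>i<n. norm (x (v i) - x (u i))) \<le> (\<Sum>i<n. L * (v i - u i))"
      proof (rule sum_mono)
        fix i assume "i \<in> {..<n}"
        then have "a \<le> u i" "u i \<le> v i" "v i \<le> b" using 2 by auto
        then show "norm (x (v i) - x (u i)) \<le> L * (v i - u i)" using L[of "v i" "u i"] by auto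
      qed
      also have "\<dots> = L * (\<Sum>i<n. v i - u i)" by (simp add: sum_distrib_left)
      also have "\<dots> < e" using 2 L0 by (simp add: field_simps)
      finally show ?case .
    qed
  qed
  obtain h1 M1 where h1: "h1 \<in> borel_measurable lborel" "\<And>t. \<bar>h1 t\<bar> \<le> M1" "ae a b (\<lambda>t. h1 t = u1 t)"
    using bm_borel_version[OF ctlD(6)[OF c]] by blast
  obtain h2 M2 where h2: "h2 \<in> borel_measurable lborel" "\<And>t. \<bar>h2 t\<bar> \<le> M2" "ae a b (\<lambda>t. h2 t = u2 t)"
    using bm_borel_version[OF ctlD(7)[OF c]] by blast
  have "ae a b (\<lambda>t. (x has_vector_derivative (h1 t *\<^sub>R X1 (x t) + h2 t *\<^sub>R X2 (x t))) (at t))"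
    by (rule ae_mono3[OF ctl_deriv[OF c] h1(3) h2(3)]) simp
  moreover have "\<exists>M. \<forall>t\<in>{a..b}. \<bar>h1 t\<bar> \<le> M \<and> \<bar>h2 t\<bar> \<le> M"
    using h1(2) h2(2) by (intro exI[of _ "max M1 M2"]) (auto simp: le_max_iff_disj)
  ultimately show ?thesis unfolding horizontal_def AE_lborel_iff_ae using ac h1(1) h2(1) ctlD(1)[OF c] by blast
qed

text \<open>The exceptional point \<open>c\<close> is the junction of two concatenated curves, where
  the pieced controls agree with only one of the two sides.\<close>

lemma prim_cong_fin:
  assumes p: "prim a b F f" and G: "\<And>t. t \<in> {a..b} \<Longrightarrow> G t = F t" and g: "\<And>t. t \<in> {a..b} \<Longrightarrow> t \<noteq> c \<Longrightarrow> g t = f t"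
  shows "prim a b G g"
proof (rule prim_cong[OF p G])
  have e: "ae a b (\<lambda>t. t \<notin> {c})" by (rule ae_finite) simp
  show e': "ae a b (\<lambda>t. g t = f t)" by (rule ae_mono[OF e]) (use g in auto)
  obtain M where M: "\<And>t. t \<in> {a..b} \<Longrightarrow> \<bar>f t\<bar> \<le> M" using bm_bounded[OF prim_bm[OF p]] by blast
  have "\<bar>g t\<bar> \<le> max M \<bar>g c\<bar>" if "t \<in> {a..b}" for t using g[of t] M[of t] that by (cases "t = c") auto
  then show "bm a b g" by (rule bm_ae_cong[OF prim_bm[OF p] e'])
qed

lemma ctl_cong_fin:
  assumes c: "ctl a b u1 u2 x" and "\<And>t. t \<in> {a..b} \<Longrightarrow> y t = x t"
    "\<And>t. t \<in> {a..b} \<Longrightarrow> t \<noteq> c \<Longrightarrow> v1 t = u1 t" "\<And>t. t \<in> {a..b} \<Longrightarrow> t \<noteq> c \<Longrightarrow> v2 t = u2 t"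
  shows "ctl a b v1 v2 y"
  unfolding ctl_def
proof (intro conjI)
  show "a \<le> b" by (rule ctlD(1)[OF c])
  show "prim a b (\<lambda>t. y t $ 1) v1"
    by (rule prim_cong_fin[OF ctlD(2)[OF c], where c=c]) (simp_all add: assms(2-4))
  show "prim a b (\<lambda>t. y t $ 2) v2"
    by (rule prim_cong_fin[OF ctlD(3)[OF c], where c=c]) (simp_all add: assms(2-4))
  show "prim a b (\<lambda>t. y t $ 3) (\<lambda>t. 2 * y t $ 2 * v1 t - 2 * y t $ 1 * v2 t)"
    by (rule prim_cong_fin[OF ctlD(4)[OF c], where c=c]) (simp_all add: assms(2-4))
  show "prim a b (\<lambda>t. y t $ 4) (\<lambda>t. (y t $ 3)\<^sup>2 * v1 t)"
    by (rule prim_cong_fin[OF ctlD(5)[OF c], where c=c]) (simp_all add: assms(2-4))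
qed

lemma ctl_shift: "ctl a b u1 u2 x \<Longrightarrow> ctl (a + c) (b + c) (\<lambda>t. u1 (t - c)) (\<lambda>t. u2 (t - c)) (\<lambda>t. x (t - c))"
  unfolding ctl_def using prim_shift[of a b _ _ c] by fastforce

lemma ctl_subset: "ctl a b u1 u2 x \<Longrightarrow> a \<le> c \<Longrightarrow> c \<le> d \<Longrightarrow> d \<le> b \<Longrightarrow> ctl c d u1 u2 x"
  unfolding ctl_def using prim_subset by blast

lemma ctl_join: "ctl a b u1 u2 x \<Longrightarrow> ctl b c u1 u2 x \<Longrightarrow> ctl a c u1 u2 x"
  unfolding ctl_def using prim_join by (meson order_trans)

lemma smooth_R4_cont: assumes "smooth_R4 f" shows "continuous_on S f"
proof -
  from assms[unfolded smooth_R4_def] have "continuous_on UNIV f"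
  proof (elim exE conjE)
    fix D assume "D [] = f" "\<forall>is. continuous_on UNIV (D is)"
    then show ?thesis by metis
  qed
  then show ?thesis by (rule continuous_on_subset) simp
qed

lemma bm_sqrt: assumes "bm a b f" shows "bm a b (\<lambda>t. sqrt (f t))"
proof -
  obtain M where "M > 0" "\<And>t. t \<in> {a..b} \<Longrightarrow> \<bar>f t\<bar> \<le> M" using bm_bounded[OF assms] by blast
  then have "\<forall>t\<in>{a..b}. \<bar>sqrt (f t)\<bar> \<le> sqrt M" by (auto simp flip: real_sqrt_abs2 simp: real_sqrt_abs abs_if real_sqrt_minus[symmetric])
  moreover have "(\<lambda>t. sqrt (f t)) \<in> borel_measurable (lebesgue_on {a..b})"
    using assms unfolding bm_def by (auto intro: borel_measurable_sqrt)
  ultimately show ?thesis unfolding bm_def by blast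
qed

lemma primI_deriv:
  assumes "continuous_on {a..b} f" "\<And>t. t \<in> {a..b} \<Longrightarrow> (F has_real_derivative f t) (at t within {a..b})"
  shows "prim a b F f"
proof (rule primI_integral[OF bm_cont[OF assms(1)], where C="F a"])
  fix t assume t: "t \<in> {a..b}"
  have "(f has_integral F t - F a) {a..t}"
  proof (rule fundamental_theorem_of_calculus)
    fix s assume s: "s \<in> {a..t}"
    have "(F has_real_derivative f s) (at s within {a..t})"
      by (rule DERIV_subset[OF assms(2)]) (use s t in auto)
    then show "(F has_vector_derivative f s) (at s within {a..t})" by (simp add: has_real_derivative_iff_has_vector_derivative)
  qed (use t in simp)
  then show "F t = F a + integral {a..t} f" by (simp add: integral_unique)
qed

section \<open>The metric in the frame, lengths and reachability\<close>

locale metric =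
  fixes g :: "real^4 \<Rightarrow> real^4 \<Rightarrow> real" and A B C :: "real^4 \<Rightarrow> real"
  assumes smooth: "smooth_R4 A" "smooth_R4 B" "smooth_R4 C"
    and pos: "\<And>x. A x > 0" "\<And>x. A x * C x - (B x)\<^sup>2 > 0"
    and g_eq: "\<And>x h1 h2. g x (h1 *\<^sub>R X1 x + h2 *\<^sub>R X2 x) = A x * h1\<^sup>2 + 2 * B x * h1 * h2 + C x * h2\<^sup>2"
begin

definition q :: "real^4 \<Rightarrow> real \<Rightarrow> real \<Rightarrow> real" where
  "q x h1 h2 = A x * h1\<^sup>2 + 2 * B x * h1 * h2 + C x * h2\<^sup>2"

lemma q_complete_square: "A x * q x h1 h2 = (A x * h1 + B x * h2)\<^sup>2 + (A x * C x - (B x)\<^sup>2) * h2\<^sup>2"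
  unfolding q_def by (simp add: power2_eq_square algebra_simps)

lemma q_nonneg [simp]: "0 \<le> q x h1 h2"
proof -
  have "0 \<le> A x * q x h1 h2" unfolding q_complete_square using pos(2)[of x] by (intro add_nonneg_nonneg mult_nonneg_nonneg) auto
  then show ?thesis using pos(1)[of x] by (simp add: zero_le_mult_iff)
qed

lemma q_eq_0_iff: "q x h1 h2 = 0 \<longleftrightarrow> h1 = 0 \<and> h2 = 0"
proof
  assume "q x h1 h2 = 0"
  then have "(A x * h1 + B x * h2)\<^sup>2 + (A x * C x - (B x)\<^sup>2) * h2\<^sup>2 = 0" using q_complete_square[of x h1 h2] by simp
  moreover have "0 \<le> (A x * C x - (B x)\<^sup>2) * h2\<^sup>2" using pos(2)[of x] by simp
  ultimately have "(A x * h1 + B x * h2)\<^sup>2 = 0" "(A x * C x - (B x)\<^sup>2) * h2\<^sup>2 = 0"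
    using zero_le_power2[of "A x * h1 + B x * h2"] by linarith+
  then have "h2 = 0" "A x * h1 = 0" using pos(2)[of x] by auto
  then show "h1 = 0 \<and> h2 = 0" using pos(1)[of x] by simp
qed (simp add: q_def)

lemma coeff_cont: "continuous_on S A" "continuous_on S B" "continuous_on S C"
  using smooth smooth_R4_cont by blast+

definition speed :: "(real \<Rightarrow> real) \<Rightarrow> (real \<Rightarrow> real) \<Rightarrow> (real \<Rightarrow> real^4) \<Rightarrow> real \<Rightarrow> real" where
  "speed u1 u2 x t = sqrt (q (x t) (u1 t) (u2 t))"

lemma speed_nonneg [simp]: "0 \<le> speed u1 u2 x t" unfolding speed_def by simp

lemma q_bm: assumes "ctl a b u1 u2 x" shows "bm a b (\<lambda>t. q (x t) (u1 t) (u2 t))"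
proof -
  have "continuous_on {a..b} (\<lambda>t. F (x t))" if "\<And>S. continuous_on S F" for F :: "real^4 \<Rightarrow> real"
    using continuous_on_compose2[OF that[of UNIV] ctl_cont[OF assms]] by simp
  note c = bm_cont[OF this[OF coeff_cont(1)]] bm_cont[OF this[OF coeff_cont(2)]] bm_cont[OF this[OF coeff_cont(3)]]
  show ?thesis unfolding q_def by (intro bm_intros c ctlD(6,7)[OF assms])
qed

lemma speed_bm: "ctl a b u1 u2 x \<Longrightarrow> bm a b (speed u1 u2 x)"
  unfolding speed_def[abs_def] by (intro bm_sqrt q_bm)

lemma sr_length_ctl: assumes c: "ctl a b u1 u2 x" shows "sr_length g a b x = integral {a..b} (speed u1 u2 x)"
  unfolding sr_length_def
  by (rule ae_integral_cong, rule ae_mono[OF ctl_deriv[OF c]]) (auto dest!: vector_derivative_at simp: g_eq speed_def q_def)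

text \<open>Reachability within a length budget is used in place of the distance: budgets add under
  concatenation, and estimates of lengths combine without handling an infimum.\<close>

definition reach :: "real^4 \<Rightarrow> real^4 \<Rightarrow> real \<Rightarrow> bool" where
  "reach x y l \<longleftrightarrow> (\<exists>a b u1 u2 z. ctl a b u1 u2 z \<and> z a = x \<and> z b = y \<and> integral {a..b} (speed u1 u2 z) \<le> l)"

lemma reach_ctl: "ctl a b u1 u2 x \<Longrightarrow> integral {a..b} (speed u1 u2 x) \<le> l \<Longrightarrow> reach (x a) (x b) l"
  unfolding reach_def by blast

lemma reach_dist: assumes "reach x y l" shows "sr_dist g x y \<le> l"
proof -
  obtain a b u1 u2 z where z: "ctl a b u1 u2 z" "z a = x" "z b = y" "integral {a..b} (speed u1 u2 z) \<le> l"
    using assms unfolding reach_def by blast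
  let ?S = "{sr_length g a b \<gamma> | a b \<gamma>. horizontal a b \<gamma> \<and> \<gamma> a = x \<and> \<gamma> b = y}"
  \<comment> \<open>The infimum of a set of reals is a lower bound only once the set is known to be
    bounded below.\<close>
  have "0 \<le> s" if sS: "s \<in> ?S" for s
  proof -
    obtain a b \<gamma> where s: "s = sr_length g a b \<gamma>" "horizontal a b \<gamma>" using sS by blast
    obtain u1 u2 where c: "ctl a b u1 u2 \<gamma>" using horizontal_imp_ctl[OF s(2)] by blast
    show ?thesis unfolding s(1) sr_length_ctl[OF c]
      by (rule integral_nonneg[OF bm_integrable[OF speed_bm[OF c]]]) simp
  qed
  then have "bdd_below ?S" by (rule bdd_belowI)
  moreover have "sr_length g a b z \<in> ?S" using z ctl_imp_horizontal by blast
  ultimately have "Inf ?S \<le> sr_length g a b z" by (rule cInf_lower[rotated])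
  then show ?thesis unfolding sr_dist_def using z(4) sr_length_ctl[OF z(1)] by simp
qed

lemma reach_trans: assumes "reach x y l" "reach y z m" shows "reach x z (l + m)"
proof -
  obtain a b u1 u2 v where v: "ctl a b u1 u2 v" "v a = x" "v b = y" "integral {a..b} (speed u1 u2 v) \<le> l"
    using assms(1) unfolding reach_def by blast
  obtain c d w1 w2 w where w: "ctl c d w1 w2 w" "w c = y" "w d = z" "integral {c..d} (speed w1 w2 w) \<le> m"
    using assms(2) unfolding reach_def by blast
  \<comment> \<open>The time shift that starts the second curve when the first one ends. At the
    junction the controls of the first curve are kept, which spoils the second piece at a single
    instant.\<close>
  define s where "s = b - c"
  define x' where "x' t = (if t \<le> b then v t else w (t - s))" for t
  define u1' where "u1' t = (if t \<le> b then u1 t else w1 (t - s))" for t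
  define u2' where "u2' t = (if t \<le> b then u2 t else w2 (t - s))" for t
  have ab: "a \<le> b" "c \<le> d" using ctlD(1)[OF v(1)] ctlD(1)[OF w(1)] by auto
  have w': "ctl b (d + s) (\<lambda>t. w1 (t - s)) (\<lambda>t. w2 (t - s)) (\<lambda>t. w (t - s))"
    using ctl_shift[OF w(1), of s] unfolding s_def by simp
  have c1: "ctl a b u1' u2' x'" by (rule ctl_cong_fin[OF v(1), of _ b]) (auto simp: x'_def u1'_def u2'_def)
  have c2: "ctl b (d + s) u1' u2' x'"
    by (rule ctl_cong_fin[OF w', of _ b]) (use v w in \<open>auto simp: x'_def u1'_def u2'_def s_def\<close>)
  have c: "ctl a (d + s) u1' u2' x'" by (rule ctl_join[OF c1 c2])
  have sp: "prim c d (\<lambda>t. integral {c..t} (speed w1 w2 w)) (speed w1 w2 w)"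
    by (rule primI_integral[OF speed_bm[OF w(1)], where C=0]) simp
  have "integral {a..d + s} (speed u1' u2' x') = integral {a..b} (speed u1' u2' x') + integral {b..d + s} (speed u1' u2' x')"
    by (rule Henstock_Kurzweil_Integration.integral_combine[symmetric])
      (use ab bm_integrable[OF speed_bm[OF c]] in \<open>auto simp: s_def\<close>)
  also have "integral {a..b} (speed u1' u2' x') = integral {a..b} (speed u1 u2 v)"
    by (rule integral_cong) (auto simp: speed_def x'_def u1'_def u2'_def)
  also have "integral {b..d + s} (speed u1' u2' x') = integral {b..d + s} (\<lambda>t. speed w1 w2 w (t - s))"
    by (rule integral_spike[of "{b}"]) (auto simp: speed_def x'_def u1'_def u2'_def)
  also have "\<dots> = integral {c..d} (speed w1 w2 w)"
    using prim_integral[OF prim_shift[OF sp, of s], of b "d + s"] ab unfolding s_def by simp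
  finally have "integral {a..d + s} (speed u1' u2' x') \<le> l + m" using v(4) w(4) by linarith
  from reach_ctl[OF c this] show ?thesis
    using v(2,3) w(2,3) ab unfolding x'_def s_def by (auto split: if_splits)
qed

lemma minimizer_le_reach:
  assumes "length_minimizing g a b x" "ctl a b u1 u2 x" "reach (x a) (x b) l"
  shows "integral {a..b} (speed u1 u2 x) \<le> l"
  using assms reach_dist sr_length_ctl unfolding length_minimizing_def by metis

text \<open>Along the constant control (h1, h2) the quantity x2 h1 - x1 h2 does not change, so x3 is affine and x4 cubic in time.\<close>

lemma reach_segment:
  fixes x y :: "real^4"
  defines "k h1 h2 \<equiv> 2 * (x$2 * h1 - x$1 * h2)"
  assumes y: "y = vector [x$1 + h1, x$2 + h2, x$3 + k h1 h2, x$4 + h1 * ((x$3)\<^sup>2 + x$3 * k h1 h2 + (k h1 h2)\<^sup>2 / 3)]"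
    and l: "\<And>t. t \<in> {0..1} \<Longrightarrow> sqrt (q (vector [x$1 + t * h1, x$2 + t * h2, x$3 + t * k h1 h2,
        x$4 + h1 * ((x$3)\<^sup>2 * t + x$3 * k h1 h2 * t\<^sup>2 + (k h1 h2)\<^sup>2 / 3 * t^3)]) h1 h2) \<le> l"
  shows "reach x y l"
proof -
  define K where "K = k h1 h2"
  define z :: "real \<Rightarrow> real^4" where "z t = vector [x$1 + t * h1, x$2 + t * h2, x$3 + t * K,
        x$4 + h1 * ((x$3)\<^sup>2 * t + x$3 * K * t\<^sup>2 + K\<^sup>2 / 3 * t^3)]" for t
  have c: "ctl 0 1 (\<lambda>_. h1) (\<lambda>_. h2) z"
    unfolding ctl_def
  proof (intro conjI)
    show "prim 0 1 (\<lambda>t. z t $ 1) (\<lambda>_. h1)" "prim 0 1 (\<lambda>t. z t $ 2) (\<lambda>_. h2)"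
      unfolding z_def vector4_nth by (auto intro!: primI_deriv continuous_intros derivative_eq_intros)
    show "prim 0 1 (\<lambda>t. z t $ 3) (\<lambda>t. 2 * z t $ 2 * h1 - 2 * z t $ 1 * h2)"
      unfolding z_def vector4_nth K_def k_def
      by (auto intro!: primI_deriv continuous_intros derivative_eq_intros simp: algebra_simps)
    show "prim 0 1 (\<lambda>t. z t $ 4) (\<lambda>t. (z t $ 3)\<^sup>2 * h1)"
      unfolding z_def vector4_nth
      by (auto intro!: primI_deriv continuous_intros derivative_eq_intros simp: algebra_simps power2_eq_square)
  qed simp
  have "integral {0..1} (speed (\<lambda>_. h1) (\<lambda>_. h2) z) \<le> integral {0..1::real} (\<lambda>_. l)"
    by (rule integral_le[OF bm_integrable[OF speed_bm[OF c]]]) (use l in \<open>auto simp: speed_def z_def K_def\<close>)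
  then have "reach (z 0) (z 1) l" using reach_ctl[OF c, of l] by simp
  moreover have "z 0 = x" "z 1 = y" unfolding z_def y K_def by (simp_all add: vec4_eq_iff vector4_nth)
  ultimately show ?thesis by simp
qed

end

section \<open>Smooth functions on four-space\<close>

definition pd :: "(real^4 \<Rightarrow> real) \<Rightarrow> 4 \<Rightarrow> real^4 \<Rightarrow> real" where
  "pd f i x = deriv (\<lambda>s. f (x + s *\<^sub>R axis i 1)) 0"

definition n1 :: "real^4 \<Rightarrow> real" where "n1 x = (\<Sum>i\<in>UNIV. \<bar>x $ i\<bar>)"

definition cube :: "real \<Rightarrow> (real^4) set" where "cube R = {x. \<forall>i. \<bar>x $ i\<bar> \<le> R}"

lemma smooth_R4_pd:
  assumes "smooth_R4 f"
  shows "smooth_R4 (pd f i)" "((\<lambda>s. f (x + s *\<^sub>R axis i 1)) has_real_derivative pd f i x) (at 0)"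
proof -
  from assms[unfolded smooth_R4_def] obtain D where D: "D [] = f"
     "\<forall>is x i. ((\<lambda>s. D is (x + s *\<^sub>R axis i 1)) has_real_derivative D (i # is) x) (at 0)"
     "\<forall>is. continuous_on UNIV (D is)" by (elim exE conjE)
  have d: "((\<lambda>s. f (x + s *\<^sub>R axis i 1)) has_real_derivative D [i] x) (at 0)" for x i
    using D(2)[rule_format, of "[]" x i] D(1) by simp
  have eq: "pd f i = D [i]" for i unfolding pd_def using DERIV_imp_deriv[OF d] by blast
  show "((\<lambda>s. f (x + s *\<^sub>R axis i 1)) has_real_derivative pd f i x) (at 0)" using d eq by simp
  \<comment> \<open>Each differentiation extends the list at its head, so differentiating in
    direction \<open>i\<close> first corresponds to \<open>i\<close> at the far end.\<close>
  show "smooth_R4 (pd f i)" unfolding smooth_R4_def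
    by (intro exI[of _ "\<lambda>is. D (is @ [i])"]) (use D eq in auto)
qed

lemma smooth_R4_axis_deriv:
  assumes "smooth_R4 f"
  shows "((\<lambda>s. f (x + s *\<^sub>R axis i 1)) has_real_derivative pd f i (x + s *\<^sub>R axis i 1)) (at s)"
proof -
  have "((\<lambda>r. f ((x + s *\<^sub>R axis i 1) + r *\<^sub>R axis i 1)) has_real_derivative pd f i (x + s *\<^sub>R axis i 1)) (at (s - s))"
    using smooth_R4_pd(2)[OF assms] by simp
  then have "((\<lambda>r. f ((x + s *\<^sub>R axis i 1) + (r - s) *\<^sub>R axis i 1)) has_real_derivative pd f i (x + s *\<^sub>R axis i 1)) (at s)"
    using DERIV_shift[of "\<lambda>r. f ((x + s *\<^sub>R axis i 1) + r *\<^sub>R axis i 1)" _ s "-s"] by simp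
  then show ?thesis by (simp add: algebra_simps)
qed

lemma smooth_R4_axis_mvt:
  assumes "smooth_R4 f"
  obtains s where "min 0 d \<le> s" "s \<le> max 0 d" "f (x + d *\<^sub>R axis i 1) - f x = d * pd f i (x + s *\<^sub>R axis i 1)"
proof -
  let ?h = "\<lambda>s. f (x + s *\<^sub>R axis i 1)"
  consider "d = 0" | "d > 0" | "d < 0" by linarith
  then show ?thesis
  proof cases
    case 1 then show ?thesis using that[of 0] by simp
  next
    case 2
    then obtain s where "0 < s" "s < d" "?h d - ?h 0 = (d - 0) * pd f i (x + s *\<^sub>R axis i 1)"
      using MVT2[of 0 d ?h "\<lambda>s. pd f i (x + s *\<^sub>R axis i 1)"] smooth_R4_axis_deriv[OF assms] by blast
    then show ?thesis using that[of s] by simp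
  next
    case 3
    then obtain s where "d < s" "s < 0" "?h 0 - ?h d = (0 - d) * pd f i (x + s *\<^sub>R axis i 1)"
      using MVT2[of d 0 ?h "\<lambda>s. pd f i (x + s *\<^sub>R axis i 1)"] smooth_R4_axis_deriv[OF assms] by blast
    then show ?thesis using that[of s] by simp
  qed
qed

text \<open>The increment is split into four moves parallel to the axes, with the one-variable mean
  value theorem on each. The four intermediate points differ, but all lie in the box spanned by
  \<open>x\<close> and \<open>y\<close>. This is how information on partial derivatives alone yields
  estimates.\<close>

lemma smooth_R4_mvt:
  assumes f: "smooth_R4 f"
  obtains z :: "4 \<Rightarrow> real^4" where "\<And>i j. min (x$j) (y$j) \<le> z i $ j \<and> z i $ j \<le> max (x$j) (y$j)"
    "f y - f x = (\<Sum>i\<in>UNIV. pd f i (z i) * (y$i - x$i))"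
proof -
  define d where "d i = y$i - x$i" for i
  define e where "e i = (axis i 1 :: real^4)" for i
  obtain s1 where s1: "min 0 (d 1) \<le> s1" "s1 \<le> max 0 (d 1)" "f (x + d 1 *\<^sub>R e 1) - f x = d 1 * pd f 1 (x + s1 *\<^sub>R e 1)"
    using smooth_R4_axis_mvt[OF f] unfolding e_def by blast
  define p1 where "p1 = x + d 1 *\<^sub>R e 1"
  obtain s2 where s2: "min 0 (d 2) \<le> s2" "s2 \<le> max 0 (d 2)" "f (p1 + d 2 *\<^sub>R e 2) - f p1 = d 2 * pd f 2 (p1 + s2 *\<^sub>R e 2)"
    using smooth_R4_axis_mvt[OF f] unfolding e_def by blast
  define p2 where "p2 = p1 + d 2 *\<^sub>R e 2"
  obtain s3 where s3: "min 0 (d 3) \<le> s3" "s3 \<le> max 0 (d 3)" "f (p2 + d 3 *\<^sub>R e 3) - f p2 = d 3 * pd f 3 (p2 + s3 *\<^sub>R e 3)"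
    using smooth_R4_axis_mvt[OF f] unfolding e_def by blast
  define p3 where "p3 = p2 + d 3 *\<^sub>R e 3"
  obtain s4 where s4: "min 0 (d 4) \<le> s4" "s4 \<le> max 0 (d 4)" "f (p3 + d 4 *\<^sub>R e 4) - f p3 = d 4 * pd f 4 (p3 + s4 *\<^sub>R e 4)"
    using smooth_R4_axis_mvt[OF f] unfolding e_def by blast
  have y: "y = p3 + d 4 *\<^sub>R e 4"
    unfolding vec4_eq_iff p3_def p2_def p1_def d_def e_def by (simp add: axis_def)
  define z where "z i = (if i = 1 then x + s1 *\<^sub>R e 1 else if i = 2 then p1 + s2 *\<^sub>R e 2 else
     if i = 3 then p2 + s3 *\<^sub>R e 3 else p3 + s4 *\<^sub>R e 4)" for i :: 4
  show ?thesis
  proof (rule that[of z])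
    have S: "min (x$1) (y$1) \<le> x$1 + s1" "x$1 + s1 \<le> max (x$1) (y$1)" "min (x$2) (y$2) \<le> x$2 + s2" "x$2 + s2 \<le> max (x$2) (y$2)"
      "min (x$3) (y$3) \<le> x$3 + s3" "x$3 + s3 \<le> max (x$3) (y$3)" "min (x$4) (y$4) \<le> x$4 + s4" "x$4 + s4 \<le> max (x$4) (y$4)"
      using s1(1,2) s2(1,2) s3(1,2) s4(1,2) unfolding d_def by linarith+
    have zn: "z 1 $ 1 = x$1 + s1" "z 1 $ 2 = x$2" "z 1 $ 3 = x$3" "z 1 $ 4 = x$4"
      "z 2 $ 1 = y$1" "z 2 $ 2 = x$2 + s2" "z 2 $ 3 = x$3" "z 2 $ 4 = x$4"
      "z 3 $ 1 = y$1" "z 3 $ 2 = y$2" "z 3 $ 3 = x$3 + s3" "z 3 $ 4 = x$4"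
      "z 4 $ 1 = y$1" "z 4 $ 2 = y$2" "z 4 $ 3 = y$3" "z 4 $ 4 = x$4 + s4"
      unfolding z_def p3_def p2_def p1_def e_def d_def by (simp_all add: axis_def)
    have "\<forall>i j. min (x$j) (y$j) \<le> z i $ j \<and> z i $ j \<le> max (x$j) (y$j)"
      unfolding forall_4 zn
      by (intro conjI) (rule S min.cobounded1 min.cobounded2 max.cobounded1 max.cobounded2)+
    then show "min (x$j) (y$j) \<le> z i $ j \<and> z i $ j \<le> max (x$j) (y$j)" for i j by blast
    have "f y - f x = (f p1 - f x) + (f p2 - f p1) + (f p3 - f p2) + (f y - f p3)" by simp
    also have "\<dots> = d 1 * pd f 1 (z 1) + d 2 * pd f 2 (z 2) + d 3 * pd f 3 (z 3) + d 4 * pd f 4 (z 4)"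
      using s1(3) s2(3) s3(3) s4(3) unfolding y z_def p1_def[symmetric] p2_def[symmetric] p3_def[symmetric] by simp
    finally show "f y - f x = (\<Sum>i\<in>UNIV. pd f i (z i) * (y$i - x$i))"
      unfolding sum_4 d_def by (simp add: mult.commute)
  qed
qed

lemma cube_bounded_smooth:
  assumes "smooth_R4 f" obtains M where "M > 0" "\<And>x. x \<in> cube R \<Longrightarrow> \<bar>f x\<bar> \<le> M"
proof -
  have "cube R = cbox (\<chi> i. -R) (\<chi> i. R)" unfolding cube_def by (auto simp: mem_box_cart abs_le_iff; smt (verit))
  then have "compact (cube R)" by simp
  then have "bounded (f ` cube R)"
    using compact_continuous_image[OF smooth_R4_cont[OF assms]] compact_imp_bounded by blast
  then obtain M where "\<forall>x\<in>cube R. \<bar>f x\<bar> \<le> M" unfolding bounded_iff by auto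
  then show ?thesis using that[of "\<bar>M\<bar> + 1"] by fastforce
qed

lemma n1_nonneg [simp]: "0 \<le> n1 x" unfolding n1_def by (simp add: sum_nonneg)

lemma n1_component: "\<bar>x $ i\<bar> \<le> n1 x" unfolding n1_def by (rule member_le_sum) auto

lemma cube_between:
  assumes "x \<in> cube R" "y \<in> cube R" and z: "\<And>j. min (x$j) (y$j) \<le> z $ j \<and> z $ j \<le> max (x$j) (y$j)"
  shows "z \<in> cube R"
proof -
  have "\<bar>z $ j\<bar> \<le> R" for j
  proof -
    have "\<bar>x $ j\<bar> \<le> R" "\<bar>y $ j\<bar> \<le> R" using assms(1,2) unfolding cube_def by blast+
    then show ?thesis using z[of j] by linarith
  qed
  then show ?thesis unfolding cube_def by blast
qed

lemma n1_between: assumes "\<And>j. min (x$j) (y$j) \<le> z $ j \<and> z $ j \<le> max (x$j) (y$j)" shows "n1 (z - x) \<le> n1 (y - x)"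
  unfolding n1_def
proof (rule sum_mono)
  fix j show "\<bar>(z - x) $ j\<bar> \<le> \<bar>(y - x) $ j\<bar>" using assms[of j] by (auto simp: abs_if min_def max_def split: if_splits)
qed

lemma smooth_R4_lip:
  assumes f: "smooth_R4 f"
  obtains M where "M > 0" "\<And>x y. x \<in> cube R \<Longrightarrow> y \<in> cube R \<Longrightarrow> \<bar>f y - f x\<bar> \<le> M * n1 (y - x)"
proof -
  have "\<exists>M. M > 0 \<and> (\<forall>x\<in>cube R. \<bar>pd f i x\<bar> \<le> M)" for i
    using cube_bounded_smooth[OF smooth_R4_pd(1)[OF f]] by metis
  then obtain M where M: "\<And>i. M i > 0" "\<And>i x. x \<in> cube R \<Longrightarrow> \<bar>pd f i x\<bar> \<le> M i" by metis
  have M0: "(\<Sum>i\<in>UNIV. M i) > 0" by (rule sum_pos) (use M in auto)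
  show ?thesis
  proof (rule that[OF M0])
    fix x y assume xy: "x \<in> cube R" "y \<in> cube R"
    obtain z where z: "\<And>i j. min (x$j) (y$j) \<le> z i $ j \<and> z i $ j \<le> max (x$j) (y$j)"
      "f y - f x = (\<Sum>i\<in>UNIV. pd f i (z i) * (y$i - x$i))" using smooth_R4_mvt[OF f] by blast
    have "\<bar>f y - f x\<bar> \<le> (\<Sum>i\<in>UNIV. \<bar>pd f i (z i) * (y$i - x$i)\<bar>)" unfolding z(2) by (rule sum_abs)
    also have "\<dots> \<le> (\<Sum>i\<in>UNIV. M i * n1 (y - x))"
    proof (rule sum_mono)
      fix i
      have "\<bar>pd f i (z i)\<bar> \<le> M i" using M(2) cube_between[OF xy z(1)] by blast
      moreover have "\<bar>y$i - x$i\<bar> \<le> n1 (y - x)" using n1_component[of "y - x" i] by simp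
      ultimately show "\<bar>pd f i (z i) * (y$i - x$i)\<bar> \<le> M i * n1 (y - x)"
        unfolding abs_mult using M(1)[of i] by (intro mult_mono) auto
    qed
    finally show "\<bar>f y - f x\<bar> \<le> (\<Sum>i\<in>UNIV. M i) * n1 (y - x)" by (simp add: sum_distrib_right)
  qed
qed

text \<open>In the mean value formula each intermediate point is moved to \<open>x\<close>; the
  partial derivatives are Lipschitz on the cube, so the price is quadratic.\<close>

lemma smooth_R4_taylor:
  assumes f: "smooth_R4 f"
  obtains M where "M > 0" "\<And>x y. x \<in> cube R \<Longrightarrow> y \<in> cube R \<Longrightarrow>
    \<bar>f y - f x - (\<Sum>i\<in>UNIV. pd f i x * (y$i - x$i))\<bar> \<le> M * (n1 (y - x))\<^sup>2"
proof -
  have "\<exists>M. M > 0 \<and> (\<forall>x\<in>cube R. \<forall>y\<in>cube R. \<bar>pd f i y - pd f i x\<bar> \<le> M * n1 (y - x))" for i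
    using smooth_R4_lip[OF smooth_R4_pd(1)[OF f]] by metis
  then obtain M where M: "\<And>i. M i > 0" "\<And>i x y. x \<in> cube R \<Longrightarrow> y \<in> cube R \<Longrightarrow> \<bar>pd f i y - pd f i x\<bar> \<le> M i * n1 (y - x)" by metis
  have M0: "(\<Sum>i\<in>UNIV. M i) > 0" by (rule sum_pos) (use M in auto)
  show ?thesis
  proof (rule that[OF M0])
    fix x y assume xy: "x \<in> cube R" "y \<in> cube R"
    obtain z where z: "\<And>i j. min (x$j) (y$j) \<le> z i $ j \<and> z i $ j \<le> max (x$j) (y$j)"
      "f y - f x = (\<Sum>i\<in>UNIV. pd f i (z i) * (y$i - x$i))" using smooth_R4_mvt[OF f] by blast
    have "\<bar>f y - f x - (\<Sum>i\<in>UNIV. pd f i x * (y$i - x$i))\<bar> = \<bar>\<Sum>i\<in>UNIV. (pd f i (z i) - pd f i x) * (y$i - x$i)\<bar>"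
      unfolding z(2) by (simp add: sum_subtractf[symmetric] algebra_simps)
    also have "\<dots> \<le> (\<Sum>i\<in>UNIV. \<bar>(pd f i (z i) - pd f i x) * (y$i - x$i)\<bar>)" by (rule sum_abs)
    also have "\<dots> \<le> (\<Sum>i\<in>UNIV. M i * (n1 (y - x))\<^sup>2)"
    proof (rule sum_mono)
      fix i
      have "\<bar>pd f i (z i) - pd f i x\<bar> \<le> M i * n1 (z i - x)" using M(2) cube_between[OF xy z(1)] xy by blast
      also have "\<dots> \<le> M i * n1 (y - x)" using n1_between[OF z(1), of i] M(1)[of i] by simp
      finally have 1: "\<bar>pd f i (z i) - pd f i x\<bar> \<le> M i * n1 (y - x)" .
      have 2: "\<bar>y$i - x$i\<bar> \<le> n1 (y - x)" using n1_component[of "y - x" i] by simp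
      have "\<bar>(pd f i (z i) - pd f i x) * (y$i - x$i)\<bar> \<le> (M i * n1 (y - x)) * n1 (y - x)"
        unfolding abs_mult using M(1)[of i] 1 2 by (intro mult_mono) auto
      then show "\<bar>(pd f i (z i) - pd f i x) * (y$i - x$i)\<bar> \<le> M i * (n1 (y - x))\<^sup>2" by (simp add: power2_eq_square)
    qed
    finally show "\<bar>f y - f x - (\<Sum>i\<in>UNIV. pd f i x * (y$i - x$i))\<bar> \<le> (\<Sum>i\<in>UNIV. M i) * (n1 (y - x))\<^sup>2"
      by (simp add: sum_distrib_right)
  qed
qed

lemma n1_le_norm: "n1 x \<le> 4 * norm x"
proof -
  have "n1 x \<le> (\<Sum>i\<in>(UNIV::4 set). norm x)" unfolding n1_def by (rule sum_mono) (rule component_le_norm_cart)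
  then show ?thesis by simp
qed

lemma smooth_R4_has_derivative:
  assumes f: "smooth_R4 f"
  shows "(f has_derivative (\<lambda>h. \<Sum>i\<in>UNIV. pd f i x * h$i)) (at x)"
  unfolding has_derivative_at_alt
proof (intro conjI allI impI)
  show "bounded_linear (\<lambda>h. \<Sum>i\<in>UNIV. pd f i x * h$i)"
    by (intro bounded_linear_sum bounded_linear_const_mult bounded_linear_vec_nth)
  fix e :: real assume e: "e > 0"
  define R where "R = norm x + 1"
  obtain M where M: "M > 0" "\<And>x y. x \<in> cube R \<Longrightarrow> y \<in> cube R \<Longrightarrow>
    \<bar>f y - f x - (\<Sum>i\<in>UNIV. pd f i x * (y$i - x$i))\<bar> \<le> M * (n1 (y - x))\<^sup>2" using smooth_R4_taylor[OF f] by blast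
  \<comment> \<open>The factor 16 is the square of the constant 4 in
    \<open>n1_le_norm\<close>.\<close>
  define d where "d = min 1 (e / (16 * M))"
  show "\<exists>d>0. \<forall>y. norm (y - x) < d \<longrightarrow> norm (f y - f x - (\<Sum>i\<in>UNIV. pd f i x * (y - x)$i)) \<le> e * norm (y - x)"
  proof (intro exI[of _ d] conjI allI impI)
    show "d > 0" unfolding d_def using M e by simp
    fix y assume y: "norm (y - x) < d"
    have cube: "v \<in> cube R" if "norm v \<le> R" for v
      unfolding cube_def using order_trans[OF component_le_norm_cart that] by blast
    have "norm y \<le> norm x + norm (y - x)" by (metis add.commute diff_add_cancel norm_triangle_ineq)
    then have "norm y \<le> R" using y unfolding R_def d_def by auto
    then have "\<bar>f y - f x - (\<Sum>i\<in>UNIV. pd f i x * (y$i - x$i))\<bar> \<le> M * (n1 (y - x))\<^sup>2"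
      by (intro M(2) cube) (simp add: R_def)
    also have "\<dots> \<le> M * (4 * norm (y - x))\<^sup>2" using M(1) n1_le_norm[of "y - x"] by (intro mult_left_mono power_mono) auto
    also have "\<dots> = (16 * M * norm (y - x)) * norm (y - x)" by (simp add: power2_eq_square)
    also have "\<dots> \<le> e * norm (y - x)"
    proof (rule mult_right_mono)
      have "norm (y - x) \<le> e / (16 * M)" using y unfolding d_def by auto
      then show "16 * M * norm (y - x) \<le> e" using M(1) by (simp add: field_simps)
    qed simp
    finally show "norm (f y - f x - (\<Sum>i\<in>UNIV. pd f i x * (y - x)$i)) \<le> e * norm (y - x)" by simp
  qed
qed

lemma ae_all4: "(\<And>i::4. ae a b (P i)) \<Longrightarrow> ae a b (\<lambda>t. \<forall>i. P i t)"
  unfolding forall_4 by (intro ae_conj)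

lemma smooth_R4_chain:
  assumes f: "smooth_R4 f" and x: "\<And>i. ((\<lambda>t. x t $ i) has_real_derivative v i) (at t within S)"
  shows "((\<lambda>t. f (x t)) has_real_derivative (\<Sum>i\<in>UNIV. pd f i (x t) * v i)) (at t within S)"
proof -
  have "(x has_vector_derivative (\<chi> i. v i)) (at t within S)" unfolding has_vector_derivative_iff_nth using x by simp
  then have "(x has_derivative (\<lambda>h. h *\<^sub>R (\<chi> i. v i))) (at t within S)" unfolding has_vector_derivative_def .
  from has_derivative_compose[OF this smooth_R4_has_derivative[OF f]]
  have "((\<lambda>t. f (x t)) has_derivative (\<lambda>h. \<Sum>i\<in>UNIV. pd f i (x t) * (h *\<^sub>R (\<chi> i. v i)) $ i)) (at t within S)" .
  moreover have "(\<lambda>h. \<Sum>i\<in>UNIV. pd f i (x t) * (h *\<^sub>R (\<chi> i. v i)) $ i) = (\<lambda>h. (\<Sum>i\<in>UNIV. pd f i (x t) * v i) * h)"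
  proof (rule ext)
    fix h
    show "(\<Sum>i\<in>UNIV. pd f i (x t) * (h *\<^sub>R (\<chi> i. v i)) $ i) = (\<Sum>i\<in>UNIV. pd f i (x t) * v i) * h"
      unfolding sum_distrib_right by (rule sum.cong) (simp_all add: mult.commute[of h] mult.assoc)
  qed
  ultimately show ?thesis unfolding has_field_derivative_def by simp
qed

lemma prim_smooth_comp:
  assumes f: "smooth_R4 f" and x: "\<And>i. prim a b (\<lambda>t. x t $ i) (v i)"
  shows "prim a b (\<lambda>t. f (x t)) (\<lambda>t. \<Sum>i\<in>UNIV. pd f i (x t) * v i t)"
  unfolding prim_def
proof (intro conjI)
  have "\<exists>M. M > 0 \<and> (\<forall>t\<in>{a..b}. \<bar>x t $ i\<bar> \<le> M) \<and> (\<forall>s\<in>{a..b}. \<forall>t\<in>{a..b}. \<bar>x s $ i - x t $ i\<bar> \<le> M * \<bar>s - t\<bar>)" for i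
    using prim_lip[OF x] .
  then obtain M where M: "\<And>i. M i > 0" "\<And>i t. t \<in> {a..b} \<Longrightarrow> \<bar>x t $ i\<bar> \<le> M i"
    "\<And>i s t. s \<in> {a..b} \<Longrightarrow> t \<in> {a..b} \<Longrightarrow> \<bar>x s $ i - x t $ i\<bar> \<le> M i * \<bar>s - t\<bar>" by metis
  define R where "R = (\<Sum>i\<in>UNIV. M i)"
  have MR: "M i \<le> R" for i unfolding R_def by (rule member_le_sum) (use M(1) less_imp_le in auto)
  have cube: "x t \<in> cube R" if "t \<in> {a..b}" for t unfolding cube_def using M(2)[OF that] MR order_trans by blast
  obtain N where N: "N > 0" "\<And>x y. x \<in> cube R \<Longrightarrow> y \<in> cube R \<Longrightarrow> \<bar>f y - f x\<bar> \<le> N * n1 (y - x)" using smooth_R4_lip[OF f] by blast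
  have "\<bar>f (x s) - f (x t)\<bar> \<le> N * R * \<bar>s - t\<bar>" if st: "s \<in> {a..b}" "t \<in> {a..b}" for s t
  proof -
    have "n1 (x s - x t) \<le> (\<Sum>i\<in>UNIV. M i * \<bar>s - t\<bar>)" unfolding n1_def by (rule sum_mono) (use M(3) st in simp)
    then have "n1 (x s - x t) \<le> R * \<bar>s - t\<bar>" unfolding R_def by (simp add: sum_distrib_right)
    then have "N * n1 (x s - x t) \<le> N * (R * \<bar>s - t\<bar>)" using N(1) by (intro mult_left_mono) auto
    then show ?thesis using N(2)[OF cube[OF st(2)] cube[OF st(1)]] by (simp add: mult.assoc)
  qed
  then show "lipr a b (\<lambda>t. f (x t))" unfolding lipr_def by blast
  have cx: "continuous_on {a..b} x"
    using continuous_on_vec_lambda[of "{a..b}" "\<lambda>i t. x t $ i"] prim_cont[OF x] by simp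
  have "continuous_on {a..b} (\<lambda>t. pd f i (x t))" for i
    using continuous_on_compose2[OF smooth_R4_cont[OF smooth_R4_pd(1)[OF f]] cx, of UNIV] by simp
  then show "bm a b (\<lambda>t. \<Sum>i\<in>UNIV. pd f i (x t) * v i t)" by (intro bm_sum bm_mult bm_cont prim_bm[OF x])
  have "ae a b (\<lambda>t. \<forall>i. ((\<lambda>t. x t $ i) has_real_derivative v i t) (at t))"
    by (rule ae_all4) (use x in \<open>auto simp: prim_def\<close>)
  then show "ae a b (\<lambda>t. ((\<lambda>t. f (x t)) has_real_derivative (\<Sum>i\<in>UNIV. pd f i (x t) * v i t)) (at t))"
    by (rule ae_mono) (rule smooth_R4_chain[OF f], simp)
qed

section \<open>Families of functions with a uniform first-order expansion in a parameter\<close>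

text \<open>\<open>f'\<close> is the derivative in the parameter \<open>s\<close> at 0. The bounds
  are uniform in the time \<open>t\<close>, so they survive integration in time. The Lipschitz
  clause gives continuity in \<open>s\<close> on the unit ball, as the open mapping argument
  requires, beyond differentiability at the centre.\<close>

definition nice :: "real \<Rightarrow> real \<Rightarrow> ('v::real_normed_vector \<Rightarrow> real \<Rightarrow> real) \<Rightarrow> ('v \<Rightarrow> real \<Rightarrow> real) \<Rightarrow> bool" where
  "nice a b f f' \<longleftrightarrow> (\<forall>s. bm a b (f s)) \<and> (\<forall>s. bm a b (f' s)) \<and> (\<forall>t\<in>{a..b}. linear (\<lambda>s. f' s t)) \<and>
    (\<exists>K\<ge>0. (\<forall>s. \<forall>t\<in>{a..b}. \<bar>f' s t\<bar> \<le> K * norm s) \<and>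
       (\<forall>s. \<forall>t\<in>{a..b}. norm s \<le> 1 \<longrightarrow> \<bar>f s t\<bar> \<le> K \<and> \<bar>f s t - f 0 t - f' s t\<bar> \<le> K * (norm s)\<^sup>2) \<and>
       (\<forall>s r. \<forall>t\<in>{a..b}. norm s \<le> 1 \<longrightarrow> norm r \<le> 1 \<longrightarrow> \<bar>f s t - f r t\<bar> \<le> K * norm (s - r)))"

lemma niceI:
  fixes f f' :: "'v::real_normed_vector \<Rightarrow> real \<Rightarrow> real"
  assumes "\<And>s. bm a b (f s)" "\<And>s. bm a b (f' s)" "\<And>t. t \<in> {a..b} \<Longrightarrow> linear (\<lambda>s. f' s t)" "K \<ge> 0"
    "\<And>s t. t \<in> {a..b} \<Longrightarrow> \<bar>f' s t\<bar> \<le> K * norm s"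
    "\<And>s t. t \<in> {a..b} \<Longrightarrow> norm s \<le> 1 \<Longrightarrow> \<bar>f s t\<bar> \<le> K"
    "\<And>s t. t \<in> {a..b} \<Longrightarrow> norm s \<le> 1 \<Longrightarrow> \<bar>f s t - f 0 t - f' s t\<bar> \<le> K * (norm s)\<^sup>2"
    "\<And>s r t. t \<in> {a..b} \<Longrightarrow> norm s \<le> 1 \<Longrightarrow> norm r \<le> 1 \<Longrightarrow> \<bar>f s t - f r t\<bar> \<le> K * norm (s - r)"
  shows "nice a b f f'"
  unfolding nice_def using assms by blast

lemma niceE:
  assumes "nice a b f f'"
  obtains K where "K \<ge> 0"
    "\<And>s t. t \<in> {a..b} \<Longrightarrow> \<bar>f' s t\<bar> \<le> K * norm s"
    "\<And>s t. t \<in> {a..b} \<Longrightarrow> norm s \<le> 1 \<Longrightarrow> \<bar>f s t\<bar> \<le> K"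
    "\<And>s t. t \<in> {a..b} \<Longrightarrow> norm s \<le> 1 \<Longrightarrow> \<bar>f s t - f 0 t - f' s t\<bar> \<le> K * (norm s)\<^sup>2"
    "\<And>s r t. t \<in> {a..b} \<Longrightarrow> norm s \<le> 1 \<Longrightarrow> norm r \<le> 1 \<Longrightarrow> \<bar>f s t - f r t\<bar> \<le> K * norm (s - r)"
    "\<And>s t. t \<in> {a..b} \<Longrightarrow> norm s \<le> 1 \<Longrightarrow> \<bar>f s t - f 0 t\<bar> \<le> K * norm s"
proof -
  obtain K where K: "K \<ge> 0" "\<forall>s. \<forall>t\<in>{a..b}. \<bar>f' s t\<bar> \<le> K * norm s"
       "\<forall>s. \<forall>t\<in>{a..b}. norm s \<le> 1 \<longrightarrow> \<bar>f s t\<bar> \<le> K \<and> \<bar>f s t - f 0 t - f' s t\<bar> \<le> K * (norm s)\<^sup>2"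
       "\<forall>s r. \<forall>t\<in>{a..b}. norm s \<le> 1 \<longrightarrow> norm r \<le> 1 \<longrightarrow> \<bar>f s t - f r t\<bar> \<le> K * norm (s - r)"
    using assms unfolding nice_def by blast
  have "\<bar>f s t - f 0 t\<bar> \<le> K * norm s" if "t \<in> {a..b}" "norm s \<le> 1" for s t
    using K(4)[rule_format, of t s 0] that by simp
  then show ?thesis using that[of K] K by simp
qed

lemma nice_bm: "nice a b f f' \<Longrightarrow> bm a b (f s)" "nice a b f f' \<Longrightarrow> bm a b (f' s)"
  unfolding nice_def by auto

lemma nice_linear: "nice a b f f' \<Longrightarrow> t \<in> {a..b} \<Longrightarrow> linear (\<lambda>s. f' s t)"
  unfolding nice_def by auto

lemma linear_mult_fun: "linear f \<Longrightarrow> linear (\<lambda>s. c * f s :: real)"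
  by (simp add: linear_iff algebra_simps)

lemma nice_affine:
  fixes L :: "'v::real_normed_vector \<Rightarrow> real \<Rightarrow> real"
  assumes u: "bm a b u" and L: "\<And>s. bm a b (L s)" "\<And>t. t \<in> {a..b} \<Longrightarrow> linear (\<lambda>s. L s t)"
    and N: "\<And>s t. t \<in> {a..b} \<Longrightarrow> \<bar>L s t\<bar> \<le> N * norm s"
  shows "nice a b (\<lambda>s t. u t + L s t) L"
proof -
  obtain M where M: "M > 0" "\<And>t. t \<in> {a..b} \<Longrightarrow> \<bar>u t\<bar> \<le> M" using bm_bounded[OF u] by blast
  have N': "\<bar>L s t\<bar> \<le> (M + \<bar>N\<bar>) * norm s" if "t \<in> {a..b}" for s t
  proof -
    have "\<bar>L s t\<bar> \<le> N * norm s" by (rule N[OF that])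
    also have "\<dots> \<le> (M + \<bar>N\<bar>) * norm s" using M(1) by (intro mult_right_mono) auto
    finally show ?thesis .
  qed
  show ?thesis
  proof (rule niceI[where K="M + \<bar>N\<bar>"])
    show "bm a b (\<lambda>t. u t + L s t)" for s using u L by (intro bm_add)
    show "bm a b (L s)" for s by (rule L)
    show "linear (\<lambda>s. L s t)" if "t \<in> {a..b}" for t by (rule L(2)[OF that])
    show "0 \<le> M + \<bar>N\<bar>" using M(1) by simp
    fix s r :: 'v and t assume t: "t \<in> {a..b}"
    show "\<bar>L s t\<bar> \<le> (M + \<bar>N\<bar>) * norm s" by (rule N'[OF t])
    have l: "linear (\<lambda>s. L s t)" by (rule L(2)[OF t])
    have L0: "L 0 t = 0" using linear_0[OF l] .
    show "\<bar>u t + L s t - (u t + L 0 t) - L s t\<bar> \<le> (M + \<bar>N\<bar>) * (norm s)\<^sup>2" using L0 M(1) by simp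
    have "u t + L s t - (u t + L r t) = L (s - r) t" using linear_diff[OF l, of s r] by simp
    then show "\<bar>u t + L s t - (u t + L r t)\<bar> \<le> (M + \<bar>N\<bar>) * norm (s - r)" using N'[OF t] by simp
    assume s: "norm s \<le> 1"
    have "\<bar>L s t\<bar> \<le> \<bar>N\<bar> * norm s" 
      using N[OF t, of s] mult_right_mono[OF abs_ge_self[of N] norm_ge_zero[of s]] by linarith
    also have "\<dots> \<le> \<bar>N\<bar> * 1" using s by (intro mult_left_mono) auto
    finally show "\<bar>u t + L s t\<bar> \<le> M + \<bar>N\<bar>" using M(2)[OF t] by linarith
  qed
qed

lemma nice_const: assumes "bm a b u" shows "nice a b (\<lambda>s. u) (\<lambda>s t. 0)"
  using nice_affine[OF assms, of "\<lambda>s t. 0" 0] by (simp add: linear_iff)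

lemma nice_add:
  fixes f g :: "'v::real_normed_vector \<Rightarrow> real \<Rightarrow> real"
  assumes f: "nice a b f f'" and g: "nice a b g g'"
  shows "nice a b (\<lambda>s t. f s t + g s t) (\<lambda>s t. f' s t + g' s t)"
proof -
  obtain K where K: "K \<ge> 0"
    "\<And>s t. t \<in> {a..b} \<Longrightarrow> \<bar>f' s t\<bar> \<le> K * norm s"
    "\<And>s t. t \<in> {a..b} \<Longrightarrow> norm s \<le> 1 \<Longrightarrow> \<bar>f s t\<bar> \<le> K"
    "\<And>s t. t \<in> {a..b} \<Longrightarrow> norm s \<le> 1 \<Longrightarrow> \<bar>f s t - f 0 t - f' s t\<bar> \<le> K * (norm s)\<^sup>2"
    "\<And>s r t. t \<in> {a..b} \<Longrightarrow> norm s \<le> 1 \<Longrightarrow> norm r \<le> 1 \<Longrightarrow> \<bar>f s t - f r t\<bar> \<le> K * norm (s - r)"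
    by (rule niceE[OF f], rule that; blast)
  obtain N where N: "N \<ge> 0"
    "\<And>s t. t \<in> {a..b} \<Longrightarrow> \<bar>g' s t\<bar> \<le> N * norm s"
    "\<And>s t. t \<in> {a..b} \<Longrightarrow> norm s \<le> 1 \<Longrightarrow> \<bar>g s t\<bar> \<le> N"
    "\<And>s t. t \<in> {a..b} \<Longrightarrow> norm s \<le> 1 \<Longrightarrow> \<bar>g s t - g 0 t - g' s t\<bar> \<le> N * (norm s)\<^sup>2"
    "\<And>s r t. t \<in> {a..b} \<Longrightarrow> norm s \<le> 1 \<Longrightarrow> norm r \<le> 1 \<Longrightarrow> \<bar>g s t - g r t\<bar> \<le> N * norm (s - r)"
    by (rule niceE[OF g], rule that; blast)
  show ?thesis
  proof (rule niceI[where K="K + N"])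
    show "bm a b (\<lambda>t. f s t + g s t)" "bm a b (\<lambda>t. f' s t + g' s t)" for s
      using nice_bm[OF f] nice_bm[OF g] by (auto intro: bm_add)
    show "linear (\<lambda>s. f' s t + g' s t)" if "t \<in> {a..b}" for t
      using nice_linear[OF f that] nice_linear[OF g that] by (rule linear_compose_add)
    show "0 \<le> K + N" using K(1) N(1) by simp
    fix s r :: 'v and t assume t: "t \<in> {a..b}"
    show "\<bar>f' s t + g' s t\<bar> \<le> (K + N) * norm s" using K(2)[OF t, of s] N(2)[OF t, of s] by (simp add: algebra_simps)
    assume s: "norm s \<le> 1"
    show "\<bar>f s t + g s t\<bar> \<le> K + N" using K(3)[OF t s] N(3)[OF t s] by simp
    show "\<bar>f s t + g s t - (f 0 t + g 0 t) - (f' s t + g' s t)\<bar> \<le> (K + N) * (norm s)\<^sup>2"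
      using K(4)[OF t s] N(4)[OF t s] by (simp add: algebra_simps)
    assume r: "norm r \<le> 1"
    show "\<bar>f s t + g s t - (f r t + g r t)\<bar> \<le> (K + N) * norm (s - r)"
      using K(5)[OF t s r] N(5)[OF t s r] by (simp add: algebra_simps)
  qed
qed

lemma nice_mult:
  fixes f g :: "'v::real_normed_vector \<Rightarrow> real \<Rightarrow> real"
  assumes f: "nice a b f f'" and g: "nice a b g g'"
  shows "nice a b (\<lambda>s t. f s t * g s t) (\<lambda>s t. f' s t * g 0 t + f 0 t * g' s t)"
proof -
  obtain K where K: "K \<ge> 0"
    "\<And>s t. t \<in> {a..b} \<Longrightarrow> \<bar>f' s t\<bar> \<le> K * norm s"
    "\<And>s t. t \<in> {a..b} \<Longrightarrow> norm s \<le> 1 \<Longrightarrow> \<bar>f s t\<bar> \<le> K"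
    "\<And>s t. t \<in> {a..b} \<Longrightarrow> norm s \<le> 1 \<Longrightarrow> \<bar>f s t - f 0 t - f' s t\<bar> \<le> K * (norm s)\<^sup>2"
    "\<And>s r t. t \<in> {a..b} \<Longrightarrow> norm s \<le> 1 \<Longrightarrow> norm r \<le> 1 \<Longrightarrow> \<bar>f s t - f r t\<bar> \<le> K * norm (s - r)"
    "\<And>s t. t \<in> {a..b} \<Longrightarrow> norm s \<le> 1 \<Longrightarrow> \<bar>f s t - f 0 t\<bar> \<le> K * norm s"
    by (rule niceE[OF f], rule that; blast)
  obtain N where N: "N \<ge> 0"
    "\<And>s t. t \<in> {a..b} \<Longrightarrow> \<bar>g' s t\<bar> \<le> N * norm s"
    "\<And>s t. t \<in> {a..b} \<Longrightarrow> norm s \<le> 1 \<Longrightarrow> \<bar>g s t\<bar> \<le> N"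
    "\<And>s t. t \<in> {a..b} \<Longrightarrow> norm s \<le> 1 \<Longrightarrow> \<bar>g s t - g 0 t - g' s t\<bar> \<le> N * (norm s)\<^sup>2"
    "\<And>s r t. t \<in> {a..b} \<Longrightarrow> norm s \<le> 1 \<Longrightarrow> norm r \<le> 1 \<Longrightarrow> \<bar>g s t - g r t\<bar> \<le> N * norm (s - r)"
    "\<And>s t. t \<in> {a..b} \<Longrightarrow> norm s \<le> 1 \<Longrightarrow> \<bar>g s t - g 0 t\<bar> \<le> N * norm s"
    by (rule niceE[OF g], rule that; blast)
  have KN: "0 \<le> K * N" using K(1) N(1) by simp
  show ?thesis
  proof (rule niceI[where K="3 * (K * N)"])
    show "bm a b (\<lambda>t. f s t * g s t)" "bm a b (\<lambda>t. f' s t * g 0 t + f 0 t * g' s t)" for s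
      using nice_bm[OF f] nice_bm[OF g] by (auto intro!: bm_add bm_mult)
    show "linear (\<lambda>s. f' s t * g 0 t + f 0 t * g' s t)" if "t \<in> {a..b}" for t
      using nice_linear[OF f that] nice_linear[OF g that] by (simp add: linear_iff algebra_simps)
    show "0 \<le> 3 * (K * N)" using KN by simp
    fix s r :: 'v and t assume t: "t \<in> {a..b}"
    have f0: "\<bar>f 0 t\<bar> \<le> K" and g0: "\<bar>g 0 t\<bar> \<le> N" using K(3)[OF t, of 0] N(3)[OF t, of 0] by auto
    have b1: "\<bar>f' s t * g 0 t\<bar> \<le> (K * norm s) * N" unfolding abs_mult using K(1,2) N(1) g0 t by (intro mult_mono) auto
    have b2: "\<bar>f 0 t * g' s t\<bar> \<le> K * (N * norm s)" unfolding abs_mult using K(1) N(1,2) f0 t by (intro mult_mono) auto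
    have "0 \<le> K * N * norm s" using KN by simp
    then show "\<bar>f' s t * g 0 t + f 0 t * g' s t\<bar> \<le> 3 * (K * N) * norm s" using b1 b2 by (simp add: algebra_simps)
    assume s: "norm s \<le> 1"
    have "\<bar>f s t * g s t\<bar> \<le> K * N" unfolding abs_mult using K(1,3) N(1,3) t s by (intro mult_mono) auto
    then show "\<bar>f s t * g s t\<bar> \<le> 3 * (K * N)" using KN by linarith
    have c1: "\<bar>(f s t - f 0 t) * (g s t - g 0 t)\<bar> \<le> (K * norm s) * (N * norm s)"
      unfolding abs_mult using K(1,6) N(1,6) t s by (intro mult_mono) auto
    have c2: "\<bar>(f s t - f 0 t - f' s t) * g 0 t\<bar> \<le> (K * (norm s)\<^sup>2) * N"
      unfolding abs_mult using K(1,4) N(1) g0 t s by (intro mult_mono) auto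
    have c3: "\<bar>f 0 t * (g s t - g 0 t - g' s t)\<bar> \<le> K * (N * (norm s)\<^sup>2)"
      unfolding abs_mult using K(1) N(1,4) f0 t s by (intro mult_mono) auto
    \<comment> \<open>The remainder of a product: two increments of first order multiplied together,
      plus the remainder of each factor times a bounded factor.\<close>
    have "f s t * g s t - f 0 t * g 0 t - (f' s t * g 0 t + f 0 t * g' s t) =
      (f s t - f 0 t) * (g s t - g 0 t) + (f s t - f 0 t - f' s t) * g 0 t + f 0 t * (g s t - g 0 t - g' s t)"
      by (simp add: algebra_simps)
    then have "\<bar>f s t * g s t - f 0 t * g 0 t - (f' s t * g 0 t + f 0 t * g' s t)\<bar> \<le>
      (K * norm s) * (N * norm s) + (K * (norm s)\<^sup>2) * N + K * (N * (norm s)\<^sup>2)" using c1 c2 c3 by linarith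
    then show "\<bar>f s t * g s t - f 0 t * g 0 t - (f' s t * g 0 t + f 0 t * g' s t)\<bar> \<le> 3 * (K * N) * (norm s)\<^sup>2"
      by (simp add: power2_eq_square algebra_simps)
    assume r: "norm r \<le> 1"
    have d1: "\<bar>(f s t - f r t) * g s t\<bar> \<le> (K * norm (s - r)) * N" unfolding abs_mult using K(1,5) N(1,3) t s r by (intro mult_mono) auto
    have d2: "\<bar>f r t * (g s t - g r t)\<bar> \<le> K * (N * norm (s - r))" unfolding abs_mult using K(1,3) N(1,5) t s r by (intro mult_mono) auto
    have "f s t * g s t - f r t * g r t = (f s t - f r t) * g s t + f r t * (g s t - g r t)" by (simp add: algebra_simps)
    moreover have "0 \<le> K * N * norm (s - r)" using KN by simp
    ultimately show "\<bar>f s t * g s t - f r t * g r t\<bar> \<le> 3 * (K * N) * norm (s - r)" using d1 d2 by (simp add: algebra_simps)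
  qed
qed

lemma nice_cmult: assumes "nice a b f f'" shows "nice a b (\<lambda>s t. c * f s t) (\<lambda>s t. c * f' s t)"
  using nice_mult[OF nice_const[OF bm_const[of a b c]] assms] by simp

lemma nice_diff: assumes "nice a b f f'" "nice a b g g'"
  shows "nice a b (\<lambda>s t. f s t - g s t) (\<lambda>s t. f' s t - g' s t)"
  using nice_add[OF assms(1) nice_cmult[OF assms(2), of "-1"]] by simp

lemma bm_integral_bound:
  assumes h: "bm a b h" and t: "t \<in> {a..b}" and K: "\<And>t. t \<in> {a..b} \<Longrightarrow> \<bar>h t\<bar> \<le> K" "K \<ge> 0"
  shows "\<bar>integral {a..t} h\<bar> \<le> K * (b - a)"
proof -
  have "norm (integral {a..t} h) \<le> integral {a..t} (\<lambda>_. K)"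
    by (rule integral_norm_bound_integral) (use t K bm_integrable_sub[OF h] in auto)
  also have "\<dots> = K * (t - a)" using t by (simp add: mult.commute)
  also have "\<dots> \<le> K * (b - a)" using t K(2) by (intro mult_left_mono) auto
  finally show ?thesis by simp
qed

lemma bm_indefinite_integral: "bm a b f \<Longrightarrow> bm a b (\<lambda>t. integral {a..t} f)"
  by (rule bm_cont[OF prim_cont[OF primI_integral[where C=0]]]) auto

lemma bm_integral_add: "bm a b f \<Longrightarrow> bm a b g \<Longrightarrow> t \<in> {a..b} \<Longrightarrow>
   integral {a..t} (\<lambda>u. f u + g u) = integral {a..t} f + integral {a..t} g"
  by (rule Henstock_Kurzweil_Integration.integral_add) (auto intro: bm_integrable_sub)

lemma bm_integral_diff: "bm a b f \<Longrightarrow> bm a b g \<Longrightarrow> t \<in> {a..b} \<Longrightarrow>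
   integral {a..t} (\<lambda>u. f u - g u) = integral {a..t} f - integral {a..t} g"
  by (rule Henstock_Kurzweil_Integration.integral_diff) (auto intro: bm_integrable_sub)

text \<open>Uniform bounds integrate at the price of the factor \<open>b - a\<close>. Closure under
  integration is what lets the triangular system pass the expansion from the controls to the
  curve.\<close>

lemma nice_integral:
  fixes f :: "'v::real_normed_vector \<Rightarrow> real \<Rightarrow> real"
  assumes f: "nice a b f f'"
  shows "nice a b (\<lambda>s t. integral {a..t} (f s)) (\<lambda>s t. integral {a..t} (f' s))"
proof (cases "a \<le> b")
  case False
  then have e: "{a..b} = {}" by simp
  show ?thesis by (rule niceI[where K=0]) (auto simp: e intro: bm_cont)
next
  case ab: True
  obtain K where K: "K \<ge> 0"
    "\<And>s t. t \<in> {a..b} \<Longrightarrow> \<bar>f' s t\<bar> \<le> K * norm s"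
    "\<And>s t. t \<in> {a..b} \<Longrightarrow> norm s \<le> 1 \<Longrightarrow> \<bar>f s t\<bar> \<le> K"
    "\<And>s t. t \<in> {a..b} \<Longrightarrow> norm s \<le> 1 \<Longrightarrow> \<bar>f s t - f 0 t - f' s t\<bar> \<le> K * (norm s)\<^sup>2"
    "\<And>s r t. t \<in> {a..b} \<Longrightarrow> norm s \<le> 1 \<Longrightarrow> norm r \<le> 1 \<Longrightarrow> \<bar>f s t - f r t\<bar> \<le> K * norm (s - r)"
    by (rule niceE[OF f], rule that; blast)
  note bmf = nice_bm[OF f]
  show ?thesis
  proof (rule niceI[where K="K * (b - a)"])
    show "bm a b (\<lambda>t. integral {a..t} (f s))" "bm a b (\<lambda>t. integral {a..t} (f' s))" for s
      using bmf by (auto intro: bm_indefinite_integral)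
    show "0 \<le> K * (b - a)" using K(1) ab by simp
    fix s r :: 'v and t assume t: "t \<in> {a..b}"
    show "linear (\<lambda>s. integral {a..t} (f' s))"
      unfolding linear_iff
    proof (intro conjI allI)
      fix x y c
      have l: "linear (\<lambda>s. f' s u)" if "u \<in> {a..t}" for u using nice_linear[OF f] that t by auto
      have "integral {a..t} (f' (x + y)) = integral {a..t} (\<lambda>u. f' x u + f' y u)"
        by (rule integral_cong) (use linear_add[OF l] in auto)
      then show "integral {a..t} (f' (x + y)) = integral {a..t} (f' x) + integral {a..t} (f' y)"
        using bm_integral_add[OF bmf(2) bmf(2) t] by simp
      have "integral {a..t} (f' (c *\<^sub>R x)) = integral {a..t} (\<lambda>u. c * f' x u)"
        by (rule integral_cong) (use linear_scale[OF l] in auto)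
      then show "integral {a..t} (f' (c *\<^sub>R x)) = c *\<^sub>R integral {a..t} (f' x)" by simp
    qed
    show "\<bar>integral {a..t} (f' s)\<bar> \<le> K * (b - a) * norm s"
      using bm_integral_bound[OF bmf(2) t, of s "K * norm s"] K(1,2) by (simp add: mult_ac)
    assume s: "norm s \<le> 1"
    show "\<bar>integral {a..t} (f s)\<bar> \<le> K * (b - a)"
      using bm_integral_bound[OF bmf(1) t, of s K] K(1,3) s by simp
    have "integral {a..t} (f s) - integral {a..t} (f 0) - integral {a..t} (f' s) = integral {a..t} (\<lambda>u. f s u - f 0 u - f' s u)"
      using bm_integral_diff[OF bm_diff[OF bmf(1) bmf(1)] bmf(2) t] bm_integral_diff[OF bmf(1) bmf(1) t] by simp
    moreover have "\<bar>integral {a..t} (\<lambda>u. f s u - f 0 u - f' s u)\<bar> \<le> (K * (norm s)\<^sup>2) * (b - a)"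
      using K(1,4) s bmf by (intro bm_integral_bound[OF _ t] bm_diff) auto
    ultimately show "\<bar>integral {a..t} (f s) - integral {a..t} (f 0) - integral {a..t} (f' s)\<bar> \<le> K * (b - a) * (norm s)\<^sup>2"
      by (simp add: mult_ac)
    assume r: "norm r \<le> 1"
    have "\<bar>integral {a..t} (\<lambda>u. f s u - f r u)\<bar> \<le> (K * norm (s - r)) * (b - a)"
      using K(1,5) s r bmf by (intro bm_integral_bound[OF _ t] bm_diff) auto
    then show "\<bar>integral {a..t} (f s) - integral {a..t} (f r)\<bar> \<le> K * (b - a) * norm (s - r)"
      using bm_integral_diff[OF bmf(1) bmf(1) t] by (simp add: mult_ac)
  qed
qed

lemma bm_comp:
  fixes \<phi> :: "real^4 \<Rightarrow> real"
  assumes x: "\<And>i. bm a b (\<lambda>t. x t $ i)" and f: "continuous_on UNIV \<phi>"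
  shows "bm a b (\<lambda>t. \<phi> (x t))"
proof -
  have "x \<in> borel_measurable (lebesgue_on {a..b})"
    by (subst borel_measurable_euclidean_space) (use x in \<open>auto simp: bm_def Basis_vec_def inner_axis\<close>)
  then have m: "(\<lambda>t. \<phi> (x t)) \<in> borel_measurable (lebesgue_on {a..b})"
    using borel_measurable_continuous_onI[OF f] by (rule measurable_compose)
  have "\<exists>M. M > 0 \<and> (\<forall>t\<in>{a..b}. \<bar>x t $ i\<bar> \<le> M)" for i using bm_bounded[OF x] by metis
  then obtain M where M: "\<And>i. M i > 0" "\<And>i t. t \<in> {a..b} \<Longrightarrow> \<bar>x t $ i\<bar> \<le> M i" by metis
  have sub: "x ` {a..b} \<subseteq> cbox (\<chi> i. - M i) (\<chi> i. M i)"
    using M(2) by (auto simp: mem_box_cart abs_le_iff) (smt (verit) M(2) atLeastAtMost_iff)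
  have "bounded (\<phi> ` cbox (\<chi> i. - M i) (\<chi> i. M i))"
    using continuous_on_subset[OF f] by (intro compact_imp_bounded compact_continuous_image) auto
  then have "bounded (\<phi> ` x ` {a..b})" using sub by (meson bounded_subset image_mono)
  then show ?thesis using m unfolding bm_def bounded_iff by auto
qed

text \<open>For parameters in the unit ball all points lie in one cube, on which a single Lipschitz
  constant and a single Taylor constant are available.\<close>

lemma nice_comp:
  fixes X :: "'v::real_normed_vector \<Rightarrow> real \<Rightarrow> real^4"
  assumes f: "smooth_R4 \<phi>" and X: "\<And>i. nice a b (\<lambda>s t. X s t $ i) (Y i)"
  shows "nice a b (\<lambda>s t. \<phi> (X s t)) (\<lambda>s t. \<Sum>i\<in>UNIV. pd \<phi> i (X 0 t) * Y i s t)"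
proof -
  have "\<exists>K\<ge>0. (\<forall>s. \<forall>t\<in>{a..b}. \<bar>Y i s t\<bar> \<le> K * norm s) \<and>
       (\<forall>s. \<forall>t\<in>{a..b}. norm s \<le> 1 \<longrightarrow> \<bar>X s t $ i\<bar> \<le> K \<and> \<bar>X s t $ i - X 0 t $ i - Y i s t\<bar> \<le> K * (norm s)\<^sup>2) \<and>
       (\<forall>s r. \<forall>t\<in>{a..b}. norm s \<le> 1 \<longrightarrow> norm r \<le> 1 \<longrightarrow> \<bar>X s t $ i - X r t $ i\<bar> \<le> K * norm (s - r))" for i
    using X[of i] unfolding nice_def by blast
  then obtain K where K0: "\<forall>i. K i \<ge> 0 \<and> (\<forall>s. \<forall>t\<in>{a..b}. \<bar>Y i s t\<bar> \<le> K i * norm s) \<and>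
       (\<forall>s. \<forall>t\<in>{a..b}. norm s \<le> 1 \<longrightarrow> \<bar>X s t $ i\<bar> \<le> K i \<and> \<bar>X s t $ i - X 0 t $ i - Y i s t\<bar> \<le> K i * (norm s)\<^sup>2) \<and>
       (\<forall>s r. \<forall>t\<in>{a..b}. norm s \<le> 1 \<longrightarrow> norm r \<le> 1 \<longrightarrow> \<bar>X s t $ i - X r t $ i\<bar> \<le> K i * norm (s - r))"
    by metis
  have K: "K i \<ge> 0" "\<And>s t. t \<in> {a..b} \<Longrightarrow> \<bar>Y i s t\<bar> \<le> K i * norm s"
    "\<And>s t. t \<in> {a..b} \<Longrightarrow> norm s \<le> 1 \<Longrightarrow> \<bar>X s t $ i\<bar> \<le> K i"
    "\<And>s t. t \<in> {a..b} \<Longrightarrow> norm s \<le> 1 \<Longrightarrow> \<bar>X s t $ i - X 0 t $ i - Y i s t\<bar> \<le> K i * (norm s)\<^sup>2"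
    "\<And>s r t. t \<in> {a..b} \<Longrightarrow> norm s \<le> 1 \<Longrightarrow> norm r \<le> 1 \<Longrightarrow> \<bar>X s t $ i - X r t $ i\<bar> \<le> K i * norm (s - r)" for i
    using K0 by blast+
  define R where "R = (\<Sum>i\<in>UNIV. K i)"
  have R0: "R \<ge> 0" unfolding R_def by (rule sum_nonneg) (use K(1) in auto)
  have KR: "K i \<le> R" for i unfolding R_def by (rule member_le_sum) (use K(1) in auto)
  have cube: "X s t \<in> cube R" if "t \<in> {a..b}" "norm s \<le> 1" for s t
    unfolding cube_def using K(3)[OF that] KR order_trans by blast
  have n1: "n1 (X s t - X r t) \<le> R * norm (s - r)" if "t \<in> {a..b}" "norm s \<le> 1" "norm r \<le> 1" for s r t
    unfolding n1_def R_def sum_distrib_right by (rule sum_mono) (use K(5)[OF that] in simp)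
  obtain P where P: "P > 0" "\<And>x. x \<in> cube R \<Longrightarrow> \<bar>\<phi> x\<bar> \<le> P" using cube_bounded_smooth[OF f] by blast
  obtain L where L: "L > 0" "\<And>x y. x \<in> cube R \<Longrightarrow> y \<in> cube R \<Longrightarrow> \<bar>\<phi> y - \<phi> x\<bar> \<le> L * n1 (y - x)" using smooth_R4_lip[OF f] by blast
  obtain M where M: "M > 0" "\<And>x y. x \<in> cube R \<Longrightarrow> y \<in> cube R \<Longrightarrow>
    \<bar>\<phi> y - \<phi> x - (\<Sum>i\<in>UNIV. pd \<phi> i x * (y$i - x$i))\<bar> \<le> M * (n1 (y - x))\<^sup>2" using smooth_R4_taylor[OF f] by blast
  have "\<exists>Q. Q > 0 \<and> (\<forall>x\<in>cube R. \<bar>pd \<phi> i x\<bar> \<le> Q)" for i using cube_bounded_smooth[OF smooth_R4_pd(1)[OF f]] by metis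
  then obtain Q where Q: "\<And>i. Q i > 0" "\<And>i x. x \<in> cube R \<Longrightarrow> \<bar>pd \<phi> i x\<bar> \<le> Q i" by metis
  define W where "W = (\<Sum>i\<in>UNIV. Q i * K i)"
  have W0: "W \<ge> 0" unfolding W_def by (rule sum_nonneg) (use Q(1) K(1) less_imp_le in \<open>auto intro!: mult_nonneg_nonneg\<close>)
  define Z where "Z = P + L * R + M * R\<^sup>2 + W"
  have MR: "0 \<le> M * R\<^sup>2" "0 \<le> L * R" using M(1) L(1) R0 by simp_all
  have Z: "P \<le> Z" "L * R \<le> Z" "M * R\<^sup>2 + W \<le> Z" "W \<le> Z" "0 \<le> Z" unfolding Z_def using P(1) MR W0 by simp_all
  show ?thesis
  proof (rule niceI[where K=Z])
    have bX: "bm a b (\<lambda>t. X s t $ i)" for s i by (rule nice_bm(1)[OF X])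
    show "bm a b (\<lambda>t. \<phi> (X s t))" for s by (rule bm_comp[OF bX smooth_R4_cont[OF f]])
    show "bm a b (\<lambda>t. \<Sum>i\<in>UNIV. pd \<phi> i (X 0 t) * Y i s t)" for s
      by (intro bm_sum bm_mult bm_comp[OF bX smooth_R4_cont[OF smooth_R4_pd(1)[OF f]]] nice_bm(2)[OF X])
    show "0 \<le> Z" by (rule Z)
    fix s r :: 'v and t assume t: "t \<in> {a..b}"
    show "linear (\<lambda>s. \<Sum>i\<in>UNIV. pd \<phi> i (X 0 t) * Y i s t)"
      by (intro linear_compose_sum ballI linear_mult_fun nice_linear[OF X t])
    have "\<bar>\<Sum>i\<in>UNIV. pd \<phi> i (X 0 t) * Y i s t\<bar> \<le> (\<Sum>i\<in>UNIV. Q i * (K i * norm s))"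
    proof (rule order_trans[OF sum_abs sum_mono])
      fix i show "\<bar>pd \<phi> i (X 0 t) * Y i s t\<bar> \<le> Q i * (K i * norm s)"
        unfolding abs_mult using Q(2)[OF cube[OF t], of 0 i] Q(1)[of i] K(2)[OF t] by (intro mult_mono) auto
    qed
    also have "\<dots> = W * norm s" unfolding W_def by (simp add: sum_distrib_right mult.assoc)
    also have "\<dots> \<le> Z * norm s" using Z(4) by (intro mult_right_mono) auto
    finally show "\<bar>\<Sum>i\<in>UNIV. pd \<phi> i (X 0 t) * Y i s t\<bar> \<le> Z * norm s" .
    assume s: "norm s \<le> 1"
    show "\<bar>\<phi> (X s t)\<bar> \<le> Z" using P(2)[OF cube[OF t s]] Z(1) by linarith
    have c0: "X 0 t \<in> cube R" using cube[OF t] by simp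
    have "\<bar>\<phi> (X s t) - \<phi> (X 0 t) - (\<Sum>i\<in>UNIV. pd \<phi> i (X 0 t) * (X s t $ i - X 0 t $ i))\<bar> \<le> M * (n1 (X s t - X 0 t))\<^sup>2"
      by (rule M(2)[OF c0 cube[OF t s]])
    also have "\<dots> \<le> M * (R * norm s)\<^sup>2" using n1[OF t s, of 0] M(1) by (intro mult_left_mono power_mono) auto
    finally have 1: "\<bar>\<phi> (X s t) - \<phi> (X 0 t) - (\<Sum>i\<in>UNIV. pd \<phi> i (X 0 t) * (X s t $ i - X 0 t $ i))\<bar> \<le> M * (R * norm s)\<^sup>2" .
    have "\<bar>\<Sum>i\<in>UNIV. pd \<phi> i (X 0 t) * (X s t $ i - X 0 t $ i - Y i s t)\<bar> \<le> (\<Sum>i\<in>UNIV. Q i * (K i * (norm s)\<^sup>2))"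
    proof (rule order_trans[OF sum_abs sum_mono])
      fix i show "\<bar>pd \<phi> i (X 0 t) * (X s t $ i - X 0 t $ i - Y i s t)\<bar> \<le> Q i * (K i * (norm s)\<^sup>2)"
        unfolding abs_mult using Q(2)[OF c0, of i] Q(1)[of i] K(4)[OF t s, of i] by (intro mult_mono) auto
    qed
    also have "\<dots> = W * (norm s)\<^sup>2" unfolding W_def by (simp add: sum_distrib_right mult.assoc)
    finally have 2: "\<bar>\<Sum>i\<in>UNIV. pd \<phi> i (X 0 t) * (X s t $ i - X 0 t $ i - Y i s t)\<bar> \<le> W * (norm s)\<^sup>2" .
    have 3: "(\<Sum>i\<in>UNIV. pd \<phi> i (X 0 t) * (X s t $ i - X 0 t $ i - Y i s t)) =
      (\<Sum>i\<in>UNIV. pd \<phi> i (X 0 t) * (X s t $ i - X 0 t $ i)) - (\<Sum>i\<in>UNIV. pd \<phi> i (X 0 t) * Y i s t)"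
      by (simp add: sum_subtractf[symmetric] algebra_simps)
    have "\<bar>\<phi> (X s t) - \<phi> (X 0 t) - (\<Sum>i\<in>UNIV. pd \<phi> i (X 0 t) * Y i s t)\<bar> \<le> M * (R * norm s)\<^sup>2 + W * (norm s)\<^sup>2"
      using 1 2 unfolding 3 by linarith
    also have "\<dots> = (M * R\<^sup>2 + W) * (norm s)\<^sup>2" by (simp add: power_mult_distrib algebra_simps)
    also have "\<dots> \<le> Z * (norm s)\<^sup>2" using Z(3) by (intro mult_right_mono) auto
    finally show "\<bar>\<phi> (X s t) - \<phi> (X 0 t) - (\<Sum>i\<in>UNIV. pd \<phi> i (X 0 t) * Y i s t)\<bar> \<le> Z * (norm s)\<^sup>2" .
    assume r: "norm r \<le> 1"
    have "\<bar>\<phi> (X s t) - \<phi> (X r t)\<bar> \<le> L * n1 (X s t - X r t)" by (rule L(2)[OF cube[OF t r] cube[OF t s]])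
    also have "\<dots> \<le> L * (R * norm (s - r))" using n1[OF t s r] L(1) by (intro mult_left_mono) auto
    also have "\<dots> \<le> Z * norm (s - r)" using Z(2) unfolding mult.assoc[symmetric] by (intro mult_right_mono) auto
    finally show "\<bar>\<phi> (X s t) - \<phi> (X r t)\<bar> \<le> Z * norm (s - r)" .
  qed
qed

lemma nice_has_derivative:
  assumes f: "nice a b f f'" and t: "t \<in> {a..b}"
  shows "((\<lambda>s. f s t) has_derivative (\<lambda>s. f' s t)) (at 0)"
  unfolding has_derivative_at_alt
proof (intro conjI allI impI)
  obtain K where K: "K \<ge> 0"
    "\<And>s t. t \<in> {a..b} \<Longrightarrow> \<bar>f' s t\<bar> \<le> K * norm s"
    "\<And>s t. t \<in> {a..b} \<Longrightarrow> norm s \<le> 1 \<Longrightarrow> \<bar>f s t - f 0 t - f' s t\<bar> \<le> K * (norm s)\<^sup>2"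
    by (rule niceE[OF f], rule that; blast)
  show "bounded_linear (\<lambda>s. f' s t)"
    by (rule bounded_linear_intro[where K=K])
      (use nice_linear[OF f t] K(2)[OF t] in \<open>auto simp: linear_iff mult.commute\<close>)
  fix e :: real assume e: "e > 0"
  show "\<exists>d>0. \<forall>y. norm (y - 0) < d \<longrightarrow> norm (f y t - f 0 t - f' (y - 0) t) \<le> e * norm (y - 0)"
  proof (intro exI[of _ "min 1 (e / (K + 1))"] conjI allI impI)
    show "0 < min 1 (e / (K + 1))" using e K(1) by simp
    fix s :: 'a assume "norm (s - 0) < min 1 (e / (K + 1))"
    then have s: "norm s \<le> 1" "norm s \<le> e / (K + 1)" by auto
    have "\<bar>f s t - f 0 t - f' s t\<bar> \<le> (K * norm s) * norm s" using K(3)[OF t s(1)] by (simp add: power2_eq_square)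
    also have "\<dots> \<le> e * norm s"
    proof (rule mult_right_mono)
      have "K * norm s \<le> (K + 1) * norm s" by (simp add: algebra_simps)
      also have "\<dots> \<le> e" using s(2) K(1) by (simp add: field_simps)
      finally show "K * norm s \<le> e" .
    qed simp
    finally show "norm (f s t - f 0 t - f' (s - 0) t) \<le> e * norm (s - 0)" by simp
  qed
qed

lemma nice_continuous:
  assumes f: "nice a b f f'" and t: "t \<in> {a..b}"
  shows "continuous_on (ball 0 1) (\<lambda>s. f s t)"
proof -
  obtain K where K: "K \<ge> 0"
    "\<And>s r t. t \<in> {a..b} \<Longrightarrow> norm s \<le> 1 \<Longrightarrow> norm r \<le> 1 \<Longrightarrow> \<bar>f s t - f r t\<bar> \<le> K * norm (s - r)"
    by (rule niceE[OF f], rule that; blast)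
  have "K-lipschitz_on (ball 0 1) (\<lambda>s. f s t)"
    by (rule lipschitz_onI) (use K t in \<open>auto simp: dist_norm\<close>)
  then show ?thesis by (rule lipschitz_on_continuous_on)
qed

section \<open>Variations of the controls and the multiplier rule\<close>

lemma nice_cong:
  assumes "nice a b f f'" "\<And>s t. t \<in> {a..b} \<Longrightarrow> g s t = f s t" "\<And>s t. t \<in> {a..b} \<Longrightarrow> g' s t = f' s t"
  shows "nice a b g g'"
proof -
  obtain K where K: "K \<ge> 0"
    "\<And>s t. t \<in> {a..b} \<Longrightarrow> \<bar>f' s t\<bar> \<le> K * norm s"
    "\<And>s t. t \<in> {a..b} \<Longrightarrow> norm s \<le> 1 \<Longrightarrow> \<bar>f s t\<bar> \<le> K"
    "\<And>s t. t \<in> {a..b} \<Longrightarrow> norm s \<le> 1 \<Longrightarrow> \<bar>f s t - f 0 t - f' s t\<bar> \<le> K * (norm s)\<^sup>2"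
    "\<And>s r t. t \<in> {a..b} \<Longrightarrow> norm s \<le> 1 \<Longrightarrow> norm r \<le> 1 \<Longrightarrow> \<bar>f s t - f r t\<bar> \<le> K * norm (s - r)"
    by (rule niceE[OF assms(1)], rule that; blast)
  show ?thesis
  proof (rule niceI[where K=K])
    show "bm a b (g s)" "bm a b (g' s)" for s
      using bm_cong[OF nice_bm(1)[OF assms(1)] assms(2)] bm_cong[OF nice_bm(2)[OF assms(1)] assms(3)] by auto
    show "linear (\<lambda>s. g' s t)" if "t \<in> {a..b}" for t
      using nice_linear[OF assms(1) that] assms(3)[OF that] by simp
  qed (use K assms(2,3) in auto)
qed

lemma has_derivative_vec4I:
  assumes "\<And>i. ((\<lambda>s. F s $ i) has_derivative (\<lambda>s. F' s $ i)) (at p)"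
  shows "(F has_derivative (F' :: _ \<Rightarrow> real^4)) (at p)"
  by (subst has_derivative_componentwise_within) (use assms in \<open>auto simp: Basis_vec_def inner_axis\<close>)

section \<open>Linearization of energy and endpoint along a controlled curve\<close>

locale controlled = metric +
  fixes a b :: real and u1 u2 :: "real \<Rightarrow> real" and x :: "real \<Rightarrow> real^4"
  assumes ctl: "ctl a b u1 u2 x"
begin

lemma ab: "a \<le> b" using ctlD(1)[OF ctl] .

lemma x_bm: "bm a b (\<lambda>t. x t $ i)" by (rule bm_cont[OF ctl_cont_nth[OF ctl]])

lemma smooth_x_bm: "smooth_R4 f \<Longrightarrow> bm a b (\<lambda>t. f (x t))"
  by (rule bm_comp[OF x_bm smooth_R4_cont])

lemmas u_bm = ctlD(6,7)[OF ctl]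

text \<open>The partial derivative of half of \<open>q\<close> in the coordinate \<open>k\<close>,
  with the controls frozen. Below, \<open>m1\<close> and \<open>m2\<close> are its partial
  derivatives in the controls.\<close>

definition qd :: "4 \<Rightarrow> real \<Rightarrow> real" where
  "qd k t = (pd A k (x t) * (u1 t)\<^sup>2 + 2 * pd B k (x t) * u1 t * u2 t + pd C k (x t) * (u2 t)\<^sup>2) / 2"

definition m1 where "m1 t = A (x t) * u1 t + B (x t) * u2 t"
definition m2 where "m2 t = B (x t) * u1 t + C (x t) * u2 t"

lemma qd_bm: "bm a b (qd k)"
proof -
  have "bm a b (\<lambda>t. (1/2) * (pd A k (x t) * (u1 t)\<^sup>2 + 2 * pd B k (x t) * u1 t * u2 t + pd C k (x t) * (u2 t)\<^sup>2))"
    by (intro bm_intros smooth_x_bm smooth_R4_pd(1) smooth u_bm)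
  then show ?thesis by (rule bm_cong) (simp add: qd_def)
qed

lemma m_bm: "bm a b m1" "bm a b m2"
  unfolding m1_def[abs_def] m2_def[abs_def] by (intro bm_intros smooth_x_bm smooth u_bm)+

text \<open>\<open>Y1\<close>, \<open>Y3\<close> and \<open>Y4\<close> solve the linearized control
  system with zero initial value; the first two coordinates both have the form \<open>Y1\<close>.
  Being triangular, the system is solved by successive integration.\<close>

definition Y1 where "Y1 \<xi> t = integral {a..t} \<xi>" for \<xi> :: "real \<Rightarrow> real"
definition Y3 where "Y3 \<xi>1 \<xi>2 t = integral {a..t} (\<lambda>t. 2 * (Y1 \<xi>2 t * u1 t + x t $ 2 * \<xi>1 t) - 2 * (Y1 \<xi>1 t * u2 t + x t $ 1 * \<xi>2 t))"
definition Y4 where "Y4 \<xi>1 \<xi>2 t = integral {a..t} (\<lambda>t. 2 * x t $ 3 * Y3 \<xi>1 \<xi>2 t * u1 t + (x t $ 3)\<^sup>2 * \<xi>1 t)"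
definition Yv :: "(real \<Rightarrow> real) \<Rightarrow> (real \<Rightarrow> real) \<Rightarrow> real \<Rightarrow> real^4" where
  "Yv \<xi>1 \<xi>2 t = vector [Y1 \<xi>1 t, Y1 \<xi>2 t, Y3 \<xi>1 \<xi>2 t, Y4 \<xi>1 \<xi>2 t]"
definition dE where "dE \<xi>1 \<xi>2 = integral {a..b} (\<lambda>t. (\<Sum>k\<in>UNIV. qd k t * Yv \<xi>1 \<xi>2 t $ k) + m1 t * \<xi>1 t + m2 t * \<xi>2 t)"
text \<open>The differential, in the direction of a control variation, of the map from controls to
  the pair of energy and endpoint.\<close>

definition dFull :: "(real \<Rightarrow> real) \<Rightarrow> (real \<Rightarrow> real) \<Rightarrow> real \<times> (real^4)" where
  "dFull \<xi>1 \<xi>2 = (dE \<xi>1 \<xi>2, Yv \<xi>1 \<xi>2 b)"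

lemma Y_prim:
  assumes "bm a b \<xi>1" "bm a b \<xi>2"
  shows "prim a b (Y1 \<xi>1) \<xi>1"
    "prim a b (Y3 \<xi>1 \<xi>2) (\<lambda>t. 2 * (Y1 \<xi>2 t * u1 t + x t $ 2 * \<xi>1 t) - 2 * (Y1 \<xi>1 t * u2 t + x t $ 1 * \<xi>2 t))"
    "prim a b (Y4 \<xi>1 \<xi>2) (\<lambda>t. 2 * x t $ 3 * Y3 \<xi>1 \<xi>2 t * u1 t + (x t $ 3)\<^sup>2 * \<xi>1 t)"
proof -
  have Y1: "prim a b (Y1 \<xi>) \<xi>" if "bm a b \<xi>" for \<xi>
    by (rule primI_integral[OF that, where C=0]) (simp add: Y1_def)
  show "prim a b (Y1 \<xi>1) \<xi>1" by (rule Y1[OF assms(1)])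
  show Y3: "prim a b (Y3 \<xi>1 \<xi>2) (\<lambda>t. 2 * (Y1 \<xi>2 t * u1 t + x t $ 2 * \<xi>1 t) - 2 * (Y1 \<xi>1 t * u2 t + x t $ 1 * \<xi>2 t))"
    by (rule primI_integral[where C=0])
      (auto simp: Y3_def intro!: bm_intros x_bm u_bm assms bm_cont[OF prim_cont[OF Y1]])
  show "prim a b (Y4 \<xi>1 \<xi>2) (\<lambda>t. 2 * x t $ 3 * Y3 \<xi>1 \<xi>2 t * u1 t + (x t $ 3)\<^sup>2 * \<xi>1 t)"
    by (rule primI_integral[where C=0])
      (auto simp: Y4_def intro!: bm_intros x_bm u_bm assms bm_cont[OF prim_cont[OF Y3]])
qed

end

text \<open>A family of controls \<open>u + L s\<close> that is affine in a finite-dimensional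
  parameter. The corresponding curves \<open>Z s\<close> all start at \<open>x a\<close>, and
  \<open>s = 0\<close> returns the given curve.\<close>

locale variation = controlled +
  fixes L1 L2 :: "'v::euclidean_space \<Rightarrow> real \<Rightarrow> real" and N :: real
  assumes L_bm: "\<And>s. bm a b (L1 s)" "\<And>s. bm a b (L2 s)"
    and L_linear: "\<And>t. linear (\<lambda>s. L1 s t)" "\<And>t. linear (\<lambda>s. L2 s t)"
    and L_bound: "\<And>s t. t \<in> {a..b} \<Longrightarrow> \<bar>L1 s t\<bar> \<le> N * norm s" "\<And>s t. t \<in> {a..b} \<Longrightarrow> \<bar>L2 s t\<bar> \<le> N * norm s"
begin

definition w1 where "w1 s t = u1 t + L1 s t"
definition w2 where "w2 s t = u2 t + L2 s t"
definition Z1 where "Z1 s t = x a $ 1 + integral {a..t} (w1 s)"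
definition Z2 where "Z2 s t = x a $ 2 + integral {a..t} (w2 s)"
definition Z3 where "Z3 s t = x a $ 3 + integral {a..t} (\<lambda>t. 2 * (Z2 s t * w1 s t) - 2 * (Z1 s t * w2 s t))"
definition Z4 where "Z4 s t = x a $ 4 + integral {a..t} (\<lambda>t. (Z3 s t * Z3 s t) * w1 s t)"
definition Z :: "'v \<Rightarrow> real \<Rightarrow> real^4" where "Z s t = vector [Z1 s t, Z2 s t, Z3 s t, Z4 s t]"

lemma nice_w: "nice a b w1 L1" "nice a b w2 L2"
  unfolding w1_def[abs_def] w2_def[abs_def]
  by (rule nice_affine[OF u_bm(1) L_bm(1) L_linear(1) L_bound(1)] nice_affine[OF u_bm(2) L_bm(2) L_linear(2) L_bound(2)]; assumption)+

lemma w0: "w1 0 t = u1 t" "w2 0 t = u2 t"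
  unfolding w1_def w2_def using linear_0[OF L_linear(1)] linear_0[OF L_linear(2)] by simp_all

lemma nice_Z12: "nice a b Z1 (\<lambda>s. Y1 (L1 s))" "nice a b Z2 (\<lambda>s. Y1 (L2 s))"
  by (rule nice_cong[OF nice_add[OF nice_const[OF bm_const[of a b "x a $ 1"]] nice_integral[OF nice_w(1)]]]; simp add: Z1_def Y1_def)
    (rule nice_cong[OF nice_add[OF nice_const[OF bm_const[of a b "x a $ 2"]] nice_integral[OF nice_w(2)]]]; simp add: Z2_def Y1_def)

lemma Z12_0: "t \<in> {a..b} \<Longrightarrow> Z1 0 t = x t $ 1" "t \<in> {a..b} \<Longrightarrow> Z2 0 t = x t $ 2"
  using prim_integral[OF ctlD(2)[OF ctl], of a t] prim_integral[OF ctlD(3)[OF ctl], of a t]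
  by (auto simp: Z1_def Z2_def w0[abs_def])

lemma nice_Z3: "nice a b Z3 (\<lambda>s. Y3 (L1 s) (L2 s))"
proof -
  have "nice a b (\<lambda>s t. 2 * (Z2 s t * w1 s t) - 2 * (Z1 s t * w2 s t))
     (\<lambda>s t. 2 * (Y1 (L2 s) t * w1 0 t + Z2 0 t * L1 s t) - 2 * (Y1 (L1 s) t * w2 0 t + Z1 0 t * L2 s t))"
    by (intro nice_diff nice_cmult nice_mult nice_Z12 nice_w)
  from nice_add[OF nice_const[OF bm_const[of a b "x a $ 3"]] nice_integral[OF this]] show ?thesis
    by (rule nice_cong) (auto simp: Z3_def Y3_def w0 Z12_0 intro!: integral_cong)
qed

lemma Z3_0: assumes t: "t \<in> {a..b}" shows "Z3 0 t = x t $ 3"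
proof -
  have "integral {a..t} (\<lambda>t. 2 * (Z2 0 t * w1 0 t) - 2 * (Z1 0 t * w2 0 t)) = integral {a..t} (\<lambda>t. 2 * x t $ 2 * u1 t - 2 * x t $ 1 * u2 t)"
    by (rule integral_cong) (use t Z12_0 w0 in auto)
  then show ?thesis using prim_integral[OF ctlD(4)[OF ctl], of a t] t unfolding Z3_def by auto
qed

lemma nice_Z4: "nice a b Z4 (\<lambda>s. Y4 (L1 s) (L2 s))"
proof -
  have "nice a b (\<lambda>s t. (Z3 s t * Z3 s t) * w1 s t)
     (\<lambda>s t. (Y3 (L1 s) (L2 s) t * Z3 0 t + Z3 0 t * Y3 (L1 s) (L2 s) t) * w1 0 t + (Z3 0 t * Z3 0 t) * L1 s t)"
    by (intro nice_mult nice_Z3 nice_w)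
  from nice_add[OF nice_const[OF bm_const[of a b "x a $ 4"]] nice_integral[OF this]] show ?thesis
    by (rule nice_cong) (auto simp: Z4_def Y4_def w0 Z3_0 power2_eq_square algebra_simps intro!: integral_cong)
qed

lemma Z4_0: assumes t: "t \<in> {a..b}" shows "Z4 0 t = x t $ 4"
proof -
  have "integral {a..t} (\<lambda>t. (Z3 0 t * Z3 0 t) * w1 0 t) = integral {a..t} (\<lambda>t. (x t $ 3)\<^sup>2 * u1 t)"
    by (rule integral_cong) (use t Z3_0 w0 in \<open>auto simp: power2_eq_square\<close>)
  then show ?thesis using prim_integral[OF ctlD(5)[OF ctl], of a t] t unfolding Z4_def by auto
qed

lemma Z_nth: "Z s t $ 1 = Z1 s t" "Z s t $ 2 = Z2 s t" "Z s t $ 3 = Z3 s t" "Z s t $ 4 = Z4 s t"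
  unfolding Z_def vector4_nth by simp_all

lemma Yv_nth: "Yv \<xi>1 \<xi>2 t $ 1 = Y1 \<xi>1 t" "Yv \<xi>1 \<xi>2 t $ 2 = Y1 \<xi>2 t" "Yv \<xi>1 \<xi>2 t $ 3 = Y3 \<xi>1 \<xi>2 t" "Yv \<xi>1 \<xi>2 t $ 4 = Y4 \<xi>1 \<xi>2 t"
  unfolding Yv_def vector4_nth by simp_all

lemma nice_Z: "nice a b (\<lambda>s t. Z s t $ i) (\<lambda>s t. Yv (L1 s) (L2 s) t $ i)"
proof -
  have "\<forall>i. nice a b (\<lambda>s t. Z s t $ i) (\<lambda>s t. Yv (L1 s) (L2 s) t $ i)"
    unfolding forall_4 Z_nth Yv_nth using nice_Z12 nice_Z3 nice_Z4 by blast
  then show ?thesis by blast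
qed

lemma Z_0: "t \<in> {a..b} \<Longrightarrow> Z 0 t = x t"
  unfolding vec4_eq_iff Z_nth using Z12_0 Z3_0 Z4_0 by simp

lemma Z_a: "Z s a = x a"
  unfolding vec4_eq_iff Z_nth Z1_def Z2_def Z3_def Z4_def by simp

lemma Z_ctl: "ctl a b (w1 s) (w2 s) (Z s)"
  unfolding ctl_def Z_nth
proof (intro conjI)
  note bms = bm_intros nice_bm(1)[OF nice_w(1)] nice_bm(1)[OF nice_w(2)] nice_bm(1)[OF nice_Z12(1)] nice_bm(1)[OF nice_Z12(2)] nice_bm(1)[OF nice_Z3]
  show "a \<le> b" by (rule ab)
  show "prim a b (Z1 s) (w1 s)" by (rule primI_integral[where C="x a $ 1"]) (auto simp: Z1_def intro!: bms)
  show "prim a b (Z2 s) (w2 s)" by (rule primI_integral[where C="x a $ 2"]) (auto simp: Z2_def intro!: bms)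
  show "prim a b (Z3 s) (\<lambda>t. 2 * Z2 s t * w1 s t - 2 * Z1 s t * w2 s t)"
    by (rule primI_integral[where C="x a $ 3"]) (auto simp: Z3_def mult.assoc intro!: bms)
  show "prim a b (Z4 s) (\<lambda>t. (Z3 s t)\<^sup>2 * w1 s t)"
    by (rule primI_integral[where C="x a $ 4"]) (auto simp: Z4_def power2_eq_square intro!: bms)
qed

definition En where "En s = integral {a..b} (\<lambda>t. q (Z s t) (w1 s t) (w2 s t) / 2)"

lemma nice_q: "nice a b (\<lambda>s t. q (Z s t) (w1 s t) (w2 s t) / 2)
   (\<lambda>s t. (\<Sum>k\<in>UNIV. qd k t * Yv (L1 s) (L2 s) t $ k) + m1 t * L1 s t + m2 t * L2 s t)"
proof -
  let ?d = "\<lambda>f s t. \<Sum>i\<in>UNIV. pd f i (Z 0 t) * Yv (L1 s) (L2 s) t $ i"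
  have nc: "nice a b (\<lambda>s t. f (Z s t)) (?d f)" if "smooth_R4 f" for f
    by (rule nice_comp[OF that nice_Z])
  have "nice a b (\<lambda>s t. (1/2) * (A (Z s t) * (w1 s t * w1 s t)) + B (Z s t) * (w1 s t * w2 s t) + (1/2) * (C (Z s t) * (w2 s t * w2 s t)))
   (\<lambda>s t. (1/2) * (?d A s t * (w1 0 t * w1 0 t) + A (Z 0 t) * (L1 s t * w1 0 t + w1 0 t * L1 s t)) +
      (?d B s t * (w1 0 t * w2 0 t) + B (Z 0 t) * (L1 s t * w2 0 t + w1 0 t * L2 s t)) +
      (1/2) * (?d C s t * (w2 0 t * w2 0 t) + C (Z 0 t) * (L2 s t * w2 0 t + w2 0 t * L2 s t)))"
    by (intro nice_add nice_cmult nice_mult nc smooth nice_w)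
  then show ?thesis
  proof (rule nice_cong)
    fix s t assume t: "t \<in> {a..b}"
    show "q (Z s t) (w1 s t) (w2 s t) / 2 = (1/2) * (A (Z s t) * (w1 s t * w1 s t)) + B (Z s t) * (w1 s t * w2 s t) + (1/2) * (C (Z s t) * (w2 s t * w2 s t))"
      unfolding q_def by (simp add: power2_eq_square algebra_simps)
    show "(\<Sum>k\<in>UNIV. qd k t * Yv (L1 s) (L2 s) t $ k) + m1 t * L1 s t + m2 t * L2 s t =
      (1/2) * (?d A s t * (w1 0 t * w1 0 t) + A (Z 0 t) * (L1 s t * w1 0 t + w1 0 t * L1 s t)) +
      (?d B s t * (w1 0 t * w2 0 t) + B (Z 0 t) * (L1 s t * w2 0 t + w1 0 t * L2 s t)) +
      (1/2) * (?d C s t * (w2 0 t * w2 0 t) + C (Z 0 t) * (L2 s t * w2 0 t + w2 0 t * L2 s t))"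
      unfolding sum_4 qd_def m1_def m2_def w0 Z_0[OF t] by (simp add: power2_eq_square field_simps)
  qed
qed

definition F :: "'v \<Rightarrow> real \<times> (real^4)" where "F s = (En s, Z s b)"

lemma F_deriv: "(F has_derivative (\<lambda>s. dFull (L1 s) (L2 s))) (at 0)"
  unfolding F_def[abs_def] dFull_def
proof (rule has_derivative_Pair)
  have b: "b \<in> {a..b}" using ab by simp
  show "(En has_derivative (\<lambda>s. dE (L1 s) (L2 s))) (at 0)"
    using nice_has_derivative[OF nice_integral[OF nice_q] b] unfolding En_def[abs_def] dE_def .
  show "((\<lambda>s. Z s b) has_derivative (\<lambda>s. Yv (L1 s) (L2 s) b)) (at 0)"
    by (rule has_derivative_vec4I) (rule nice_has_derivative[OF nice_Z b])
qed

lemma F_cont: "continuous_on (ball 0 1) F"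
proof -
  have b: "b \<in> {a..b}" using ab by simp
  have "continuous_on (ball 0 1) En" using nice_continuous[OF nice_integral[OF nice_q] b] unfolding En_def[abs_def] .
  moreover have "continuous_on (ball 0 1) (\<lambda>s. Z s b)"
    using continuous_on_vec_lambda[of "ball 0 1" "\<lambda>i s. Z s b $ i"] nice_continuous[OF nice_Z b] by simp
  ultimately show ?thesis unfolding F_def[abs_def] by (rule continuous_on_Pair)
qed

lemma dFull_linear: "linear (\<lambda>s. dFull (L1 s) (L2 s))"
  using F_deriv has_derivative_linear by blast

end

section \<open>A multiplier for energy and endpoint\<close>

context controlled
begin

text \<open>Linearity is inherited: the combination is the derivative of a two-parameter family of
  curves in the direction \<open>(r, s)\<close>, and derivatives are linear.\<close>

lemma dFull_combination:
  assumes "bm a b \<xi>1" "bm a b \<xi>2" "bm a b \<eta>1" "bm a b \<eta>2"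
  shows "dFull (\<lambda>t. r * \<xi>1 t + s * \<eta>1 t) (\<lambda>t. r * \<xi>2 t + s * \<eta>2 t) = r *\<^sub>R dFull \<xi>1 \<xi>2 + s *\<^sub>R dFull \<eta>1 \<eta>2"
proof -
  obtain M1 M2 M3 M4 where M: "\<And>t. t \<in> {a..b} \<Longrightarrow> \<bar>\<xi>1 t\<bar> \<le> M1" "\<And>t. t \<in> {a..b} \<Longrightarrow> \<bar>\<xi>2 t\<bar> \<le> M2"
    "\<And>t. t \<in> {a..b} \<Longrightarrow> \<bar>\<eta>1 t\<bar> \<le> M3" "\<And>t. t \<in> {a..b} \<Longrightarrow> \<bar>\<eta>2 t\<bar> \<le> M4"
    using assms unfolding bm_def by metis
  define N where "N = \<bar>M1\<bar> + \<bar>M2\<bar> + \<bar>M3\<bar> + \<bar>M4\<bar>"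
  have bd: "\<bar>fst s * f t + snd s * h t\<bar> \<le> N * norm s"
    if "\<bar>f t\<bar> \<le> Mf" "\<bar>h t\<bar> \<le> Mh" "\<bar>Mf\<bar> + \<bar>Mh\<bar> \<le> N" for s :: "real \<times> real" and f h :: "real \<Rightarrow> real" and t Mf Mh
  proof -
    have "\<bar>fst s * f t\<bar> \<le> norm s * \<bar>Mf\<bar>" unfolding abs_mult using that norm_fst_le[of "fst s" "snd s"] by (intro mult_mono) auto
    moreover have "\<bar>snd s * h t\<bar> \<le> norm s * \<bar>Mh\<bar>" unfolding abs_mult using that norm_snd_le[of "snd s" "fst s"] by (intro mult_mono) auto
    ultimately have "\<bar>fst s * f t + snd s * h t\<bar> \<le> norm s * (\<bar>Mf\<bar> + \<bar>Mh\<bar>)" by (simp add: algebra_simps)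
    also have "\<dots> \<le> norm s * N" using that(3) by (intro mult_left_mono) auto
    finally show ?thesis by (simp add: mult.commute)
  qed
  interpret variation g A B C a b u1 u2 x "\<lambda>s t. fst s * \<xi>1 t + snd s * \<eta>1 t" "\<lambda>s t. fst s * \<xi>2 t + snd s * \<eta>2 t" N
  proof (intro variation.intro variation_axioms.intro)
    show "controlled g A B C a b u1 u2 x" by (rule controlled_axioms)
    show "bm a b (\<lambda>t. fst s * \<xi>1 t + snd s * \<eta>1 t)" "bm a b (\<lambda>t. fst s * \<xi>2 t + snd s * \<eta>2 t)" for s :: "real \<times> real"
      by (intro bm_intros assms)+
    show "linear (\<lambda>s. fst s * \<xi>1 t + snd s * \<eta>1 t)" "linear (\<lambda>s. fst s * \<xi>2 t + snd s * \<eta>2 t)" for t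
      by (simp_all add: linear_iff algebra_simps)
    fix s :: "real \<times> real" and t assume t: "t \<in> {a..b}"
    show "\<bar>fst s * \<xi>1 t + snd s * \<eta>1 t\<bar> \<le> N * norm s"
      by (rule bd[where f=\<xi>1 and h=\<eta>1 and t=t, OF M(1)[OF t] M(3)[OF t]]) (simp add: N_def)
    show "\<bar>fst s * \<xi>2 t + snd s * \<eta>2 t\<bar> \<le> N * norm s"
      by (rule bd[where f=\<xi>2 and h=\<eta>2 and t=t, OF M(2)[OF t] M(4)[OF t]]) (simp add: N_def)
  qed
  have eq: "(r, s) = r *\<^sub>R (1, 0) + s *\<^sub>R (0, 1)" by simp
  show ?thesis
    using linear_add[OF dFull_linear, of "r *\<^sub>R (1, 0)" "s *\<^sub>R (0, 1)"] linear_scale[OF dFull_linear, of r "(1,0)"]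
      linear_scale[OF dFull_linear, of s "(0,1)"] by (simp add: scaleR_prod_def)
qed

text \<open>Were the differential onto, the endpoint could be kept while the energy is lowered. So
  its image is a proper subspace of the five-dimensional space of energy and endpoint, and a normal
  vector to it is the multiplier.\<close>

lemma multiplier_exists:
  assumes minimal: "\<And>w1 w2 z. ctl a b w1 w2 z \<Longrightarrow> z a = x a \<Longrightarrow> z b = x b \<Longrightarrow>
     integral {a..b} (\<lambda>t. q (x t) (u1 t) (u2 t) / 2) \<le> integral {a..b} (\<lambda>t. q (z t) (w1 t) (w2 t) / 2)"
  obtains l0 and l :: "real^4" where "(l0, l) \<noteq> 0"
    "\<And>\<xi>1 \<xi>2. bm a b \<xi>1 \<Longrightarrow> bm a b \<xi>2 \<Longrightarrow> l0 * dE \<xi>1 \<xi>2 + (\<Sum>k\<in>UNIV. l $ k * Yv \<xi>1 \<xi>2 b $ k) = 0"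
proof -
  define V where "V = {dFull \<xi>1 \<xi>2 | \<xi>1 \<xi>2. bm a b \<xi>1 \<and> bm a b \<xi>2}"
  have VI: "dFull \<xi>1 \<xi>2 \<in> V" if "bm a b \<xi>1" "bm a b \<xi>2" for \<xi>1 \<xi>2
    unfolding V_def using that by (intro CollectI exI[of _ \<xi>1] exI[of _ \<xi>2]) simp
  have VE: "\<exists>\<xi>1 \<xi>2. (bm a b \<xi>1 \<and> bm a b \<xi>2) \<and> v = dFull \<xi>1 \<xi>2" if "v \<in> V" for v
    using that unfolding V_def by (elim CollectE exE conjE) (intro exI conjI)
  have sub: "subspace V"
    unfolding subspace_def
  proof (intro conjI ballI allI)
    have "dFull (\<lambda>t. 0) (\<lambda>t. 0) = 0"
      using dFull_combination[of "\<lambda>t. 0" "\<lambda>t. 0" "\<lambda>t. 0" "\<lambda>t. 0" 0 0] by simp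
    then show "0 \<in> V" using VI[OF bm_const bm_const, of 0 0] by simp
  next
    fix v w assume "v \<in> V" "w \<in> V"
    then obtain \<xi>1 \<xi>2 \<eta>1 \<eta>2 where vw: "bm a b \<xi>1" "bm a b \<xi>2" "bm a b \<eta>1" "bm a b \<eta>2" "v = dFull \<xi>1 \<xi>2" "w = dFull \<eta>1 \<eta>2"
      using VE[of v] VE[of w] by blast
    have "v + w = dFull (\<lambda>t. 1 * \<xi>1 t + 1 * \<eta>1 t) (\<lambda>t. 1 * \<xi>2 t + 1 * \<eta>2 t)"
      using dFull_combination[OF vw(1-4), of 1 1] vw(5,6) by simp
    moreover have "bm a b (\<lambda>t. 1 * \<xi>1 t + 1 * \<eta>1 t)" "bm a b (\<lambda>t. 1 * \<xi>2 t + 1 * \<eta>2 t)" by (intro bm_intros vw)+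
    ultimately show "v + w \<in> V" using VI by presburger
  next
    fix c :: real and v assume "v \<in> V"
    then obtain \<xi>1 \<xi>2 where v: "bm a b \<xi>1" "bm a b \<xi>2" "v = dFull \<xi>1 \<xi>2"
      using VE[of v] by blast
    have "c *\<^sub>R v = dFull (\<lambda>t. c * \<xi>1 t + 0 * \<xi>1 t) (\<lambda>t. c * \<xi>2 t + 0 * \<xi>2 t)"
      using dFull_combination[OF v(1,2) v(1,2), of c 0] v(3) by simp
    moreover have "bm a b (\<lambda>t. c * \<xi>1 t + 0 * \<xi>1 t)" "bm a b (\<lambda>t. c * \<xi>2 t + 0 * \<xi>2 t)" by (intro bm_intros v)+
    ultimately show "c *\<^sub>R v \<in> V" using VI by presburger
  qed
  have "V \<noteq> UNIV"
  proof
    assume "V = UNIV"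
    have "\<exists>\<xi>1 \<xi>2. (bm a b \<xi>1 \<and> bm a b \<xi>2) \<and> e = dFull \<xi>1 \<xi>2" for e
      by (rule VE) (simp add: \<open>V = UNIV\<close>)
    then obtain \<xi>1 \<xi>2 where xi: "\<And>e. bm a b (\<xi>1 e)" "\<And>e. bm a b (\<xi>2 e)" "\<And>e. dFull (\<xi>1 e) (\<xi>2 e) = e" by metis
    \<comment> \<open>One variation for each basis vector of the target, superposed linearly: the
      parameter space is the target itself and the derivative becomes the identity.\<close>
    define Lf where "Lf \<zeta> s t = (\<Sum>e\<in>Basis. (s \<bullet> e) * \<zeta> e t)" for \<zeta> :: "real \<times> (real^4) \<Rightarrow> real \<Rightarrow> real" and s t
    have Lbound: "\<exists>N\<ge>0. \<forall>s. \<forall>t\<in>{a..b}. \<bar>Lf \<zeta> s t\<bar> \<le> N * norm s" if z: "\<And>e. bm a b (\<zeta> e)" for \<zeta>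
    proof -
      have "\<exists>M. M > 0 \<and> (\<forall>t\<in>{a..b}. \<bar>\<zeta> e t\<bar> \<le> M)" for e using bm_bounded[OF z] by metis
      then obtain M where M: "\<And>e. M e > 0" "\<And>e t. t \<in> {a..b} \<Longrightarrow> \<bar>\<zeta> e t\<bar> \<le> M e" by metis
      show ?thesis
      proof (intro exI[of _ "\<Sum>e\<in>Basis. M e"] conjI allI ballI)
        show "0 \<le> (\<Sum>e\<in>Basis. M e)" by (rule sum_nonneg) (use M(1) less_imp_le in blast)
        fix s :: "real \<times> (real^4)" and t assume t: "t \<in> {a..b}"
        have "\<bar>Lf \<zeta> s t\<bar> \<le> (\<Sum>e\<in>Basis. norm s * M e)"
          unfolding Lf_def
        proof (rule order_trans[OF sum_abs sum_mono])
          fix e :: "real \<times> (real^4)" assume "e \<in> Basis"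
          then show "\<bar>(s \<bullet> e) * \<zeta> e t\<bar> \<le> norm s * M e"
            unfolding abs_mult using M(2)[OF t, of e] by (intro mult_mono) (auto intro: Basis_le_norm)
        qed
        then show "\<bar>Lf \<zeta> s t\<bar> \<le> (\<Sum>e\<in>Basis. M e) * norm s" by (simp add: sum_distrib_left mult.commute)
      qed
    qed
    obtain N1 where N1: "N1 \<ge> 0" "\<forall>s. \<forall>t\<in>{a..b}. \<bar>Lf \<xi>1 s t\<bar> \<le> N1 * norm s" using Lbound[of \<xi>1] xi(1) by blast
    obtain N2 where N2: "N2 \<ge> 0" "\<forall>s. \<forall>t\<in>{a..b}. \<bar>Lf \<xi>2 s t\<bar> \<le> N2 * norm s" using Lbound[of \<xi>2] xi(2) by blast
    have Llin: "linear (\<lambda>s. Lf \<zeta> s t)" for \<zeta> t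
      unfolding Lf_def by (simp add: linear_iff inner_add_left algebra_simps sum.distrib sum_distrib_left)
    interpret variation g A B C a b u1 u2 x "Lf \<xi>1" "Lf \<xi>2" "N1 + N2"
    proof (intro variation.intro variation_axioms.intro)
      show "controlled g A B C a b u1 u2 x" by (rule controlled_axioms)
      show "bm a b (Lf \<xi>1 s)" "bm a b (Lf \<xi>2 s)" for s unfolding Lf_def[abs_def] by (intro bm_intros xi)+
      show "linear (\<lambda>s. Lf \<xi>1 s t)" "linear (\<lambda>s. Lf \<xi>2 s t)" for t by (rule Llin)+
      fix s :: "real \<times> (real^4)" and t assume t: "t \<in> {a..b}"
      have "N1 * norm s \<le> (N1 + N2) * norm s" "N2 * norm s \<le> (N1 + N2) * norm s" using N1(1) N2(1) by (auto intro: mult_right_mono)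
      then show "\<bar>Lf \<xi>1 s t\<bar> \<le> (N1 + N2) * norm s" "\<bar>Lf \<xi>2 s t\<bar> \<le> (N1 + N2) * norm s"
        using N1(2) N2(2) t by (meson order_trans)+
    qed
    have Lb: "Lf \<zeta> e = \<zeta> e" if e: "e \<in> Basis" for \<zeta> e
    proof (rule ext)
      fix t
      have "Lf \<zeta> e t = (\<Sum>e'\<in>Basis. (if e' = e then \<zeta> e' t else 0))"
        unfolding Lf_def by (rule sum.cong) (use e in \<open>auto simp: inner_Basis\<close>)
      then show "Lf \<zeta> e t = \<zeta> e t" using e by simp
    qed
    have id: "(\<lambda>s. dFull (Lf \<xi>1 s) (Lf \<xi>2 s)) = id"
    proof (rule linear_eq_stdbasis[OF dFull_linear])
      show "linear id" by (rule linear_id)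
      show "dFull (Lf \<xi>1 e) (Lf \<xi>2 e) = id e" if "e \<in> Basis" for e using that Lb xi(3) by simp
    qed
    \<comment> \<open>This open mapping theorem takes continuity near 0 and differentiability at 0
      only, which is what \<open>nice\<close> provides.\<close>
    have "F 0 \<in> interior (F ` ball 0 1)"
    proof (rule sussmann_open_mapping[OF open_ball F_cont])
      show "(F has_derivative id) (at 0)" using F_deriv id by simp
      show "bounded_linear (id :: real \<times> (real^4) \<Rightarrow> _)" by (simp add: bounded_linear_ident id_def)
    qed auto
    then obtain e where e: "e > 0" "ball (F 0) e \<subseteq> F ` ball 0 1"
      unfolding mem_interior by blast
    \<comment> \<open>The forbidden target: the same endpoint with strictly smaller energy.\<close>
    have "F 0 - (e/2, 0) \<in> ball (F 0) e" using e(1) by (simp add: dist_norm norm_Pair)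
    then have "F 0 - (e/2, 0) \<in> F ` ball 0 1" using e(2) by (rule rev_subsetD)
    then obtain s where s: "F 0 - (e/2, 0) = F s" by (rule imageE)
    then have Zs: "Z s b = x b" "En s = En 0 - e/2" using Z_0[of b] ab s unfolding F_def by auto
    have "En 0 = integral {a..b} (\<lambda>t. q (x t) (u1 t) (u2 t) / 2)"
      unfolding En_def by (rule integral_cong) (simp add: Z_0 w0)
    also have "\<dots> \<le> En s" unfolding En_def by (rule minimal[OF Z_ctl Z_a Zs(1)])
    finally show False using Zs(2) e(1) by simp
  qed
  then have "span V \<noteq> UNIV" by (metis span_eq_iff sub)
  then obtain l where l: "l \<noteq> 0" "\<And>v. v \<in> span V \<Longrightarrow> l \<bullet> v = 0" using span_not_UNIV_orthogonal by blast
  show ?thesis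
  proof (rule that[of "fst l" "snd l"])
    show "(fst l, snd l) \<noteq> 0" using l(1) by simp
    fix \<xi>1 \<xi>2 assume "bm a b \<xi>1" "bm a b \<xi>2"
    then have "dFull \<xi>1 \<xi>2 \<in> span V" by (intro span_base VI)
    from l(2)[OF this] show "fst l * dE \<xi>1 \<xi>2 + (\<Sum>k\<in>UNIV. snd l $ k * Yv \<xi>1 \<xi>2 b $ k) = 0"
      unfolding dFull_def inner_prod_def by (simp add: inner_vec_def)
  qed
qed

end

section \<open>Costates and the pointwise extremality equations\<close>

context controlled
begin

lemma costate_exists:
  assumes "bm a b f" obtains P where "prim a b P (\<lambda>t. - f t)" "P b = l"
proof -
  define P where "P t = (l - integral {a..b} (\<lambda>t. - f t)) + integral {a..t} (\<lambda>t. - f t)" for t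
  have "prim a b P (\<lambda>t. - f t)" by (rule primI_integral[OF bm_minus[OF assms]]) (simp add: P_def)
  moreover have "P b = l" by (simp add: P_def)
  ultimately show ?thesis using that by blast
qed

text \<open>The adjoint system is triangular in the opposite order, so \<open>p4\<close>,
  \<open>p3\<close>, \<open>p2\<close>, \<open>p1\<close> are integrated one after another from
  their terminal values. The stationarity equations follow by testing the multiplier against their
  own left-hand sides used as control variations.\<close>

lemma pontryagin:
  assumes minimal: "\<And>w1 w2 z. ctl a b w1 w2 z \<Longrightarrow> z a = x a \<Longrightarrow> z b = x b \<Longrightarrow>
     integral {a..b} (\<lambda>t. q (x t) (u1 t) (u2 t) / 2) \<le> integral {a..b} (\<lambda>t. q (z t) (w1 t) (w2 t) / 2)"
  obtains l0 p1 p2 p3 p4 where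
    "prim a b p1 (\<lambda>t. - (l0 * qd 1 t - 2 * p3 t * u2 t))"
    "prim a b p2 (\<lambda>t. - (l0 * qd 2 t + 2 * p3 t * u1 t))"
    "prim a b p3 (\<lambda>t. - (l0 * qd 3 t + 2 * p4 t * x t $ 3 * u1 t))"
    "prim a b p4 (\<lambda>t. - (l0 * qd 4 t))"
    "ae a b (\<lambda>t. l0 * m1 t + p1 t + 2 * x t $ 2 * p3 t + (x t $ 3)\<^sup>2 * p4 t = 0)"
    "ae a b (\<lambda>t. l0 * m2 t + p2 t - 2 * x t $ 1 * p3 t = 0)"
    "l0 \<noteq> 0 \<or> p1 b \<noteq> 0 \<or> p2 b \<noteq> 0 \<or> p3 b \<noteq> 0 \<or> p4 b \<noteq> 0"
proof -
  obtain l0 and l :: "real^4" where l: "(l0, l) \<noteq> 0"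
    "\<And>\<xi>1 \<xi>2. bm a b \<xi>1 \<Longrightarrow> bm a b \<xi>2 \<Longrightarrow> l0 * dE \<xi>1 \<xi>2 + (\<Sum>k\<in>UNIV. l $ k * Yv \<xi>1 \<xi>2 b $ k) = 0"
    using multiplier_exists[OF minimal] by blast
  note bms = bm_intros x_bm u_bm qd_bm m_bm
  have "bm a b (\<lambda>t. l0 * qd 4 t)" by (intro bms)
  from costate_exists[OF this] obtain p4 where p4: "prim a b p4 (\<lambda>t. - (l0 * qd 4 t))" "p4 b = l $ 4" by blast
  have b4: "bm a b p4" by (rule bm_cont[OF prim_cont[OF p4(1)]])
  have "bm a b (\<lambda>t. l0 * qd 3 t + 2 * p4 t * x t $ 3 * u1 t)" by (intro bms b4)
  from costate_exists[OF this] obtain p3 where p3: "prim a b p3 (\<lambda>t. - (l0 * qd 3 t + 2 * p4 t * x t $ 3 * u1 t))" "p3 b = l $ 3" by blast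
  have b3: "bm a b p3" by (rule bm_cont[OF prim_cont[OF p3(1)]])
  have "bm a b (\<lambda>t. l0 * qd 2 t + 2 * p3 t * u1 t)" by (intro bms b3)
  from costate_exists[OF this] obtain p2 where p2: "prim a b p2 (\<lambda>t. - (l0 * qd 2 t + 2 * p3 t * u1 t))" "p2 b = l $ 2" by blast
  have b2: "bm a b p2" by (rule bm_cont[OF prim_cont[OF p2(1)]])
  have "bm a b (\<lambda>t. l0 * qd 1 t - 2 * p3 t * u2 t)" by (intro bms b3)
  from costate_exists[OF this] obtain p1 where p1: "prim a b p1 (\<lambda>t. - (l0 * qd 1 t - 2 * p3 t * u2 t))" "p1 b = l $ 1" by blast
  have b1: "bm a b p1" by (rule bm_cont[OF prim_cont[OF p1(1)]])
  \<comment> \<open>\<open>K1\<close> and \<open>K2\<close> are the derivatives in the controls of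
    the Hamiltonian, that is, of \<open>l0\<close> times half of \<open>q\<close> plus the costate
    applied to the velocity.\<close>
  define K1 where "K1 t = l0 * m1 t + p1 t + 2 * x t $ 2 * p3 t + (x t $ 3)\<^sup>2 * p4 t" for t
  define K2 where "K2 t = l0 * m2 t + p2 t - 2 * x t $ 1 * p3 t" for t
  have bK: "bm a b K1" "bm a b K2" unfolding K1_def[abs_def] K2_def[abs_def] by (intro bms b1 b2 b3 b4)+
  note Y = Y_prim[OF bK] Y_prim(1)[OF bK(2) bK(1)]
  \<comment> \<open>The pairing of costate and linearized curve. It vanishes at \<open>a\<close>,
    and at \<open>b\<close> it is the endpoint part of the multiplier identity.\<close>
  define W where "W t = p1 t * Y1 K1 t + (p2 t * Y1 K2 t + (p3 t * Y3 K1 K2 t + p4 t * Y4 K1 K2 t))" for t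
  define W' where "W' t = (- (l0 * qd 1 t - 2 * p3 t * u2 t) * Y1 K1 t + p1 t * K1 t) +
     ((- (l0 * qd 2 t + 2 * p3 t * u1 t) * Y1 K2 t + p2 t * K2 t) +
     ((- (l0 * qd 3 t + 2 * p4 t * x t $ 3 * u1 t) * Y3 K1 K2 t +
       p3 t * (2 * (Y1 K2 t * u1 t + x t $ 2 * K1 t) - 2 * (Y1 K1 t * u2 t + x t $ 1 * K2 t))) +
      (- (l0 * qd 4 t) * Y4 K1 K2 t + p4 t * (2 * x t $ 3 * Y3 K1 K2 t * u1 t + (x t $ 3)\<^sup>2 * K1 t))))" for t
  have pW: "prim a b W W'"
    unfolding W_def[abs_def] W'_def[abs_def]
    by (intro prim_add prim_mult p1(1) p2(1) p3(1) p4(1) Y)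
  have Y0: "Y1 K1 a = 0" "Y1 K2 a = 0" "Y3 K1 K2 a = 0" "Y4 K1 K2 a = 0"
    unfolding Y1_def Y3_def Y4_def by simp_all
  have Wb: "(\<Sum>k\<in>UNIV. l $ k * Yv K1 K2 b $ k) = integral {a..b} W'"
    using prim_integral[OF pW order_refl ab order_refl] Y0 p1(2) p2(2) p3(2) p4(2)
    unfolding sum_4 Yv_def vector4_nth W_def by simp
  have bY: "bm a b (\<lambda>t. Yv K1 K2 t $ k)" for k
  proof -
    have "\<forall>k. bm a b (\<lambda>t. Yv K1 K2 t $ k)" unfolding forall_4 Yv_def vector4_nth
      using Y[THEN prim_cont, THEN bm_cont] by blast
    then show ?thesis by blast
  qed
  have bE: "bm a b (\<lambda>t. l0 * ((\<Sum>k\<in>UNIV. qd k t * Yv K1 K2 t $ k) + m1 t * K1 t + m2 t * K2 t))"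
    by (intro bms bY bK)
  \<comment> \<open>By the choice of the costates all terms with a linearized coordinate cancel, so
    the sum of squares is the energy variation plus the derivative of \<open>W\<close>.\<close>
  have "integral {a..b} (\<lambda>t. K1 t * K1 t + K2 t * K2 t) =
    integral {a..b} (\<lambda>t. l0 * ((\<Sum>k\<in>UNIV. qd k t * Yv K1 K2 t $ k) + m1 t * K1 t + m2 t * K2 t) + W' t)"
  proof (rule integral_cong)
    fix t
    have "K1 t * K1 t + K2 t * K2 t = (l0 * m1 t + p1 t + 2 * x t $ 2 * p3 t + (x t $ 3)\<^sup>2 * p4 t) * K1 t
       + (l0 * m2 t + p2 t - 2 * x t $ 1 * p3 t) * K2 t" unfolding K1_def K2_def by simp
    then show "K1 t * K1 t + K2 t * K2 t = l0 * ((\<Sum>k\<in>UNIV. qd k t * Yv K1 K2 t $ k) + m1 t * K1 t + m2 t * K2 t) + W' t"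
      unfolding sum_4 Yv_def vector4_nth W'_def by (simp add: algebra_simps)
  qed
  also have "\<dots> = l0 * dE K1 K2 + integral {a..b} W'"
    unfolding dE_def using bm_integral_add[OF bE prim_bm[OF pW], of b] ab by simp
  also have "\<dots> = 0" using l(2)[OF bK] Wb by simp
  finally have "integral {a..b} (\<lambda>t. K1 t * K1 t + K2 t * K2 t) = 0" .
  then have K0: "ae a b (\<lambda>t. K1 t * K1 t + K2 t * K2 t = 0)"
    by (intro integral_nonneg_ae_0 bm_intros bK) auto
  show ?thesis
  proof (rule that[OF p1(1) p2(1) p3(1) p4(1)])
    show "ae a b (\<lambda>t. l0 * m1 t + p1 t + 2 * x t $ 2 * p3 t + (x t $ 3)\<^sup>2 * p4 t = 0)"
      by (rule ae_mono[OF K0]) (simp add: sum_squares_eq_zero_iff K1_def)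
    show "ae a b (\<lambda>t. l0 * m2 t + p2 t - 2 * x t $ 1 * p3 t = 0)"
      by (rule ae_mono[OF K0]) (simp add: sum_squares_eq_zero_iff K2_def)
    show "l0 \<noteq> 0 \<or> p1 b \<noteq> 0 \<or> p2 b \<noteq> 0 \<or> p3 b \<noteq> 0 \<or> p4 b \<noteq> 0"
      using l(1) unfolding p1(2) p2(2) p3(2) p4(2) by (auto simp: vec4_eq_iff zero_prod_def)
  qed
qed

end

section \<open>Smoothness by algebras closed under differentiation\<close>

text \<open>Bootstrapping without counting derivatives: if the derivatives of the generators lie in
  the algebra they generate, the whole algebra is closed under differentiation and consists of
  smooth functions.\<close>

inductive_set alg :: "(real \<Rightarrow> real) set \<Rightarrow> (real \<Rightarrow> real) set" for G where
  alg_const: "(\<lambda>t. c) \<in> alg G"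
| alg_gen: "f \<in> G \<Longrightarrow> f \<in> alg G"
| alg_add: "f \<in> alg G \<Longrightarrow> h \<in> alg G \<Longrightarrow> (\<lambda>t. f t + h t) \<in> alg G"
| alg_mult: "f \<in> alg G \<Longrightarrow> h \<in> alg G \<Longrightarrow> (\<lambda>t. f t * h t) \<in> alg G"

lemma alg_minus: "f \<in> alg G \<Longrightarrow> (\<lambda>t. - f t) \<in> alg G"
  using alg_mult[OF alg_const[of "-1" G]] by simp

lemma alg_diff: "f \<in> alg G \<Longrightarrow> h \<in> alg G \<Longrightarrow> (\<lambda>t. f t - h t) \<in> alg G"
  using alg_add[OF _ alg_minus] by simp

lemma alg_power: "f \<in> alg G \<Longrightarrow> (\<lambda>t. f t ^ n) \<in> alg G"
  by (induction n) (auto intro: alg_const alg_mult)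

lemma alg_divide_const: "f \<in> alg G \<Longrightarrow> (\<lambda>t. f t / c) \<in> alg G"
  using alg_mult[OF alg_const[of "1/c" G]] by simp

lemma alg_sum4: "(\<And>i::4. f i \<in> alg G) \<Longrightarrow> (\<lambda>t. \<Sum>i\<in>UNIV. f i t) \<in> alg G"
  unfolding sum_4 by (intro alg_add)

lemmas alg_closed = alg_const alg_add alg_mult alg_minus alg_diff alg_power alg_divide_const

lemma alg_mono: "f \<in> alg G \<Longrightarrow> G \<subseteq> H \<Longrightarrow> f \<in> alg H"
  by (induction rule: alg.induct) (auto intro: alg.intros)

text \<open>The Leibniz rule. Two generating sets are kept apart because the derivatives may involve
  an auxiliary generator of \<open>H\<close> whose own differentiability is not yet known.\<close>

lemma alg_prim:
  assumes G: "\<And>g. g \<in> G \<Longrightarrow> \<exists>k k'. prim a b g k \<and> k' \<in> alg H \<and> ae a b (\<lambda>t. k t = k' t)" and GH: "G \<subseteq> H"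
    and f: "f \<in> alg G"
  shows "\<exists>k k'. prim a b f k \<and> k' \<in> alg H \<and> ae a b (\<lambda>t. k t = k' t)"
  using f
proof (induction rule: alg.induct)
  case (alg_const c)
  then show ?case using prim_const alg.alg_const[of 0 H] by (blast intro: ae_all)
next
  case (alg_gen f)
  then show ?case using G by blast
next
  case (alg_add f h)
  then obtain k1 k1' k2 k2' where k: "prim a b f k1" "k1' \<in> alg H" "ae a b (\<lambda>t. k1 t = k1' t)"
    "prim a b h k2" "k2' \<in> alg H" "ae a b (\<lambda>t. k2 t = k2' t)" by blast
  have "ae a b (\<lambda>t. k1 t + k2 t = k1' t + k2' t)" by (rule ae_mono2[OF k(3,6)]) simp
  then show ?case using prim_add[OF k(1,4)] alg.alg_add[OF k(2,5)] by blast
next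
  case (alg_mult f h)
  then obtain k1 k1' k2 k2' where k: "prim a b f k1" "k1' \<in> alg H" "ae a b (\<lambda>t. k1 t = k1' t)"
    "prim a b h k2" "k2' \<in> alg H" "ae a b (\<lambda>t. k2 t = k2' t)" by blast
  have "ae a b (\<lambda>t. k1 t * h t + f t * k2 t = k1' t * h t + f t * k2' t)" by (rule ae_mono2[OF k(3,6)]) simp
  moreover have "(\<lambda>t. k1' t * h t + f t * k2' t) \<in> alg H"
    by (intro alg.alg_add alg.alg_mult k alg_mono[OF alg_mult(1) GH] alg_mono[OF alg_mult(2) GH])
  ultimately show ?case using prim_mult[OF k(1,4)] by blast
qed

text \<open>An almost everywhere derivative with a continuous representative is a derivative
  everywhere, one-sided at the ends, since the function is the integral of that
  representative.\<close>

lemma prim_cont_deriv: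
  assumes p: "prim a b F f" and e: "ae a b (\<lambda>t. f t = f' t)" and c: "continuous_on {a..b} f'" and t: "t \<in> {a..b}"
  shows "(F has_real_derivative f' t) (at t within {a..b})"
proof -
  have F: "F s = F a + integral {a..s} f'" if "s \<in> {a..b}" for s
  proof -
    have "integral {a..s} f = integral {a..s} f'"
      by (rule ae_integral_cong, rule ae_subset[OF e]) (use that in auto)
    then show ?thesis using prim_integral[OF p, of a s] that by auto
  qed
  have "((\<lambda>s. integral {a..s} f') has_real_derivative f' t) (at t within {a..b})"
    by (rule integral_has_real_derivative[OF c t])
  then have "((\<lambda>s. F a + integral {a..s} f') has_real_derivative f' t) (at t within {a..b})"
    using DERIV_add[OF DERIV_const[of "F a"]] by simp
  then show ?thesis
    by (rule has_field_derivative_transform_within[OF _ zero_less_one t]) (erule F[symmetric])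
qed

text \<open>A coinductive form of smoothness: membership in some family that is closed under taking
  derivatives.\<close>

definition smooth1 :: "real \<Rightarrow> real \<Rightarrow> (real \<Rightarrow> real) \<Rightarrow> bool" where
  "smooth1 a b f \<longleftrightarrow> (\<exists>S. f \<in> S \<and> (\<forall>h\<in>S. \<exists>h'\<in>S. \<forall>t\<in>{a..b}. (h has_real_derivative h' t) (at t within {a..b})))"

lemma alg_smooth:
  assumes G: "\<And>g. g \<in> G \<Longrightarrow> \<exists>k k'. prim a b g k \<and> k' \<in> alg G \<and> ae a b (\<lambda>t. k t = k' t)"
    and f: "f \<in> alg G"
  shows "smooth1 a b f"
  unfolding smooth1_def
proof (intro exI[of _ "alg G"] conjI ballI f)
  fix h assume h: "h \<in> alg G"
  have P: "\<exists>k k'. prim a b h k \<and> k' \<in> alg G \<and> ae a b (\<lambda>t. k t = k' t)" if "h \<in> alg G" for h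
    using alg_prim[OF G subset_refl that] .
  obtain k k' where k: "prim a b h k" "k' \<in> alg G" "ae a b (\<lambda>t. k t = k' t)" using P[OF h] by blast
  \<comment> \<open>\<open>k'\<close> lies in the algebra again, so it is itself a Lipschitz
    primitive and in particular continuous.\<close>
  have "continuous_on {a..b} k'" using P[OF k(2)] prim_cont by blast
  then show "\<exists>h'\<in>alg G. \<forall>t\<in>{a..b}. (h has_real_derivative h' t) (at t within {a..b})"
    using prim_cont_deriv[OF k(1) k(3)] k(2) by blast
qed

lemma smooth_curve_onI:
  assumes "\<And>i. smooth1 a b (\<lambda>t. \<gamma> t $ i)" shows "smooth_curve_on {a..b} \<gamma>"
proof -
  have "\<exists>D. D 0 = f \<and> (\<forall>k. \<forall>t\<in>{a..b}. (D k has_real_derivative D (Suc k) t) (at t within {a..b}))"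
    if "smooth1 a b f" for f
  proof -
    obtain S where S: "f \<in> S" "\<forall>h\<in>S. \<exists>h'\<in>S. \<forall>t\<in>{a..b}. (h has_real_derivative h' t) (at t within {a..b})"
      using \<open>smooth1 a b f\<close> unfolding smooth1_def by blast
    obtain d where d: "\<And>h. h \<in> S \<Longrightarrow> d h \<in> S" "\<And>h t. h \<in> S \<Longrightarrow> t \<in> {a..b} \<Longrightarrow> (h has_real_derivative d h t) (at t within {a..b})"
      using S(2) by metis
    have "(d ^^ k) f \<in> S" for k by (induction k) (use S(1) d(1) in auto)
    then show ?thesis using d(2) by (intro exI[of _ "\<lambda>k. (d ^^ k) f"]) auto
  qed
  then have "\<exists>D. D 0 = (\<lambda>t. \<gamma> t $ i) \<and> (\<forall>k. \<forall>t\<in>{a..b}. (D k has_real_derivative D (Suc k) t) (at t within {a..b}))" for i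
    using assms by blast
  then obtain D where D: "\<And>i. D i 0 = (\<lambda>t. \<gamma> t $ i)"
    "\<And>i k t. t \<in> {a..b} \<Longrightarrow> (D i k has_real_derivative D i (Suc k) t) (at t within {a..b})" by metis
  show ?thesis unfolding smooth_curve_on_def
    by (intro exI[of _ "\<lambda>k t. \<chi> i. D i k t"]) (use D in \<open>simp add: has_vector_derivative_iff_nth vec_eq_iff\<close>)
qed

lemma prim_comp_real:
  assumes F: "prim a b F f" and m: "\<And>t. t \<in> {a..b} \<Longrightarrow> F t \<in> {m..M}"
    and d: "\<And>y. y \<in> {m..M} \<Longrightarrow> (\<phi> has_real_derivative \<phi>' y) (at y)" and c: "continuous_on {m..M} \<phi>'"
  shows "prim a b (\<lambda>t. \<phi> (F t)) (\<lambda>t. \<phi>' (F t) * f t)"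
  unfolding prim_def
proof (intro conjI)
  have cF: "continuous_on {a..b} (\<lambda>t. \<phi>' (F t))"
    by (rule continuous_on_compose2[OF c prim_cont[OF F]]) (use m in auto)
  show "bm a b (\<lambda>t. \<phi>' (F t) * f t)" by (intro bm_mult bm_cont[OF cF] prim_bm[OF F])
  obtain K where K: "K > 0" "\<And>y. y \<in> {m..M} \<Longrightarrow> \<bar>\<phi>' y\<bar> \<le> K" using bm_bounded[OF bm_cont[OF c]] by blast
  obtain N where N: "N > 0" "\<forall>s\<in>{a..b}. \<forall>t\<in>{a..b}. \<bar>F s - F t\<bar> \<le> N * \<bar>s - t\<bar>" using prim_lip[OF F] by blast
  have "\<bar>\<phi> (F s) - \<phi> (F t)\<bar> \<le> (K * N) * \<bar>s - t\<bar>" if st: "s \<in> {a..b}" "t \<in> {a..b}" for s t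
  proof -
    have "norm (\<phi> (F s) - \<phi> (F t)) \<le> K * norm (F s - F t)"
      by (rule field_differentiable_bound[where f'=\<phi>' and S="{m..M}"])
        (use d K(2) m st in \<open>auto intro: has_field_derivative_at_within\<close>)
    also have "\<dots> \<le> K * (N * \<bar>s - t\<bar>)" using N(2) st K(1) by (intro mult_left_mono) auto
    finally show ?thesis by (simp add: mult.assoc)
  qed
  then show "lipr a b (\<lambda>t. \<phi> (F t))" unfolding lipr_def by blast
  have "ae a b (\<lambda>t. (F has_real_derivative f t) (at t))" using F unfolding prim_def by simp
  then show "ae a b (\<lambda>t. ((\<lambda>t. \<phi> (F t)) has_real_derivative \<phi>' (F t) * f t) (at t))"
  proof (rule ae_mono)
    fix t assume t: "t \<in> {a..b}" "(F has_real_derivative f t) (at t)"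
    have "(\<phi> has_real_derivative \<phi>' (F t)) (at (F t))" by (rule d[OF m[OF t(1)]])
    from DERIV_chain2[OF this t(2)] show "((\<lambda>t. \<phi> (F t)) has_real_derivative \<phi>' (F t) * f t) (at t)" .
  qed
qed

text \<open>The derivative is written as a polynomial in \<open>1 / sqrt (F t)\<close> times
  \<open>f t\<close>, so that adjoining this one function keeps an algebra closed under
  differentiation.\<close>

lemma prim_inverse_sqrt:
  assumes F: "prim a b F f" and p: "\<And>t. t \<in> {a..b} \<Longrightarrow> F t > 0"
  shows "prim a b (\<lambda>t. 1 / sqrt (F t)) (\<lambda>t. - (1/2) * (1 / sqrt (F t)) ^ 3 * f t)"
proof (cases "a \<le> b")
  case True
  obtain t0 where t0: "t0 \<in> {a..b}" "\<And>t. t \<in> {a..b} \<Longrightarrow> F t0 \<le> F t"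
    using continuous_attains_inf[OF compact_Icc _ prim_cont[OF F]] True by auto
  obtain M where M: "\<And>t. t \<in> {a..b} \<Longrightarrow> \<bar>F t\<bar> \<le> M" using prim_lip[OF F] by blast
  have p0: "F t0 > 0" by (rule p[OF t0(1)])
  show ?thesis
  proof (rule prim_comp_real[OF F, of "F t0" M "\<lambda>y. 1 / sqrt y" "\<lambda>y. - (1/2) * (1 / sqrt y) ^ 3"])
    show "F t \<in> {F t0..M}" if "t \<in> {a..b}" for t using t0(2)[OF that] M[OF that] by auto
    show "continuous_on {F t0..M} (\<lambda>y. - (1/2) * (1 / sqrt y) ^ 3)"
      using p0 by (intro continuous_intros) auto
    fix y assume y: "y \<in> {F t0..M}"
    then have y0: "y > 0" using p0 by auto
    have "sqrt y ^ 3 = sqrt y * y" using y0 by (simp add: power3_eq_cube)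
    then show "((\<lambda>y. 1 / sqrt y) has_real_derivative - (1/2) * (1 / sqrt y) ^ 3) (at y)"
      using y0 by (auto intro!: derivative_eq_intros simp: power_divide field_simps)
  qed
next
  case False
  then show ?thesis unfolding prim_def lipr_def ae_def by (auto intro: bm_cont)
qed

section \<open>Smoothness of normal extremals and of curves with a prescribed direction\<close>

context controlled
begin

definition coords :: "(real \<Rightarrow> real) set" where
  "coords = {\<lambda>t. x t $ i | i. True} \<union> {\<lambda>t. f (x t) | f. smooth_R4 f}"

lemma coords_nth: "(\<lambda>t. x t $ i) \<in> alg (coords \<union> H)" by (rule alg_gen) (auto simp: coords_def)
lemma coords_smooth: "smooth_R4 f \<Longrightarrow> (\<lambda>t. f (x t)) \<in> alg (coords \<union> H)" by (rule alg_gen) (auto simp: coords_def)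

lemma x_prim: "prim a b (\<lambda>t. x t $ i) (\<lambda>t. (u1 t *\<^sub>R X1 (x t) + u2 t *\<^sub>R X2 (x t)) $ i)"
proof -
  have "\<forall>i. prim a b (\<lambda>t. x t $ i) (\<lambda>t. (u1 t *\<^sub>R X1 (x t) + u2 t *\<^sub>R X2 (x t)) $ i)"
    unfolding forall_4 frame_nth using ctlD(2-5)[OF ctl] by blast
  then show ?thesis by blast
qed

lemma coords_prim:
  assumes U: "U1 \<in> alg (coords \<union> H)" "U2 \<in> alg (coords \<union> H)" "ae a b (\<lambda>t. u1 t = U1 t)" "ae a b (\<lambda>t. u2 t = U2 t)"
    and y: "y \<in> coords"
  shows "\<exists>k k'. prim a b y k \<and> k' \<in> alg (coords \<union> H) \<and> ae a b (\<lambda>t. k t = k' t)"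
proof -
  let ?v = "\<lambda>i t. (u1 t *\<^sub>R X1 (x t) + u2 t *\<^sub>R X2 (x t)) $ i"
  let ?V = "\<lambda>i t. (U1 t *\<^sub>R X1 (x t) + U2 t *\<^sub>R X2 (x t)) $ i"
  have V: "?V i \<in> alg (coords \<union> H)" for i
  proof -
    have "\<forall>i. ?V i \<in> alg (coords \<union> H)" unfolding forall_4 frame_nth
      by (intro conjI alg_closed U coords_nth)
    then show ?thesis by blast
  qed
  have e: "ae a b (\<lambda>t. u1 t = U1 t \<and> u2 t = U2 t)" by (rule ae_conj[OF U(3,4)])
  have vV: "ae a b (\<lambda>t. ?v i t = ?V i t)" for i by (rule ae_mono[OF e]) simp
  from y consider i where "y = (\<lambda>t. x t $ i)" | f where "y = (\<lambda>t. f (x t))" "smooth_R4 f" unfolding coords_def by blast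
  then show ?thesis
  proof cases
    case 1 then show ?thesis using x_prim V vV by blast
  next
    case 2
    have "(\<lambda>t. \<Sum>i\<in>UNIV. pd f i (x t) * ?V i t) \<in> alg (coords \<union> H)"
      by (intro alg_sum4 alg_mult V coords_smooth smooth_R4_pd(1) 2)
    moreover have "ae a b (\<lambda>t. (\<Sum>i\<in>UNIV. pd f i (x t) * ?v i t) = (\<Sum>i\<in>UNIV. pd f i (x t) * ?V i t))"
      by (rule ae_mono[OF e]) simp
    ultimately show ?thesis using prim_smooth_comp[OF 2(2) x_prim] unfolding 2(1) by blast
  qed
qed

text \<open>The velocity is polynomial in coordinates and controls. Once the controls agree almost
  everywhere with elements of the algebra, the coordinates and all smooth functions of them have
  derivatives in it.\<close>

lemma smooth_of_controls:
  assumes U: "U1 \<in> alg (coords \<union> H)" "U2 \<in> alg (coords \<union> H)" "ae a b (\<lambda>t. u1 t = U1 t)" "ae a b (\<lambda>t. u2 t = U2 t)"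
    and H: "\<And>h. h \<in> H \<Longrightarrow> \<exists>k k'. prim a b h k \<and> k' \<in> alg (coords \<union> H) \<and> ae a b (\<lambda>t. k t = k' t)"
  shows "smooth_curve_on {a..b} x"
proof (rule smooth_curve_onI)
  fix i
  show "smooth1 a b (\<lambda>t. x t $ i)"
    by (rule alg_smooth[of "coords \<union> H", OF _ coords_nth]) (use coords_prim[OF U] H in blast)
qed

lemma det_pos: "A y * C y - B y * B y > 0" using pos(2)[of y] by (simp add: power2_eq_square)

text \<open>For nonzero \<open>l0\<close> the extremality equations express \<open>m1\<close> and
  \<open>m2\<close> through position and costate, and the controls follow by Cramer's rule because
  the matrix of the metric is positive definite.\<close>

lemma normal_smooth:
  assumes p1: "prim a b p1 (\<lambda>t. - (l0 * qd 1 t - 2 * p3 t * u2 t))"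
    and p2: "prim a b p2 (\<lambda>t. - (l0 * qd 2 t + 2 * p3 t * u1 t))"
    and p3: "prim a b p3 (\<lambda>t. - (l0 * qd 3 t + 2 * p4 t * x t $ 3 * u1 t))"
    and p4: "prim a b p4 (\<lambda>t. - (l0 * qd 4 t))"
    and e1: "ae a b (\<lambda>t. l0 * m1 t + p1 t + 2 * x t $ 2 * p3 t + (x t $ 3)\<^sup>2 * p4 t = 0)"
    and e2: "ae a b (\<lambda>t. l0 * m2 t + p2 t - 2 * x t $ 1 * p3 t = 0)"
    and l0: "l0 \<noteq> 0"
  shows "smooth_curve_on {a..b} x"
proof -
  \<comment> \<open>The algebra has no division, so the reciprocal determinant is adjoined as a
    generator.\<close>
  define d where "d t = 1 / (A (x t) * C (x t) - B (x t) * B (x t))" for t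
  define H where "H = {p1, p2, p3, p4, d}"
  have h: "p1 \<in> alg (coords \<union> H)" "p2 \<in> alg (coords \<union> H)" "p3 \<in> alg (coords \<union> H)" "p4 \<in> alg (coords \<union> H)" "d \<in> alg (coords \<union> H)"
    by (auto simp: H_def intro: alg_gen)
  define r1 where "r1 t = - (p1 t + 2 * x t $ 2 * p3 t + (x t $ 3)\<^sup>2 * p4 t) / l0" for t
  define r2 where "r2 t = - (p2 t - 2 * x t $ 1 * p3 t) / l0" for t
  have r: "r1 \<in> alg (coords \<union> H)" "r2 \<in> alg (coords \<union> H)"
    unfolding r1_def[abs_def] r2_def[abs_def] by (intro alg_closed h coords_nth)+
  define U1 where "U1 t = (C (x t) * r1 t - B (x t) * r2 t) * d t" for t
  define U2 where "U2 t = (A (x t) * r2 t - B (x t) * r1 t) * d t" for t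
  have U: "U1 \<in> alg (coords \<union> H)" "U2 \<in> alg (coords \<union> H)"
    unfolding U1_def[abs_def] U2_def[abs_def] by (intro alg_closed h r coords_smooth smooth)+
  have "ae a b (\<lambda>t. u1 t = U1 t \<and> u2 t = U2 t)"
  proof (rule ae_mono2[OF e1 e2])
    fix t assume "l0 * m1 t + p1 t + 2 * x t $ 2 * p3 t + (x t $ 3)\<^sup>2 * p4 t = 0" "l0 * m2 t + p2 t - 2 * x t $ 1 * p3 t = 0"
    then have "m1 t = r1 t" "m2 t = r2 t" unfolding r1_def r2_def using l0 by (simp_all add: field_simps)
    then have r: "r1 t = A (x t) * u1 t + B (x t) * u2 t" "r2 t = B (x t) * u1 t + C (x t) * u2 t"
      unfolding m1_def m2_def by auto
    have "C (x t) * r1 t - B (x t) * r2 t = u1 t * (A (x t) * C (x t) - B (x t) * B (x t))"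
      "A (x t) * r2 t - B (x t) * r1 t = u2 t * (A (x t) * C (x t) - B (x t) * B (x t))"
      unfolding r by (simp_all add: algebra_simps)
    then show "u1 t = U1 t \<and> u2 t = U2 t" unfolding U1_def U2_def d_def using det_pos[of "x t"] by simp
  qed
  then have e: "ae a b (\<lambda>t. u1 t = U1 t)" "ae a b (\<lambda>t. u2 t = U2 t)" by (auto elim: ae_mono)
  define qD where "qD k t = (pd A k (x t) * (U1 t)\<^sup>2 + 2 * pd B k (x t) * U1 t * U2 t + pd C k (x t) * (U2 t)\<^sup>2) / 2" for k t
  have qD: "qD k \<in> alg (coords \<union> H)" for k
    unfolding qD_def[abs_def] by (intro alg_closed U coords_smooth smooth_R4_pd(1) smooth)
  have qe: "ae a b (\<lambda>t. qd k t = qD k t)" for k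
    by (rule ae_mono2[OF e]) (simp add: qd_def qD_def)
  show ?thesis
  proof (rule smooth_of_controls[OF U e])
    fix y assume "y \<in> H"
    then consider "y = p1" | "y = p2" | "y = p3" | "y = p4" | "y = d" unfolding H_def by blast
    then show "\<exists>k k'. prim a b y k \<and> k' \<in> alg (coords \<union> H) \<and> ae a b (\<lambda>t. k t = k' t)"
    proof cases
      case 1
      show ?thesis unfolding 1
      proof (intro exI conjI)
        show "prim a b p1 (\<lambda>t. - (l0 * qd 1 t - 2 * p3 t * u2 t))" by (rule p1)
        show "(\<lambda>t. - (l0 * qD 1 t - 2 * p3 t * U2 t)) \<in> alg (coords \<union> H)" by (intro alg_closed h qD U)
        show "ae a b (\<lambda>t. - (l0 * qd 1 t - 2 * p3 t * u2 t) = - (l0 * qD 1 t - 2 * p3 t * U2 t))"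
          by (rule ae_mono2[OF qe[of 1] e(2)]) simp
      qed
    next
      case 2
      show ?thesis unfolding 2
      proof (intro exI conjI)
        show "prim a b p2 (\<lambda>t. - (l0 * qd 2 t + 2 * p3 t * u1 t))" by (rule p2)
        show "(\<lambda>t. - (l0 * qD 2 t + 2 * p3 t * U1 t)) \<in> alg (coords \<union> H)" by (intro alg_closed h qD U)
        show "ae a b (\<lambda>t. - (l0 * qd 2 t + 2 * p3 t * u1 t) = - (l0 * qD 2 t + 2 * p3 t * U1 t))"
          by (rule ae_mono2[OF qe[of 2] e(1)]) simp
      qed
    next
      case 3
      show ?thesis unfolding 3
      proof (intro exI conjI)
        show "prim a b p3 (\<lambda>t. - (l0 * qd 3 t + 2 * p4 t * x t $ 3 * u1 t))" by (rule p3)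
        show "(\<lambda>t. - (l0 * qD 3 t + 2 * p4 t * x t $ 3 * U1 t)) \<in> alg (coords \<union> H)" by (intro alg_closed h qD U coords_nth)
        show "ae a b (\<lambda>t. - (l0 * qd 3 t + 2 * p4 t * x t $ 3 * u1 t) = - (l0 * qD 3 t + 2 * p4 t * x t $ 3 * U1 t))"
          by (rule ae_mono2[OF qe[of 3] e(1)]) simp
      qed
    next
      case 4
      show ?thesis unfolding 4
      proof (intro exI conjI)
        show "prim a b p4 (\<lambda>t. - (l0 * qd 4 t))" by (rule p4)
        show "(\<lambda>t. - (l0 * qD 4 t)) \<in> alg (coords \<union> H)" by (intro alg_closed h qD)
        show "ae a b (\<lambda>t. - (l0 * qd 4 t) = - (l0 * qD 4 t))" by (rule ae_mono[OF qe[of 4]]) simp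
      qed
    next
      case 5
      \<comment> \<open>The determinant involves the old generators only, whose derivatives are
        already known; this avoids circularity when its reciprocal is differentiated.\<close>
      have "(\<lambda>t. A (x t) * C (x t) - B (x t) * B (x t)) \<in> alg coords"
        using coords_smooth[of _ "{}"] smooth by (auto intro!: alg_closed)
      from alg_prim[OF coords_prim[OF U e] _ this] obtain k k' where
        k: "prim a b (\<lambda>t. A (x t) * C (x t) - B (x t) * B (x t)) k" "k' \<in> alg (coords \<union> H)" "ae a b (\<lambda>t. k t = k' t)" by blast
      have nz: "A (x t) * C (x t) - B (x t) * B (x t) \<noteq> 0" for t using det_pos[of "x t"] by simp
      show ?thesis unfolding 5
      proof (intro exI conjI)
        show "prim a b d (\<lambda>t. - k t / (A (x t) * C (x t) - B (x t) * B (x t))\<^sup>2)"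
          using prim_recip[OF k(1) nz] unfolding d_def[abs_def] .
        show "(\<lambda>t. - (k' t * (d t)\<^sup>2)) \<in> alg (coords \<union> H)" by (intro alg_closed h k)
        show "ae a b (\<lambda>t. - k t / (A (x t) * C (x t) - B (x t) * B (x t))\<^sup>2 = - (k' t * (d t)\<^sup>2))"
          by (rule ae_mono[OF k(3)]) (simp add: d_def power_divide)
      qed
    qed
  qed
qed

text \<open>Direction and constant speed determine the controls: \<open>W1\<close> and
  \<open>W2\<close> normalized by their own length, times \<open>sqrt c\<close>. The sign condition
  on the factor matters, since otherwise the curve could reverse along the same direction
  field.\<close>

lemma direction_smooth:
  assumes W: "W1 \<in> alg coords" "W2 \<in> alg coords" "\<And>t. t \<in> {a..b} \<Longrightarrow> W1 t \<noteq> 0 \<or> W2 t \<noteq> 0"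
    and u: "ae a b (\<lambda>t. \<exists>\<mu>\<ge>0. u1 t = \<mu> * W1 t \<and> u2 t = \<mu> * W2 t)"
    and c: "ae a b (\<lambda>t. q (x t) (u1 t) (u2 t) = c)"
  shows "smooth_curve_on {a..b} x"
proof -
  define Q where "Q t = q (x t) (W1 t) (W2 t)" for t
  define r where "r t = 1 / sqrt (Q t)" for t
  define H where "H = {r}"
  have rH: "r \<in> alg (coords \<union> H)" by (auto simp: H_def intro: alg_gen)
  have Qp: "Q t > 0" if "t \<in> {a..b}" for t
    using W(3)[OF that] q_nonneg[of "x t" "W1 t" "W2 t"] q_eq_0_iff[of "x t" "W1 t" "W2 t"] unfolding Q_def by linarith
  define U1 where "U1 t = sqrt c * (r t * W1 t)" for t
  define U2 where "U2 t = sqrt c * (r t * W2 t)" for t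
  have W': "W1 \<in> alg (coords \<union> H)" "W2 \<in> alg (coords \<union> H)" using W(1,2) by (auto intro: alg_mono)
  have U: "U1 \<in> alg (coords \<union> H)" "U2 \<in> alg (coords \<union> H)"
    unfolding U1_def[abs_def] U2_def[abs_def] by (intro alg_closed rH W')+
  have "ae a b (\<lambda>t. u1 t = U1 t \<and> u2 t = U2 t)"
  proof (rule ae_mono2[OF u c])
    fix t assume t: "t \<in> {a..b}" "\<exists>\<mu>\<ge>0. u1 t = \<mu> * W1 t \<and> u2 t = \<mu> * W2 t" "q (x t) (u1 t) (u2 t) = c"
    then obtain m where m: "m \<ge> 0" "u1 t = m * W1 t" "u2 t = m * W2 t" by blast
    have "c = m\<^sup>2 * Q t" unfolding t(3)[symmetric] m Q_def q_def by (simp add: power2_eq_square algebra_simps)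
    then have "sqrt c = m * sqrt (Q t)" using m(1) by (simp add: real_sqrt_mult)
    then have "m = sqrt c * r t" unfolding r_def using Qp[OF t(1)] by simp
    then show "u1 t = U1 t \<and> u2 t = U2 t" unfolding U1_def U2_def m by simp
  qed
  then have e: "ae a b (\<lambda>t. u1 t = U1 t)" "ae a b (\<lambda>t. u2 t = U2 t)" by (auto elim: ae_mono)
  show ?thesis
  proof (rule smooth_of_controls[OF U e])
    fix y assume "y \<in> H"
    then have y: "y = r" unfolding H_def by simp
    have "(\<lambda>t. A (x t) * (W1 t)\<^sup>2 + 2 * B (x t) * W1 t * W2 t + C (x t) * (W2 t)\<^sup>2) \<in> alg coords"
      using coords_smooth[of _ "{}"] smooth W(1,2) by (auto intro!: alg_closed)
    then have "Q \<in> alg coords" unfolding Q_def[abs_def] q_def .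
    from alg_prim[OF coords_prim[OF U e] _ this] obtain k k' where
      k: "prim a b Q k" "k' \<in> alg (coords \<union> H)" "ae a b (\<lambda>t. k t = k' t)" by blast
    show "\<exists>k k'. prim a b y k \<and> k' \<in> alg (coords \<union> H) \<and> ae a b (\<lambda>t. k t = k' t)"
      unfolding y
    proof (intro exI conjI)
      show "prim a b r (\<lambda>t. - (1/2) * (1 / sqrt (Q t)) ^ 3 * k t)"
        using prim_inverse_sqrt[OF k(1) Qp] unfolding r_def[abs_def] .
      show "(\<lambda>t. - (1/2) * (r t) ^ 3 * k' t) \<in> alg (coords \<union> H)" by (intro alg_closed rH k)
      show "ae a b (\<lambda>t. - (1/2) * (1 / sqrt (Q t)) ^ 3 * k t = - (1/2) * (r t) ^ 3 * k' t)"
        by (rule ae_mono[OF k(3)]) (simp add: r_def)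
    qed
  qed
qed

end

section \<open>Minimizers of constant speed and abnormal extremals\<close>

lemma ae_cont_zero:
  assumes e: "ae a b (\<lambda>t. f t = (0::real))" and c: "continuous_on {a..b} f" and ab: "a < b" and t: "t \<in> {a..b}"
  shows "f t = 0"
proof (rule ccontr)
  assume "f t \<noteq> 0"
  then obtain d where d: "d > 0" "\<And>s. s \<in> {a..b} \<Longrightarrow> dist s t < d \<Longrightarrow> dist (f s) (f t) < \<bar>f t\<bar>"
    using c t unfolding continuous_on_iff by (metis zero_less_abs_iff)
  define l where "l = max a (t - d/2)"
  define r where "r = min b (t + d/2)"
  have lr: "l < r" unfolding l_def r_def using t ab d(1) by auto
  have "{l..r} \<subseteq> {t\<in>{a..b}. \<not> f t = 0}"
  proof
    fix s assume s: "s \<in> {l..r}"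
    then have "s \<in> {a..b}" "dist s t < d" unfolding l_def r_def using d(1) by (auto simp: dist_real_def)
    then have "dist (f s) (f t) < \<bar>f t\<bar>" "s \<in> {a..b}" using d(2) by auto
    then show "s \<in> {t\<in>{a..b}. \<not> f t = 0}" by (auto simp: dist_real_def)
  qed
  then have "negligible {l..r}" using e negligible_subset unfolding ae_def by blast
  then show False using lr negligible_interval(1)[of l r] by simp
qed

lemma prim_zero_deriv: assumes "prim a b F f" "\<And>t. t \<in> {a..b} \<Longrightarrow> F t = C" shows "ae a b (\<lambda>t. f t = 0)"
proof -
  have "prim a b (\<lambda>t. C) f" by (rule prim_cong'[OF assms(1)]) (use assms(2) in auto)
  then show ?thesis using prim_unique prim_const by blast
qed

text \<open>A continuous injective function on an interval is strictly monotone. Together with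
  \<open>x_inj\<close> below this excludes motion back and forth.\<close>

lemma prim_inj_sign:
  assumes p: "prim a b F f" and inj: "inj_on F {a..b}"
  shows "ae a b (\<lambda>t. 0 \<le> f t) \<or> ae a b (\<lambda>t. f t \<le> 0)"
proof -
  have c: "continuous_on {a..b} F" by (rule prim_cont[OF p])
  have d: "ae a b (\<lambda>t. (F has_real_derivative f t) (at t))" using p unfolding prim_def by simp
  have sgn: "ae a b (\<lambda>t. 0 \<le> s * f t)" if m: "mono_on {a..b} (\<lambda>t. s * F t)" for s
  proof (rule ae_mono2[OF d ae_interior])
    fix t assume t: "(F has_real_derivative f t) (at t)" "a < t \<and> t < b"
    have "((\<lambda>t. s * F t) has_real_derivative s * f t) (at t)" using t(1) by (intro DERIV_cmult)
    from mono_on_imp_deriv_nonneg[OF m this] show "0 \<le> s * f t" using t(2) by simp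
  qed
  have "strict_mono_on {a..b} F \<or> strict_antimono_on {a..b} F"
    using injective_eq_monotone_map[OF is_interval_cc c] inj by blast
  then show ?thesis
  proof
    assume "strict_mono_on {a..b} F"
    then have "mono_on {a..b} (\<lambda>t. 1 * F t)" by (simp add: strict_mono_on_imp_mono_on)
    from sgn[OF this] show ?thesis by simp
  next
    assume *: "strict_antimono_on {a..b} F"
    have "mono_on {a..b} (\<lambda>t. -1 * F t)"
    proof (rule mono_onI)
      fix r s assume rs: "r \<in> {a..b}" "s \<in> {a..b}" "r \<le> s"
      show "-1 * F r \<le> -1 * F s"
      proof (cases "r = s")
        case False
        then have "r < s" using rs(3) by simp
        from monotone_onD[OF * rs(1,2) this] show ?thesis by simp
      qed simp
    qed
    from sgn[OF this] show ?thesis by simp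
  qed
qed

locale minimizer = controlled +
  fixes c :: real
  assumes lt: "a < b" and c: "c > 0" and speed_c: "ae a b (\<lambda>t. q (x t) (u1 t) (u2 t) = c)"
    and minimal: "\<And>l. reach (x a) (x b) l \<Longrightarrow> integral {a..b} (speed u1 u2 x) \<le> l"
begin

lemma length_between: assumes "s \<in> {a..b}" "t \<in> {a..b}" "s \<le> t" shows "integral {s..t} (speed u1 u2 x) = sqrt c * (t - s)"
proof -
  have "integral {s..t} (speed u1 u2 x) = integral {s..t} (\<lambda>_. sqrt c)"
    by (rule ae_integral_cong, rule ae_mono, rule ae_subset[OF speed_c]) (use assms in \<open>auto simp: speed_def\<close>)
  then show ?thesis using assms by (simp add: mult.commute)
qed

lemma reach_between: assumes "s \<in> {a..b}" "t \<in> {a..b}" "s \<le> t" shows "reach (x s) (x t) (sqrt c * (t - s))"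
  by (rule reach_ctl[OF ctl_subset[OF ctl]]) (use assms length_between in auto)

lemma minimal': "reach (x a) (x b) l \<Longrightarrow> sqrt c * (b - a) \<le> l"
  using minimal length_between[of a b] lt by auto

text \<open>If a point were visited twice, the loop between the visits could be cut out, saving the
  positive length \<open>sqrt c * (t - s)\<close>.\<close>

lemma x_inj: "inj_on x {a..b}"
proof -
  have "False" if st: "s \<in> {a..b}" "t \<in> {a..b}" "s < t" "x s = x t" for s t
  proof -
    have "reach (x a) (x s) (sqrt c * (s - a))" "reach (x s) (x b) (sqrt c * (b - t))"
      using reach_between[of a s] reach_between[of t b] st lt by auto
    then have "sqrt c * (b - a) \<le> sqrt c * (s - a) + sqrt c * (b - t)" using minimal' reach_trans by blast
    then have "sqrt c * (t - s) \<le> 0" by (simp add: algebra_simps)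
    then show False using c st(3) by (simp add: mult_le_0_iff)
  qed
  then show ?thesis unfolding inj_on_def by (metis linorder_neqE_linordered_idom)
qed

text \<open>The Cauchy-Schwarz inequality, obtained by integrating the square of
  \<open>speed - sqrt c\<close>: energy is bounded below in terms of length, with equality for
  constant speed.\<close>

lemma energy_minimal:
  assumes z: "ctl a b w1 w2 z" "z a = x a" "z b = x b"
  shows "integral {a..b} (\<lambda>t. q (x t) (u1 t) (u2 t) / 2) \<le> integral {a..b} (\<lambda>t. q (z t) (w1 t) (w2 t) / 2)"
proof -
  let ?T = "integral {a..b} (speed w1 w2 z)"
  let ?Q = "integral {a..b} (\<lambda>t. q (z t) (w1 t) (w2 t))"
  have T: "sqrt c * (b - a) \<le> ?T" using minimal'[of ?T] reach_ctl[OF z(1) order_refl] z(2,3) by simp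
  have bq: "bm a b (\<lambda>t. q (z t) (w1 t) (w2 t))" by (rule q_bm[OF z(1)])
  have bs: "bm a b (\<lambda>t. 2 * sqrt c * speed w1 w2 z t)" by (intro bm_cmult speed_bm[OF z(1)])
  have b: "b \<in> {a..b}" using ab by simp
  have "0 \<le> integral {a..b} (\<lambda>t. (speed w1 w2 z t - sqrt c)\<^sup>2)"
    by (rule integral_nonneg[OF bm_integrable]) (auto intro!: bm_intros speed_bm[OF z(1)])
  also have "\<dots> = integral {a..b} (\<lambda>t. (q (z t) (w1 t) (w2 t) - 2 * sqrt c * speed w1 w2 z t) + c)"
    by (rule integral_cong) (use c in \<open>simp add: speed_def power2_diff\<close>)
  also have "\<dots> = integral {a..b} (\<lambda>t. q (z t) (w1 t) (w2 t) - 2 * sqrt c * speed w1 w2 z t) + integral {a..b} (\<lambda>t. c)"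
    by (rule bm_integral_add[OF bm_diff[OF bq bs] bm_const b])
  also have "\<dots> = ?Q - 2 * sqrt c * ?T + c * (b - a)"
    using bm_integral_diff[OF bq bs b] lt by (simp add: mult.commute)
  finally have 1: "2 * sqrt c * ?T - c * (b - a) \<le> ?Q" by simp
  have "sqrt c * (sqrt c * (b - a)) \<le> sqrt c * ?T" using T c by (intro mult_left_mono) auto
  then have 2: "c * (b - a) \<le> sqrt c * ?T" using c by (simp add: mult.assoc[symmetric])
  have "integral {a..b} (\<lambda>t. q (x t) (u1 t) (u2 t)) = integral {a..b} (\<lambda>t. c)" by (rule ae_integral_cong[OF speed_c])
  then have "integral {a..b} (\<lambda>t. q (x t) (u1 t) (u2 t)) = c * (b - a)" using lt by (simp add: mult.commute)
  then show ?thesis using 1 2 by simp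
qed

text \<open>Differentiating the two pointwise constraints of an abnormal extremal gives p3 = p4 x1 x3.\<close>

lemma smooth_or_abnormal:
  "smooth_curve_on {a..b} x \<or> ae a b (\<lambda>t. u1 t * (3 * x t $ 3 + 2 * x t $ 1 * x t $ 2) = 2 * (x t $ 1)\<^sup>2 * u2 t)"
proof -
  obtain l0 p1 p2 p3 p4 where p:
    "prim a b p1 (\<lambda>t. - (l0 * qd 1 t - 2 * p3 t * u2 t))"
    "prim a b p2 (\<lambda>t. - (l0 * qd 2 t + 2 * p3 t * u1 t))"
    "prim a b p3 (\<lambda>t. - (l0 * qd 3 t + 2 * p4 t * x t $ 3 * u1 t))"
    "prim a b p4 (\<lambda>t. - (l0 * qd 4 t))"
    "ae a b (\<lambda>t. l0 * m1 t + p1 t + 2 * x t $ 2 * p3 t + (x t $ 3)\<^sup>2 * p4 t = 0)"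
    "ae a b (\<lambda>t. l0 * m2 t + p2 t - 2 * x t $ 1 * p3 t = 0)"
    "l0 \<noteq> 0 \<or> p1 b \<noteq> 0 \<or> p2 b \<noteq> 0 \<or> p3 b \<noteq> 0 \<or> p4 b \<noteq> 0"
    by (rule pontryagin[OF energy_minimal])
  show ?thesis
  proof (cases "l0 = 0")
    case False
    then show ?thesis using normal_smooth[OF p(1-6)] by blast
  next
    case True
    define k where "k = p4 a"
    have p4: "p4 t = k" if "t \<in> {a..b}" for t
      unfolding k_def by (rule prim_zero_const[OF p(4) _ that]) (simp add: True ae_all)
    note x1 = ctlD(2)[OF ctl] and x2 = ctlD(3)[OF ctl] and x3 = ctlD(4)[OF ctl]
    have P3: "prim a b p3 (\<lambda>t. - (2 * k * x t $ 3 * u1 t))" by (rule prim_cong'[OF p(3)]) (use p4 True in auto)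
    have P2: "prim a b p2 (\<lambda>t. - (2 * p3 t * u1 t))" by (rule prim_cong'[OF p(2)]) (use True in auto)
    have P1: "prim a b p1 (\<lambda>t. 2 * p3 t * u2 t)" by (rule prim_cong'[OF p(1)]) (use True in auto)
    \<comment> \<open>With \<open>l0 = 0\<close> the two extremality equations are continuous in
      time, so they hold everywhere and may be differentiated.\<close>
    define E1 where "E1 t = p1 t + 2 * (x t $ 2 * p3 t) + k * (x t $ 3 * x t $ 3)" for t
    define E2 where "E2 t = p2 t - 2 * (x t $ 1 * p3 t)" for t
    have pE1: "prim a b E1 (\<lambda>t. 2 * p3 t * u2 t + 2 * (u2 t * p3 t + x t $ 2 * (- (2 * k * x t $ 3 * u1 t)))
       + k * ((2 * x t $ 2 * u1 t - 2 * x t $ 1 * u2 t) * x t $ 3 + x t $ 3 * (2 * x t $ 2 * u1 t - 2 * x t $ 1 * u2 t)))"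
      unfolding E1_def[abs_def] by (intro prim_add prim_cmult prim_mult P1 P3 x2 x3)
    have pE2: "prim a b E2 (\<lambda>t. - (2 * p3 t * u1 t) - 2 * (u1 t * p3 t + x t $ 1 * (- (2 * k * x t $ 3 * u1 t))))"
      unfolding E2_def[abs_def] by (intro prim_diff prim_cmult prim_mult P2 P3 x1)
    have E1: "E1 t = 0" if t: "t \<in> {a..b}" for t
      by (rule ae_cont_zero[OF _ prim_cont[OF pE1] lt t], rule ae_mono[OF p(5)])
        (use True p4 in \<open>simp add: E1_def power2_eq_square algebra_simps\<close>)
    have E2: "E2 t = 0" if t: "t \<in> {a..b}" for t
      by (rule ae_cont_zero[OF _ prim_cont[OF pE2] lt t], rule ae_mono[OF p(6)])
        (use True in \<open>simp add: E2_def algebra_simps\<close>)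
    define h where "h t = p3 t - k * (x t $ 1 * x t $ 3)" for t
    have ph: "prim a b h (\<lambda>t. - (2 * k * x t $ 3 * u1 t) - k * (u1 t * x t $ 3 + x t $ 1 * (2 * x t $ 2 * u1 t - 2 * x t $ 1 * u2 t)))"
      unfolding h_def[abs_def] by (intro prim_diff prim_cmult prim_mult P3 x1 x3)
    have "ae a b (\<lambda>t. h t = 0)"
    proof (rule ae_mono3[OF prim_zero_deriv[OF pE1 E1] prim_zero_deriv[OF pE2 E2] speed_c])
      fix t assume "2 * p3 t * u2 t + 2 * (u2 t * p3 t + x t $ 2 * (- (2 * k * x t $ 3 * u1 t)))
       + k * ((2 * x t $ 2 * u1 t - 2 * x t $ 1 * u2 t) * x t $ 3 + x t $ 3 * (2 * x t $ 2 * u1 t - 2 * x t $ 1 * u2 t)) = 0"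
       "- (2 * p3 t * u1 t) - 2 * (u1 t * p3 t + x t $ 1 * (- (2 * k * x t $ 3 * u1 t))) = 0"
      \<comment> \<open>The derivative of \<open>E1\<close> is \<open>4 * u2 t * h t\<close> and
        that of \<open>E2\<close> is \<open>- 4 * u1 t * h t\<close>. Positive speed forbids both
        controls to vanish, so \<open>h\<close> must.\<close>
      then have "u2 t * h t = 0" "u1 t * h t = 0" unfolding h_def by (auto simp: algebra_simps)
      moreover assume "q (x t) (u1 t) (u2 t) = c"
      then have "u1 t \<noteq> 0 \<or> u2 t \<noteq> 0" using c q_eq_0_iff[of "x t" "u1 t" "u2 t"] by auto
      ultimately show "h t = 0" by auto
    qed
    then have h0: "h t = 0" if "t \<in> {a..b}" for t using ae_cont_zero[OF _ prim_cont[OF ph] lt that] by blast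
    \<comment> \<open>If \<open>p4\<close> vanished, then \<open>p3 = k x1 x3\<close> would vanish,
      and through \<open>E1\<close> and \<open>E2\<close> also \<open>p1\<close> and
      \<open>p2\<close>, against the nontriviality of the multiplier.\<close>
    have k0: "k \<noteq> 0"
    proof
      assume "k = 0"
      then have "p3 b = 0" "p4 b = 0" using h0[of b] p4[of b] lt unfolding h_def by auto
      moreover from this have "p2 b = 0" "p1 b = 0" using E1[of b] E2[of b] lt \<open>k = 0\<close> unfolding E1_def E2_def by auto
      ultimately show False using p(7) True by simp
    qed
    \<comment> \<open>The abnormal equation is the derivative of \<open>h = 0\<close>, divided by
      \<open>- k\<close>.\<close>
    have "ae a b (\<lambda>t. u1 t * (3 * x t $ 3 + 2 * x t $ 1 * x t $ 2) = 2 * (x t $ 1)\<^sup>2 * u2 t)"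
    proof (rule ae_mono[OF prim_zero_deriv[OF ph h0]])
      fix t assume "- (2 * k * x t $ 3 * u1 t) - k * (u1 t * x t $ 3 + x t $ 1 * (2 * x t $ 2 * u1 t - 2 * x t $ 1 * u2 t)) = 0"
      then have "k * (u1 t * (3 * x t $ 3 + 2 * x t $ 1 * x t $ 2) - 2 * (x t $ 1)\<^sup>2 * u2 t) = 0"
        by (simp add: algebra_simps power2_eq_square)
      then show "u1 t * (3 * x t $ 3 + 2 * x t $ 1 * x t $ 2) = 2 * (x t $ 1)\<^sup>2 * u2 t" using k0 by simp
    qed
    then show ?thesis by blast
  qed
qed

end

lemma prim_power: assumes "prim a b F f" shows "prim a b (\<lambda>t. F t ^ Suc n) (\<lambda>t. real (Suc n) * F t ^ n * f t)"
proof (induction n)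
  case 0
  show ?case by (rule prim_cong'[OF assms]) auto
next
  case (Suc n)
  show ?case by (rule prim_cong'[OF prim_mult[OF assms Suc]]) (auto simp: algebra_simps)
qed

lemma prim_cube: assumes "prim a b F f" shows "prim a b (\<lambda>t. F t ^ 3) (\<lambda>t. 3 * F t ^ 2 * f t)"
  by (rule prim_cong'[OF prim_power[OF assms, of 2]]) (auto simp: eval_nat_numeral)

lemma prim_fifth: assumes "prim a b F f" shows "prim a b (\<lambda>t. F t ^ 5) (\<lambda>t. 5 * F t ^ 4 * f t)"
  by (rule prim_cong'[OF prim_power[OF assms, of 4]]) (auto simp: eval_nat_numeral)

context minimizer
begin

lemmas x1_prim = ctlD(2)[OF ctl] and x2_prim = ctlD(3)[OF ctl] and x3_prim = ctlD(4)[OF ctl] and x4_prim = ctlD(5)[OF ctl]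

text \<open>The coordinate along the line is injective because the curve is and all else is fixed;
  hence it is monotone and the direction is constant, up to one choice of sign.\<close>

lemma line_smooth:
  assumes v: "v1 \<noteq> 0 \<or> v2 \<noteq> 0"
    and line: "\<And>t. t \<in> {a..b} \<Longrightarrow> x t $ 1 * v2 = x t $ 2 * v1"
    and x34: "\<And>t. t \<in> {a..b} \<Longrightarrow> x t $ 3 = c3" "\<And>t. t \<in> {a..b} \<Longrightarrow> x t $ 4 = c4"
  shows "smooth_curve_on {a..b} x"
proof -
  define N where "N = v1 * v1 + v2 * v2"
  have N: "N > 0" unfolding N_def using v by (auto simp: sum_squares_gt_zero_iff)
  define \<theta> where "\<theta> t = v1 * x t $ 1 + v2 * x t $ 2" for t
  have p\<theta>: "prim a b \<theta> (\<lambda>t. v1 * u1 t + v2 * u2 t)"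
    unfolding \<theta>_def[abs_def] by (intro prim_add prim_cmult x1_prim x2_prim)
  have x12: "N * x t $ 1 = v1 * \<theta> t" "N * x t $ 2 = v2 * \<theta> t" if "t \<in> {a..b}" for t
  proof -
    have e: "x t $ 1 * v2 = x t $ 2 * v1" by (rule line[OF that])
    have "N * x t $ 1 - v1 * \<theta> t = v2 * (x t $ 1 * v2 - x t $ 2 * v1)" unfolding N_def \<theta>_def by (simp add: algebra_simps)
    then show "N * x t $ 1 = v1 * \<theta> t" using e by simp
    have "N * x t $ 2 - v2 * \<theta> t = - (v1 * (x t $ 1 * v2 - x t $ 2 * v1))" unfolding N_def \<theta>_def by (simp add: algebra_simps)
    then show "N * x t $ 2 = v2 * \<theta> t" using e by simp
  qed
  have inj: "inj_on \<theta> {a..b}"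
  proof (rule inj_onI)
    fix s t assume st: "s \<in> {a..b}" "t \<in> {a..b}" "\<theta> s = \<theta> t"
    then have "N * x s $ 1 = N * x t $ 1" "N * x s $ 2 = N * x t $ 2" using x12 by simp_all
    then have "x s $ 1 = x t $ 1" "x s $ 2 = x t $ 2" using N by simp_all
    then have "x s = x t" unfolding vec4_eq_iff using x34 st by simp
    then show "s = t" using x_inj st unfolding inj_on_def by blast
  qed
  have "prim a b (\<lambda>t. v2 * x t $ 1 - v1 * x t $ 2) (\<lambda>t. v2 * u1 t - v1 * u2 t)"
    by (intro prim_diff prim_cmult x1_prim x2_prim)
  then have "ae a b (\<lambda>t. v2 * u1 t - v1 * u2 t = 0)"
    by (rule prim_zero_deriv[where C=0]) (use line in \<open>simp add: mult.commute\<close>)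
  then have par: "ae a b (\<lambda>t. u1 t = ((v1 * u1 t + v2 * u2 t) / N) * v1 \<and> u2 t = ((v1 * u1 t + v2 * u2 t) / N) * v2)"
  proof (rule ae_mono)
    fix t assume e: "v2 * u1 t - v1 * u2 t = 0"
    have "N * u1 t - (v1 * u1 t + v2 * u2 t) * v1 = v2 * (v2 * u1 t - v1 * u2 t)"
      "N * u2 t - (v1 * u1 t + v2 * u2 t) * v2 = - v1 * (v2 * u1 t - v1 * u2 t)" unfolding N_def by (simp_all add: algebra_simps)
    then have "N * u1 t = (v1 * u1 t + v2 * u2 t) * v1" "N * u2 t = (v1 * u1 t + v2 * u2 t) * v2" using e by simp_all
    then show "u1 t = ((v1 * u1 t + v2 * u2 t) / N) * v1 \<and> u2 t = ((v1 * u1 t + v2 * u2 t) / N) * v2"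
      using N by (simp add: field_simps)
  qed
  from prim_inj_sign[OF p\<theta> inj] show ?thesis
  proof
    assume s: "ae a b (\<lambda>t. 0 \<le> v1 * u1 t + v2 * u2 t)"
    show ?thesis
    proof (rule direction_smooth[where ?W1.0="\<lambda>t. v1" and ?W2.0="\<lambda>t. v2", OF alg_const alg_const v _ speed_c])
      show "ae a b (\<lambda>t. \<exists>\<mu>\<ge>0. u1 t = \<mu> * v1 \<and> u2 t = \<mu> * v2)"
      proof (rule ae_mono2[OF par s])
        fix t assume *: "u1 t = ((v1 * u1 t + v2 * u2 t) / N) * v1 \<and> u2 t = ((v1 * u1 t + v2 * u2 t) / N) * v2" "0 \<le> v1 * u1 t + v2 * u2 t"
        then have "0 \<le> (v1 * u1 t + v2 * u2 t) / N" using N by simp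
        then show "\<exists>\<mu>\<ge>0. u1 t = \<mu> * v1 \<and> u2 t = \<mu> * v2" using *(1) by blast
      qed
    qed
  next
    assume s: "ae a b (\<lambda>t. v1 * u1 t + v2 * u2 t \<le> 0)"
    show ?thesis
    proof (rule direction_smooth[where ?W1.0="\<lambda>t. - v1" and ?W2.0="\<lambda>t. - v2", OF alg_const alg_const _ _ speed_c])
      show "- v1 \<noteq> 0 \<or> - v2 \<noteq> 0" using v by simp
      show "ae a b (\<lambda>t. \<exists>\<mu>\<ge>0. u1 t = \<mu> * - v1 \<and> u2 t = \<mu> * - v2)"
      proof (rule ae_mono2[OF par s])
        fix t assume *: "u1 t = ((v1 * u1 t + v2 * u2 t) / N) * v1 \<and> u2 t = ((v1 * u1 t + v2 * u2 t) / N) * v2" "v1 * u1 t + v2 * u2 t \<le> 0"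
        then have "0 \<le> - ((v1 * u1 t + v2 * u2 t) / N)" using N by (simp add: divide_nonpos_pos)
        moreover have "u1 t = - ((v1 * u1 t + v2 * u2 t) / N) * - v1 \<and> u2 t = - ((v1 * u1 t + v2 * u2 t) / N) * - v2"
          using *(1) by simp
        ultimately show "\<exists>\<mu>\<ge>0. u1 t = \<mu> * - v1 \<and> u2 t = \<mu> * - v2" by blast
      qed
    qed
  qed
qed

text \<open>The derivative is \<open>(x t $ 1)\<^sup>2\<close> times the difference of the two sides
  of the abnormal equation.\<close>

lemma x3_x1_cubed_const:
  assumes R: "ae a b (\<lambda>t. u1 t * (3 * x t $ 3 + 2 * x t $ 1 * x t $ 2) = 2 * (x t $ 1)\<^sup>2 * u2 t)" and t: "t \<in> {a..b}"
  shows "x t $ 3 * (x t $ 1) ^ 3 = x a $ 3 * (x a $ 1) ^ 3"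
proof (rule prim_zero_const[OF prim_mult[OF x3_prim prim_cube[OF x1_prim]] _ t], rule ae_mono[OF R])
  fix t assume r: "u1 t * (3 * x t $ 3 + 2 * x t $ 1 * x t $ 2) = 2 * (x t $ 1)\<^sup>2 * u2 t"
  have "(2 * x t $ 2 * u1 t - 2 * x t $ 1 * u2 t) * x t $ 1 ^ 3 + x t $ 3 * (3 * (x t $ 1)\<^sup>2 * u1 t) =
    (x t $ 1)\<^sup>2 * (u1 t * (3 * x t $ 3 + 2 * x t $ 1 * x t $ 2) - 2 * (x t $ 1)\<^sup>2 * u2 t)"
    by (simp add: power2_eq_square power3_eq_cube algebra_simps)
  then show "(2 * x t $ 2 * u1 t - 2 * x t $ 1 * u2 t) * x t $ 1 ^ 3 + x t $ 3 * (3 * (x t $ 1)\<^sup>2 * u1 t) = 0"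
    using r by simp
qed

text \<open>If x3 x1^3 is a nonzero constant k, the abnormal equation integrates explicitly: with y = 1/x1 the
  quantities x3 - k y^3, x2 y + (3k/10) y^5 and x4 + (k^2/5) y^5 are constant, so the curve is a graph over x1.\<close>

lemma abnormal_smooth_nonzero:
  assumes R: "ae a b (\<lambda>t. u1 t * (3 * x t $ 3 + 2 * x t $ 1 * x t $ 2) = 2 * (x t $ 1)\<^sup>2 * u2 t)"
    and nz: "x a $ 3 * (x a $ 1) ^ 3 \<noteq> 0"
  shows "smooth_curve_on {a..b} x"
proof -
  define k where "k = x a $ 3 * (x a $ 1) ^ 3"
  have K: "x t $ 3 * (x t $ 1) ^ 3 = k" if "t \<in> {a..b}" for t using x3_x1_cubed_const[OF R that] unfolding k_def .
  have x1nz: "x t $ 1 \<noteq> 0" if "t \<in> {a..b}" for t using K[OF that] nz unfolding k_def by auto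
  define y where "y t = 1 / x t $ 1" for t
  have yx: "x t $ 1 * y t = 1" if "t \<in> {a..b}" for t using x1nz[OF that] unfolding y_def by simp
  have py: "prim a b y (\<lambda>t. - u1 t * (y t)\<^sup>2)"
    by (rule prim_cong'[OF prim_recip[OF x1_prim x1nz]]) (auto simp: y_def power_divide)
  have x3: "x t $ 3 = k * y t ^ 3" if t: "t \<in> {a..b}" for t
  proof -
    have "k * y t ^ 3 = x t $ 3 * (x t $ 1 * y t) ^ 3" unfolding K[OF t, symmetric] by (simp add: power_mult_distrib)
    then show ?thesis using yx[OF t] by simp
  qed
  define J1 where "J1 t = x t $ 2 * y t + (3 * k / 10) * y t ^ 5" for t
  define J2 where "J2 t = x t $ 4 + (k\<^sup>2 / 5) * y t ^ 5" for t
  have J1: "J1 t = J1 a" if t: "t \<in> {a..b}" for t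
  proof (rule prim_zero_const[OF _ _ t])
    show "prim a b J1 (\<lambda>t. (u2 t * y t + x t $ 2 * (- u1 t * (y t)\<^sup>2)) + (3 * k / 10) * (5 * y t ^ 4 * (- u1 t * (y t)\<^sup>2)))"
      unfolding J1_def[abs_def] by (intro prim_add prim_cmult prim_mult prim_fifth py x2_prim)
    show "ae a b (\<lambda>t. (u2 t * y t + x t $ 2 * (- u1 t * (y t)\<^sup>2)) + (3 * k / 10) * (5 * y t ^ 4 * (- u1 t * (y t)\<^sup>2)) = 0)"
    proof (rule ae_mono[OF R])
      fix t assume t: "t \<in> {a..b}" and r: "u1 t * (3 * x t $ 3 + 2 * x t $ 1 * x t $ 2) = 2 * (x t $ 1)\<^sup>2 * u2 t"
      have "2 * (x t $ 1 * y t)\<^sup>2 * (u2 t * y t) = (2 * (x t $ 1)\<^sup>2 * u2 t) * y t ^ 3"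
        by (simp add: power2_eq_square power3_eq_cube algebra_simps)
      also have "\<dots> = u1 t * (3 * (k * y t ^ 3) * y t ^ 3 + 2 * (x t $ 1 * y t) * x t $ 2 * (y t)\<^sup>2)"
        unfolding r[symmetric] x3[OF t] by (simp add: power2_eq_square power3_eq_cube algebra_simps)
      finally have "2 * (u2 t * y t) = u1 t * (3 * (k * y t ^ 3) * y t ^ 3 + 2 * x t $ 2 * (y t)\<^sup>2)" using yx[OF t] by simp
      then have "u2 t * y t = u1 t * (3 * (k * y t ^ 3) * y t ^ 3 + 2 * x t $ 2 * (y t)\<^sup>2) / 2" by simp
      then show "(u2 t * y t + x t $ 2 * (- u1 t * (y t)\<^sup>2)) + (3 * k / 10) * (5 * y t ^ 4 * (- u1 t * (y t)\<^sup>2)) = 0"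
        by (simp add: eval_nat_numeral field_simps)
    qed
  qed
  have J2: "J2 t = J2 a" if t: "t \<in> {a..b}" for t
  proof (rule prim_zero_const[OF _ _ t])
    show "prim a b J2 (\<lambda>t. (x t $ 3)\<^sup>2 * u1 t + (k\<^sup>2 / 5) * (5 * y t ^ 4 * (- u1 t * (y t)\<^sup>2)))"
      unfolding J2_def[abs_def] by (intro prim_add prim_cmult prim_fifth py x4_prim)
    show "ae a b (\<lambda>t. (x t $ 3)\<^sup>2 * u1 t + (k\<^sup>2 / 5) * (5 * y t ^ 4 * (- u1 t * (y t)\<^sup>2)) = 0)"
      by (rule ae_all) (simp add: x3 eval_nat_numeral)
  qed
  have inj: "inj_on (\<lambda>t. x t $ 1) {a..b}"
  proof (rule inj_onI)
    fix s t assume st: "s \<in> {a..b}" "t \<in> {a..b}" "x s $ 1 = x t $ 1"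
    then have y: "y s = y t" unfolding y_def by simp
    have ynz: "y t \<noteq> 0" using yx[OF st(2)] by auto
    have "J1 s = J1 t" "J2 s = J2 t" using J1 J2 st by metis+
    then have "x s $ 2 = x t $ 2" "x s $ 4 = x t $ 4" unfolding J1_def J2_def y using ynz by simp_all
    then have "x s = x t" unfolding vec4_eq_iff using st x3 y by simp
    then show "s = t" using x_inj st unfolding inj_on_def by blast
  qed
  \<comment> \<open>The abnormal equation says that the controls are proportional to
    \<open>2 * (x t $ 1)\<^sup>2\<close> and \<open>3 * x t $ 3 + 2 * x t $ 1 * x t $ 2\<close>; the
    factor has the sign of \<open>u1 t\<close>.\<close>
  have Wu: "u1 t = (u1 t / (2 * (x t $ 1)\<^sup>2)) * (2 * (x t $ 1)\<^sup>2)"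
     "u2 t = (u1 t / (2 * (x t $ 1)\<^sup>2)) * (3 * x t $ 3 + 2 * x t $ 1 * x t $ 2)"
    if "t \<in> {a..b}" "u1 t * (3 * x t $ 3 + 2 * x t $ 1 * x t $ 2) = 2 * (x t $ 1)\<^sup>2 * u2 t" for t
    using x1nz[OF that(1)] that(2) by (simp_all add: field_simps)
  have W: "(\<lambda>t. 2 * (x t $ 1)\<^sup>2) \<in> alg coords" "(\<lambda>t. 3 * x t $ 3 + 2 * x t $ 1 * x t $ 2) \<in> alg coords"
    using coords_nth[of _ "{}"] by (auto intro!: alg_closed)
  from prim_inj_sign[OF x1_prim inj] show ?thesis
  proof
    assume s: "ae a b (\<lambda>t. 0 \<le> u1 t)"
    show ?thesis
    proof (rule direction_smooth[OF W _ _ speed_c])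
      show "2 * (x t $ 1)\<^sup>2 \<noteq> 0 \<or> 3 * x t $ 3 + 2 * x t $ 1 * x t $ 2 \<noteq> 0" if "t \<in> {a..b}" for t using x1nz[OF that] by simp
      show "ae a b (\<lambda>t. \<exists>\<mu>\<ge>0. u1 t = \<mu> * (2 * (x t $ 1)\<^sup>2) \<and> u2 t = \<mu> * (3 * x t $ 3 + 2 * x t $ 1 * x t $ 2))"
      proof (rule ae_mono2[OF R s])
        fix t assume t: "t \<in> {a..b}" "u1 t * (3 * x t $ 3 + 2 * x t $ 1 * x t $ 2) = 2 * (x t $ 1)\<^sup>2 * u2 t" "0 \<le> u1 t"
        show "\<exists>\<mu>\<ge>0. u1 t = \<mu> * (2 * (x t $ 1)\<^sup>2) \<and> u2 t = \<mu> * (3 * x t $ 3 + 2 * x t $ 1 * x t $ 2)"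
          using Wu[OF t(1,2)] t(3) by (intro exI[of _ "u1 t / (2 * (x t $ 1)\<^sup>2)"]) simp
      qed
    qed
  next
    assume s: "ae a b (\<lambda>t. u1 t \<le> 0)"
    show ?thesis
    proof (rule direction_smooth[OF alg_minus[OF W(1)] alg_minus[OF W(2)] _ _ speed_c])
      show "- (2 * (x t $ 1)\<^sup>2) \<noteq> 0 \<or> - (3 * x t $ 3 + 2 * x t $ 1 * x t $ 2) \<noteq> 0" if "t \<in> {a..b}" for t using x1nz[OF that] by simp
      show "ae a b (\<lambda>t. \<exists>\<mu>\<ge>0. u1 t = \<mu> * - (2 * (x t $ 1)\<^sup>2) \<and> u2 t = \<mu> * - (3 * x t $ 3 + 2 * x t $ 1 * x t $ 2))"
      proof (rule ae_mono2[OF R s])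
        fix t assume t: "t \<in> {a..b}" "u1 t * (3 * x t $ 3 + 2 * x t $ 1 * x t $ 2) = 2 * (x t $ 1)\<^sup>2 * u2 t" "u1 t \<le> 0"
        define m where "m = - (u1 t / (2 * (x t $ 1)\<^sup>2))"
        have "0 \<le> m" unfolding m_def using t(3) by (simp add: divide_nonpos_nonneg)
        moreover have "u1 t = m * - (2 * (x t $ 1)\<^sup>2)" "u2 t = m * - (3 * x t $ 3 + 2 * x t $ 1 * x t $ 2)"
          using Wu[OF t(1,2)] unfolding m_def minus_mult_minus by blast+
        ultimately show "\<exists>\<mu>\<ge>0. u1 t = \<mu> * - (2 * (x t $ 1)\<^sup>2) \<and> u2 t = \<mu> * - (3 * x t $ 3 + 2 * x t $ 1 * x t $ 2)" by blast
      qed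
    qed
  qed
qed

text \<open>Here \<open>x1 x3 = 0\<close> along the curve. Differentiating this and subtracting from
  the abnormal equation gives \<open>u1 x3 = 0\<close>, which makes \<open>x3\<close> squared and
  \<open>x4\<close> constant. So either \<open>x3\<close> vanishes identically, and its zero
  derivative gives the planar equation, or \<open>x1\<close> does.\<close>

lemma abnormal_zero_cases:
  assumes R: "ae a b (\<lambda>t. u1 t * (3 * x t $ 3 + 2 * x t $ 1 * x t $ 2) = 2 * (x t $ 1)\<^sup>2 * u2 t)"
    and z: "x a $ 3 * (x a $ 1) ^ 3 = 0"
  shows "smooth_curve_on {a..b} x \<or>
    ((\<forall>t\<in>{a..b}. x t $ 3 = 0) \<and> (\<forall>t\<in>{a..b}. x t $ 4 = x a $ 4) \<and> ae a b (\<lambda>t. x t $ 2 * u1 t = x t $ 1 * u2 t))"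
proof -
  have x13: "x t $ 1 * x t $ 3 = 0" if "t \<in> {a..b}" for t using x3_x1_cubed_const[OF R that] z by auto
  have e: "ae a b (\<lambda>t. u1 t * x t $ 3 = 0)"
  proof (rule ae_mono2[OF R prim_zero_deriv[OF prim_mult[OF x1_prim x3_prim] x13]])
    fix t assume r: "u1 t * (3 * x t $ 3 + 2 * x t $ 1 * x t $ 2) = 2 * (x t $ 1)\<^sup>2 * u2 t"
      and r': "u1 t * x t $ 3 + x t $ 1 * (2 * x t $ 2 * u1 t - 2 * x t $ 1 * u2 t) = 0"
    have "2 * (u1 t * x t $ 3) = (u1 t * (3 * x t $ 3 + 2 * x t $ 1 * x t $ 2) - 2 * (x t $ 1)\<^sup>2 * u2 t)
      - (u1 t * x t $ 3 + x t $ 1 * (2 * x t $ 2 * u1 t - 2 * x t $ 1 * u2 t))"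
      by (simp add: algebra_simps power2_eq_square)
    then show "u1 t * x t $ 3 = 0" using r r' by simp
  qed
  have sq: "x t $ 3 * x t $ 3 = x a $ 3 * x a $ 3" if t: "t \<in> {a..b}" for t
  proof (rule prim_zero_const[OF prim_mult[OF x3_prim x3_prim] _ t], rule ae_mono[OF e])
    fix t assume t: "t \<in> {a..b}" and r: "u1 t * x t $ 3 = 0"
    have "(2 * x t $ 2 * u1 t - 2 * x t $ 1 * u2 t) * x t $ 3 + x t $ 3 * (2 * x t $ 2 * u1 t - 2 * x t $ 1 * u2 t)
      = 4 * x t $ 2 * (u1 t * x t $ 3) - 4 * u2 t * (x t $ 1 * x t $ 3)" by (simp add: algebra_simps)
    then show "(2 * x t $ 2 * u1 t - 2 * x t $ 1 * u2 t) * x t $ 3 + x t $ 3 * (2 * x t $ 2 * u1 t - 2 * x t $ 1 * u2 t) = 0"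
      using r x13[OF t] by simp
  qed
  have x4: "x t $ 4 = x a $ 4" if t: "t \<in> {a..b}" for t
    by (rule prim_zero_const[OF x4_prim _ t], rule ae_mono[OF e]) (simp add: power2_eq_square mult.commute)
  show ?thesis
  proof (cases "x a $ 3 = 0")
    case True
    then have x3: "x t $ 3 = 0" if "t \<in> {a..b}" for t using sq[OF that] by simp
    have "ae a b (\<lambda>t. x t $ 2 * u1 t = x t $ 1 * u2 t)"
      by (rule ae_mono[OF prim_zero_deriv[OF x3_prim x3]]) (simp_all add: algebra_simps)
    then show ?thesis using x3 x4 by blast
  next
    case False
    then have x3nz: "x t $ 3 \<noteq> 0" if "t \<in> {a..b}" for t using sq[OF that] by auto
    then have x1: "x t $ 1 = 0" if "t \<in> {a..b}" for t using x13[OF that] that by auto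
    have x3: "x t $ 3 = x a $ 3" if t: "t \<in> {a..b}" for t
      by (rule prim_zero_const[OF x3_prim _ t], rule ae_mono[OF e]) (simp add: x1 x3nz)
    have "smooth_curve_on {a..b} x"
    proof (rule line_smooth[of 0 1])
      show "x t $ 3 = x a $ 3" "x t $ 4 = x a $ 4" "x t $ 1 * 1 = x t $ 2 * 0" if "t \<in> {a..b}" for t
        using x1[OF that] by (simp_all only: x3[OF that] x4[OF that] mult_zero_right mult_1_right)
    qed simp
    then show ?thesis by blast
  qed
qed

text \<open>\<open>w\<close> squared over \<open>S\<close> is a constant times the squared sine of
  the angle between \<open>x r\<close> and the moving point. The velocity is radial, so this
  quantity is constant, and it vanishes at time \<open>r\<close>.\<close>

lemma ray:
  assumes R: "ae a b (\<lambda>t. x t $ 2 * u1 t = x t $ 1 * u2 t)" and st: "a \<le> s" "t \<le> b"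
    and nz: "\<And>\<tau>. \<tau> \<in> {s..t} \<Longrightarrow> x \<tau> $ 1 \<noteq> 0 \<or> x \<tau> $ 2 \<noteq> 0"
    and r: "r \<in> {s..t}" "\<tau> \<in> {s..t}"
  shows "x \<tau> $ 1 * x r $ 2 = x \<tau> $ 2 * x r $ 1"
proof -
  define w where "w \<tau> = x r $ 2 * x \<tau> $ 1 - x r $ 1 * x \<tau> $ 2" for \<tau>
  define S where "S \<tau> = x \<tau> $ 1 * x \<tau> $ 1 + x \<tau> $ 2 * x \<tau> $ 2" for \<tau>
  have S: "S \<tau> > 0" if "\<tau> \<in> {s..t}" for \<tau> using nz[OF that] unfolding S_def by (auto simp: sum_squares_gt_zero_iff)
  note p1 = prim_subset[OF x1_prim st] and p2 = prim_subset[OF x2_prim st]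
  have pw: "prim s t w (\<lambda>\<tau>. x r $ 2 * u1 \<tau> - x r $ 1 * u2 \<tau>)"
    unfolding w_def[abs_def] by (intro prim_diff prim_cmult p1 p2)
  have pS: "prim s t S (\<lambda>\<tau>. (u1 \<tau> * x \<tau> $ 1 + x \<tau> $ 1 * u1 \<tau>) + (u2 \<tau> * x \<tau> $ 2 + x \<tau> $ 2 * u2 \<tau>))"
    unfolding S_def[abs_def] by (intro prim_add prim_mult p1 p2)
  have pi: "prim s t (\<lambda>\<tau>. 1 / S \<tau>) (\<lambda>\<tau>. - ((u1 \<tau> * x \<tau> $ 1 + x \<tau> $ 1 * u1 \<tau>) + (u2 \<tau> * x \<tau> $ 2 + x \<tau> $ 2 * u2 \<tau>)) / (S \<tau>)\<^sup>2)"
    by (rule prim_recip[OF pS]) (use S in force)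
  define D where "D \<tau> = (w \<tau> * w \<tau>) * (1 / S \<tau>)" for \<tau>
  note pD = prim_mult[OF prim_mult[OF pw pw] pi, folded D_def]
  have D: "D \<tau> = D s" if "\<tau> \<in> {s..t}" for \<tau>
  proof (rule prim_zero_const[OF pD _ that], rule ae_mono[OF ae_subset[OF R st]])
    fix \<tau> assume t: "\<tau> \<in> {s..t}" and e: "x \<tau> $ 2 * u1 \<tau> = x \<tau> $ 1 * u2 \<tau>"
    have "(x r $ 2 * u1 \<tau> - x r $ 1 * u2 \<tau>) * S \<tau> - w \<tau> * (x \<tau> $ 1 * u1 \<tau> + x \<tau> $ 2 * u2 \<tau>) =
       (x r $ 2 * x \<tau> $ 2 + x r $ 1 * x \<tau> $ 1) * (x \<tau> $ 2 * u1 \<tau> - x \<tau> $ 1 * u2 \<tau>)"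
      unfolding S_def w_def by (simp add: algebra_simps)
    then have e1: "(x r $ 2 * u1 \<tau> - x r $ 1 * u2 \<tau>) * S \<tau> = w \<tau> * (x \<tau> $ 1 * u1 \<tau> + x \<tau> $ 2 * u2 \<tau>)" using e by simp
    have "((x r $ 2 * u1 \<tau> - x r $ 1 * u2 \<tau>) * w \<tau> + w \<tau> * (x r $ 2 * u1 \<tau> - x r $ 1 * u2 \<tau>)) * (1 / S \<tau>) +
      w \<tau> * w \<tau> * (- ((u1 \<tau> * x \<tau> $ 1 + x \<tau> $ 1 * u1 \<tau>) + (u2 \<tau> * x \<tau> $ 2 + x \<tau> $ 2 * u2 \<tau>)) / (S \<tau>)\<^sup>2) =
      2 * w \<tau> * ((x r $ 2 * u1 \<tau> - x r $ 1 * u2 \<tau>) * S \<tau> - w \<tau> * (x \<tau> $ 1 * u1 \<tau> + x \<tau> $ 2 * u2 \<tau>)) / (S \<tau>)\<^sup>2"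
      using S[OF t] by (simp add: field_simps power2_eq_square)
    then show "((x r $ 2 * u1 \<tau> - x r $ 1 * u2 \<tau>) * w \<tau> + w \<tau> * (x r $ 2 * u1 \<tau> - x r $ 1 * u2 \<tau>)) * (1 / S \<tau>) +
      w \<tau> * w \<tau> * (- ((u1 \<tau> * x \<tau> $ 1 + x \<tau> $ 1 * u1 \<tau>) + (u2 \<tau> * x \<tau> $ 2 + x \<tau> $ 2 * u2 \<tau>)) / (S \<tau>)\<^sup>2) = 0"
      using e1 by simp
  qed
  have "D r = 0" unfolding D_def w_def by (simp add: mult.commute)
  then have "D \<tau> = 0" using D[OF r(1)] D[OF r(2)] by simp
  then have "w \<tau> = 0" unfolding D_def using S[OF r(2)] by simp
  then show ?thesis unfolding w_def by (simp add: mult.commute)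
qed

text \<open>Since \<open>x3\<close> and \<open>x4\<close> are constant, injectivity allows at most
  one passage through the origin of the plane; away from it the motion stays on a line through the
  origin.\<close>

lemma planar_smooth_or_corner:
  assumes R: "ae a b (\<lambda>t. x t $ 2 * u1 t = x t $ 1 * u2 t)"
    and x3: "\<And>t. t \<in> {a..b} \<Longrightarrow> x t $ 3 = 0" and x4: "\<And>t. t \<in> {a..b} \<Longrightarrow> x t $ 4 = c4"
  shows "smooth_curve_on {a..b} x \<or> (\<exists>t0\<in>{a<..<b}. x t0 $ 1 = 0 \<and> x t0 $ 2 = 0 \<and>
    (\<forall>t\<in>{a..t0}. x t $ 1 * x a $ 2 = x t $ 2 * x a $ 1) \<and> (\<forall>t\<in>{t0..b}. x t $ 1 * x b $ 2 = x t $ 2 * x b $ 1) \<and>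
    x a $ 2 * x b $ 1 - x a $ 1 * x b $ 2 \<noteq> 0)"
proof (cases "\<exists>t0\<in>{a<..<b}. x t0 $ 1 = 0 \<and> x t0 $ 2 = 0")
  case False
  define r where "r = (a + b) / 2"
  have r: "r \<in> {a<..<b}" unfolding r_def using lt by auto
  \<comment> \<open>The curve may start or end at the origin, where \<open>ray\<close> does not
    apply; the end points are added afterwards by continuity.\<close>
  have in_open: "x t $ 1 * x r $ 2 = x t $ 2 * x r $ 1" if t: "t \<in> {a<..<b}" for t
    by (rule ray[OF R, of "min r t" "max r t"]) (use r t False in \<open>auto simp: min_def max_def split: if_splits\<close>)
  have p: "prim a b (\<lambda>t. x r $ 2 * x t $ 1 - x r $ 1 * x t $ 2) (\<lambda>t. x r $ 2 * u1 t - x r $ 1 * u2 t)"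
    by (intro prim_diff prim_cmult x1_prim x2_prim)
  have "x r $ 2 * x t $ 1 - x r $ 1 * x t $ 2 = 0" if t: "t \<in> {a..b}" for t
    by (rule ae_cont_zero[OF _ prim_cont[OF p] lt t], rule ae_mono[OF ae_interior]) (use in_open in \<open>simp add: mult.commute\<close>)
  then have "x t $ 1 * x r $ 2 = x t $ 2 * x r $ 1" if "t \<in> {a..b}" for t using that by (simp add: mult.commute)
  then have "smooth_curve_on {a..b} x"
    by (rule line_smooth[of "x r $ 1" "x r $ 2" 0 c4, rotated]) (use x3 x4 False r in auto)
  then show ?thesis by blast
next
  case True
  then obtain t0 where t0: "t0 \<in> {a<..<b}" "x t0 $ 1 = 0" "x t0 $ 2 = 0" by blast
  have only: "x t $ 1 \<noteq> 0 \<or> x t $ 2 \<noteq> 0" if t: "t \<in> {a..b}" "t \<noteq> t0" for t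
  proof (rule ccontr)
    assume "\<not> ?thesis"
    then have "x t = x t0" unfolding vec4_eq_iff using t0 x3[of t] x3[of t0] x4[of t] x4[of t0] t by auto
    then have "t = t0" using inj_onD[OF x_inj] t t0(1) by auto
    then show False using t by simp
  qed
  have L: "x t $ 1 * x a $ 2 = x t $ 2 * x a $ 1" if t: "t \<in> {a..t0}" for t
  proof (cases "t = t0")
    case False
    show ?thesis by (rule ray[OF R, of a t]) (use t0 t False only in auto)
  qed (use t0 in simp)
  have Rr: "x t $ 1 * x b $ 2 = x t $ 2 * x b $ 1" if t: "t \<in> {t0..b}" for t
  proof (cases "t = t0")
    case False
    show ?thesis by (rule ray[OF R, of t b]) (use t0 t False only in auto)
  qed (use t0 in simp)
  show ?thesis
  proof (cases "x a $ 2 * x b $ 1 - x a $ 1 * x b $ 2 = 0")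
    case False then show ?thesis using t0 L Rr by blast
  next
    case True
    have nzb: "x b $ 1 \<noteq> 0 \<or> x b $ 2 \<noteq> 0" using only[of b] t0 by auto
    have "x t $ 1 * x a $ 2 = x t $ 2 * x a $ 1" if t: "t \<in> {a..b}" for t
    proof (cases "t \<le> t0")
      case True then show ?thesis using L t by auto
    next
      case False
      then have e: "x t $ 1 * x b $ 2 = x t $ 2 * x b $ 1" using Rr t by auto
      \<comment> \<open>The two pieces lie on parallel lines through the origin, hence on one line;
        one coordinate of \<open>x b\<close> is nonzero and can be cancelled.\<close>
      have "x b $ 1 * (x t $ 1 * x a $ 2 - x t $ 2 * x a $ 1) = x t $ 1 * (x a $ 2 * x b $ 1 - x a $ 1 * x b $ 2) + x a $ 1 * (x t $ 1 * x b $ 2 - x t $ 2 * x b $ 1)"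
        "x b $ 2 * (x t $ 1 * x a $ 2 - x t $ 2 * x a $ 1) = x t $ 2 * (x a $ 2 * x b $ 1 - x a $ 1 * x b $ 2) + x a $ 2 * (x t $ 1 * x b $ 2 - x t $ 2 * x b $ 1)"
        by (simp_all add: algebra_simps)
      then show ?thesis using e True nzb by auto
    qed
    then have "smooth_curve_on {a..b} x"
      by (rule line_smooth[of "x a $ 1" "x a $ 2" 0 c4, rotated]) (use x3 x4 only[of a] t0 in auto)
    then show ?thesis by blast
  qed
qed

end

section \<open>Shortcuts at a corner\<close>

definition pt :: "real \<Rightarrow> real \<Rightarrow> real \<Rightarrow> real \<Rightarrow> real^4" where "pt w x y z = vector [w,x,y,z]"

lemma pt_nth: "pt w x y z $ 1 = w" "pt w x y z $ 2 = x" "pt w x y z $ 3 = y" "pt w x y z $ 4 = z"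
  unfolding pt_def vector4_nth by simp_all

lemma pt_eq: "pt w x y z = pt w' x' y' z' \<longleftrightarrow> w = w' \<and> x = x' \<and> y = y' \<and> z = z'"
  unfolding vec4_eq_iff pt_nth ..

lemma pt_cube: "pt w x y z \<in> cube R \<longleftrightarrow> \<bar>w\<bar> \<le> R \<and> \<bar>x\<bar> \<le> R \<and> \<bar>y\<bar> \<le> R \<and> \<bar>z\<bar> \<le> R"
  unfolding cube_def mem_Collect_eq forall_4 pt_nth ..

text \<open>The point reached in unit time under the constant controls \<open>h1\<close>,
  \<open>h2\<close>; see \<open>reach_segment\<close>.\<close>

definition seg :: "real^4 \<Rightarrow> real \<Rightarrow> real \<Rightarrow> real^4" where
  "seg x h1 h2 = pt (x$1 + h1) (x$2 + h2) (x$3 + 2 * (x$2 * h1 - x$1 * h2))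
    (x$4 + h1 * ((x$3)\<^sup>2 + x$3 * (2 * (x$2 * h1 - x$1 * h2)) + (2 * (x$2 * h1 - x$1 * h2))\<^sup>2 / 3))"

text \<open>A crude bound for one arc with controls at most 1: \<open>x3\<close> changes by at most
  4 R, and \<open>x4\<close> by at most R^2 + 4 R^2 + 16 R^2.\<close>

definition grow :: "real \<Rightarrow> real" where "grow R = R + 21 * R\<^sup>2"

lemma grow_ge: "1 \<le> R \<Longrightarrow> R \<le> grow R" unfolding grow_def by simp
lemma grow_ge_1: "1 \<le> R \<Longrightarrow> 1 \<le> grow R" using grow_ge by fastforce
lemma cube_mono: "x \<in> cube R \<Longrightarrow> R \<le> S \<Longrightarrow> x \<in> cube S"
  unfolding cube_def mem_Collect_eq using order_trans by blast

lemma seg_cube: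
  assumes x: "x \<in> cube R" and R: "1 \<le> R" and h: "\<bar>h1\<bar> \<le> 1" "\<bar>h2\<bar> \<le> 1"
  shows "seg x h1 h2 \<in> cube (grow R)"
proof -
  have xi: "\<bar>x $ i\<bar> \<le> R" for i using x unfolding cube_def by blast
  define k where "k = 2 * (x$2 * h1 - x$1 * h2)"
  have "\<bar>x$2 * h1\<bar> \<le> R * 1" "\<bar>x$1 * h2\<bar> \<le> R * 1" unfolding abs_mult using xi R h by (intro mult_mono; auto)+
  moreover have "\<bar>2 * (c - d)\<bar> \<le> 4 * R" if "\<bar>c\<bar> \<le> R * 1" "\<bar>d\<bar> \<le> R * 1" for c d :: real
    using that unfolding mult_1_right right_diff_distrib by linarith
  ultimately have k: "\<bar>k\<bar> \<le> 4 * R" unfolding k_def by blast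
  have RR: "R \<le> R\<^sup>2" using R by (simp add: power2_eq_square)
  have s1: "\<bar>(x$3)\<^sup>2\<bar> \<le> R\<^sup>2" using power_mono[OF xi[of 3], of 2] by simp
  have s2: "\<bar>x$3 * k\<bar> \<le> 4 * R\<^sup>2" using mult_mono[OF xi[of 3] k] R by (simp add: abs_mult power2_eq_square)
  have "k\<^sup>2 \<le> 16 * R\<^sup>2" using power_mono[OF k, of 2] by (simp add: power_mult_distrib)
  then have s3: "\<bar>k\<^sup>2 / 3\<bar> \<le> 16 * R\<^sup>2" using zero_le_power2[of k] by linarith
  have "\<bar>(x$3)\<^sup>2 + x$3 * k + k\<^sup>2 / 3\<bar> \<le> 21 * R\<^sup>2" using s1 s2 s3 by linarith
  then have h4: "\<bar>h1 * ((x$3)\<^sup>2 + x$3 * k + k\<^sup>2 / 3)\<bar> \<le> 1 * (21 * R\<^sup>2)" unfolding abs_mult using h by (intro mult_mono) auto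
  then show ?thesis
    unfolding seg_def pt_cube k_def[symmetric] grow_def
  proof (intro conjI)
    have g: "R + 4 * R \<le> R + 21 * R\<^sup>2" "R + 1 \<le> R + 21 * R\<^sup>2" using RR R by linarith+
    show "\<bar>x $ 1 + h1\<bar> \<le> R + 21 * R\<^sup>2" using abs_triangle_ineq[of "x$1" h1] xi[of 1] h(1) g(2) by linarith
    show "\<bar>x $ 2 + h2\<bar> \<le> R + 21 * R\<^sup>2" using abs_triangle_ineq[of "x$2" h2] xi[of 2] h(2) g(2) by linarith
    show "\<bar>x $ 3 + k\<bar> \<le> R + 21 * R\<^sup>2" using abs_triangle_ineq[of "x$3" k] xi[of 3] k g(1) by linarith
    show "\<bar>x $ 4 + h1 * ((x $ 3)\<^sup>2 + x $ 3 * k + k\<^sup>2 / 3)\<bar> \<le> R + 21 * R\<^sup>2"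
      using order_trans[OF abs_triangle_ineq add_mono[OF xi[of 4] h4]] by simp
  qed
qed

context metric
begin

lemma q_scale: "q x (r * h1) (r * h2) = r\<^sup>2 * q x h1 h2"
  unfolding q_def by (simp add: power2_eq_square algebra_simps)

lemma sqrt_q_scale: "sqrt (q x (r * h1) (r * h2)) = \<bar>r\<bar> * sqrt (q x h1 h2)"
  unfolding q_scale by (simp add: real_sqrt_mult)

lemma reach_mono: "reach x y l \<Longrightarrow> l \<le> m \<Longrightarrow> reach x y m"
  unfolding reach_def by (elim exE conjE, intro exI conjI, assumption+, rule order_trans)

lemma reach_seg:
  assumes "\<And>t. t \<in> {0..1} \<Longrightarrow> sqrt (q (seg x (t * h1) (t * h2)) h1 h2) \<le> l"
  shows "reach x (seg x h1 h2) l"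
proof (rule reach_segment[where ?h1.0=h1 and ?h2.0=h2])
  show "seg x h1 h2 = vector [x$1 + h1, x$2 + h2, x$3 + 2 * (x$2 * h1 - x$1 * h2),
    x$4 + h1 * ((x$3)\<^sup>2 + x$3 * (2 * (x$2 * h1 - x$1 * h2)) + (2 * (x$2 * h1 - x$1 * h2))\<^sup>2 / 3)]"
    unfolding seg_def pt_def ..
  fix t :: real assume t: "t \<in> {0..1}"
  have "vector [x$1 + t * h1, x$2 + t * h2, x$3 + t * (2 * (x$2 * h1 - x$1 * h2)),
        x$4 + h1 * ((x$3)\<^sup>2 * t + x$3 * (2 * (x$2 * h1 - x$1 * h2)) * t\<^sup>2 + (2 * (x$2 * h1 - x$1 * h2))\<^sup>2 / 3 * t^3)]
    = seg x (t * h1) (t * h2)"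
    unfolding seg_def pt_def[symmetric] pt_eq by (simp add: algebra_simps power2_eq_square power3_eq_cube)
  then show "sqrt (q (vector [x$1 + t * h1, x$2 + t * h2, x$3 + t * (2 * (x$2 * h1 - x$1 * h2)),
        x$4 + h1 * ((x$3)\<^sup>2 * t + x$3 * (2 * (x$2 * h1 - x$1 * h2)) * t\<^sup>2 + (2 * (x$2 * h1 - x$1 * h2))\<^sup>2 / 3 * t^3)]) h1 h2) \<le> l"
    using assms[OF t] by simp
qed

lemma q_le_l1:
  assumes "\<bar>A1\<bar> \<le> M" "\<bar>B1\<bar> \<le> M" "\<bar>C1\<bar> \<le> (M::real)"
  shows "\<bar>A1 * h1\<^sup>2 + 2 * B1 * h1 * h2 + C1 * h2\<^sup>2\<bar> \<le> M * (\<bar>h1\<bar> + \<bar>h2\<bar>)\<^sup>2"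
proof -
  have "\<bar>A1 * h1\<^sup>2\<bar> \<le> M * \<bar>h1\<bar>\<^sup>2" "\<bar>B1 * (h1 * h2)\<bar> \<le> M * (\<bar>h1\<bar> * \<bar>h2\<bar>)" "\<bar>C1 * h2\<^sup>2\<bar> \<le> M * \<bar>h2\<bar>\<^sup>2"
    unfolding abs_mult using assms by (auto intro!: mult_mono)
  then have "\<bar>A1 * h1\<^sup>2 + 2 * (B1 * (h1 * h2)) + C1 * h2\<^sup>2\<bar> \<le> M * \<bar>h1\<bar>\<^sup>2 + 2 * (M * (\<bar>h1\<bar> * \<bar>h2\<bar>)) + M * \<bar>h2\<bar>\<^sup>2" by linarith
  also have "\<dots> = M * (\<bar>h1\<bar> + \<bar>h2\<bar>)\<^sup>2" by (simp add: power2_eq_square algebra_simps)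
  finally show ?thesis by (simp add: mult.assoc)
qed

lemma q_bound:
  obtains M where "M > 0" "\<And>z h1 h2. z \<in> cube R \<Longrightarrow> sqrt (q z h1 h2) \<le> M * (\<bar>h1\<bar> + \<bar>h2\<bar>)"
proof -
  obtain MA where MA: "MA > 0" "\<And>x. x \<in> cube R \<Longrightarrow> \<bar>A x\<bar> \<le> MA" using cube_bounded_smooth[OF smooth(1)] by blast
  obtain MB where MB: "MB > 0" "\<And>x. x \<in> cube R \<Longrightarrow> \<bar>B x\<bar> \<le> MB" using cube_bounded_smooth[OF smooth(2)] by blast
  obtain MC where MC: "MC > 0" "\<And>x. x \<in> cube R \<Longrightarrow> \<bar>C x\<bar> \<le> MC" using cube_bounded_smooth[OF smooth(3)] by blast
  define M where "M = MA + MB + MC"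
  have M0: "M > 0" unfolding M_def using MA MB MC by simp
  show ?thesis
  proof (rule that[of "sqrt M"])
    show "sqrt M > 0" using M0 by simp
    fix z h1 h2 assume z: "z \<in> cube R"
    have "q z h1 h2 \<le> M * (\<bar>h1\<bar> + \<bar>h2\<bar>)\<^sup>2"
      using q_le_l1[of "A z" M "B z" "C z" h1 h2] MA(2)[OF z] MB(2)[OF z] MC(2)[OF z] MA(1) MB(1) MC(1)
      unfolding q_def M_def by linarith
    then have "sqrt (q z h1 h2) \<le> sqrt (M * (\<bar>h1\<bar> + \<bar>h2\<bar>)\<^sup>2)" by simp
    then show "sqrt (q z h1 h2) \<le> sqrt M * (\<bar>h1\<bar> + \<bar>h2\<bar>)" by (simp add: real_sqrt_mult)
  qed
qed

lemma sqrt_diff_le: assumes "0 \<le> a" "0 \<le> b" "\<bar>a - b\<bar> \<le> d\<^sup>2" "0 \<le> d" shows "\<bar>sqrt a - sqrt b\<bar> \<le> d"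
proof -
  have "sqrt u \<le> sqrt v + d" if "0 \<le> v" "u \<le> v + d\<^sup>2" for u v
  proof (rule real_le_lsqrt)
    have "v + d\<^sup>2 \<le> (sqrt v + d)\<^sup>2" using that assms(4) by (simp add: power2_sum)
    then show "u \<le> (sqrt v + d)\<^sup>2" using that(2) by linarith
  qed (use that assms(4) in auto)
  from this[of b a] this[of a b] show ?thesis using assms by (simp add: abs_le_iff)
qed

text \<open>Coefficients within \<eta>^2 give forms within \<eta>^2 times the square of the size of
  \<open>h\<close>, and the root of that is homogeneous of degree one. One radius thus serves all
  directions and all scales.\<close>

lemma q_near:
  assumes \<eta>: "\<eta> > 0"
  obtains \<rho> where "\<rho> > 0" "\<And>z h1 h2. (\<And>i. \<bar>z $ i - p $ i\<bar> \<le> \<rho>) \<Longrightarrow>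
     \<bar>sqrt (q z h1 h2) - sqrt (q p h1 h2)\<bar> \<le> \<eta> * (\<bar>h1\<bar> + \<bar>h2\<bar>)"
proof -
  have "isCont F p \<Longrightarrow> \<exists>d>0. \<forall>z. dist z p < d \<longrightarrow> dist (F z) (F p) < \<eta>\<^sup>2" for F :: "real^4 \<Rightarrow> real"
    using \<eta> unfolding continuous_at_eps_delta by simp
  moreover have "isCont A p" "isCont B p" "isCont C p"
    using coeff_cont[of UNIV] by (simp_all add: continuous_on_eq_continuous_at)
  ultimately obtain dA dB dC where d: "dA > 0" "\<forall>z. dist z p < dA \<longrightarrow> dist (A z) (A p) < \<eta>\<^sup>2"
    "dB > 0" "\<forall>z. dist z p < dB \<longrightarrow> dist (B z) (B p) < \<eta>\<^sup>2" "dC > 0" "\<forall>z. dist z p < dC \<longrightarrow> dist (C z) (C p) < \<eta>\<^sup>2" by metis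
  \<comment> \<open>The division by 5 leaves room for the sum of four coordinate
    differences.\<close>
  define \<rho> where "\<rho> = min dA (min dB dC) / 5"
  show ?thesis
  proof (rule that[of \<rho>])
    show "\<rho> > 0" unfolding \<rho>_def using d by simp
    fix z :: "real^4" and h1 h2 assume z: "\<And>i. \<bar>z $ i - p $ i\<bar> \<le> \<rho>"
    have mu: "0 < min dA (min dB dC)" using d by simp
    have "dist z p \<le> (\<Sum>i\<in>UNIV. \<bar>(z - p) $ i\<bar>)" unfolding dist_norm by (rule norm_le_l1_cart)
    also have "\<dots> \<le> 4 * \<rho>" unfolding sum_4 using z[of 1] z[of 2] z[of 3] z[of 4] by simp
    also have "\<dots> < min dA (min dB dC)" unfolding \<rho>_def using mu by linarith
    finally have "\<bar>A z - A p\<bar> < \<eta>\<^sup>2" "\<bar>B z - B p\<bar> < \<eta>\<^sup>2" "\<bar>C z - C p\<bar> < \<eta>\<^sup>2" using d by (auto simp: dist_real_def)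
    then have "\<bar>(A z - A p) * h1\<^sup>2 + 2 * (B z - B p) * h1 * h2 + (C z - C p) * h2\<^sup>2\<bar> \<le> \<eta>\<^sup>2 * (\<bar>h1\<bar> + \<bar>h2\<bar>)\<^sup>2"
      by (intro q_le_l1) auto
    moreover have "(A z - A p) * h1\<^sup>2 + 2 * (B z - B p) * h1 * h2 + (C z - C p) * h2\<^sup>2 = q z h1 h2 - q p h1 h2"
      unfolding q_def by (simp add: algebra_simps)
    ultimately have "\<bar>q z h1 h2 - q p h1 h2\<bar> \<le> (\<eta> * (\<bar>h1\<bar> + \<bar>h2\<bar>))\<^sup>2" by (simp add: power_mult_distrib)
    then show "\<bar>sqrt (q z h1 h2) - sqrt (q p h1 h2)\<bar> \<le> \<eta> * (\<bar>h1\<bar> + \<bar>h2\<bar>)"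
      by (intro sqrt_diff_le) (use \<eta> in auto)
  qed
qed

lemma reach_seg_cube:
  assumes M: "\<And>z h1 h2. z \<in> cube S \<Longrightarrow> sqrt (q z h1 h2) \<le> M * (\<bar>h1\<bar> + \<bar>h2\<bar>)"
    and x: "x \<in> cube R" "1 \<le> R" "grow R \<le> S" and h: "\<bar>h1\<bar> \<le> 1" "\<bar>h2\<bar> \<le> 1"
  shows "reach x (seg x h1 h2) (M * (\<bar>h1\<bar> + \<bar>h2\<bar>))"
proof (rule reach_seg)
  fix t :: real assume t: "t \<in> {0..1}"
  have "\<bar>t * h1\<bar> \<le> 1 * 1" "\<bar>t * h2\<bar> \<le> 1 * 1" unfolding abs_mult using t h by (intro mult_mono; auto)+
  then have "seg x (t * h1) (t * h2) \<in> cube S" using cube_mono[OF seg_cube[OF x(1,2)] x(3)] by simp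
  then show "sqrt (q (seg x (t * h1) (t * h2)) h1 h2) \<le> M * (\<bar>h1\<bar> + \<bar>h2\<bar>)" by (rule M)
qed

text \<open>A loop in the plane: a step \<open>\<delta>\<close> in the second coordinate, a run of
  \<open>D\<close> with slope \<open>m\<close>, the step undone, and the return along the ray. On
  the ray the third coordinate does not change, so the net change is that of the parallel run and
  the two steps.\<close>

lemma reach_loop:
  assumes M: "\<And>z h1 h2. z \<in> cube S \<Longrightarrow> sqrt (q z h1 h2) \<le> M * (\<bar>h1\<bar> + \<bar>h2\<bar>)"
    and p: "pt X (m * X) s y \<in> cube R" "1 \<le> R" "grow (grow (grow (grow R))) \<le> S"
    and h: "\<bar>\<delta>\<bar> \<le> 1" "\<bar>D\<bar> \<le> 1" "\<bar>m * D\<bar> \<le> 1"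
  defines "\<Phi> \<equiv> (s - 2 * X * \<delta>)\<^sup>2 + (s - 2 * X * \<delta>) * (2 * \<delta> * D) + (2 * \<delta> * D)\<^sup>2 / 3 - (s + 4 * \<delta> * D)\<^sup>2"
  shows "reach (pt X (m * X) s y) (pt X (m * X) (s + 4 * \<delta> * D) (y + D * \<Phi>))
      (M * (2 * \<bar>\<delta>\<bar> + 2 * (\<bar>D\<bar> + \<bar>m * D\<bar>)))"
    "pt X (m * X) (s + 4 * \<delta> * D) (y + D * \<Phi>) \<in> cube (grow (grow (grow (grow R))))"
proof -
  let ?y = "y + D * ((s - 2 * X * \<delta>)\<^sup>2 + (s - 2 * X * \<delta>) * (2 * \<delta> * D) + (2 * \<delta> * D)\<^sup>2 / 3)"
  have e1: "seg (pt X (m * X) s y) 0 \<delta> = pt X (m * X + \<delta>) (s - 2 * X * \<delta>) y"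
    unfolding seg_def pt_nth pt_eq by simp
  have e2: "seg (pt X (m * X + \<delta>) (s - 2 * X * \<delta>) y) D (m * D) = pt (X + D) (m * (X + D) + \<delta>) (s - 2 * X * \<delta> + 2 * \<delta> * D) ?y"
    unfolding seg_def pt_nth pt_eq by (simp add: algebra_simps)
  have e3: "seg (pt (X + D) (m * (X + D) + \<delta>) (s - 2 * X * \<delta> + 2 * \<delta> * D) ?y) 0 (- \<delta>) = pt (X + D) (m * (X + D)) (s + 4 * \<delta> * D) ?y"
    unfolding seg_def pt_nth pt_eq by (simp add: algebra_simps)
  have e4: "seg (pt (X + D) (m * (X + D)) (s + 4 * \<delta> * D) ?y) (- D) (- (m * D)) = pt X (m * X) (s + 4 * \<delta> * D) (y + D * \<Phi>)"
    unfolding seg_def pt_nth pt_eq \<Phi>_def by (simp add: algebra_simps)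
  have rsc: "reach x (seg x h1 h2) (M * (\<bar>h1\<bar> + \<bar>h2\<bar>))"
    if "x \<in> cube R'" "1 \<le> R'" "grow R' \<le> S" "\<bar>h1\<bar> \<le> 1" "\<bar>h2\<bar> \<le> 1" for x R' h1 h2
    by (rule reach_seg_cube[where S=S and R=R'], erule M) (rule that)+
  note R = p(2) grow_ge_1[OF p(2)] grow_ge_1[OF grow_ge_1[OF p(2)]] grow_ge_1[OF grow_ge_1[OF grow_ge_1[OF p(2)]]]
  note G = grow_ge[OF R(2)] grow_ge[OF R(3)] grow_ge[OF R(4)]
  have c1: "pt X (m * X + \<delta>) (s - 2 * X * \<delta>) y \<in> cube (grow R)" using seg_cube[OF p(1) R(1), of 0 \<delta>] h unfolding e1 by simp
  have c2: "pt (X + D) (m * (X + D) + \<delta>) (s - 2 * X * \<delta> + 2 * \<delta> * D) ?y \<in> cube (grow (grow R))"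
    using seg_cube[OF c1 R(2) h(2,3)] unfolding e2 .
  have c3: "pt (X + D) (m * (X + D)) (s + 4 * \<delta> * D) ?y \<in> cube (grow (grow (grow R)))"
    using seg_cube[OF c2 R(3), of 0 "-\<delta>"] h unfolding e3 by simp
  show "pt X (m * X) (s + 4 * \<delta> * D) (y + D * \<Phi>) \<in> cube (grow (grow (grow (grow R))))"
    using seg_cube[OF c3 R(4), of "-D" "-(m*D)"] h unfolding e4 by simp
  have r1: "reach (pt X (m * X) s y) (pt X (m * X + \<delta>) (s - 2 * X * \<delta>) y) (M * \<bar>\<delta>\<bar>)"
    using rsc[OF p(1) R(1), of 0 \<delta>] h p(3) G unfolding e1 by simp
  have r2: "reach (pt X (m * X + \<delta>) (s - 2 * X * \<delta>) y) (pt (X + D) (m * (X + D) + \<delta>) (s - 2 * X * \<delta> + 2 * \<delta> * D) ?y) (M * (\<bar>D\<bar> + \<bar>m * D\<bar>))"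
    using rsc[OF c1 R(2), of D "m * D"] h p(3) G unfolding e2 by simp
  have r3: "reach (pt (X + D) (m * (X + D) + \<delta>) (s - 2 * X * \<delta> + 2 * \<delta> * D) ?y) (pt (X + D) (m * (X + D)) (s + 4 * \<delta> * D) ?y) (M * \<bar>\<delta>\<bar>)"
    using rsc[OF c2 R(3), of 0 "-\<delta>"] h p(3) G unfolding e3 by simp
  have r4: "reach (pt (X + D) (m * (X + D)) (s + 4 * \<delta> * D) ?y) (pt X (m * X) (s + 4 * \<delta> * D) (y + D * \<Phi>)) (M * (\<bar>D\<bar> + \<bar>m * D\<bar>))"
    using rsc[OF c3 R(4), of "-D" "-(m * D)"] h p(3) unfolding e4 by simp
  from reach_trans[OF reach_trans[OF reach_trans[OF r1 r2] r3] r4]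
  show "reach (pt X (m * X) s y) (pt X (m * X) (s + 4 * \<delta> * D) (y + D * \<Phi>)) (M * (2 * \<bar>\<delta>\<bar> + 2 * (\<bar>D\<bar> + \<bar>m * D\<bar>)))"
    by (simp add: algebra_simps)
qed

text \<open>A second loop with \<open>- \<delta>\<close> undoes the change of the third coordinate.
  The changes of the fourth are quadratic in \<open>\<delta>\<close> and add up.\<close>

lemma reach_double_loop:
  assumes M: "\<And>z h1 h2. z \<in> cube S \<Longrightarrow> sqrt (q z h1 h2) \<le> M * (\<bar>h1\<bar> + \<bar>h2\<bar>)"
    and p: "pt X (m * X) 0 y \<in> cube R" "1 \<le> R" "grow (grow (grow (grow (grow (grow (grow (grow R))))))) \<le> S"
    and h: "\<bar>\<delta>\<bar> \<le> 1" "\<bar>D\<bar> \<le> 1" "\<bar>m * D\<bar> \<le> 1"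
  shows "reach (pt X (m * X) 0 y) (pt X (m * X) 0 (y + 8 * \<delta>\<^sup>2 * D * (X\<^sup>2 + X * D - 2 / 3 * D\<^sup>2)))
      (M * (4 * \<bar>\<delta>\<bar> + 4 * (\<bar>D\<bar> + \<bar>m * D\<bar>)))"
proof -
  let ?R = "grow (grow (grow (grow R)))"
  have R1: "1 \<le> grow R" "1 \<le> grow (grow R)" "1 \<le> grow (grow (grow R))" "1 \<le> ?R" using p(2) by (auto intro: grow_ge_1)
  have "1 \<le> grow ?R" "1 \<le> grow (grow ?R)" "1 \<le> grow (grow (grow ?R))" using R1(4) by (auto intro: grow_ge_1)
  then have "?R \<le> grow (grow (grow (grow ?R)))" using grow_ge[OF R1(4)] grow_ge[of "grow ?R"] grow_ge[of "grow (grow ?R)"] grow_ge[of "grow (grow (grow ?R))"] by linarith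
  then have S: "?R \<le> S" using p(3) by linarith
  let ?y = "y + D * ((0 - 2 * X * \<delta>)\<^sup>2 + (0 - 2 * X * \<delta>) * (2 * \<delta> * D) + (2 * \<delta> * D)\<^sup>2 / 3 - (0 + 4 * \<delta> * D)\<^sup>2)"
  note rl = reach_loop[where S=S and M=M and X=X and m=m, OF M]
  note r1 = rl[OF _ p(1,2) S h]
  have h': "\<bar>- \<delta>\<bar> \<le> 1" using h(1) by simp
  note r2 = rl(1)[OF _ r1(2) R1(4) p(3) h' h(2,3)]
  have "0 + 4 * \<delta> * D + 4 * (- \<delta>) * D = 0" by simp
  moreover have "?y + D * ((0 + 4 * \<delta> * D - 2 * X * (- \<delta>))\<^sup>2 + (0 + 4 * \<delta> * D - 2 * X * (- \<delta>)) * (2 * (- \<delta>) * D) + (2 * (- \<delta>) * D)\<^sup>2 / 3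
     - (0 + 4 * \<delta> * D + 4 * (- \<delta>) * D)\<^sup>2) = y + 8 * \<delta>\<^sup>2 * D * (X\<^sup>2 + X * D - 2 / 3 * D\<^sup>2)"
    by (simp add: power2_eq_square field_simps)
  ultimately show ?thesis using reach_trans[OF r1(1) r2] by (simp add: algebra_simps)
qed

text \<open>A change of x4 of order e^5 is achieved at cost o(e), by taking D of order e^2 and delta of order e^(3/2).\<close>

lemma reach_correction:
  assumes X: "X \<noteq> 0" and \<kappa>: "\<kappa> > 0" and E: "E \<ge> 0"
  obtains e0 where "e0 > 0" "\<And>e \<tau> y. 0 < e \<Longrightarrow> e \<le> e0 \<Longrightarrow> \<bar>\<tau>\<bar> \<le> E * e ^ 5 \<Longrightarrow> \<bar>y\<bar> \<le> Y \<Longrightarrow>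
     reach (pt X (m * X) 0 y) (pt X (m * X) 0 (y + \<tau>)) (\<kappa> * e)"
proof -
  define R where "R = 1 + \<bar>X\<bar> + \<bar>m * X\<bar> + \<bar>Y\<bar>"
  have R: "1 \<le> R" unfolding R_def by simp
  define S where "S = grow (grow (grow (grow (grow (grow (grow (grow R)))))))"
  obtain M where M: "M > 0" "\<And>z h1 h2. z \<in> cube S \<Longrightarrow> sqrt (q z h1 h2) \<le> M * (\<bar>h1\<bar> + \<bar>h2\<bar>)" using q_bound by blast
  \<comment> \<open>Read off from the final cost: if \<open>\<delta>\<close> and \<open>D\<close>
    are at most \<open>k * e\<close>, the double loop costs at most
    \<open>4 * M * (2 + \<bar>m\<bar>) * k * e\<close>, which is
    \<open>\<kappa> * e\<close>.\<close>
  define k where "k = \<kappa> / (4 * M * (2 + \<bar>m\<bar>))"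
  have k: "k > 0" unfolding k_def using \<kappa> M(1) by (auto intro!: divide_pos_pos mult_pos_pos)
  \<comment> \<open>The entries ensure in turn: powers of \<open>e\<close> decrease,
    \<open>\<delta>\<close> is at most 1, \<open>D\<close> is at most \<open>k * e\<close>,
    \<open>D\<close> is small against \<open>X\<close>, \<open>m * D\<close> is at most 1, and
    \<open>\<delta>\<close> is at most \<open>k * e\<close>.\<close>
  define e0 where "e0 = min (min 1 (1 / k)) (min (min k (\<bar>X\<bar> / 4)) (min (1 / (1 + \<bar>m\<bar>)) (4 * X\<^sup>2 * k\<^sup>2 / (E + 1))))"
  have e0: "e0 > 0" unfolding e0_def using k X E by (auto intro!: divide_pos_pos mult_pos_pos)
  show ?thesis
  proof (rule that[OF e0])
    fix e \<tau> y :: real assume e: "0 < e" "e \<le> e0" and t: "\<bar>\<tau>\<bar> \<le> E * e ^ 5" and y: "\<bar>y\<bar> \<le> Y"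
    have e': "e \<le> 1" "e \<le> 1 / k" "e \<le> k" "e \<le> \<bar>X\<bar> / 4" "e \<le> 1 / (1 + \<bar>m\<bar>)" "e \<le> 4 * X\<^sup>2 * k\<^sup>2 / (E + 1)"
      using e(2) unfolding e0_def by auto
    \<comment> \<open>The effect of the double loop has the sign of \<open>D\<close>, because
      \<open>\<delta>\<close> enters squared.\<close>
    define D where "D = (if \<tau> \<ge> 0 then e\<^sup>2 else - e\<^sup>2)"
    have aD: "\<bar>D\<bar> = e\<^sup>2" unfolding D_def by simp
    have e2: "e\<^sup>2 \<le> e" using e'(1) e(1) by (simp add: power2_eq_square mult_left_le_one_le)
    define Q where "Q = X\<^sup>2 + X * D - 2 / 3 * D\<^sup>2"
    have DX: "\<bar>D\<bar> \<le> \<bar>X\<bar> / 4" using aD e2 e'(4) by linarith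
    have XX: "\<bar>X\<bar> * \<bar>X\<bar> = X\<^sup>2" by (simp add: power2_eq_square)
    have "\<bar>X * D\<bar> \<le> \<bar>X\<bar> * (\<bar>X\<bar> / 4)" unfolding abs_mult using DX by (intro mult_left_mono) auto
    then have q1: "\<bar>X * D\<bar> \<le> X\<^sup>2 / 4" using XX by simp
    have "\<bar>D\<bar> * \<bar>D\<bar> \<le> (\<bar>X\<bar> / 4) * (\<bar>X\<bar> / 4)" using DX by (intro mult_mono) auto
    then have q2: "D\<^sup>2 \<le> X\<^sup>2 / 16" using XX by (simp add: power2_eq_square)
    have Q: "Q \<ge> X\<^sup>2 / 2" unfolding Q_def using q1 q2 by linarith
    have X2: "X\<^sup>2 > 0" using X by simp
    \<comment> \<open>The square of the required \<open>\<delta>\<close>, solving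
      \<open>8 * d2 * D * Q = \<tau>\<close>; \<open>Q\<close> is at least half of \<open>X\<close>
      squared, so this is of order e^3.\<close>
    define d2 where "d2 = \<tau> / (8 * D * Q)"
    have D0: "D \<noteq> 0" using aD e(1) by auto
    have Q0: "Q > 0" using Q X2 by linarith
    have sg: "\<tau> / D = \<bar>\<tau>\<bar> / e\<^sup>2" unfolding D_def by auto
    have d2: "d2 = (\<bar>\<tau>\<bar> / e\<^sup>2) / (8 * Q)" unfolding d2_def sg[symmetric] by simp
    have d2_0: "d2 \<ge> 0" unfolding d2 using Q0 by simp
    have "\<bar>\<tau>\<bar> / e\<^sup>2 \<le> E * e ^ 3" using t e(1) by (simp add: field_simps eval_nat_numeral)
    then have "d2 \<le> (E * e ^ 3) / (8 * Q)" unfolding d2 using Q0 by (intro divide_right_mono) auto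
    also have "\<dots> \<le> (E * e ^ 3) / (4 * X\<^sup>2)" 
    proof (rule divide_left_mono)
      show "4 * X\<^sup>2 \<le> 8 * Q" using Q by simp
      show "0 \<le> E * e ^ 3" using E e(1) by simp
      show "0 < 8 * Q * (4 * X\<^sup>2)" using Q0 X by simp
    qed
    also have "\<dots> = (E * e / (4 * X\<^sup>2)) * e\<^sup>2" by (simp add: eval_nat_numeral)
    also have "\<dots> \<le> k\<^sup>2 * e\<^sup>2"
    proof (rule mult_right_mono)
      have "E * e \<le> (E + 1) * e" using e(1) by simp
      also have "\<dots> \<le> 4 * X\<^sup>2 * k\<^sup>2" using e'(6) E by (simp add: field_simps)
      finally show "E * e / (4 * X\<^sup>2) \<le> k\<^sup>2" using X2 by (simp add: field_simps)
    qed simp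
    finally have d2le: "d2 \<le> (k * e)\<^sup>2" by (simp add: power_mult_distrib)
    define \<delta> where "\<delta> = sqrt d2"
    have \<delta>: "\<bar>\<delta>\<bar> \<le> k * e" unfolding \<delta>_def using d2le d2_0 k e(1) by (simp add: real_le_lsqrt)
    have "k * e \<le> 1" using e'(2) k by (simp add: field_simps)
    then have \<delta>1: "\<bar>\<delta>\<bar> \<le> 1" using \<delta> by linarith
    have D1: "\<bar>D\<bar> \<le> 1" using aD e2 e'(1) by linarith
    have "\<bar>m * D\<bar> \<le> (1 + \<bar>m\<bar>) * e" unfolding abs_mult aD using e2 by (intro mult_mono) auto
    also have "\<dots> \<le> 1" using e'(5) by (simp add: field_simps add_pos_nonneg)
    finally have mD: "\<bar>m * D\<bar> \<le> 1" .
    have pR: "pt X (m * X) 0 y \<in> cube R" unfolding pt_cube R_def using y by simp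
    have "8 * \<delta>\<^sup>2 * D * Q = \<tau>" unfolding \<delta>_def using d2_0 D0 Q0 by (simp add: d2_def)
    then have r: "reach (pt X (m * X) 0 y) (pt X (m * X) 0 (y + \<tau>)) (M * (4 * \<bar>\<delta>\<bar> + 4 * (\<bar>D\<bar> + \<bar>m * D\<bar>)))"
      using reach_double_loop[where S=S, OF M(2) pR R _ \<delta>1 D1 mD] unfolding Q_def by (simp add: S_def)
    have "e\<^sup>2 \<le> k * e" using e'(3) e(1) by (simp add: power2_eq_square mult_right_mono)
    then have "\<bar>D\<bar> \<le> k * e" using aD by simp
    moreover have "\<bar>m * D\<bar> \<le> \<bar>m\<bar> * (k * e)" unfolding abs_mult using \<open>\<bar>D\<bar> \<le> k * e\<close> by (intro mult_left_mono) auto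
    moreover have "4 * c + 4 * (d + f) \<le> 4 * K + 4 * (K + L)" if "c \<le> K" "d \<le> K" "f \<le> L" for c d f K L :: real
      using that unfolding distrib_left by linarith
    ultimately have "4 * \<bar>\<delta>\<bar> + 4 * (\<bar>D\<bar> + \<bar>m * D\<bar>) \<le> 4 * (k * e) + 4 * (k * e + \<bar>m\<bar> * (k * e))" using \<delta> by blast
    then have "M * (4 * \<bar>\<delta>\<bar> + 4 * (\<bar>D\<bar> + \<bar>m * D\<bar>)) \<le> M * (4 * (k * e) + 4 * (k * e + \<bar>m\<bar> * (k * e)))" using M(1) by (intro mult_left_mono) auto
    also have "\<dots> = (4 * M * (2 + \<bar>m\<bar>) * k) * e" by (simp add: algebra_simps)
    also have "4 * M * (2 + \<bar>m\<bar>) * k = \<kappa>" unfolding k_def using M(1) by simp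
    finally have le: "M * (4 * \<bar>\<delta>\<bar> + 4 * (\<bar>D\<bar> + \<bar>m * D\<bar>)) \<le> \<kappa> * e" .
    show "reach (pt X (m * X) 0 y) (pt X (m * X) 0 (y + \<tau>)) (\<kappa> * e)" by (rule reach_mono[OF r le])
  qed
qed

end

section \<open>Dilations and the shortcut at scale e\<close>

context metric
begin

text \<open>The dilation centred at the point of height \<open>c\<close> over the origin. The
  distribution is invariant under translations in \<open>x4\<close>, so the height is a free
  parameter; this is used to place a shifted shortcut.\<close>

definition dil :: "real \<Rightarrow> real \<Rightarrow> real^4 \<Rightarrow> real^4" where
  "dil e c y = pt (e * y$1) (e * y$2) (e\<^sup>2 * y$3) (c + e ^ 5 * y$4)"

lemma dil_seg: "seg (dil e c y) (e * h1) (e * h2) = dil e c (seg y h1 h2)"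
  unfolding dil_def seg_def pt_nth pt_eq by (simp add: algebra_simps eval_nat_numeral)

lemma seg_bounded: "\<exists>R. \<forall>t\<in>{0..1}. seg y (t * h1) (t * h2) \<in> cube R"
proof -
  have "\<forall>i. continuous_on {0..1} (\<lambda>t. seg y (t * h1) (t * h2) $ i)"
    unfolding forall_4 seg_def pt_nth by (auto intro!: continuous_on_add continuous_on_mult continuous_on_const continuous_on_id continuous_on_diff continuous_on_power continuous_on_divide)
  then have bb: "bm 0 1 (\<lambda>t. seg y (t * h1) (t * h2) $ i)" for i by (intro bm_cont) blast
  have "\<exists>M. M > 0 \<and> (\<forall>t\<in>{0..1}. \<bar>seg y (t * h1) (t * h2) $ i\<bar> \<le> M)" for i
    by (rule bm_bounded[OF bb[of i]]) blast
  then obtain M where M: "\<And>i. M i > 0" "\<And>i t. t \<in> {0..1} \<Longrightarrow> \<bar>seg y (t * h1) (t * h2) $ i\<bar> \<le> M i" by metis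
  have le: "M i \<le> (\<Sum>i\<in>UNIV. M i)" for i by (rule member_le_sum) (auto intro: less_imp_le[OF M(1)])
  have "\<bar>seg y (t * h1) (t * h2) $ i\<bar> \<le> (\<Sum>i\<in>UNIV. M i)" if "t \<in> {0..1}" for t i by (rule order_trans[OF M(2)[OF that] le])
  then have "\<forall>t\<in>{0..1}. seg y (t * h1) (t * h2) \<in> cube (\<Sum>i\<in>UNIV. M i)" unfolding cube_def mem_Collect_eq by (intro ballI allI)
  then show ?thesis by (rule exI)
qed

lemma dil_near:
  assumes "y \<in> cube R" "0 < e" "e \<le> 1" "e * R \<le> \<rho> / 2" "\<bar>c - c0\<bar> \<le> \<rho> / 2"
  shows "\<bar>dil e c y $ i - pt 0 0 0 c0 $ i\<bar> \<le> \<rho>"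
proof -
  have y: "\<bar>y $ i\<bar> \<le> R" for i using assms(1) unfolding cube_def by blast
  have R: "0 \<le> R" using y[of 1] by linarith
  have p: "\<bar>e ^ Suc n * y $ i\<bar> \<le> e * R" for n i
  proof -
    have "e ^ n \<le> 1" using assms(2,3) by (simp add: power_le_one)
    then have "e ^ Suc n \<le> e" using assms(2) by simp
    then show ?thesis unfolding abs_mult using y[of i] assms(2) by (intro mult_mono) auto
  qed
  have "\<bar>e * y $ 1\<bar> \<le> e * R" "\<bar>e * y $ 2\<bar> \<le> e * R" "\<bar>e\<^sup>2 * y $ 3\<bar> \<le> e * R" "\<bar>e ^ 5 * y $ 4\<bar> \<le> e * R"
    using p[of 0 1] p[of 0 2] p[of 1 3] p[of 4 4] by (simp_all add: eval_nat_numeral)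
  then have "\<forall>i. \<bar>dil e c y $ i - pt 0 0 0 c0 $ i\<bar> \<le> \<rho>"
    unfolding forall_4 dil_def pt_nth using assms(4,5) by (intro conjI) linarith+
  then show ?thesis by blast
qed

text \<open>For small \<open>e\<close> the dilated arc stays where the metric is close to the one
  frozen at height \<open>c0\<close>, and its controls are multiplied by \<open>e\<close>. The bound
  is uniform in nearby heights \<open>c\<close>.\<close>

lemma reach_dil_seg:
  assumes \<rho>: "\<rho> > 0" and near: "\<And>z. (\<And>i. \<bar>z $ i - pt 0 0 0 c0 $ i\<bar> \<le> \<rho>) \<Longrightarrow> sqrt (q z h1 h2) \<le> l"
  shows "\<exists>e0>0. \<forall>e c. 0 < e \<longrightarrow> e \<le> e0 \<longrightarrow> \<bar>c - c0\<bar> \<le> \<rho> / 2 \<longrightarrow> reach (dil e c y) (dil e c (seg y h1 h2)) (e * l)"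
proof -
  obtain R0 where R0: "\<forall>t\<in>{0..1}. seg y (t * h1) (t * h2) \<in> cube R0" using seg_bounded by blast
  define R where "R = \<bar>R0\<bar> + 1"
  have R: "seg y (t * h1) (t * h2) \<in> cube R" if "t \<in> {0..1}" for t
    using R0 that cube_mono[of _ R0 R] unfolding R_def by auto
  have Rp: "R > 0" unfolding R_def by simp
  show ?thesis
  proof (intro exI[of _ "min 1 (\<rho> / (2 * R))"] conjI allI impI)
    show "0 < min 1 (\<rho> / (2 * R))" using \<rho> Rp by simp
    fix e c assume e: "0 < e" "e \<le> min 1 (\<rho> / (2 * R))" and c: "\<bar>c - c0\<bar> \<le> \<rho> / 2"
    have eR: "e * R \<le> \<rho> / 2" using e Rp by (simp add: field_simps)
    have "reach (dil e c y) (seg (dil e c y) (e * h1) (e * h2)) (e * l)"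
    proof (rule reach_seg)
      fix t :: real assume t: "t \<in> {0..1}"
      have "seg (dil e c y) (t * (e * h1)) (t * (e * h2)) = dil e c (seg y (t * h1) (t * h2))"
        using dil_seg[of e c y "t * h1" "t * h2"] by (simp add: mult.left_commute)
      then have "sqrt (q (seg (dil e c y) (t * (e * h1)) (t * (e * h2))) h1 h2) \<le> l"
        using near[OF dil_near[OF R[OF t] e(1) _ eR c]] e by simp
      then have "e * sqrt (q (seg (dil e c y) (t * (e * h1)) (t * (e * h2))) h1 h2) \<le> e * l" using e(1) by simp
      then show "sqrt (q (seg (dil e c y) (t * (e * h1)) (t * (e * h2))) (e * h1) (e * h2)) \<le> e * l"
        unfolding sqrt_q_scale using e(1) by simp
    qed
    then show "reach (dil e c y) (dil e c (seg y h1 h2)) (e * l)" unfolding dil_seg .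
  qed
qed

text \<open>Polarization, and the Gram determinant of two vectors as the determinant of the form
  times a squared area.\<close>

lemma q_add:
  defines "b x h1 h2 k1 k2 \<equiv> A x * h1 * k1 + B x * (h1 * k2 + h2 * k1) + C x * h2 * k2"
  shows "q x (h1 + k1) (h2 + k2) = q x h1 h2 + 2 * b x h1 h2 k1 k2 + q x k1 k2"
    "q x h1 h2 * q x k1 k2 - (b x h1 h2 k1 k2)\<^sup>2 = (A x * C x - (B x)\<^sup>2) * (h1 * k2 - h2 * k1)\<^sup>2"
  unfolding b_def q_def by (simp_all add: power2_eq_square algebra_simps)

text \<open>By the Gram identity the Cauchy-Schwarz inequality is strict for independent vectors.
  This strictness is the source of the saving at a corner.\<close>

lemma sqrt_q_triangle:
  "sqrt (q x (h1 + k1) (h2 + k2)) \<le> sqrt (q x h1 h2) + sqrt (q x k1 k2)"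
  "h1 * k2 \<noteq> h2 * k1 \<Longrightarrow> sqrt (q x (h1 + k1) (h2 + k2)) < sqrt (q x h1 h2) + sqrt (q x k1 k2)"
proof -
  define b where "b = A x * h1 * k1 + B x * (h1 * k2 + h2 * k1) + C x * h2 * k2"
  define s where "s = sqrt (q x h1 h2) * sqrt (q x k1 k2)"
  have s0: "0 \<le> s" unfolding s_def by simp
  have s2: "s\<^sup>2 = q x h1 h2 * q x k1 k2" unfolding s_def by (simp add: power_mult_distrib)
  have sb: "s\<^sup>2 - b\<^sup>2 = (A x * C x - (B x)\<^sup>2) * (h1 * k2 - h2 * k1)\<^sup>2"
    unfolding s2 b_def using q_add(2)[of x h1 h2 k1 k2] .
  have sq: "(sqrt (q x h1 h2) + sqrt (q x k1 k2))\<^sup>2 = q x h1 h2 + 2 * s + q x k1 k2"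
    unfolding s_def by (simp add: power2_sum)
  have qe: "q x (h1 + k1) (h2 + k2) = q x h1 h2 + 2 * b + q x k1 k2"
    unfolding b_def using q_add(1)[of x h1 k1 h2 k2] .
  have "0 \<le> s\<^sup>2 - b\<^sup>2" unfolding sb using pos(2)[of x] by simp
  then have "b\<^sup>2 \<le> s\<^sup>2" by simp
  then have "b \<le> s" by (rule power2_le_imp_le[OF _ s0])
  then have "q x (h1 + k1) (h2 + k2) \<le> (sqrt (q x h1 h2) + sqrt (q x k1 k2))\<^sup>2" unfolding sq qe by simp
  then show "sqrt (q x (h1 + k1) (h2 + k2)) \<le> sqrt (q x h1 h2) + sqrt (q x k1 k2)"
    by (intro real_le_lsqrt) auto
  assume "h1 * k2 \<noteq> h2 * k1"
  then have "0 < s\<^sup>2 - b\<^sup>2" unfolding sb using pos(2)[of x] by simp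
  then have "b\<^sup>2 < s\<^sup>2" by simp
  then have "b < s" by (rule power2_less_imp_less[OF _ s0])
  then have "q x (h1 + k1) (h2 + k2) < (sqrt (q x h1 h2) + sqrt (q x k1 k2))\<^sup>2" unfolding sq qe by simp
  then show "sqrt (q x (h1 + k1) (h2 + k2)) < sqrt (q x h1 h2) + sqrt (q x k1 k2)"
    by (intro real_less_lsqrt) auto
qed

text \<open>The cut replaces the corner by the chord from k v to k w at relative scale k; the swept area is compensated by
  moving along a line that passes at distance of order k^2 from the second ray, which costs only O(k^2).
  The dilations preserve the distribution, so x3 closes up exactly and x4 is off by a multiple of e^5.\<close>

lemma corner_cut:
  fixes c0 v1 v2 w1 w2 :: real
  assumes om: "v2 * w1 - v1 * w2 \<noteq> 0"
  defines "N h1 h2 \<equiv> sqrt (q (pt 0 0 0 c0) h1 h2)"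
  obtains \<sigma> E e0 \<rho> where "\<sigma> > 0" "e0 > 0" "\<rho> > 0"
    "\<And>e c. 0 < e \<Longrightarrow> e \<le> e0 \<Longrightarrow> \<bar>c - c0\<bar> \<le> \<rho> \<Longrightarrow>
      reach (pt (e * v1) (e * v2) 0 c) (pt (e * w1) (e * w2) 0 (c + e ^ 5 * E)) (e * (N v1 v2 + N w1 w2 - \<sigma>))"
proof -
  have Nsc: "N (r * h1) (r * h2) = \<bar>r\<bar> * N h1 h2" for r h1 h2 unfolding N_def sqrt_q_scale ..
  have Nt: "N (h1 + k1) (h2 + k2) \<le> N h1 h2 + N k1 k2" for h1 h2 k1 k2 unfolding N_def by (rule sqrt_q_triangle)
  \<comment> \<open>The gain of the chord over the two sides at unit scale.\<close>
  define s1 where "s1 = N v1 v2 + N w1 w2 - N (w1 - v1) (w2 - v2)"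
  have "N (w1 + (-1) * v1) (w2 + (-1) * v2) < N w1 w2 + N ((-1) * v1) ((-1) * v2)"
    unfolding N_def by (rule sqrt_q_triangle(2)) (use om in \<open>simp add: algebra_simps\<close>)
  then have s1: "s1 > 0" unfolding s1_def Nsc by simp
  have "q (pt 0 0 0 c0) v1 v2 \<noteq> 0" using om q_eq_0_iff by auto
  then have Nv: "N v1 v2 > 0" unfolding N_def using q_nonneg[of "pt 0 0 0 c0" v1 v2] by (simp add: less_le)
  \<comment> \<open>The chord gains \<open>k * s1\<close>, while compensating the area costs at most
    \<open>4 * k\<^sup>2 * N v1 v2\<close>; this choice keeps the cost below half of the
    gain.\<close>
  define k where "k = min (1/2) (s1 / (8 * N v1 v2))"
  have k: "0 < k" "k \<le> 1/2" "8 * k * N v1 v2 \<le> s1"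
  proof -
    show "0 < k" "k \<le> 1/2" unfolding k_def using s1 Nv by auto
    have "k \<le> s1 / (8 * N v1 v2)" unfolding k_def by simp
    then show "8 * k * N v1 v2 \<le> s1" using Nv by (simp add: field_simps)
  qed
  \<comment> \<open>Fixed by closing up the third coordinate: the chord contributes
    \<open>k\<^sup>2\<close>, the detour \<open>- j * (1 - k)\<close>, both in units of twice the
    area.\<close>
  define j where "j = k\<^sup>2 / (1 - k)"
  have jk: "j * (1 - k) = k\<^sup>2" unfolding j_def using k by simp
  have j0: "0 \<le> j" unfolding j_def using k by simp
  have "j * (1/2) \<le> j * (1 - k)" using j0 k by (intro mult_left_mono) auto
  then have j: "j \<le> 2 * k\<^sup>2" using jk by simp
  define y0 where "y0 = pt v1 v2 0 0"
  \<comment> \<open>The path at unit scale: inwards along the first ray, across the chord, out to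
    \<open>w / 2 - j v\<close> off the second ray, and from there to \<open>w\<close>.\<close>
  define y1 where "y1 = seg y0 ((k - 1) * v1) ((k - 1) * v2)"
  define y2 where "y2 = seg y1 (k * (w1 - v1)) (k * (w2 - v2))"
  define y3 where "y3 = seg y2 ((1/2 - k) * w1 + (-j) * v1) ((1/2 - k) * w2 + (-j) * v2)"
  define y4 where "y4 = seg y3 ((1/2) * w1 + j * v1) ((1/2) * w2 + j * v2)"
  have n0: "y0 $ 1 = v1" "y0 $ 2 = v2" "y0 $ 3 = 0" "y0 $ 4 = 0" unfolding y0_def pt_nth by simp_all
  have n1: "y1 $ 1 = k * v1" "y1 $ 2 = k * v2" "y1 $ 3 = 0"
    unfolding y1_def seg_def pt_nth n0 by (simp_all add: algebra_simps)
  have n2: "y2 $ 1 = k * w1" "y2 $ 2 = k * w2" "y2 $ 3 = 2 * k\<^sup>2 * (v2 * w1 - v1 * w2)"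
    unfolding y2_def seg_def pt_nth n1 by (simp_all add: algebra_simps power2_eq_square)
  have n3: "y3 $ 1 = (1/2) * w1 - j * v1" "y3 $ 2 = (1/2) * w2 - j * v2" "y3 $ 3 = 2 * (k\<^sup>2 + k * j) * (v2 * w1 - v1 * w2)"
    unfolding y3_def seg_def pt_nth n2 by (simp_all add: algebra_simps power2_eq_square)
  have "y4 $ 3 = 2 * (k\<^sup>2 - j * (1 - k)) * (v2 * w1 - v1 * w2)"
    unfolding y4_def seg_def pt_nth n3 by (simp add: field_simps)
  then have n4: "y4 $ 1 = w1" "y4 $ 2 = w2" "y4 $ 3 = 0"
    unfolding jk by (simp_all add: y4_def seg_def pt_nth n3)
  define P where "P = (\<bar>(k - 1) * v1\<bar> + \<bar>(k - 1) * v2\<bar>) + (\<bar>k * (w1 - v1)\<bar> + \<bar>k * (w2 - v2)\<bar>) +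
    (\<bar>(1/2 - k) * w1 + (-j) * v1\<bar> + \<bar>(1/2 - k) * w2 + (-j) * v2\<bar>) + (\<bar>(1/2) * w1 + j * v1\<bar> + \<bar>(1/2) * w2 + j * v2\<bar>)"
  have P0: "0 \<le> P" unfolding P_def by simp
  \<comment> \<open>The variation of the metric may consume a quarter of \<open>k * s1\<close>; a
    quarter is then left as net gain.\<close>
  define \<eta> where "\<eta> = k * s1 / (4 * (P + 1))"
  have \<eta>: "\<eta> > 0" unfolding \<eta>_def using k s1 P0 by simp
  have \<eta>1: "\<eta> * P \<le> \<eta> * (P + 1)" using \<eta> by simp
  have dm: "x / (4 * p) * p = x / 4" if "p \<noteq> 0" for x p :: real using that by simp
  have \<eta>P: "\<eta> * P \<le> k * s1 / 4" using \<eta>1 dm[of "P + 1" "k * s1"] P0 unfolding \<eta>_def by linarith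
  obtain \<rho> where \<rho>: "\<rho> > 0" "\<And>z h1 h2. (\<And>i. \<bar>z $ i - pt 0 0 0 c0 $ i\<bar> \<le> \<rho>) \<Longrightarrow>
     \<bar>sqrt (q z h1 h2) - N h1 h2\<bar> \<le> \<eta> * (\<bar>h1\<bar> + \<bar>h2\<bar>)" using q_near[OF \<eta>, of "pt 0 0 0 c0"] unfolding N_def by blast
  have near: "sqrt (q z h1 h2) \<le> N h1 h2 + \<eta> * (\<bar>h1\<bar> + \<bar>h2\<bar>)" if "\<And>i. \<bar>z $ i - pt 0 0 0 c0 $ i\<bar> \<le> \<rho>" for z h1 h2
    using \<rho>(2)[OF that, of h1 h2] by linarith
  have rs: "\<exists>e0>0. \<forall>e c. 0 < e \<longrightarrow> e \<le> e0 \<longrightarrow> \<bar>c - c0\<bar> \<le> \<rho> / 2 \<longrightarrow>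
      reach (dil e c y) (dil e c (seg y h1 h2)) (e * (N h1 h2 + \<eta> * (\<bar>h1\<bar> + \<bar>h2\<bar>)))" for y h1 h2
    by (rule reach_dil_seg[OF \<rho>(1)]) (erule near)
  obtain e1 where e1: "e1 > 0" "\<And>e c. 0 < e \<Longrightarrow> e \<le> e1 \<Longrightarrow> \<bar>c - c0\<bar> \<le> \<rho> / 2 \<Longrightarrow> reach (dil e c y0) (dil e c y1)
     (e * (N ((k - 1) * v1) ((k - 1) * v2) + \<eta> * (\<bar>(k - 1) * v1\<bar> + \<bar>(k - 1) * v2\<bar>)))"
    using rs[of y0 "(k - 1) * v1" "(k - 1) * v2"] unfolding y1_def by blast
  obtain e2 where e2: "e2 > 0" "\<And>e c. 0 < e \<Longrightarrow> e \<le> e2 \<Longrightarrow> \<bar>c - c0\<bar> \<le> \<rho> / 2 \<Longrightarrow> reach (dil e c y1) (dil e c y2)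
     (e * (N (k * (w1 - v1)) (k * (w2 - v2)) + \<eta> * (\<bar>k * (w1 - v1)\<bar> + \<bar>k * (w2 - v2)\<bar>)))"
    using rs[of y1 "k * (w1 - v1)" "k * (w2 - v2)"] unfolding y2_def by blast
  obtain e3 where e3: "e3 > 0" "\<And>e c. 0 < e \<Longrightarrow> e \<le> e3 \<Longrightarrow> \<bar>c - c0\<bar> \<le> \<rho> / 2 \<Longrightarrow> reach (dil e c y2) (dil e c y3)
     (e * (N ((1/2 - k) * w1 + (-j) * v1) ((1/2 - k) * w2 + (-j) * v2) + \<eta> * (\<bar>(1/2 - k) * w1 + (-j) * v1\<bar> + \<bar>(1/2 - k) * w2 + (-j) * v2\<bar>)))"
    using rs[of y2 "(1/2 - k) * w1 + (-j) * v1" "(1/2 - k) * w2 + (-j) * v2"] unfolding y3_def by blast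
  obtain e4 where e4: "e4 > 0" "\<And>e c. 0 < e \<Longrightarrow> e \<le> e4 \<Longrightarrow> \<bar>c - c0\<bar> \<le> \<rho> / 2 \<Longrightarrow> reach (dil e c y3) (dil e c y4)
     (e * (N ((1/2) * w1 + j * v1) ((1/2) * w2 + j * v2) + \<eta> * (\<bar>(1/2) * w1 + j * v1\<bar> + \<bar>(1/2) * w2 + j * v2\<bar>)))"
    using rs[of y3 "(1/2) * w1 + j * v1" "(1/2) * w2 + j * v2"] unfolding y4_def by blast
  have L1: "N ((k - 1) * v1) ((k - 1) * v2) = (1 - k) * N v1 v2" unfolding Nsc using k by simp
  have L2: "N (k * (w1 - v1)) (k * (w2 - v2)) = k * N (w1 - v1) (w2 - v2)" unfolding Nsc using k by simp
  have L3: "N ((1/2 - k) * w1 + (-j) * v1) ((1/2 - k) * w2 + (-j) * v2) \<le> (1/2 - k) * N w1 w2 + j * N v1 v2"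
    using Nt[of "(1/2 - k) * w1" "(-j) * v1" "(1/2 - k) * w2" "(-j) * v2"] k j0 unfolding Nsc by simp
  have L4: "N ((1/2) * w1 + j * v1) ((1/2) * w2 + j * v2) \<le> (1/2) * N w1 w2 + j * N v1 v2"
    using Nt[of "(1/2) * w1" "j * v1" "(1/2) * w2" "j * v2"] j0 unfolding Nsc by simp
  let ?l = "(N ((k - 1) * v1) ((k - 1) * v2) + \<eta> * (\<bar>(k - 1) * v1\<bar> + \<bar>(k - 1) * v2\<bar>)) +
    (N (k * (w1 - v1)) (k * (w2 - v2)) + \<eta> * (\<bar>k * (w1 - v1)\<bar> + \<bar>k * (w2 - v2)\<bar>)) +
    (N ((1/2 - k) * w1 + (-j) * v1) ((1/2 - k) * w2 + (-j) * v2) + \<eta> * (\<bar>(1/2 - k) * w1 + (-j) * v1\<bar> + \<bar>(1/2 - k) * w2 + (-j) * v2\<bar>)) +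
    (N ((1/2) * w1 + j * v1) ((1/2) * w2 + j * v2) + \<eta> * (\<bar>(1/2) * w1 + j * v1\<bar> + \<bar>(1/2) * w2 + j * v2\<bar>))"
  have "?l = N ((k - 1) * v1) ((k - 1) * v2) + N (k * (w1 - v1)) (k * (w2 - v2)) + N ((1/2 - k) * w1 + (-j) * v1) ((1/2 - k) * w2 + (-j) * v2)
    + N ((1/2) * w1 + j * v1) ((1/2) * w2 + j * v2) + \<eta> * P" unfolding P_def distrib_left by linarith
  also have "\<dots> \<le> (1 - k) * N v1 v2 + k * N (w1 - v1) (w2 - v2) + (1/2 - k) * N w1 w2 + j * N v1 v2 + (1/2) * N w1 w2 + j * N v1 v2 + k * s1 / 4"
    using L1 L2 L3 L4 \<eta>P by linarith
  also have "\<dots> = N v1 v2 + N w1 w2 - k * s1 + 2 * j * N v1 v2 + k * s1 / 4" unfolding s1_def by (simp add: algebra_simps)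
  also have "\<dots> \<le> N v1 v2 + N w1 w2 - k * s1 / 4"
  proof -
    have "2 * j * N v1 v2 \<le> 2 * (2 * k\<^sup>2) * N v1 v2" using j Nv by (intro mult_right_mono) auto
    also have "\<dots> = k * (8 * k * N v1 v2) / 2" by (simp add: power2_eq_square)
    also have "\<dots> \<le> k * s1 / 2" using k(1,3) by (intro divide_right_mono mult_left_mono) auto
    finally show ?thesis by linarith
  qed
  finally have l: "?l \<le> N v1 v2 + N w1 w2 - k * s1 / 4" .
  show ?thesis
  proof (rule that[of "k * s1 / 4" "min (min e1 e2) (min e3 e4)" "\<rho> / 2" "y4 $ 4"])
    show "0 < k * s1 / 4" "0 < min (min e1 e2) (min e3 e4)" "0 < \<rho> / 2" using k s1 e1(1) e2(1) e3(1) e4(1) \<rho>(1) by simp_all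
    fix e c assume e: "0 < e" "e \<le> min (min e1 e2) (min e3 e4)" and c: "\<bar>c - c0\<bar> \<le> \<rho> / 2"
    have le: "e \<le> e1" "e \<le> e2" "e \<le> e3" "e \<le> e4" using e(2) by auto
    have r: "reach (dil e c y0) (dil e c y4) (e * ?l)"
      using reach_trans[OF reach_trans[OF reach_trans[OF e1(2)[OF e(1) le(1) c] e2(2)[OF e(1) le(2) c]] e3(2)[OF e(1) le(3) c]] e4(2)[OF e(1) le(4) c]]
      unfolding distrib_left[of e] by (simp only: add.assoc)
    have d: "dil e c y0 = pt (e * v1) (e * v2) 0 c" "dil e c y4 = pt (e * w1) (e * w2) 0 (c + e ^ 5 * y4 $ 4)"
      unfolding dil_def pt_eq n0 n4 by simp_all
    have m: "e * ?l \<le> e * (N v1 v2 + N w1 w2 - k * s1 / 4)" using l e(1) by (intro mult_left_mono) auto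
    show "reach (pt (e * v1) (e * v2) 0 c) (pt (e * w1) (e * w2) 0 (c + e ^ 5 * y4 $ 4)) (e * (N v1 v2 + N w1 w2 - k * s1 / 4))"
      by (rule reach_mono[OF r[unfolded d] m])
  qed
qed

end

section \<open>Exclusion of corners\<close>

lemma ae_integral_le:
  assumes f: "bm s t f" and le: "ae s t (\<lambda>r. f r \<le> k)" and st: "s \<le> t"
  shows "integral {s..t} f \<le> k * (t - s)"
proof -
  have "integral {s..t} (\<lambda>r. k - f r) = integral {s..t} (\<lambda>r. \<bar>k - f r\<bar>)"
    by (rule ae_integral_cong, rule ae_mono[OF le]) simp
  also have "\<dots> \<ge> 0" by (rule integral_nonneg[OF bm_integrable[OF bm_abs[OF bm_diff[OF bm_const f]]]]) simp
  finally show ?thesis using bm_integral_diff[OF bm_const[of s t k] f, of t] st by (simp add: mult.commute)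
qed

definition sh :: "real \<Rightarrow> real^4 \<Rightarrow> real^4" where "sh \<tau> y = pt (y$1) (y$2) (y$3) (y$4 + \<tau>)"

text \<open>Finds the instant at which a ray is at relative distance \<open>e\<close> from the
  corner, with all later points nearer; the shortcut departs there.\<close>

lemma decreasing_level:
  fixes \<theta> :: "real \<Rightarrow> real"
  assumes c: "continuous_on {l..r} \<theta>" and inj: "inj_on \<theta> {l..r}" and v: "\<theta> l = 1" "\<theta> r = 0" and lr: "l \<le> r" and e: "0 < e" "e < 1"
  obtains s where "s \<in> {l..r}" "\<theta> s = e" "\<And>t. t \<in> {s..r} \<Longrightarrow> 0 \<le> \<theta> t \<and> \<theta> t \<le> e"
proof -
  have "l \<noteq> r" using v by auto
  then have lr': "l < r" using lr by simp
  have "strict_mono_on {l..r} \<theta> \<or> strict_antimono_on {l..r} \<theta>"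
    using injective_eq_monotone_map[OF is_interval_cc c] inj by blast
  moreover have "\<not> strict_mono_on {l..r} \<theta>"
  proof
    assume "strict_mono_on {l..r} \<theta>"
    from strict_mono_onD[OF this _ _ lr'] show False using v lr' by auto
  qed
  ultimately have a: "strict_antimono_on {l..r} \<theta>" by blast
  have mono: "\<theta> y \<le> \<theta> x" if "x \<in> {l..r}" "y \<in> {l..r}" "x \<le> y" for x y
    using monotone_onD[OF a that(1,2)] that(3) by (cases "x = y") auto
  obtain s where s: "l \<le> s" "s \<le> r" "\<theta> s = e" using IVT2'[of \<theta> r e l, OF _ _ lr c] v e by auto
  show ?thesis
  proof (rule that[of s])
    fix t assume "t \<in> {s..r}"
    then show "0 \<le> \<theta> t \<and> \<theta> t \<le> e" using mono[of t r] mono[of s t] s v by auto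
  qed (use s in auto)
qed

lemma increasing_level:
  fixes \<theta> :: "real \<Rightarrow> real"
  assumes c: "continuous_on {l..r} \<theta>" and inj: "inj_on \<theta> {l..r}" and v: "\<theta> l = 0" "\<theta> r = 1" and lr: "l \<le> r" and e: "0 < e" "e < 1"
  obtains s where "s \<in> {l..r}" "\<theta> s = e" "\<And>t. t \<in> {l..s} \<Longrightarrow> 0 \<le> \<theta> t \<and> \<theta> t \<le> e"
proof -
  have c': "continuous_on {-r..-l} (\<lambda>t. \<theta> (- t))"
    by (rule continuous_on_compose2[OF c]) (auto intro: continuous_intros)
  have inj': "inj_on (\<lambda>t. \<theta> (- t)) {-r..-l}"
    using inj unfolding inj_on_def by (metis atLeastAtMost_iff minus_le_iff le_minus_iff neg_equal_iff_equal)
  obtain s where s: "s \<in> {-r..-l}" "\<theta> (- s) = e" "\<And>t. t \<in> {s..-l} \<Longrightarrow> 0 \<le> \<theta> (- t) \<and> \<theta> (- t) \<le> e"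
    using decreasing_level[OF c' inj' _ _ _ e] v lr by auto
  show ?thesis
  proof (rule that[of "-s"])
    fix t assume "t \<in> {l..-s}"
    then show "0 \<le> \<theta> t \<and> \<theta> t \<le> e" using s(3)[of "-t"] by auto
  qed (use s in auto)
qed

context minimizer
begin

text \<open>Neither field of the frame depends on \<open>x4\<close>, so a vertical translate of the
  curve has the same controls. Only the metric coefficients change, at a Lipschitz rate.\<close>

lemma reach_shift:
  obtains K where "K > 0" "\<And>s t \<tau>. s \<in> {a..b} \<Longrightarrow> t \<in> {a..b} \<Longrightarrow> s \<le> t \<Longrightarrow> \<bar>\<tau>\<bar> \<le> 1 \<Longrightarrow>
    reach (sh \<tau> (x s)) (sh \<tau> (x t)) (sqrt c * (t - s) + K * \<bar>\<tau>\<bar>)"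
proof -
  have "\<exists>M. M > 0 \<and> (\<forall>t\<in>{a..b}. \<bar>x t $ i\<bar> \<le> M)" for i by (rule bm_bounded[OF x_bm[of i]]) blast
  then obtain M where M: "\<And>i. M i > 0" "\<And>i t. t \<in> {a..b} \<Longrightarrow> \<bar>x t $ i\<bar> \<le> M i" by metis
  define R where "R = (\<Sum>i\<in>UNIV. M i) + 1"
  have MR: "M i \<le> R - 1" for i unfolding R_def using member_le_sum[of i UNIV M] M(1) less_imp_le by auto
  have xR: "\<bar>x t $ i\<bar> \<le> R - 1" if "t \<in> {a..b}" for t i using M(2)[OF that] MR order_trans by blast
  have x_cube: "x t \<in> cube R" if "t \<in> {a..b}" for t
    unfolding cube_def mem_Collect_eq by (intro allI, rule order_trans[OF xR[OF that]]) simp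
  have sh_cube: "sh \<tau> (x t) \<in> cube R" if t: "t \<in> {a..b}" and \<tau>: "\<bar>\<tau>\<bar> \<le> 1" for t \<tau>
    unfolding sh_def pt_cube using xR[OF t, of 1] xR[OF t, of 2] xR[OF t, of 3] xR[OF t, of 4] \<tau>
      abs_triangle_ineq[of "x t $ 4" \<tau>] by simp
  have sh_n1: "n1 (sh \<tau> y - y) = \<bar>\<tau>\<bar>" for \<tau> y unfolding n1_def sum_4 vector_minus_component sh_def pt_nth by simp
  obtain U1 where U1: "\<And>t. t \<in> {a..b} \<Longrightarrow> \<bar>u1 t\<bar> \<le> U1" using bm_bounded[OF u_bm(1)] by blast
  obtain U2 where U2: "\<And>t. t \<in> {a..b} \<Longrightarrow> \<bar>u2 t\<bar> \<le> U2" using bm_bounded[OF u_bm(2)] by blast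
  obtain LA where LA: "LA > 0" "\<And>x y. x \<in> cube R \<Longrightarrow> y \<in> cube R \<Longrightarrow> \<bar>A y - A x\<bar> \<le> LA * n1 (y - x)" using smooth_R4_lip[OF smooth(1)] by blast
  obtain LB where LB: "LB > 0" "\<And>x y. x \<in> cube R \<Longrightarrow> y \<in> cube R \<Longrightarrow> \<bar>B y - B x\<bar> \<le> LB * n1 (y - x)" using smooth_R4_lip[OF smooth(2)] by blast
  obtain LC where LC: "LC > 0" "\<And>x y. x \<in> cube R \<Longrightarrow> y \<in> cube R \<Longrightarrow> \<bar>C y - C x\<bar> \<le> LC * n1 (y - x)" using smooth_R4_lip[OF smooth(3)] by blast
  define L where "L = LA + LB + LC"
  have L: "LA \<le> L" "LB \<le> L" "LC \<le> L" "L > 0" unfolding L_def using LA(1) LB(1) LC(1) by simp_all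
  \<comment> \<open>The division by \<open>sqrt c\<close> converts a bound on squared speed into one
    on speed, since \<open>c + sqrt c * d\<close> is at most \<open>(sqrt c + d)\<^sup>2\<close> for
    nonnegative \<open>d\<close>.\<close>
  define W where "W = L * (U1 + U2)\<^sup>2 / sqrt c"
  have W0: "W \<ge> 0" unfolding W_def using L c by simp
  have sp: "sqrt (q (sh \<tau> (x t)) (u1 t) (u2 t)) \<le> sqrt c + W * \<bar>\<tau>\<bar>"
    if t: "t \<in> {a..b}" and \<tau>: "\<bar>\<tau>\<bar> \<le> 1" and qc: "q (x t) (u1 t) (u2 t) = c" for t \<tau>
  proof -
    have d: "\<bar>A (sh \<tau> (x t)) - A (x t)\<bar> \<le> L * \<bar>\<tau>\<bar>" "\<bar>B (sh \<tau> (x t)) - B (x t)\<bar> \<le> L * \<bar>\<tau>\<bar>" "\<bar>C (sh \<tau> (x t)) - C (x t)\<bar> \<le> L * \<bar>\<tau>\<bar>"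
      using LA(2)[OF x_cube[OF t] sh_cube[OF t \<tau>]] LB(2)[OF x_cube[OF t] sh_cube[OF t \<tau>]] LC(2)[OF x_cube[OF t] sh_cube[OF t \<tau>]]
        mult_right_mono[OF L(1), of "\<bar>\<tau>\<bar>"] mult_right_mono[OF L(2), of "\<bar>\<tau>\<bar>"] mult_right_mono[OF L(3), of "\<bar>\<tau>\<bar>"]
      unfolding sh_n1 by auto
    have "q (sh \<tau> (x t)) (u1 t) (u2 t) - q (x t) (u1 t) (u2 t) =
      (A (sh \<tau> (x t)) - A (x t)) * (u1 t)\<^sup>2 + 2 * (B (sh \<tau> (x t)) - B (x t)) * u1 t * u2 t + (C (sh \<tau> (x t)) - C (x t)) * (u2 t)\<^sup>2"
      unfolding q_def by (simp add: algebra_simps)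
    also have "\<dots> \<le> (L * \<bar>\<tau>\<bar>) * (\<bar>u1 t\<bar> + \<bar>u2 t\<bar>)\<^sup>2" using q_le_l1[OF d, of "u1 t" "u2 t"] by linarith
    also have "\<dots> \<le> (L * \<bar>\<tau>\<bar>) * (U1 + U2)\<^sup>2" using U1[OF t] U2[OF t] L(4) by (intro mult_left_mono power_mono add_mono) auto
    also have "\<dots> = sqrt c * (W * \<bar>\<tau>\<bar>)" unfolding W_def using c by simp
    finally have "q (sh \<tau> (x t)) (u1 t) (u2 t) \<le> c + sqrt c * (W * \<bar>\<tau>\<bar>)" unfolding qc by simp
    also have "\<dots> \<le> (sqrt c + W * \<bar>\<tau>\<bar>)\<^sup>2" using c W0 by (simp add: power2_sum)
    finally show ?thesis using c W0 by (intro real_le_lsqrt) auto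
  qed
  show ?thesis
  proof (rule that[of "W * (b - a) + 1"])
    show "W * (b - a) + 1 > 0" using W0 lt by (simp add: add_nonneg_pos)
    fix s t \<tau> assume st: "s \<in> {a..b}" "t \<in> {a..b}" "s \<le> t" and \<tau>: "\<bar>\<tau>\<bar> \<le> (1::real)"
    have sub: "a \<le> s" "t \<le> b" using st by auto
    have p4: "prim s t (\<lambda>r. x r $ 4 + \<tau>) (\<lambda>r. (x r $ 3)\<^sup>2 * u1 r)"
      using prim_add[OF prim_subset[OF x4_prim sub] prim_const[of s t \<tau>]] by simp
    have ct: "ctl s t u1 u2 (\<lambda>r. sh \<tau> (x r))"
      unfolding ctl_def sh_def pt_nth
      using st(3) prim_subset[OF x1_prim sub] prim_subset[OF x2_prim sub] prim_subset[OF x3_prim sub] p4 by blast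
    have "integral {s..t} (speed u1 u2 (\<lambda>r. sh \<tau> (x r))) \<le> (sqrt c + W * \<bar>\<tau>\<bar>) * (t - s)"
      by (rule ae_integral_le[OF speed_bm[OF ct] _ st(3)], rule ae_mono[OF ae_subset[OF speed_c sub]])
        (use sp[OF _ \<tau>] sub in \<open>auto simp: speed_def\<close>)
    also have "\<dots> = sqrt c * (t - s) + (W * \<bar>\<tau>\<bar>) * (t - s)" by (simp add: algebra_simps)
    also have "(W * \<bar>\<tau>\<bar>) * (t - s) \<le> (W * \<bar>\<tau>\<bar>) * (b - a)" using st W0 by (intro mult_left_mono) auto
    also have "\<dots> \<le> (W * (b - a) + 1) * \<bar>\<tau>\<bar>" by (simp add: algebra_simps)
    finally have "integral {s..t} (speed u1 u2 (\<lambda>r. sh \<tau> (x r))) \<le> sqrt c * (t - s) + (W * (b - a) + 1) * \<bar>\<tau>\<bar>" by simp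
    from reach_ctl[OF ct this] show "reach (sh \<tau> (x s)) (sh \<tau> (x t)) (sqrt c * (t - s) + (W * (b - a) + 1) * \<bar>\<tau>\<bar>)" .
  qed
qed

text \<open>On a ray the controls are the derivative of \<open>\<theta>\<close> times
  \<open>v\<close>, so constant speed bounds that derivative by \<open>sqrt c / k\<close>.
  Monotonicity of \<open>sqrt c * t\<close> minus either sign of \<open>k * \<theta> t\<close>
  integrates the bound.\<close>

lemma ray_length:
  assumes lr: "a \<le> l" "l \<le> r" "r \<le> b" and \<theta>: "prim a b \<theta> \<theta>'"
    and xv: "\<And>t. t \<in> {l..r} \<Longrightarrow> x t $ 1 = v1 * \<theta> t" "\<And>t. t \<in> {l..r} \<Longrightarrow> x t $ 2 = v2 * \<theta> t"
    and k: "0 \<le> k" "\<And>t. t \<in> {l..r} \<Longrightarrow> k \<le> sqrt (q (x t) v1 v2)"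
  shows "k * \<bar>\<theta> r - \<theta> l\<bar> \<le> sqrt c * (r - l)"
proof -
  note p\<theta> = prim_subset[OF \<theta> lr(1,3)]
  have e1: "ae l r (\<lambda>t. u1 t = v1 * \<theta>' t)"
    by (rule prim_unique[OF prim_subset[OF x1_prim lr(1,3)] prim_cong'[OF prim_cmult[OF p\<theta>, of v1]]]) (use xv in auto)
  have e2: "ae l r (\<lambda>t. u2 t = v2 * \<theta>' t)"
    by (rule prim_unique[OF prim_subset[OF x2_prim lr(1,3)] prim_cong'[OF prim_cmult[OF p\<theta>, of v2]]]) (use xv in auto)
  have bnd: "ae l r (\<lambda>t. k * \<bar>\<theta>' t\<bar> \<le> sqrt c)"
  proof (rule ae_mono3[OF e1 e2 ae_subset[OF speed_c lr(1,3)]])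
    fix t assume t: "t \<in> {l..r}" "u1 t = v1 * \<theta>' t" "u2 t = v2 * \<theta>' t" "q (x t) (u1 t) (u2 t) = c"
    have "sqrt c = \<bar>\<theta>' t\<bar> * sqrt (q (x t) v1 v2)"
      using sqrt_q_scale[of "x t" "\<theta>' t" v1 v2] t(2-4) by (simp add: mult.commute)
    moreover have "k * \<bar>\<theta>' t\<bar> \<le> sqrt (q (x t) v1 v2) * \<bar>\<theta>' t\<bar>" using k(2)[OF t(1)] by (intro mult_right_mono) auto
    ultimately show "k * \<bar>\<theta>' t\<bar> \<le> sqrt c" by (simp add: mult.commute)
  qed
  have pt: "prim l r (\<lambda>t. t) (\<lambda>t. 1)" by (rule primI_deriv) (auto intro!: derivative_eq_intros)
  have "sqrt c * l - s * k * \<theta> l \<le> sqrt c * r - s * k * \<theta> r" if s: "\<bar>s\<bar> = 1" for s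
  proof (rule prim_mono[of l r "\<lambda>t. sqrt c * t - s * k * \<theta> t" "\<lambda>t. sqrt c * 1 - s * k * \<theta>' t"])
    show "prim l r (\<lambda>t. sqrt c * t - s * k * \<theta> t) (\<lambda>t. sqrt c * 1 - s * k * \<theta>' t)"
      by (intro prim_diff prim_cmult pt p\<theta>)
    show "ae l r (\<lambda>t. 0 \<le> sqrt c * 1 - s * k * \<theta>' t)"
    proof (rule ae_mono[OF bnd])
      fix t assume b: "k * \<bar>\<theta>' t\<bar> \<le> sqrt c"
      have "s * k * \<theta>' t \<le> \<bar>s * k * \<theta>' t\<bar>" by simp
      also have "\<dots> = k * \<bar>\<theta>' t\<bar>" using s k(1) by (simp add: abs_mult)
      finally show "0 \<le> sqrt c * 1 - s * k * \<theta>' t" using b by simp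
    qed
  qed (use lr in auto)
  from this[of 1] this[of "-1"] have "k * (\<theta> r - \<theta> l) \<le> sqrt c * (r - l)" "k * (\<theta> l - \<theta> r) \<le> sqrt c * (r - l)"
    by (simp_all add: algebra_simps)
  then show ?thesis by (cases "\<theta> l \<le> \<theta> r") (auto simp: abs_if)
qed

text \<open>\<open>\<theta>\<close> is the orthogonal projection onto \<open>v\<close>, normalized
  to 1 at \<open>v\<close> and 0 at the origin, and inherits injectivity from the curve.\<close>

lemma ray_param:
  assumes v: "v1 \<noteq> 0 \<or> v2 \<noteq> 0" and lr: "a \<le> l" "r \<le> b"
    and line: "\<And>t. t \<in> {l..r} \<Longrightarrow> x t $ 1 * v2 = x t $ 2 * v1"
    and x34: "\<And>t. t \<in> {a..b} \<Longrightarrow> x t $ 3 = 0" "\<And>t. t \<in> {a..b} \<Longrightarrow> x t $ 4 = c4"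
  obtains \<theta> \<theta>' where "prim a b \<theta> \<theta>'" "inj_on \<theta> {l..r}" "\<And>t. t \<in> {l..r} \<Longrightarrow> x t = pt (v1 * \<theta> t) (v2 * \<theta> t) 0 c4"
    "\<And>t. x t $ 1 = v1 \<Longrightarrow> x t $ 2 = v2 \<Longrightarrow> \<theta> t = 1" "\<And>t. x t $ 1 = 0 \<Longrightarrow> x t $ 2 = 0 \<Longrightarrow> \<theta> t = 0"
proof -
  define N where "N = v1 * v1 + v2 * v2"
  have N: "N > 0" unfolding N_def using v by (auto simp: sum_squares_gt_zero_iff)
  define \<theta> where "\<theta> t = (v1 / N) * x t $ 1 + (v2 / N) * x t $ 2" for t
  have p\<theta>: "prim a b \<theta> (\<lambda>t. (v1 / N) * u1 t + (v2 / N) * u2 t)"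
    unfolding \<theta>_def[abs_def] by (intro prim_add prim_cmult x1_prim x2_prim)
  have N\<theta>: "N * \<theta> t = v1 * x t $ 1 + v2 * x t $ 2" for t unfolding \<theta>_def using N by (simp add: field_simps)
  have xt: "x t = pt (v1 * \<theta> t) (v2 * \<theta> t) 0 c4" if t: "t \<in> {l..r}" for t
  proof -
    have z: "x t $ 1 * v2 - x t $ 2 * v1 = 0" using line[OF t] by simp
    have "N * (x t $ 1 - v1 * \<theta> t) = v2 * (x t $ 1 * v2 - x t $ 2 * v1)" "N * (x t $ 2 - v2 * \<theta> t) = - (v1 * (x t $ 1 * v2 - x t $ 2 * v1))"
      using N\<theta>[of t] unfolding right_diff_distrib mult.left_commute[of N] by (simp_all add: N_def algebra_simps)
    then have "N * (x t $ 1 - v1 * \<theta> t) = 0" "N * (x t $ 2 - v2 * \<theta> t) = 0" unfolding z mult_zero_right minus_zero .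
    then have "x t $ 1 = v1 * \<theta> t" "x t $ 2 = v2 * \<theta> t" using N by simp_all
    then show ?thesis unfolding vec4_eq_iff pt_nth using x34 t lr by auto
  qed
  show ?thesis
  proof (rule that[OF p\<theta> _ xt])
    show "inj_on \<theta> {l..r}"
    proof (rule inj_onI)
      fix s t assume st: "s \<in> {l..r}" "t \<in> {l..r}" "\<theta> s = \<theta> t"
      then have "x s = x t" using xt by simp
      moreover have "s \<in> {a..b}" "t \<in> {a..b}" using st lr by auto
      ultimately show "s = t" using inj_onD[OF x_inj] by blast
    qed
    fix t
    show "\<theta> t = 1" if "x t $ 1 = v1" "x t $ 2 = v2"
    proof -
      have "N * \<theta> t = N * 1" unfolding N\<theta> that by (simp add: N_def)
      then show ?thesis using N by simp
    qed
    show "\<theta> t = 0" if "x t $ 1 = 0" "x t $ 2 = 0" unfolding \<theta>_def that by simp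
  qed auto
qed

text \<open>The shortcut is taken at scale \<open>e\<close>, the part of the curve between it and
  one end is run at a shifted height, and the height is repaired at that end. The end is chosen on a
  ray with nonzero first coordinate, which exists because the rays are independent.\<close>

lemma no_corner:
  assumes t0: "t0 \<in> {a<..<b}" "x t0 $ 1 = 0" "x t0 $ 2 = 0"
    and L: "\<And>t. t \<in> {a..t0} \<Longrightarrow> x t $ 1 * x a $ 2 = x t $ 2 * x a $ 1"
    and R: "\<And>t. t \<in> {t0..b} \<Longrightarrow> x t $ 1 * x b $ 2 = x t $ 2 * x b $ 1"
    and om0: "x a $ 2 * x b $ 1 - x a $ 1 * x b $ 2 \<noteq> 0"
    and x3: "\<And>t. t \<in> {a..b} \<Longrightarrow> x t $ 3 = 0" and x40: "\<And>t. t \<in> {a..b} \<Longrightarrow> x t $ 4 = x a $ 4"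
  shows False
proof -
  define v1 where "v1 = x a $ 1"
  define v2 where "v2 = x a $ 2"
  define w1 where "w1 = x b $ 1"
  define w2 where "w2 = x b $ 2"
  define c0 where "c0 = x a $ 4"
  have om: "v2 * w1 - v1 * w2 \<noteq> 0" using om0 unfolding v1_def v2_def w1_def w2_def .
  have x4: "x t $ 4 = c0" if "t \<in> {a..b}" for t unfolding c0_def by (rule x40[OF that])
  have v: "v1 \<noteq> 0 \<or> v2 \<noteq> 0" and w: "w1 \<noteq> 0 \<or> w2 \<noteq> 0" using om by auto
  have xa: "x a = pt v1 v2 0 c0" and xb: "x b = pt w1 w2 0 c0"
    unfolding vec4_eq_iff pt_nth v1_def v2_def w1_def w2_def using x3 x4 lt by auto
  have t0ab: "a \<le> t0" "t0 \<le> b" using t0(1) by auto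
  obtain \<theta> \<theta>' where \<theta>: "prim a b \<theta> \<theta>'" "inj_on \<theta> {a..t0}" "\<And>t. t \<in> {a..t0} \<Longrightarrow> x t = pt (v1 * \<theta> t) (v2 * \<theta> t) 0 c0"
    "\<And>t. x t $ 1 = v1 \<Longrightarrow> x t $ 2 = v2 \<Longrightarrow> \<theta> t = 1" "\<And>t. x t $ 1 = 0 \<Longrightarrow> x t $ 2 = 0 \<Longrightarrow> \<theta> t = 0"
  proof (rule ray_param[where ?v1.0=v1 and ?v2.0=v2 and l=a and r=t0 and ?c4.0=c0, OF v order_refl t0ab(2)])
    show "x t $ 1 * v2 = x t $ 2 * v1" if "t \<in> {a..t0}" for t unfolding v1_def v2_def by (rule L[OF that])
    show "x t $ 3 = 0" "x t $ 4 = c0" if "t \<in> {a..b}" for t by (rule x3[OF that], rule x4[OF that])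
  qed (rule that)
  obtain \<omega> \<omega>' where \<omega>: "prim a b \<omega> \<omega>'" "inj_on \<omega> {t0..b}" "\<And>t. t \<in> {t0..b} \<Longrightarrow> x t = pt (w1 * \<omega> t) (w2 * \<omega> t) 0 c0"
    "\<And>t. x t $ 1 = w1 \<Longrightarrow> x t $ 2 = w2 \<Longrightarrow> \<omega> t = 1" "\<And>t. x t $ 1 = 0 \<Longrightarrow> x t $ 2 = 0 \<Longrightarrow> \<omega> t = 0"
  proof (rule ray_param[where ?v1.0=w1 and ?v2.0=w2 and l=t0 and r=b and ?c4.0=c0, OF w t0ab(1) order_refl])
    show "x t $ 1 * w2 = x t $ 2 * w1" if "t \<in> {t0..b}" for t unfolding w1_def w2_def by (rule R[OF that])
    show "x t $ 3 = 0" "x t $ 4 = c0" if "t \<in> {a..b}" for t by (rule x3[OF that], rule x4[OF that])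
  qed (rule that)
  define p where "p = pt 0 0 0 c0"
  define Nv where "Nv = sqrt (q p v1 v2)"
  define Nw where "Nw = sqrt (q p w1 w2)"
  have NN: "Nv > 0" "Nw > 0" using v w q_eq_0_iff[of p v1 v2] q_eq_0_iff[of p w1 w2] q_nonneg[of p v1 v2] q_nonneg[of p w1 w2]
    unfolding Nv_def Nw_def by (auto simp: less_le)
  obtain \<sigma> E e0 \<rho> where cut: "\<sigma> > 0" "e0 > 0" "\<rho> > 0" "\<And>e c. 0 < e \<Longrightarrow> e \<le> e0 \<Longrightarrow> \<bar>c - c0\<bar> \<le> \<rho> \<Longrightarrow>
      reach (pt (e * v1) (e * v2) 0 c) (pt (e * w1) (e * w2) 0 (c + e ^ 5 * E)) (e * (Nv + Nw - \<sigma>))"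
    by (rule corner_cut[OF om, of c0, folded p_def, folded Nv_def Nw_def]) (rule that)
  define V where "V = \<bar>v1\<bar> + \<bar>v2\<bar> + \<bar>w1\<bar> + \<bar>w2\<bar> + 1"
  have V: "V \<ge> 1" "\<bar>v1\<bar> + \<bar>v2\<bar> \<le> V" "\<bar>w1\<bar> + \<bar>w2\<bar> \<le> V" "\<bar>v1\<bar> \<le> V" "\<bar>v2\<bar> \<le> V" "\<bar>w1\<bar> \<le> V" "\<bar>w2\<bar> \<le> V" unfolding V_def by auto
  \<comment> \<open>The allowed deviation of the metric along the rays. Staying below
    \<open>Nv\<close> and \<open>Nw\<close> keeps the lower bounds in \<open>ray_length\<close>
    nonnegative.\<close>
  define \<mu> where "\<mu> = min (\<sigma> / 8) (min Nv Nw)"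
  have \<mu>: "\<mu> > 0" "\<mu> \<le> \<sigma> / 8" "\<mu> \<le> Nv" "\<mu> \<le> Nw" unfolding \<mu>_def using cut(1) NN by auto
  define \<eta> where "\<eta> = \<mu> / V"
  have \<eta>: "\<eta> > 0" unfolding \<eta>_def using \<mu> V by simp
  have \<eta>V: "\<eta> * V = \<mu>" unfolding \<eta>_def using V by simp
  obtain r where r: "r > 0" "\<And>z h1 h2. (\<And>i. \<bar>z $ i - p $ i\<bar> \<le> r) \<Longrightarrow> \<bar>sqrt (q z h1 h2) - sqrt (q p h1 h2)\<bar> \<le> \<eta> * (\<bar>h1\<bar> + \<bar>h2\<bar>)"
    using q_near[OF \<eta>, of p] by blast
  obtain K where K: "K > 0" "\<And>s t \<tau>. s \<in> {a..b} \<Longrightarrow> t \<in> {a..b} \<Longrightarrow> s \<le> t \<Longrightarrow> \<bar>\<tau>\<bar> \<le> 1 \<Longrightarrow>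
    reach (sh \<tau> (x s)) (sh \<tau> (x t)) (sqrt c * (t - s) + K * \<bar>\<tau>\<bar>)" using reach_shift by blast
  have s8: "\<sigma> / 8 > 0" using cut(1) by simp
  have near: "\<mu>0 - \<mu> \<le> sqrt (q (pt (h1 * \<epsilon>) (h2 * \<epsilon>) 0 c0) h1 h2)"
    if "0 \<le> \<epsilon>" "\<epsilon> * V \<le> r" "\<mu>0 = sqrt (q p h1 h2)" "\<bar>h1\<bar> + \<bar>h2\<bar> \<le> V" for \<epsilon> h1 h2 \<mu>0
  proof -
    have "\<bar>h1 * \<epsilon>\<bar> \<le> V * \<epsilon>" "\<bar>h2 * \<epsilon>\<bar> \<le> V * \<epsilon>" unfolding abs_mult using that by (auto intro!: mult_mono)
    then have "\<forall>i. \<bar>pt (h1 * \<epsilon>) (h2 * \<epsilon>) 0 c0 $ i - p $ i\<bar> \<le> r" unfolding forall_4 p_def pt_nth using that(2) r(1) by (simp add: mult.commute)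
    then have "\<bar>sqrt (q (pt (h1 * \<epsilon>) (h2 * \<epsilon>) 0 c0) h1 h2) - sqrt (q p h1 h2)\<bar> \<le> \<eta> * (\<bar>h1\<bar> + \<bar>h2\<bar>)" using r(2) by blast
    moreover have "\<eta> * (\<bar>h1\<bar> + \<bar>h2\<bar>) \<le> \<eta> * V" using that(4) \<eta> by (intro mult_left_mono) auto
    ultimately show ?thesis unfolding that(3) using \<eta>V by linarith
  qed
  \<comment> \<open>\<open>reach_correction\<close> describes a base point by its first coordinate
    and slope; a nonzero first coordinate allows any base point to be so described.\<close>
  have corr_ex: "\<exists>e1>0. \<forall>e \<tau> y. 0 < e \<longrightarrow> e \<le> e1 \<longrightarrow> \<bar>\<tau>\<bar> \<le> \<bar>E\<bar> * e ^ 5 \<longrightarrow> \<bar>y\<bar> \<le> \<bar>c0\<bar> + 1 \<longrightarrow>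
     reach (pt X Y 0 y) (pt X Y 0 (y + \<tau>)) ((\<sigma> / 8) * e)" if X: "X \<noteq> 0" for X Y
  proof -
    obtain e1 where e1: "e1 > 0" "\<And>e \<tau> y. 0 < e \<Longrightarrow> e \<le> e1 \<Longrightarrow> \<bar>\<tau>\<bar> \<le> \<bar>E\<bar> * e ^ 5 \<Longrightarrow> \<bar>y\<bar> \<le> \<bar>c0\<bar> + 1 \<Longrightarrow>
     reach (pt X ((Y / X) * X) 0 y) (pt X ((Y / X) * X) 0 (y + \<tau>)) ((\<sigma> / 8) * e)"
      by (rule reach_correction[OF X s8 abs_ge_zero[of E], of "\<bar>c0\<bar> + 1" "Y / X"]) blast
    have "(Y / X) * X = Y" using X by simp
    then show ?thesis using e1 by auto
  qed
  have "\<exists>e1>0. \<forall>e \<tau> y. 0 < e \<longrightarrow> e \<le> e1 \<longrightarrow> \<bar>\<tau>\<bar> \<le> \<bar>E\<bar> * e ^ 5 \<longrightarrow> \<bar>y\<bar> \<le> \<bar>c0\<bar> + 1 \<longrightarrow>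
     (w1 \<noteq> 0 \<longrightarrow> reach (pt w1 w2 0 y) (pt w1 w2 0 (y + \<tau>)) ((\<sigma> / 8) * e)) \<and>
     (w1 = 0 \<longrightarrow> reach (pt v1 v2 0 y) (pt v1 v2 0 (y + \<tau>)) ((\<sigma> / 8) * e))"
  proof (cases "w1 = 0")
    case True
    then have "v1 \<noteq> 0" using om by auto
    then show ?thesis using corr_ex[of v1 v2] True by simp
  qed (use corr_ex[of w1 w2] in simp)
  then obtain e1 where e1: "e1 > 0" "\<And>e \<tau> y. 0 < e \<Longrightarrow> e \<le> e1 \<Longrightarrow> \<bar>\<tau>\<bar> \<le> \<bar>E\<bar> * e ^ 5 \<Longrightarrow> \<bar>y\<bar> \<le> \<bar>c0\<bar> + 1 \<Longrightarrow>
     (w1 \<noteq> 0 \<longrightarrow> reach (pt w1 w2 0 y) (pt w1 w2 0 (y + \<tau>)) ((\<sigma> / 8) * e)) \<and>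
     (w1 = 0 \<longrightarrow> reach (pt v1 v2 0 y) (pt v1 v2 0 (y + \<tau>)) ((\<sigma> / 8) * e))" by blast
  \<comment> \<open>Small enough for the shortcut, for the repair, for the metric to stay within
    \<open>\<mu>\<close>, for the shift to be at most \<open>\<rho>\<close> and 1, and for its cost
    to be at most \<open>\<sigma> * e / 8\<close>.\<close>
  define e where "e = min (min (1/2) e0) (min (min e1 (r / V)) (min (min \<rho> 1 / (\<bar>E\<bar> + 1)) (\<sigma> / (8 * (K * \<bar>E\<bar> + 1)))))"
  have e: "0 < e" "e \<le> 1/2" "e \<le> e0" "e \<le> e1" "e \<le> r / V" "e \<le> min \<rho> 1 / (\<bar>E\<bar> + 1)" "e \<le> \<sigma> / (8 * (K * \<bar>E\<bar> + 1))"
  proof -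
    have "0 < r / V" "0 < min \<rho> 1 / (\<bar>E\<bar> + 1)" "0 < \<sigma> / (8 * (K * \<bar>E\<bar> + 1))"
      using r(1) V(1) cut(1,3) K(1) by (auto intro!: divide_pos_pos mult_pos_pos add_nonneg_pos mult_nonneg_nonneg)
    then show "0 < e" unfolding e_def using cut(2) e1(1) by simp
    show "e \<le> 1/2" "e \<le> e0" "e \<le> e1" "e \<le> r / V" "e \<le> min \<rho> 1 / (\<bar>E\<bar> + 1)" "e \<le> \<sigma> / (8 * (K * \<bar>E\<bar> + 1))"
      unfolding e_def by (simp_all only: min_le_iff_disj order_refl simp_thms)
  qed
  define \<tau> where "\<tau> = e ^ 5 * E"
  have e5: "e ^ 5 \<le> e * e" "e ^ 5 \<le> e"
    using power_decreasing[of 2 5 e] power_decreasing[of 1 5 e] e(1,2) by (simp_all add: power2_eq_square)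
  have \<tau>E: "\<bar>\<tau>\<bar> = \<bar>E\<bar> * e ^ 5" unfolding \<tau>_def using e(1) by (simp add: abs_mult)
  have "\<bar>\<tau>\<bar> \<le> (\<bar>E\<bar> + 1) * e" unfolding \<tau>E using e5(2) e(1) by (intro mult_mono) auto
  also have "\<dots> \<le> min \<rho> 1" using e(6) by (simp add: field_simps pos_le_divide_eq)
  finally have \<tau>: "\<bar>\<tau>\<bar> \<le> \<rho>" "\<bar>\<tau>\<bar> \<le> 1" by auto
  have "K * \<bar>\<tau>\<bar> \<le> K * (\<bar>E\<bar> * (e * e))" unfolding \<tau>E using e5(1) K(1) by (intro mult_left_mono) auto
  also have "\<dots> \<le> ((K * \<bar>E\<bar> + 1) * e) * e" using e(1) by (simp add: algebra_simps)
  also have "\<dots> \<le> (\<sigma> / 8) * e"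
  proof (rule mult_right_mono)
    have "0 < K * \<bar>E\<bar> + 1" using K(1) by (simp add: add_nonneg_pos)
    then show "(K * \<bar>E\<bar> + 1) * e \<le> \<sigma> / 8" using e(7) by (simp add: field_simps)
  qed (use e(1) in simp)
  finally have K\<tau>: "K * \<bar>\<tau>\<bar> \<le> (\<sigma> / 8) * e" .
  have eV: "e * V \<le> r" using e(5) V(1) by (simp add: field_simps)
  have cont1: "continuous_on {a..t0} \<theta>" and cont2: "continuous_on {t0..b} \<omega>"
    using continuous_on_subset[OF prim_cont[OF \<theta>(1)]] continuous_on_subset[OF prim_cont[OF \<omega>(1)]] t0ab by simp_all
  have e1': "e < 1" using e(2) by simp
  obtain s where s: "s \<in> {a..t0}" "\<theta> s = e" "\<And>t. t \<in> {s..t0} \<Longrightarrow> 0 \<le> \<theta> t \<and> \<theta> t \<le> e"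
    by (rule decreasing_level[OF cont1 \<theta>(2) \<theta>(4) \<theta>(5)[OF t0(2,3)] t0ab(1) e(1) e1']) (simp_all add: v1_def v2_def)
  obtain t where t: "t \<in> {t0..b}" "\<omega> t = e" "\<And>\<tau>. \<tau> \<in> {t0..t} \<Longrightarrow> 0 \<le> \<omega> \<tau> \<and> \<omega> \<tau> \<le> e"
    by (rule increasing_level[OF cont2 \<omega>(2) \<omega>(5)[OF t0(2,3)] \<omega>(4) t0ab(2) e(1) e1']) (simp_all add: w1_def w2_def)
  have sab: "s \<in> {a..b}" "t \<in> {a..b}" "a \<le> s" "s \<le> t0" "t0 \<le> t" "t \<le> b" using s(1) t(1) t0ab by auto
  have small: "\<epsilon> * V \<le> r" if "\<epsilon> \<le> e" for \<epsilon>
    using mult_right_mono[OF that, of V] V(1) eV by linarith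
  have l1: "(Nv - \<mu>) * e \<le> sqrt c * (t0 - s)"
  proof -
    have "(Nv - \<mu>) * \<bar>\<theta> t0 - \<theta> s\<bar> \<le> sqrt c * (t0 - s)"
    proof (rule ray_length[OF sab(3,4) t0ab(2) \<theta>(1), where ?v1.0=v1 and ?v2.0=v2])
      fix \<xi> assume \<xi>: "\<xi> \<in> {s..t0}"
      then have x\<xi>: "x \<xi> = pt (v1 * \<theta> \<xi>) (v2 * \<theta> \<xi>) 0 c0" using \<theta>(3) sab by auto
      show "x \<xi> $ 1 = v1 * \<theta> \<xi>" "x \<xi> $ 2 = v2 * \<theta> \<xi>" unfolding x\<xi> pt_nth by simp_all
      show "Nv - \<mu> \<le> sqrt (q (x \<xi>) v1 v2)" unfolding x\<xi> using s(3)[OF \<xi>] small V(2) by (intro near) (auto simp: Nv_def)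
    qed (use \<mu> in simp)
    then show ?thesis using \<theta>(5)[OF t0(2,3)] s(2) e(1) by simp
  qed
  have l2: "(Nw - \<mu>) * e \<le> sqrt c * (t - t0)"
  proof -
    have "(Nw - \<mu>) * \<bar>\<omega> t - \<omega> t0\<bar> \<le> sqrt c * (t - t0)"
    proof (rule ray_length[OF t0ab(1) sab(5,6) \<omega>(1), where ?v1.0=w1 and ?v2.0=w2])
      fix \<xi> assume \<xi>: "\<xi> \<in> {t0..t}"
      then have x\<xi>: "x \<xi> = pt (w1 * \<omega> \<xi>) (w2 * \<omega> \<xi>) 0 c0" using \<omega>(3) sab by auto
      show "x \<xi> $ 1 = w1 * \<omega> \<xi>" "x \<xi> $ 2 = w2 * \<omega> \<xi>" unfolding x\<xi> pt_nth by simp_all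
      show "Nw - \<mu> \<le> sqrt (q (x \<xi>) w1 w2)" unfolding x\<xi> using t(3)[OF \<xi>] small V(3) by (intro near) (auto simp: Nw_def)
    qed (use \<mu> in simp)
    then show ?thesis using \<omega>(5)[OF t0(2,3)] t(2) e(1) by simp
  qed
  have xs: "x s = pt (e * v1) (e * v2) 0 c0" using \<theta>(3)[OF s(1)] s(2) by (simp add: mult.commute)
  have xt: "x t = pt (e * w1) (e * w2) 0 c0" using \<omega>(3)[OF t(1)] t(2) by (simp add: mult.commute)
  have tot: "sqrt c * (b - a) \<le> sqrt c * (s - a) + e * (Nv + Nw - \<sigma>) + (sqrt c * (b - t) + K * \<bar>\<tau>\<bar>) + (\<sigma> / 8) * e \<or>
    sqrt c * (b - a) \<le> (\<sigma> / 8) * e + (sqrt c * (s - a) + K * \<bar>\<tau>\<bar>) + e * (Nv + Nw - \<sigma>) + sqrt c * (b - t)"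
  proof (cases "w1 = 0")
    case False
    have r1: "reach (x a) (x s) (sqrt c * (s - a))" using reach_between[of a s] sab lt by auto
    have r2: "reach (x s) (sh \<tau> (x t)) (e * (Nv + Nw - \<sigma>))"
      using cut(4)[OF e(1,3), of c0] cut(3) unfolding xs xt sh_def pt_nth \<tau>_def by simp
    have r3: "reach (sh \<tau> (x t)) (sh \<tau> (x b)) (sqrt c * (b - t) + K * \<bar>\<tau>\<bar>)" using K(2)[OF sab(2) _ sab(6) \<tau>(2)] lt by simp
    have r4: "reach (sh \<tau> (x b)) (x b) ((\<sigma> / 8) * e)"
      using e1(2)[OF e(1,4), of "-\<tau>" "c0 + \<tau>"] \<tau>E \<tau>(2) False abs_triangle_ineq[of c0 \<tau>] unfolding xb sh_def pt_nth by simp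
    show ?thesis using minimal'[OF reach_trans[OF reach_trans[OF reach_trans[OF r1 r2] r3] r4]] by blast
  \<comment> \<open>The second ray has zero first coordinate, so the repair comes first, at the
    start. The shortcut then begins at height \<open>c0 - \<tau>\<close> and ends at the correct
    one.\<close>
  next
    case True
    have r1: "reach (x a) (sh (-\<tau>) (x a)) ((\<sigma> / 8) * e)"
      using e1(2)[OF e(1,4), of "-\<tau>" c0] \<tau>E True unfolding xa sh_def pt_nth by simp
    have r2: "reach (sh (-\<tau>) (x a)) (sh (-\<tau>) (x s)) (sqrt c * (s - a) + K * \<bar>\<tau>\<bar>)" using K(2)[OF _ sab(1) sab(3), of "-\<tau>"] \<tau>(2) lt by simp
    have r3: "reach (sh (-\<tau>) (x s)) (x t) (e * (Nv + Nw - \<sigma>))"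
      using cut(4)[OF e(1,3), of "c0 - \<tau>"] \<tau>(1) unfolding xs xt sh_def pt_nth \<tau>_def by simp
    have r4: "reach (x t) (x b) (sqrt c * (b - t))" using reach_between[of t b] sab lt by auto
    show ?thesis using minimal'[OF reach_trans[OF reach_trans[OF reach_trans[OF r1 r2] r3] r4]] by blast
  qed
  \<comment> \<open>The balance: the shortcut saves \<open>\<sigma> * e\<close>; the comparison of
    metrics loses at most a quarter of it, the shift and the repair an eighth each.\<close>
  have "sqrt c * (b - a) = sqrt c * (s - a) + sqrt c * (t0 - s) + sqrt c * (t - t0) + sqrt c * (b - t)" by (simp add: algebra_simps)
  moreover have "(Nv - \<mu>) * e + (Nw - \<mu>) * e = e * (Nv + Nw - \<sigma>) + e * \<sigma> - 2 * (\<mu> * e)" by (simp add: algebra_simps)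
  moreover have "\<mu> * e \<le> (\<sigma> / 8) * e" using \<mu>(2) e(1) by (intro mult_right_mono) auto
  moreover have "0 < e * \<sigma>" using e(1) cut(1) by simp
  ultimately show False using tot l1 l2 K\<tau> by (auto simp: mult.commute[of _ e])
qed

lemma minimizer_smooth: "smooth_curve_on {a..b} x"
proof (cases "ae a b (\<lambda>t. u1 t * (3 * x t $ 3 + 2 * x t $ 1 * x t $ 2) = 2 * (x t $ 1)\<^sup>2 * u2 t)")
  case False
  then show ?thesis using smooth_or_abnormal by blast
next
  case R: True
  show ?thesis
  proof (cases "x a $ 3 * (x a $ 1) ^ 3 = 0")
    case False
    then show ?thesis by (rule abnormal_smooth_nonzero[OF R])
  next
    case True
    show ?thesis
    proof (rule ccontr)
      assume n: "\<not> ?thesis"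
      then have f: "\<And>t. t \<in> {a..b} \<Longrightarrow> x t $ 3 = 0" "\<And>t. t \<in> {a..b} \<Longrightarrow> x t $ 4 = x a $ 4"
        "ae a b (\<lambda>t. x t $ 2 * u1 t = x t $ 1 * u2 t)" using abnormal_zero_cases[OF R True] by blast+
      from planar_smooth_or_corner[OF f(3,1,2)] n obtain t0 where "t0 \<in> {a<..<b}" "x t0 $ 1 = 0" "x t0 $ 2 = 0"
        "\<And>t. t \<in> {a..t0} \<Longrightarrow> x t $ 1 * x a $ 2 = x t $ 2 * x a $ 1" "\<And>t. t \<in> {t0..b} \<Longrightarrow> x t $ 1 * x b $ 2 = x t $ 2 * x b $ 1"
        "x a $ 2 * x b $ 1 - x a $ 1 * x b $ 2 \<noteq> 0" by blast
      from no_corner[OF this f(1,2)] show False .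
    qed
  qed
qed

end

section \<open>Parametrization by arc length\<close>

lemma DERIV_abs_le_lip:
  assumes d: "(F has_real_derivative D) (at r)" and r: "a < r" "r < b"
    and M: "\<And>s t. s \<in> {a..b} \<Longrightarrow> t \<in> {a..b} \<Longrightarrow> \<bar>F s - F t\<bar> \<le> M * \<bar>s - t\<bar>"
  shows "\<bar>D\<bar> \<le> M"
proof (rule tendsto_upperbound)
  show "((\<lambda>h. \<bar>(F (r + h) - F r) / h\<bar>) \<longlongrightarrow> \<bar>D\<bar>) (at 0)"
    using d unfolding DERIV_def by (rule tendsto_rabs)
  show "\<forall>\<^sub>F h in at 0. \<bar>(F (r + h) - F r) / h\<bar> \<le> M"
    unfolding eventually_at
  proof (intro exI[of _ "min (r - a) (b - r)"] conjI ballI impI)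
    show "0 < min (r - a) (b - r)" using r by simp
    fix h :: real assume h: "h \<noteq> 0 \<and> dist h 0 < min (r - a) (b - r)"
    then have "\<bar>F (r + h) - F r\<bar> \<le> M * \<bar>r + h - r\<bar>" using r by (intro M) (auto simp: dist_real_def)
    then show "\<bar>(F (r + h) - F r) / h\<bar> \<le> M" using h by (simp add: abs_divide pos_divide_le_eq)
  qed
qed simp

text \<open>The derivative is bounded by the Lipschitz constant and set to 0 where it is missing;
  its measurability comes from integrability, which the fundamental theorem supplies.\<close>

lemma lipr_prim_exists:
  assumes l: "lipr a b F" and d: "ae a b (\<lambda>r. \<exists>D. (F has_real_derivative D) (at r))" and ab: "a \<le> b"
  shows "\<exists>f. prim a b F f"
proof -
  obtain M where M: "\<And>s t. s \<in> {a..b} \<Longrightarrow> t \<in> {a..b} \<Longrightarrow> \<bar>F s - F t\<bar> \<le> M * \<bar>s - t\<bar>" using l unfolding lipr_def by blast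
  define f where "f r = (if (\<exists>D. (F has_real_derivative D) (at r)) \<and> a < r \<and> r < b then deriv F r else 0)" for r
  have df: "ae a b (\<lambda>r. (F has_real_derivative f r) (at r))"
    by (rule ae_mono2[OF d ae_interior]) (auto simp: f_def DERIV_imp_deriv)
  have fb: "\<bar>f r\<bar> \<le> \<bar>M\<bar>" for r
  proof (cases "(\<exists>D. (F has_real_derivative D) (at r)) \<and> a < r \<and> r < b")
    case True
    then obtain D where D: "(F has_real_derivative D) (at r)" "a < r" "r < b" by blast
    have "\<bar>D\<bar> \<le> M" by (rule DERIV_abs_le_lip[OF D M])
    moreover have "f r = D" unfolding f_def using True DERIV_imp_deriv[OF D(1)] by simp
    ultimately show ?thesis by simp
  qed (auto simp: f_def)
  have "(f has_integral F b - F a) {a..b}" by (rule acr_FTC[OF ab lipr_acr[OF l] df])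
  then have "f \<in> borel_measurable (lebesgue_on {a..b})" by (intro integrable_imp_measurable) (auto simp: integrable_on_def)
  then have "bm a b f" unfolding bm_def using fb by blast
  then show ?thesis unfolding prim_def using l df by blast
qed

text \<open>Sard's theorem in dimension one, where a zero derivative has rank below 1. The detour
  through \<open>real^1\<close> matches the vector form of the theorem.\<close>

lemma negligible_critical_values:
  fixes s :: "real \<Rightarrow> real"
  assumes "\<And>t. t \<in> S \<Longrightarrow> (s has_real_derivative 0) (at t)"
  shows "negligible (s ` S)"
proof -
  define f :: "real^1 \<Rightarrow> real^1" where "f y = (\<chi> i. s (y $ 1))" for y
  define S' :: "(real^1) set" where "S' = {y. y $ 1 \<in> S}"
  have "negligible (f ` S')"
  proof (rule baby_Sard[where f'="\<lambda>y h. 0"])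
    show "CARD(1) \<le> CARD(1)" by simp
    fix y assume y: "y \<in> S'"
    have "(s has_derivative (\<lambda>h. 0)) (at (y $ 1))"
      using assms[of "y $ 1"] y unfolding S'_def has_field_derivative_def by (simp add: mult_zero_left[abs_def])
    from has_derivative_compose[OF bounded_linear_imp_has_derivative[OF bounded_linear_vec_nth] this, where s=UNIV]
    have "((\<lambda>y::real^1. s (y $ 1)) has_derivative (\<lambda>h. 0)) (at y within S')" by (rule has_derivative_at_withinI)
    then show "(f has_derivative (\<lambda>h. 0)) (at y within S')"
      unfolding f_def[abs_def] by (subst has_derivative_componentwise_within) (auto simp: Basis_vec_def inner_axis)
    have "matrix (\<lambda>h::real^1. 0::real^1) = 0" unfolding matrix_def vec_eq_iff by simp
    then show "rank (matrix (\<lambda>h::real^1. 0::real^1)) < CARD(1)" by simp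
  qed
  then have "negligible ((\<lambda>y::real^1. y $ 1) ` f ` S')"
    by (intro negligible_differentiable_image_negligible[where f="\<lambda>y::real^1. y $ 1" and S="f ` S'"] linear_imp_differentiable_on
        bounded_linear.linear[OF bounded_linear_vec_nth]) simp
  moreover have "s ` S \<subseteq> (\<lambda>y::real^1. y $ 1) ` f ` S'"
  proof
    fix z assume "z \<in> s ` S"
    then obtain t where "t \<in> S" "z = s t" by blast
    then have "(\<chi> i. t) \<in> S'" "z = f (\<chi> i. t) $ 1" unfolding S'_def f_def by simp_all
    then show "z \<in> (\<lambda>y::real^1. y $ 1) ` f ` S'" by blast
  qed
  ultimately show ?thesis by (rule negligible_subset)
qed

lemma negligible_lipr_image:
  assumes l: "lipr a b s" and N: "negligible N" "N \<subseteq> {a..b}" shows "negligible (s ` N)"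
proof (rule negligible_locally_Lipschitz_image[OF _ N(1)])
  obtain M where M: "\<forall>r\<in>{a..b}. \<forall>t\<in>{a..b}. \<bar>s r - s t\<bar> \<le> M * \<bar>r - t\<bar>" using l unfolding lipr_def by blast
  fix x assume "x \<in> N"
  then show "\<exists>T B. open T \<and> x \<in> T \<and> (\<forall>y\<in>N \<inter> T. norm (s y - s x) \<le> B * norm (y - x))"
    using M N(2) by (intro exI[of _ UNIV] exI[of _ M]) auto
qed simp

text \<open>\<open>s\<close> need not be injective, so no inverse function is differentiated. A
  positive derivative at \<open>t\<close> forces every value near \<open>s t\<close> to be taken
  only near \<open>t\<close>, and the difference quotient of \<open>G\<close> is a quotient of those
  of \<open>F\<close> and \<open>s\<close>.\<close>

lemma DERIV_reparam:
  fixes s :: "real \<Rightarrow> real"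
  assumes mono: "\<And>x y. x \<in> {a..b} \<Longrightarrow> y \<in> {a..b} \<Longrightarrow> x \<le> y \<Longrightarrow> s x \<le> s y"
    and surj: "\<And>r. r \<in> {s a..s b} \<Longrightarrow> \<exists>t\<in>{a..b}. s t = r"
    and F: "\<And>t. t \<in> {a..b} \<Longrightarrow> F t = G (s t)"
    and t: "a < t" "t < b" and ds: "(s has_real_derivative d) (at t)" "d > 0" and dF: "(F has_real_derivative D) (at t)"
  shows "(G has_real_derivative D / d) (at (s t))"
  unfolding has_field_derivative_iff LIM_eq
proof (intro allI impI)
  fix \<epsilon> :: real assume \<epsilon>: "\<epsilon> > 0"
  have tab: "t \<in> {a..b}" using t by simp
  have "((\<lambda>y. ((F y - F t) / (y - t)) / ((s y - s t) / (y - t))) \<longlongrightarrow> D / d) (at t)"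
    using dF ds unfolding has_field_derivative_iff by (intro tendsto_divide) auto
  then obtain \<delta>1 where \<delta>1: "\<delta>1 > 0" "\<And>y. y \<noteq> t \<Longrightarrow> \<bar>y - t\<bar> < \<delta>1 \<Longrightarrow> \<bar>((F y - F t) / (y - t)) / ((s y - s t) / (y - t)) - D / d\<bar> < \<epsilon>"
    using \<epsilon> unfolding LIM_eq by (metis real_norm_def)
  obtain \<delta>2 where \<delta>2: "\<delta>2 > 0" "\<And>h. 0 < h \<Longrightarrow> h < \<delta>2 \<Longrightarrow> s t < s (t + h)"
    using DERIV_pos_inc_right[OF ds] by blast
  obtain \<delta>3 where \<delta>3: "\<delta>3 > 0" "\<And>h. 0 < h \<Longrightarrow> h < \<delta>3 \<Longrightarrow> s (t - h) < s t"
    using DERIV_pos_inc_left[OF ds] by blast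
  define m where "m = min (min \<delta>1 (min \<delta>2 \<delta>3)) (min (t - a) (b - t))"
  have m: "0 < m" unfolding m_def using \<delta>1(1) \<delta>2(1) \<delta>3(1) t by simp
  have m': "m \<le> \<delta>1" "m \<le> \<delta>2" "m \<le> \<delta>3" "m \<le> t - a" "m \<le> b - t"
    unfolding m_def by (simp_all only: min_le_iff_disj order_refl simp_thms)
  define h where "h = m / 2"
  have h: "0 < h" "h < \<delta>1" "h < \<delta>2" "h < \<delta>3" "a \<le> t - h" "t + h \<le> b" unfolding h_def using m m' by linarith+
  \<comment> \<open>Values closer to \<open>s t\<close> than this lie strictly between
    \<open>s (t - h)\<close> and \<open>s (t + h)\<close>, so by monotonicity their preimages lie
    within \<open>h\<close> of \<open>t\<close>.\<close>
  define \<rho> where "\<rho> = min (s (t + h) - s t) (s t - s (t - h))"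
  have \<rho>: "\<rho> > 0" unfolding \<rho>_def using \<delta>2(2)[OF h(1,3)] \<delta>3(2)[OF h(1,4)] by simp
  show "\<exists>\<rho>>0. \<forall>r. r \<noteq> s t \<and> norm (r - s t) < \<rho> \<longrightarrow> norm ((G r - G (s t)) / (r - s t) - D / d) < \<epsilon>"
  proof (intro exI[of _ \<rho>] conjI allI impI \<rho>)
    fix r assume r: "r \<noteq> s t \<and> norm (r - s t) < \<rho>"
    then have rr: "s (t - h) < r" "r < s (t + h)" unfolding \<rho>_def by auto
    have "s a \<le> s (t - h)" "s (t + h) \<le> s b" using mono[of a "t - h"] mono[of "t + h" b] h t by auto
    then obtain y where y: "y \<in> {a..b}" "s y = r" using surj[of r] rr by auto
    have "t - h < y" using mono[of y "t - h"] y rr(1) h t by (cases "y \<le> t - h") auto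
    moreover have "y < t + h" using mono[of "t + h" y] y rr(2) h t by (cases "t + h \<le> y") auto
    moreover have yt: "y \<noteq> t" using r y by auto
    ultimately have "\<bar>((F y - F t) / (y - t)) / ((s y - s t) / (y - t)) - D / d\<bar> < \<epsilon>" using h by (intro \<delta>1(2)) auto
    moreover have "((F y - F t) / (y - t)) / ((s y - s t) / (y - t)) = (G r - G (s t)) / (r - s t)"
      using yt F[OF y(1)] F[OF tab] y(2) by simp
    ultimately show "norm ((G r - G (s t)) / (r - s t) - D / d) < \<epsilon>" by simp
  qed
qed

context metric
begin

text \<open>Completing the square in either variable bounds the determinant times one squared
  control by a coefficient times \<open>q\<close>; compactness makes the constants uniform.\<close>

lemma q_lower_bound:
  fixes x :: "real \<Rightarrow> real^4"
  assumes x: "continuous_on {a..b} x"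
  obtains K where "K > 0" "\<And>t h1 h2. t \<in> {a..b} \<Longrightarrow> \<bar>h1\<bar> \<le> K * sqrt (q (x t) h1 h2) \<and> \<bar>h2\<bar> \<le> K * sqrt (q (x t) h1 h2)"
proof -
  let ?d = "\<lambda>y. A y * C y - (B y)\<^sup>2"
  have cx: "continuous_on {a..b} (\<lambda>t. f (x t))" if "continuous_on UNIV f" for f :: "real^4 \<Rightarrow> real"
    using continuous_on_compose2[OF that x] by simp
  note cc = cx[OF coeff_cont(1)] cx[OF coeff_cont(2)] cx[OF coeff_cont(3)]
  have nz: "?d (x t) \<noteq> 0" for t using pos(2)[of "x t"] by simp
  have cd: "continuous_on {a..b} (\<lambda>t. ?d (x t))" by (intro continuous_on_diff continuous_on_mult continuous_on_power cc)
  have k1: "bm a b (\<lambda>t. A (x t) / ?d (x t))" and k2: "bm a b (\<lambda>t. C (x t) / ?d (x t))"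
    by (intro bm_cont continuous_on_divide cc cd ballI nz)+
  obtain K1 where K1: "K1 > 0" "\<And>t. t \<in> {a..b} \<Longrightarrow> \<bar>A (x t) / ?d (x t)\<bar> \<le> K1" by (rule bm_bounded[OF k1]) blast
  obtain K2 where K2: "K2 > 0" "\<And>t. t \<in> {a..b} \<Longrightarrow> \<bar>C (x t) / ?d (x t)\<bar> \<le> K2" by (rule bm_bounded[OF k2]) blast
  define K where "K = sqrt (K1 + K2)"
  have bound: "\<bar>h\<bar> \<le> K * sqrt Q" if "D * h\<^sup>2 \<le> E * Q" "D > 0" "\<bar>E / D\<bar> \<le> K'" "K' \<le> K1 + K2" "0 \<le> Q" for h D E Q K'
  proof -
    have "h\<^sup>2 \<le> (E / D) * Q" using that(1,2) by (simp add: field_simps)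
    also have "\<dots> \<le> (K1 + K2) * Q" using abs_ge_self[of "E / D"] that(3,4,5) by (intro mult_right_mono) linarith+
    finally have "sqrt (h\<^sup>2) \<le> sqrt ((K1 + K2) * Q)" by (rule real_sqrt_le_mono)
    then show ?thesis unfolding K_def by (simp add: real_sqrt_mult)
  qed
  show ?thesis
  proof (rule that[of K])
    show "K > 0" unfolding K_def using K1(1) K2(1) by simp
    fix t h1 h2 assume t: "t \<in> {a..b}"
    have "A (x t) * q (x t) h1 h2 = (A (x t) * h1 + B (x t) * h2)\<^sup>2 + ?d (x t) * h2\<^sup>2"
      "C (x t) * q (x t) h1 h2 = (B (x t) * h1 + C (x t) * h2)\<^sup>2 + ?d (x t) * h1\<^sup>2"
      unfolding q_def by (simp_all add: power2_eq_square algebra_simps)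
    then have "?d (x t) * h2\<^sup>2 \<le> A (x t) * q (x t) h1 h2" "?d (x t) * h1\<^sup>2 \<le> C (x t) * q (x t) h1 h2"
      using zero_le_power2[of "A (x t) * h1 + B (x t) * h2"] zero_le_power2[of "B (x t) * h1 + C (x t) * h2"] by linarith+
    then show "\<bar>h1\<bar> \<le> K * sqrt (q (x t) h1 h2) \<and> \<bar>h2\<bar> \<le> K * sqrt (q (x t) h1 h2)"
      using bound[OF _ pos(2) K1(2)[OF t]] bound[OF _ pos(2) K2(2)[OF t]] K1(1) K2(1) by simp
  qed
qed

text \<open>Arc length may be constant on intervals where the curve rests, so the curve is factored
  through \<open>s\<close> by an estimate rather than by inverting \<open>s\<close>.\<close>

lemma arc_length_reparametrization:
  assumes ctl: "ctl a b u1 u2 x" and len: "integral {a..b} (speed u1 u2 x) > 0"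
  defines "l \<equiv> integral {a..b} (speed u1 u2 x)"
  obtains s \<beta> w1 w2 where "lipr a b s" "\<And>t. t \<in> {a..b} \<Longrightarrow> s t \<in> {0..l}" "s a = 0" "s b = l"
    "\<And>t. t \<in> {a..b} \<Longrightarrow> x t = \<beta> (s t)" "ctl 0 l w1 w2 \<beta>" "ae 0 l (\<lambda>r. q (\<beta> r) (w1 r) (w2 r) = 1)"
proof -
  interpret controlled g A B C a b u1 u2 x by (intro controlled.intro controlled_axioms.intro metric_axioms ctl)
  define s where "s t = integral {a..t} (speed u1 u2 x)" for t
  have ps: "prim a b s (speed u1 u2 x)" by (rule primI_integral[OF speed_bm[OF ctl], where C=0]) (simp add: s_def)
  have ls: "lipr a b s" using ps unfolding prim_def by simp
  have s0: "s a = 0" "s b = l" unfolding s_def l_def by simp_all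
  have mono: "s r \<le> s t" if "r \<in> {a..b}" "t \<in> {a..b}" "r \<le> t" for r t
    by (rule prim_mono[OF ps]) (use that in \<open>auto intro: ae_all\<close>)
  have sl: "s t \<in> {0..l}" if "t \<in> {a..b}" for t using mono[of a t] mono[of t b] that ab s0 by auto
  have surj: "\<exists>t\<in>{a..b}. s t = r" if "r \<in> {s a..s b}" for r
    using IVT'[of s a r b, OF _ _ ab prim_cont[OF ps]] that by auto
  obtain K where K: "K > 0" "\<And>t h1 h2. t \<in> {a..b} \<Longrightarrow> \<bar>h1\<bar> \<le> K * sqrt (q (x t) h1 h2) \<and> \<bar>h2\<bar> \<le> K * sqrt (q (x t) h1 h2)"
    using q_lower_bound[OF ctl_cont[OF ctl]] by blast
  obtain M where M: "M > 0" "\<And>t. t \<in> {a..b} \<Longrightarrow> 1 + \<bar>x t $ 1\<bar> + \<bar>x t $ 2\<bar> + (x t $ 3)\<^sup>2 \<le> M"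
  proof -
    have "continuous_on {a..b} (\<lambda>t. 1 + \<bar>x t $ 1\<bar> + \<bar>x t $ 2\<bar> + (x t $ 3)\<^sup>2)" by (intro continuous_intros ctl_cont_nth[OF ctl])
    from bm_bounded[OF bm_cont[OF this]] obtain M where "M > 0" "\<And>t. t \<in> {a..b} \<Longrightarrow> \<bar>1 + \<bar>x t $ 1\<bar> + \<bar>x t $ 2\<bar> + (x t $ 3)\<^sup>2\<bar> \<le> M" by blast
    then show ?thesis using that[of M] by (auto simp: abs_le_iff)
  qed
  let ?v = "\<lambda>i t. (u1 t *\<^sub>R X1 (x t) + u2 t *\<^sub>R X2 (x t)) $ i"
  have x_prim: "prim a b (\<lambda>t. x t $ i) (?v i)" for i
  proof -
    have "\<forall>i. prim a b (\<lambda>t. x t $ i) (?v i)" unfolding forall_4 frame_nth using ctlD(2-5)[OF ctl] by blast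
    then show ?thesis by blast
  qed
  define W where "W = 4 * M * K"
  have W0: "W > 0" unfolding W_def using M(1) K(1) by simp
  \<comment> \<open>All four velocity components are bounded by the speed; the factor 4 covers the
    two doubled terms of the third.\<close>
  have vW: "\<bar>?v i t\<bar> \<le> W * speed u1 u2 x t" if t: "t \<in> {a..b}" for i t
  proof -
    define S where "S = K * speed u1 u2 x t"
    have u: "\<bar>u1 t\<bar> \<le> S" "\<bar>u2 t\<bar> \<le> S" unfolding S_def speed_def using K(2)[OF t] by auto
    have S0: "0 \<le> S" using u(1) by linarith
    have m: "1 \<le> M" "\<bar>x t $ 1\<bar> \<le> M" "\<bar>x t $ 2\<bar> \<le> M" "(x t $ 3)\<^sup>2 \<le> M"
      using M(2)[OF t] abs_ge_zero[of "x t $ 1"] abs_ge_zero[of "x t $ 2"] zero_le_power2[of "x t $ 3"] by linarith+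
    have p0: "\<bar>u1 t\<bar> \<le> M * S" "\<bar>u2 t\<bar> \<le> M * S"
      using u m(1) mult_mono[of 1 M "\<bar>u1 t\<bar>" S] mult_mono[of 1 M "\<bar>u2 t\<bar>" S] by simp_all
    have p1: "\<bar>x t $ 2 * u1 t\<bar> \<le> M * S" "\<bar>x t $ 1 * u2 t\<bar> \<le> M * S" "\<bar>(x t $ 3)\<^sup>2 * u1 t\<bar> \<le> M * S"
      unfolding abs_mult using u m M(1) by (auto intro!: mult_mono)
    have MS: "0 \<le> M * S" using M(1) S0 by simp
    have "\<forall>i. \<bar>?v i t\<bar> \<le> 4 * (M * S)"
      unfolding forall_4 frame_nth
    proof (intro conjI)
      have "\<bar>2 * c - 2 * d\<bar> \<le> 4 * e" if "\<bar>c\<bar> \<le> e" "\<bar>d\<bar> \<le> e" for c d e :: real using that by linarith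
      from this[OF p1(1,2)] show "\<bar>2 * x t $ 2 * u1 t - 2 * x t $ 1 * u2 t\<bar> \<le> 4 * (M * S)" by (simp add: mult.assoc)
    qed (use p0 p1 MS in auto)
    then show ?thesis unfolding W_def S_def by (simp add: mult_ac)
  qed
  \<comment> \<open>The curve is Lipschitz with respect to its own arc length. In particular equal
    values of \<open>s\<close> give equal points.\<close>
  have Lip: "\<bar>x r $ i - x t $ i\<bar> \<le> W * \<bar>s r - s t\<bar>" if rt: "r \<in> {a..b}" "t \<in> {a..b}" for r t i
  proof -
    have le: "\<bar>x t $ i - x r $ i\<bar> \<le> W * (s t - s r)" if rt: "r \<in> {a..b}" "t \<in> {a..b}" "r \<le> t" for r t
    proof -
      have "W * s r - k * x r $ i \<le> W * s t - k * x t $ i" if k: "\<bar>k\<bar> = 1" for k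
      proof (rule prim_mono[of a b "\<lambda>t. W * s t - k * x t $ i" "\<lambda>t. W * speed u1 u2 x t - k * ?v i t"])
        show "prim a b (\<lambda>t. W * s t - k * x t $ i) (\<lambda>t. W * speed u1 u2 x t - k * ?v i t)"
          by (intro prim_diff prim_cmult ps x_prim)
        show "ae a b (\<lambda>t. 0 \<le> W * speed u1 u2 x t - k * ?v i t)"
        proof (rule ae_all)
          fix t assume t: "t \<in> {a..b}"
          have "k * ?v i t \<le> \<bar>k * ?v i t\<bar>" by simp
          also have "\<dots> = \<bar>?v i t\<bar>" unfolding abs_mult k by simp
          finally show "0 \<le> W * speed u1 u2 x t - k * ?v i t" using vW[OF t, of i] by linarith
        qed
      qed (use rt in auto)
      from this[of 1] this[of "-1"] show ?thesis by (simp add: right_diff_distrib abs_le_iff)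
    qed
    show ?thesis
    proof (cases "r \<le> t")
      case True
      then show ?thesis using le[OF rt True] mono[OF rt True] by (simp add: abs_minus_commute)
    next
      case False
      then show ?thesis using le[OF rt(2,1)] mono[OF rt(2,1)] by (simp add: abs_minus_commute)
    qed
  qed
  \<comment> \<open>An arbitrary preimage is chosen; by \<open>Lip\<close> the point does not depend
    on the choice.\<close>
  define \<beta> where "\<beta> r = x (SOME t. t \<in> {a..b} \<and> s t = r)" for r
  have \<beta>: "x t = \<beta> (s t)" if t: "t \<in> {a..b}" for t
  proof -
    define t' where "t' = (SOME t'. t' \<in> {a..b} \<and> s t' = s t)"
    have t': "t' \<in> {a..b} \<and> s t' = s t" unfolding t'_def by (rule someI[of _ t]) (use t in simp)
    have "x t $ i = x t' $ i" for i using Lip[of t t' i] t t' by simp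
    then have "x t = x t'" by (simp add: vec_eq_iff)
    then show ?thesis unfolding \<beta>_def t'_def .
  qed
  have l0: "0 < l" using len unfolding l_def .
  have \<beta>lip: "lipr 0 l (\<lambda>r. \<beta> r $ i)" for i
    unfolding lipr_def
  proof (intro exI[of _ W] ballI)
    fix r r' assume "r \<in> {0..l}" "r' \<in> {0..l}"
    then obtain t t' where t: "t \<in> {a..b}" "s t = r" "t' \<in> {a..b}" "s t' = r'" using surj s0 by metis
    show "\<bar>\<beta> r $ i - \<beta> r' $ i\<bar> \<le> W * \<bar>r - r'\<bar>" using Lip[OF t(1,3), of i] \<beta>[OF t(1)] \<beta>[OF t(3)] t(2,4) by simp
  qed
  define P where "P t \<longleftrightarrow> a < t \<and> t < b \<and> (s has_real_derivative speed u1 u2 x t) (at t) \<and>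
     (\<forall>i. ((\<lambda>t. x t $ i) has_real_derivative ?v i t) (at t))" for t
  have "ae a b (\<lambda>t. \<forall>i. ((\<lambda>t. x t $ i) has_real_derivative ?v i t) (at t))"
    by (rule ae_all4) (use x_prim in \<open>auto simp: prim_def\<close>)
  moreover have "ae a b (\<lambda>t. (s has_real_derivative speed u1 u2 x t) (at t))" using ps unfolding prim_def by simp
  ultimately have aeP: "ae a b P" using ae_interior by (rule ae_mono3) (auto simp: P_def)
  have "ae 0 l (\<lambda>r. \<exists>t. t \<in> {a..b} \<and> r = s t \<and> P t \<and> speed u1 u2 x t > 0)"
    unfolding ae_def
  proof (rule negligible_subset)
    \<comment> \<open>Bad parameters are images under the Lipschitz map \<open>s\<close> of a null
      set of bad times, or critical values of \<open>s\<close>; both kinds are negligible.\<close>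
    let ?N1 = "{t \<in> {a..b}. \<not> P t}" and ?N2 = "{t. (s has_real_derivative 0) (at t)}"
    show "negligible (s ` ?N1 \<union> s ` ?N2)"
    proof (rule negligible_Un)
      show "negligible (s ` ?N1)" by (rule negligible_lipr_image[OF ls aeP[unfolded ae_def]]) blast
      show "negligible (s ` ?N2)" by (rule negligible_critical_values) blast
    qed
    show "{r \<in> {0..l}. \<not> (\<exists>t. t \<in> {a..b} \<and> r = s t \<and> P t \<and> speed u1 u2 x t > 0)} \<subseteq> s ` ?N1 \<union> s ` ?N2"
    proof clarify
      fix r assume r: "r \<in> {0..l}" "\<not> (\<exists>t. t \<in> {a..b} \<and> r = s t \<and> P t \<and> speed u1 u2 x t > 0)" "r \<notin> s ` ?N2"
      obtain t where t: "t \<in> {a..b}" "s t = r" using surj[of r] r(1) s0 by auto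
      have "\<not> P t"
      proof
        assume p: "P t"
        then have "\<not> speed u1 u2 x t > 0" using r(2) t by blast
        then have "speed u1 u2 x t = 0" using speed_nonneg[of u1 u2 x t] by linarith
        then have "t \<in> ?N2" using p unfolding P_def by auto
        then show False using r(3) t by blast
      qed
      then show "r \<in> s ` ?N1" using t by blast
    qed
  qed
  then have good: "ae 0 l (\<lambda>r. \<exists>t. t \<in> {a..b} \<and> r = s t \<and> speed u1 u2 x t > 0 \<and>
     (\<forall>i. ((\<lambda>r. \<beta> r $ i) has_real_derivative ?v i t / speed u1 u2 x t) (at r)))"
  proof (rule ae_mono)
    fix r assume "\<exists>t. t \<in> {a..b} \<and> r = s t \<and> P t \<and> speed u1 u2 x t > 0"
    then obtain t where t: "t \<in> {a..b}" "r = s t" "P t" "speed u1 u2 x t > 0" by blast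
    have "((\<lambda>r. \<beta> r $ i) has_real_derivative ?v i t / speed u1 u2 x t) (at (s t))" for i
      by (rule DERIV_reparam[OF mono surj, where F="\<lambda>t. x t $ i" and d="speed u1 u2 x t"])
        (use t \<beta> in \<open>auto simp: P_def\<close>)
    then show "\<exists>t. t \<in> {a..b} \<and> r = s t \<and> speed u1 u2 x t > 0 \<and> (\<forall>i. ((\<lambda>r. \<beta> r $ i) has_real_derivative ?v i t / speed u1 u2 x t) (at r))"
      using t by blast
  qed
  have "\<exists>f. prim 0 l (\<lambda>r. \<beta> r $ i) f" for i
    by (rule lipr_prim_exists[OF \<beta>lip ae_mono[OF good]]) (use l0 in auto)
  then obtain w where w: "\<And>i. prim 0 l (\<lambda>r. \<beta> r $ i) (w i)" by metis
  have "ae 0 l (\<lambda>r. \<forall>i. ((\<lambda>r. \<beta> r $ i) has_real_derivative w i r) (at r))"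
    by (rule ae_all4) (use w in \<open>auto simp: prim_def\<close>)
  from this good have G: "ae 0 l (\<lambda>r. \<exists>t. t \<in> {a..b} \<and> r = s t \<and> speed u1 u2 x t > 0 \<and> (\<forall>i. w i r = ?v i t / speed u1 u2 x t))"
  proof (rule ae_mono2)
    fix r assume w: "\<forall>i. ((\<lambda>r. \<beta> r $ i) has_real_derivative w i r) (at r)"
      and "\<exists>t. t \<in> {a..b} \<and> r = s t \<and> speed u1 u2 x t > 0 \<and> (\<forall>i. ((\<lambda>r. \<beta> r $ i) has_real_derivative ?v i t / speed u1 u2 x t) (at r))"
    then obtain t where t: "t \<in> {a..b}" "r = s t" "speed u1 u2 x t > 0"
      "\<forall>i. ((\<lambda>r. \<beta> r $ i) has_real_derivative ?v i t / speed u1 u2 x t) (at r)" by blast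
    have "\<forall>i. w i r = ?v i t / speed u1 u2 x t" using DERIV_unique w t(4) by blast
    then show "\<exists>t. t \<in> {a..b} \<and> r = s t \<and> speed u1 u2 x t > 0 \<and> (\<forall>i. w i r = ?v i t / speed u1 u2 x t)" using t by blast
  qed
  have \<beta>bm: "bm 0 l (\<lambda>r. \<beta> r $ i)" for i by (rule bm_cont[OF prim_cont[OF w]])
  have c3: "prim 0 l (\<lambda>r. \<beta> r $ 3) (\<lambda>r. 2 * \<beta> r $ 2 * w 1 r - 2 * \<beta> r $ 1 * w 2 r)"
  proof (rule prim_cong[OF w])
    show "bm 0 l (\<lambda>r. 2 * \<beta> r $ 2 * w 1 r - 2 * \<beta> r $ 1 * w 2 r)" by (intro bm_intros \<beta>bm prim_bm[OF w])
    show "ae 0 l (\<lambda>r. 2 * \<beta> r $ 2 * w 1 r - 2 * \<beta> r $ 1 * w 2 r = w 3 r)"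
    proof (rule ae_mono[OF G], elim exE conjE)
      fix r t assume t: "t \<in> {a..b}" "r = s t" "speed u1 u2 x t > 0" "\<forall>i. w i r = ?v i t / speed u1 u2 x t"
      have wi: "w i r = ?v i t / speed u1 u2 x t" for i using t(4) by blast
      show "2 * \<beta> r $ 2 * w 1 r - 2 * \<beta> r $ 1 * w 2 r = w 3 r"
        unfolding wi frame_nth unfolding t(2) \<beta>[OF t(1), symmetric] by (simp add: diff_divide_distrib)
    qed
  qed simp
  have c4: "prim 0 l (\<lambda>r. \<beta> r $ 4) (\<lambda>r. (\<beta> r $ 3)\<^sup>2 * w 1 r)"
  proof (rule prim_cong[OF w])
    show "bm 0 l (\<lambda>r. (\<beta> r $ 3)\<^sup>2 * w 1 r)" by (intro bm_intros \<beta>bm prim_bm[OF w])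
    show "ae 0 l (\<lambda>r. (\<beta> r $ 3)\<^sup>2 * w 1 r = w 4 r)"
    proof (rule ae_mono[OF G], elim exE conjE)
      fix r t assume t: "t \<in> {a..b}" "r = s t" "speed u1 u2 x t > 0" "\<forall>i. w i r = ?v i t / speed u1 u2 x t"
      have wi: "w i r = ?v i t / speed u1 u2 x t" for i using t(4) by blast
      show "(\<beta> r $ 3)\<^sup>2 * w 1 r = w 4 r"
        unfolding wi frame_nth unfolding t(2) \<beta>[OF t(1), symmetric] by simp
    qed
  qed simp
  have c: "ctl 0 l (w 1) (w 2) \<beta>" unfolding ctl_def using l0 w c3 c4 by simp
  have unit: "ae 0 l (\<lambda>r. q (\<beta> r) (w 1 r) (w 2 r) = 1)"
  proof (rule ae_mono[OF G], elim exE conjE)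
    fix r t assume t: "t \<in> {a..b}" "r = s t" "speed u1 u2 x t > 0" "\<forall>i. w i r = ?v i t / speed u1 u2 x t"
    have w12: "w 1 r = (1 / speed u1 u2 x t) * u1 t" "w 2 r = (1 / speed u1 u2 x t) * u2 t"
      using t(4) frame_nth(1,2)[of "u1 t" "x t" "u2 t"] by simp_all
    have b: "\<beta> r = x t" using \<beta>[OF t(1)] t(2) by simp
    have "(speed u1 u2 x t)\<^sup>2 = q (x t) (u1 t) (u2 t)" unfolding speed_def by simp
    then have "q (x t) (u1 t) (u2 t) \<noteq> 0" "(1 / speed u1 u2 x t)\<^sup>2 = 1 / q (x t) (u1 t) (u2 t)" using t(3) by (auto simp: power_divide)
    then show "q (\<beta> r) (w 1 r) (w 2 r) = 1" unfolding w12 b q_scale by simp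
  qed
  show ?thesis by (rule that[OF ls sl s0 \<beta> c unit])
qed

end

section \<open>Corners under Lipschitz reparametrization\<close>

text \<open>A chain rule in which the inner function is only Lipschitz: a vanishing outer derivative
  makes the increment small compared with that of \<open>s\<close>, hence with that of time.\<close>

lemma DERIV_zero_lipr_comp:
  assumes s: "lipr a b s" "\<And>t. t \<in> {a..b} \<Longrightarrow> s t \<in> S" and t: "t \<in> {a<..<b}"
    and G: "(G has_real_derivative 0) (at (s t) within S)"
  shows "((\<lambda>t. G (s t)) has_real_derivative 0) (at t)"
proof -
  obtain M where M: "\<And>r t. r \<in> {a..b} \<Longrightarrow> t \<in> {a..b} \<Longrightarrow> \<bar>s r - s t\<bar> \<le> M * \<bar>r - t\<bar>" using s(1) unfolding lipr_def by blast
  define K where "K = \<bar>M\<bar> + 1"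
  have K: "K > 0" unfolding K_def by simp
  have sK: "\<bar>s r - s t\<bar> \<le> K * \<bar>r - t\<bar>" if "r \<in> {a..b}" for r
  proof -
    have "M * \<bar>r - t\<bar> \<le> K * \<bar>r - t\<bar>" unfolding K_def by (intro mult_right_mono) auto
    then show ?thesis using M[OF that, of t] t by simp
  qed
  have G': "\<forall>e>0. \<exists>d>0. \<forall>y\<in>S. norm (y - s t) < d \<longrightarrow> norm (G y - G (s t) - 0 * (y - s t)) \<le> e * norm (y - s t)"
    using G unfolding has_field_derivative_def has_derivative_within_alt by blast
  show ?thesis
    unfolding has_field_derivative_def has_derivative_at_alt
  proof (intro conjI allI impI)
    show "bounded_linear ((*) (0::real))" by (rule bounded_linear_mult_right)
    fix e :: real assume "e > 0"
    then have eK: "e / K > 0" using K by simp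
    then obtain d where d: "d > 0" "\<And>y. y \<in> S \<Longrightarrow> \<bar>y - s t\<bar> < d \<Longrightarrow> \<bar>G y - G (s t)\<bar> \<le> e / K * \<bar>y - s t\<bar>"
      using G'[rule_format, OF eK] by auto
    show "\<exists>d>0. \<forall>y. norm (y - t) < d \<longrightarrow> norm (G (s y) - G (s t) - 0 * (y - t)) \<le> e * norm (y - t)"
    proof (intro exI[of _ "min (d / K) (min (t - a) (b - t))"] conjI allI impI)
      show "0 < min (d / K) (min (t - a) (b - t))" using d(1) K t by simp
      fix y assume y: "norm (y - t) < min (d / K) (min (t - a) (b - t))"
      then have yab: "y \<in> {a..b}" by (auto simp: abs_less_iff)
      have "\<bar>y - t\<bar> < d / K" using y by simp
      then have "K * \<bar>y - t\<bar> < d" using K by (simp add: field_simps)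
      then have "\<bar>s y - s t\<bar> < d" using sK[OF yab] by linarith
      then have "\<bar>G (s y) - G (s t)\<bar> \<le> e / K * \<bar>s y - s t\<bar>" by (rule d(2)[OF s(2)[OF yab]])
      also have "\<dots> \<le> e / K * (K * \<bar>y - t\<bar>)" using sK[OF yab] eK by (intro mult_left_mono) auto
      also have "\<dots> = e * \<bar>y - t\<bar>" using K by simp
      finally show "norm (G (s y) - G (s t) - 0 * (y - t)) \<le> e * norm (y - t)" by simp
    qed
  qed
qed

text \<open>The hypotheses say that every linear relation between two coordinates of
  \<open>e\<close> also holds for \<open>v\<close> and \<open>w\<close>, which makes both multiples
  of \<open>e\<close>; the case \<open>e = 0\<close> is included.\<close>

lemma one_sided_derivs_dependent:
  fixes v w e :: "real^4"
  assumes "\<And>p r i j. p * e $ j + r * e $ i = 0 \<Longrightarrow> p * v $ j + r * v $ i = 0"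
    and w: "\<And>p r i j. p * e $ j + r * e $ i = 0 \<Longrightarrow> p * w $ j + r * w $ i = 0"
  obtains \<alpha> \<beta> :: real where "\<alpha> *\<^sub>R v + \<beta> *\<^sub>R w = 0" "\<alpha> \<noteq> 0 \<or> \<beta> \<noteq> 0"
proof (cases "w = 0")
  case True
  then show ?thesis using that[of 0 1] by simp
next
  case False
  then obtain i where i: "w $ i \<noteq> 0" by (auto simp: vec_eq_iff)
  then have ei: "e $ i \<noteq> 0" using w[of 0 i 1 i] by auto
  have "w $ i * v $ j - v $ i * w $ j = 0" for j
  proof -
    have v': "e $ j * v $ i = e $ i * v $ j" using assms(1)[of "e $ j" i "- e $ i" j] by simp
    have w': "e $ j * w $ i = e $ i * w $ j" using w[of "e $ j" i "- e $ i" j] by simp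
    have "e $ i * (w $ i * v $ j - v $ i * w $ j) = w $ i * (e $ i * v $ j) - v $ i * (e $ i * w $ j)" by (simp add: algebra_simps)
    also have "\<dots> = 0" unfolding v'[symmetric] w'[symmetric] by (simp add: algebra_simps)
    finally show ?thesis using ei by simp
  qed
  then have "w $ i *\<^sub>R v + (- v $ i) *\<^sub>R w = 0" unfolding vec_eq_iff by simp
  then show ?thesis using i by (intro that[of "w $ i" "- v $ i"]) auto
qed

text \<open>A linear combination of two coordinates that annihilates \<open>e\<close> has zero
  derivative along \<gamma>, even where \<open>s\<close> is not differentiable. The one-sided
  derivatives of \<gamma> thus satisfy all such relations and are dependent.\<close>

lemma no_corner_of_smooth_reparametrization:
  assumes s: "lipr a b s" "\<And>t. t \<in> {a..b} \<Longrightarrow> s t \<in> S" and t: "t \<in> {a<..<b}"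
    and \<beta>: "\<And>r. r \<in> {a..b} \<Longrightarrow> \<gamma> r = \<beta> (s r)" "(\<beta> has_vector_derivative e) (at (s t) within S)"
  shows "\<not> has_corner_at \<gamma> t"
proof
  assume "has_corner_at \<gamma> t"
  then obtain v w where vw: "(\<gamma> has_vector_derivative v) (at_left t)" "(\<gamma> has_vector_derivative w) (at_right t)"
    and ind: "\<And>\<alpha> \<beta>. \<alpha> *\<^sub>R v + \<beta> *\<^sub>R w = 0 \<Longrightarrow> \<alpha> = 0 \<and> \<beta> = 0" unfolding has_corner_at_def by blast
  have z: "((\<lambda>r. p * \<gamma> r $ j + k * \<gamma> r $ i) has_real_derivative 0) (at t)" if "p * e $ j + k * e $ i = 0" for p k i j
  proof -
    have di: "((\<lambda>r. \<beta> r $ i) has_real_derivative e $ i) (at (s t) within S)" for i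
      using \<beta>(2) unfolding has_vector_derivative_iff_nth by blast
    have "((\<lambda>r. p * \<beta> r $ j + k * \<beta> r $ i) has_real_derivative p * e $ j + k * e $ i) (at (s t) within S)"
      by (intro DERIV_add DERIV_cmult di)
    from DERIV_zero_lipr_comp[OF s t this[unfolded that]]
    show ?thesis
      by (rule has_field_derivative_transform_within_open[where S="{a<..<b}"]) (use t \<beta>(1) in auto)
  qed
  have u: "p * v' $ j + k * v' $ i = 0" if d: "(\<gamma> has_vector_derivative v') (at t within T)" "at t within T \<noteq> bot" "p * e $ j + k * e $ i = 0" for v' T p k i j
  proof -
    have di: "((\<lambda>r. \<gamma> r $ i) has_real_derivative v' $ i) (at t within T)" for i
      using d(1) unfolding has_vector_derivative_iff_nth by blast
    have "((\<lambda>r. p * \<gamma> r $ j + k * \<gamma> r $ i) has_real_derivative p * v' $ j + k * v' $ i) (at t within T)"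
      by (intro DERIV_add DERIV_cmult di)
    moreover have "((\<lambda>r. p * \<gamma> r $ j + k * \<gamma> r $ i) has_real_derivative 0) (at t within T)"
      by (rule has_field_derivative_at_within[OF z[OF d(3)]])
    ultimately show ?thesis unfolding has_field_derivative_iff by (rule tendsto_unique[OF d(2)])
  qed
  obtain \<alpha> \<beta> :: real where "\<alpha> *\<^sub>R v + \<beta> *\<^sub>R w = 0" "\<alpha> \<noteq> 0 \<or> \<beta> \<noteq> 0"
    by (rule one_sided_derivs_dependent[of e v w]) (rule u[OF vw(1)] u[OF vw(2)] that; simp)+
  then show False using ind by blast
qed

section \<open>Conclusion for minimizers of constant and of arbitrary speed\<close>

context metric
begin

lemma zero_speed_constant:
  assumes c: "ctl a b u1 u2 x" and z: "ae a b (\<lambda>t. q (x t) (u1 t) (u2 t) \<le> 0)" and t: "t \<in> {a..b}"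
  shows "x t = x a"
proof -
  have u: "ae a b (\<lambda>t. u1 t = 0 \<and> u2 t = 0)"
  proof (rule ae_mono[OF z])
    fix t assume "q (x t) (u1 t) (u2 t) \<le> 0"
    then have "q (x t) (u1 t) (u2 t) = 0" using q_nonneg[of "x t" "u1 t" "u2 t"] by linarith
    then show "u1 t = 0 \<and> u2 t = 0" unfolding q_eq_0_iff .
  qed
  have "x t $ 1 = x a $ 1" by (rule prim_zero_const[OF ctlD(2)[OF c] ae_mono[OF u] t]) simp
  moreover have "x t $ 2 = x a $ 2" by (rule prim_zero_const[OF ctlD(3)[OF c] ae_mono[OF u] t]) simp
  moreover have "x t $ 3 = x a $ 3" by (rule prim_zero_const[OF ctlD(4)[OF c] ae_mono[OF u] t]) simp
  moreover have "x t $ 4 = x a $ 4" by (rule prim_zero_const[OF ctlD(5)[OF c] ae_mono[OF u] t]) simp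
  ultimately show ?thesis unfolding vec4_eq_iff by blast
qed

lemma constant_speed_minimizer_smooth:
  assumes "ctl a b u1 u2 x" "a < b" "c > 0" "ae a b (\<lambda>t. q (x t) (u1 t) (u2 t) = c)"
    and "\<And>l. reach (x a) (x b) l \<Longrightarrow> integral {a..b} (speed u1 u2 x) \<le> l"
  shows "smooth_curve_on {a..b} x"
proof -
  have "minimizer g A B C a b u1 u2 x c"
    by (intro minimizer.intro controlled.intro controlled_axioms.intro minimizer_axioms.intro metric_axioms assms)
  then show ?thesis by (rule minimizer.minimizer_smooth)
qed

lemma constant_speed_smooth:
  assumes lm: "length_minimizing g a b \<gamma>" and cs: "constant_speed g a b \<gamma>"
  shows "smooth_curve_on {a..b} \<gamma>"
proof -
  obtain u1 u2 where ctl: "ctl a b u1 u2 \<gamma>" using lm horizontal_imp_ctl unfolding length_minimizing_def by blast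
  obtain c where "ae a b (\<lambda>t. g (\<gamma> t) (vector_derivative \<gamma> (at t)) = c)"
    using cs unfolding constant_speed_def AE_lborel_iff_ae by blast
  then have qc: "ae a b (\<lambda>t. q (\<gamma> t) (u1 t) (u2 t) = c)"
    by (rule ae_mono2[OF ctl_deriv[OF ctl]]) (auto dest!: vector_derivative_at simp: g_eq q_def)
  \<comment> \<open>The constant in \<open>constant_speed\<close> carries no sign. If it is not
    positive the curve stays put, and over a single instant smoothness is trivial.\<close>
  consider "a = b" | "c \<le> 0" | "a < b" "c > 0" using ctlD(1)[OF ctl] by linarith
  then show ?thesis
  proof cases
    case 1
    then show ?thesis unfolding smooth_curve_on_def
      by (intro exI[of _ "\<lambda>k t. if k = 0 then \<gamma> t else 0"])
        (simp add: has_vector_derivative_def has_derivative_within_singleton_iff bounded_linear_scaleR_left)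
  next
    case 2
    have "\<gamma> t = \<gamma> a" if "t \<in> {a..b}" for t
      by (rule zero_speed_constant[OF ctl ae_mono[OF qc] that]) (use 2 in simp)
    then obtain y where "\<And>t. t \<in> {a..b} \<Longrightarrow> \<gamma> t = y" by metis
    then show ?thesis unfolding smooth_curve_on_def
      by (intro exI[of _ "\<lambda>k t. if k = 0 then y else 0"]) simp
  next
    case 3
    show ?thesis by (rule constant_speed_minimizer_smooth[OF ctl 3 qc minimizer_le_reach[OF lm ctl]])
  qed
qed

text \<open>The arc length parametrization joins the same points with the same length
  \<open>l\<close>, so it is minimizing as well, has unit speed and is smooth; the original curve is
  its composition with a Lipschitz function.\<close>

lemma minimizer_no_corner_at:
  assumes lm: "length_minimizing g a b \<gamma>" and t: "t \<in> {a<..<b}"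
  shows "\<not> has_corner_at \<gamma> t"
proof -
  obtain u1 u2 where ctl: "ctl a b u1 u2 \<gamma>" using lm horizontal_imp_ctl unfolding length_minimizing_def by blast
  define l where "l = integral {a..b} (speed u1 u2 \<gamma>)"
  have "0 \<le> l" unfolding l_def by (rule integral_nonneg[OF bm_integrable[OF speed_bm[OF ctl]]]) simp
  then consider "l = 0" | "l > 0" by linarith
  then show ?thesis
  proof cases
    case 1
    have "ae a b (\<lambda>t. speed u1 u2 \<gamma> t = 0)"
      by (rule integral_nonneg_ae_0[OF speed_bm[OF ctl]]) (use 1 in \<open>auto simp: l_def\<close>)
    then have "ae a b (\<lambda>t. q (\<gamma> t) (u1 t) (u2 t) \<le> 0)" by (rule ae_mono) (simp add: speed_def)
    then have y: "\<gamma> r = \<gamma> a" if "r \<in> {a..b}" for r by (rule zero_speed_constant[OF ctl _ that])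
    \<comment> \<open>A curve of zero length is constant and factors through a constant parameter,
      with derivative 0.\<close>
    show ?thesis
    proof (rule no_corner_of_smooth_reparametrization[of a b "\<lambda>_. 0" UNIV t \<gamma> "\<lambda>_. \<gamma> a" 0])
      show "lipr a b (\<lambda>_. 0)" unfolding lipr_def by (intro exI[of _ 0]) simp
      show "\<gamma> r = \<gamma> a" if "r \<in> {a..b}" for r by (rule y[OF that])
    qed (use t in simp_all)
  next
    case 2
    obtain s \<beta> w1 w2 where s: "lipr a b s" "\<And>t. t \<in> {a..b} \<Longrightarrow> s t \<in> {0..l}" "s a = 0" "s b = l"
      "\<And>t. t \<in> {a..b} \<Longrightarrow> \<gamma> t = \<beta> (s t)" and w: "ctl 0 l w1 w2 \<beta>" "ae 0 l (\<lambda>r. q (\<beta> r) (w1 r) (w2 r) = 1)"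
      using arc_length_reparametrization[OF ctl 2[unfolded l_def]] unfolding l_def[symmetric] by blast
    have ends: "\<gamma> a = \<beta> 0" "\<gamma> b = \<beta> l" using s(3-5) ctlD(1)[OF ctl] by simp_all
    have "integral {0..l} (speed w1 w2 \<beta>) = integral {0..l} (\<lambda>_. 1)"
      by (rule ae_integral_cong, rule ae_mono[OF w(2)]) (simp add: speed_def)
    then have len: "integral {0..l} (speed w1 w2 \<beta>) = l" using 2 by simp
    have "smooth_curve_on {0..l} \<beta>"
    proof (rule constant_speed_minimizer_smooth[OF w(1) 2 zero_less_one w(2)])
      fix m assume "reach (\<beta> 0) (\<beta> l) m"
      then have "reach (\<gamma> a) (\<gamma> b) m" unfolding ends .
      from minimizer_le_reach[OF lm ctl this] show "integral {0..l} (speed w1 w2 \<beta>) \<le> m" unfolding len unfolding l_def .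
    qed
    then obtain D where D: "\<And>r. r \<in> {0..l} \<Longrightarrow> D 0 r = \<beta> r"
      "\<And>k r. r \<in> {0..l} \<Longrightarrow> (D k has_vector_derivative D (Suc k) r) (at r within {0..l})"
      unfolding smooth_curve_on_def by blast
    have st: "s t \<in> {0..l}" using s(2) t by simp
    have d: "(\<beta> has_vector_derivative D (Suc 0) (s t)) (at (s t) within {0..l})"
      by (rule has_vector_derivative_transform[OF st _ D(2)[OF st]]) (simp add: D(1))
    show ?thesis
    proof (rule no_corner_of_smooth_reparametrization[OF s(1) _ t _ d])
      show "s r \<in> {0..l}" "\<gamma> r = \<beta> (s r)" if "r \<in> {a..b}" for r by (rule s(2)[OF that], rule s(5)[OF that])
    qed
  qed
qed

end

theorem theorem1p2:
  fixes g :: "real^4 \<Rightarrow> real^4 \<Rightarrow> real"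
  assumes "smooth_metric_on_Delta g"
  shows "(\<forall>a b \<gamma>. length_minimizing g a b \<gamma> \<and> constant_speed g a b \<gamma>
            \<longrightarrow> smooth_curve_on {a..b} \<gamma>)
       \<and> (\<forall>a b \<gamma> t. horizontal a b \<gamma> \<and> t \<in> {a<..<b} \<and> has_corner_at \<gamma> t
            \<longrightarrow> \<not> length_minimizing g a b \<gamma>)"
proof -
  obtain A B C where ABC: "smooth_R4 A \<and> smooth_R4 B \<and> smooth_R4 C"
    "\<forall>x. A x > 0 \<and> A x * C x - (B x)\<^sup>2 > 0"
    "\<forall>x h1 h2. g x (h1 *\<^sub>R X1 x + h2 *\<^sub>R X2 x) = A x * h1\<^sup>2 + 2 * B x * h1 * h2 + C x * h2\<^sup>2"
    using assms unfolding smooth_metric_on_Delta_def by blast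
  interpret metric g A B C by (rule metric.intro) (use ABC in auto)
  show ?thesis using constant_speed_smooth minimizer_no_corner_at by blast
qed

end
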